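(* The classical $\mathcal W$-algebra $\mathbf W_{\nu_0}(\mathfrak g)$ is $\mathrm{Der}\,\mathcal O$-equivariantly isomorphic to the algebra $\mathrm{Fun}\,\mathrm{Op}_G(\mathbb D)$ of functions on the space of $G$-opers on $\mathbb D=\mathrm{Spec}\,\mathbb C[[t]]$.
   Context: $\mathfrak g$ is a complex simple Lie algebra of rank $\ell$ with simple roots $\alpha_i$, coroots $h_i$, Cartan matrix $a_{ij}=\alpha_j(h_i)$, generators $e_i,h_i,f_i$; $G$ is the adjoint group, $B$ the Borel subgroup with Lie algebra $\mathfrak b=\mathfrak h\oplus\mathfrak n$ containing the $e_i$, $N=[B,B]$. $\mathcal O=\mathbb C[[t]]$, $\mathrm{Der}\,\mathcal O=\mathbb C[[t]]\partial_t$, with basis elements $L_n=-t^{n+1}\partial_t$, $n\ge-1$. Opers. With $p_{-1}=\sum_{i=1}^\ell f_i$, $\mathrm{Op}_G(\mathbb D)$ is the quotient of the space of operators $\partial_t+p_{-1}+\mathbf v(t)$, $\mathbf v(t)\in\mathfrak b[[t]]$, by the gauge action of $N[[t]]$, $g\cdot(\partial_t+A)=\partial_t+gAg^{-1}-(\partial_tg)g^{-1}$. (Equivalently: triples of a $G$-bundle on $\mathbb D$, a connection and a reduction to $B$ whose relative position takes values in the open $B$-orbit of $\mathfrak n^\perp/\mathfrak b\subset\mathfrak g/\mathfrak b$.) Changes of coordinate act as follows: for $t=\varphi(s)$ the oper $\partial_t+p_{-1}+\mathbf v(t)$ becomes the class of $\partial_s+p_{-1}+\varphi'(s)\,\rho^\vee(\varphi'(s))\mathbf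 v(\varphi(s))\rho^\vee(\varphi'(s))^{-1}-\rho^\vee\varphi''(s)/\varphi'(s)$, where $\rho^\vee$ is the sum of fundamental coweights ($[\rho^\vee,e_i]=e_i$), viewed in $\mathfrak h$ or as a one-parameter subgroup. This gives the action of $\mathrm{Aut}\,\mathcal O$, and of $\mathrm{Der}\,\mathcal O$, on $\mathrm{Fun}\,\mathrm{Op}_G(\mathbb D)$. Classical $\mathcal W$-algebra. Let $\nu_0$ be a non-zero invariant inner product on $\mathfrak g$ and $\pi_{0,\nu_0}=\mathbb C[\mathbf b'_{i,n}]_{i=1,\dots,\ell;\,n<0}$. Put $\sum_{n\le0}\mathbf V_i[n]z^{-n}=\exp\big(-\sum_{m>0}\frac{\mathbf b'_{i,-m}}mz^m\big)$, let $\mathbf D_{\mathbf b'_{i,m}}$ be the derivation with $\mathbf D_{\mathbf b'_{i,m}}\mathbf b'_{j,n}=a_{ij}\delta_{n,m}$, and $\mathbf V_i[1]=\sum_{m\le0}\mathbf V_i[m]\mathbf D_{\mathbf b'_{i,m-1}}$. Then $\mathbf W_{\nu_0}(\mathfrak g)=\bigcap_{i=1}^\ell\mathrm{Ker}\,\mathbf V_i[1]\subset\pi_{0,\nu_0}$. $\mathrm{Der}\,\mathcal O$ acts on $\pi_{0,\nu_0}$ by derivations: $L_n\mathbf b'_{i,m}=-m\mathbf b'_{i,n+m}$ for $-1\le n<-m$; $L_n\mathbf b'_{i,-n}=-n(n+1)$ for $n>0$; $L_n\mathbf b'_{i,m}=0$ for $n>-m$. This action preserves $\mathbf W_{\nu_0}(\mathfrak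 g)$. *)

theory Defs
  imports
    Complex_Main
    "HOL-Library.Poly_Mapping"
    "HOL-Library.FuncSet"
    "HOL-Computational_Algebra.Formal_Power_Series"
    "HOL-Algebra.Generated_Groups"
    "HOL-Algebra.Bij"
begin

unbundle fps_syntax

section \<open>Polynomials over the complex numbers in arbitrarily many variables\<close>

type_synonym 'x cpoly = "('x \<Rightarrow>\<^sub>0 nat) \<Rightarrow>\<^sub>0 complex"

definition pconst :: "complex \<Rightarrow> 'x cpoly" where
  "pconst c = Poly_Mapping.single 0 c"

definition pvar :: "'x \<Rightarrow> 'x cpoly" where
  "pvar x = Poly_Mapping.single (Poly_Mapping.single x 1) 1"

definition pvars :: "'x cpoly \<Rightarrow> 'x set" where
  "pvars p = (\<Union>m \<in> Poly_Mapping.keys p. Poly_Mapping.keys m)"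

text \<open>Evaluation in a commutative algebra over the complex numbers with structure map \<open>c\<close>.\<close>

definition peval :: "(complex \<Rightarrow> 'r) \<Rightarrow> ('x \<Rightarrow> 'r) \<Rightarrow> 'x cpoly \<Rightarrow> 'r::comm_ring_1" where
  "peval c val p = (\<Sum>m\<in>Poly_Mapping.keys p. c (Poly_Mapping.lookup p m) *
      (\<Prod>x\<in>Poly_Mapping.keys m. val x ^ Poly_Mapping.lookup m x))"

text \<open>The unique complex-linear derivation sending the variable \<open>x\<close> to \<open>d x\<close>: a monomial
  \<open>c * m\<close> goes to \<open>\<Sum>x. c * (\<partial>m/\<partial>x) * d x\<close>.\<close>

definition derivation_of :: "('x \<Rightarrow> 'x cpoly) \<Rightarrow> 'x cpoly \<Rightarrow> 'x cpoly" where
  "derivation_of d p = (\<Sum>m\<in>Poly_Mapping.keys p. \<Sum>x\<in>Poly_Mapping.keys m.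
      Poly_Mapping.single (m - Poly_Mapping.single x 1)
        (Poly_Mapping.lookup p m * of_nat (Poly_Mapping.lookup m x)) * d x)"


section \<open>Simple Lie algebras with Chevalley generators\<close>

locale lie_algebra = vector_space scale
  for scale :: "complex \<Rightarrow> 'g::ab_group_add \<Rightarrow> 'g" +
  fixes bracket :: "'g \<Rightarrow> 'g \<Rightarrow> 'g"
  assumes bracket_add_left: "bracket (x + y) z = bracket x z + bracket y z"
    and bracket_add_right: "bracket x (y + z) = bracket x y + bracket x z"
    and bracket_scale_left: "bracket (scale c x) y = scale c (bracket x y)"
    and bracket_scale_right: "bracket x (scale c y) = scale c (bracket x y)"
    and bracket_self: "bracket x x = 0"
    and jacobi: "bracket x (bracket y z) + bracket y (bracket z x) + bracket z (bracket x y) = 0"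

locale simple_lie_algebra = lie_algebra +
  assumes finite_dimensional: "\<exists>S. finite S \<and> span S = UNIV"
    and not_abelian: "\<exists>x y. bracket x y \<noteq> 0"
    and no_ideals: "subspace I \<Longrightarrow> (\<And>x y. y \<in> I \<Longrightarrow> bracket x y \<in> I) \<Longrightarrow> I = {0} \<or> I = UNIV"

text \<open>The Lie algebra is the whole type \<open>'g\<close>; the finite type \<open>'l\<close> indexes the simple roots,
  so the rank is \<open>CARD('l)\<close>. Only the values of \<open>sroot L i\<close> on \<open>cartan L\<close> matter.\<close>

record ('g, 'l) lie_data =
  scal :: "complex \<Rightarrow> 'g \<Rightarrow> 'g"
  lbr :: "'g \<Rightarrow> 'g \<Rightarrow> 'g"
  cartan :: "'g set"
  sroot :: "'l \<Rightarrow> 'g \<Rightarrow> complex"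
  gen_e :: "'l \<Rightarrow> 'g"
  gen_h :: "'l \<Rightarrow> 'g"
  gen_f :: "'l \<Rightarrow> 'g"

definition linear_form :: "('g::ab_group_add, 'l) lie_data \<Rightarrow> ('g \<Rightarrow> complex) \<Rightarrow> bool" where
  "linear_form L u \<longleftrightarrow> Vector_Spaces.linear (scal L) (*) u"

definition ad_semisimple :: "('g::ab_group_add, 'l) lie_data \<Rightarrow> 'g \<Rightarrow> bool" where
  "ad_semisimple L x \<longleftrightarrow> module.span (scal L) {y. \<exists>c. lbr L x y = scal L c y} = UNIV"

definition toral_subalgebra :: "('g::ab_group_add, 'l) lie_data \<Rightarrow> 'g set \<Rightarrow> bool" where
  "toral_subalgebra L T \<longleftrightarrow> module.subspace (scal L) T \<and> (\<forall>x\<in>T. \<forall>y\<in>T. lbr L x y = 0) \<and>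
     (\<forall>x\<in>T. ad_semisimple L x)"

definition cartan_subalgebra :: "('g::ab_group_add, 'l) lie_data \<Rightarrow> 'g set \<Rightarrow> bool" where
  "cartan_subalgebra L T \<longleftrightarrow> toral_subalgebra L T \<and>
     (\<forall>T'. toral_subalgebra L T' \<longrightarrow> T \<subseteq> T' \<longrightarrow> T' = T)"

definition root_space :: "('g::ab_group_add, 'l) lie_data \<Rightarrow> ('g \<Rightarrow> complex) \<Rightarrow> 'g set" where
  "root_space L \<beta> = {x. \<forall>y\<in>cartan L. lbr L y x = scal L (\<beta> y) x}"

definition is_root :: "('g::ab_group_add, 'l) lie_data \<Rightarrow> ('g \<Rightarrow> complex) \<Rightarrow> bool" where
  "is_root L \<beta> \<longleftrightarrow> (\<exists>y\<in>cartan L. \<beta> y \<noteq> 0) \<and> root_space L \<beta> \<noteq> {0}"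

text \<open>A root is a linear form on the Cartan subalgebra; linearity there is automatic
  from the existence of a non-zero vector in the root space.\<close>

definition positive_root :: "('g::ab_group_add, 'l::finite) lie_data \<Rightarrow> ('g \<Rightarrow> complex) \<Rightarrow> bool" where
  "positive_root L \<beta> \<longleftrightarrow> is_root L \<beta> \<and>
     (\<exists>k::'l \<Rightarrow> nat. \<forall>y\<in>cartan L. \<beta> y = (\<Sum>i\<in>UNIV. of_nat (k i) * sroot L i y))"

definition simple_roots :: "('g::ab_group_add, 'l::finite) lie_data \<Rightarrow> bool" where
  "simple_roots L \<longleftrightarrow>
     (\<forall>i. is_root L (sroot L i)) \<and>
     (\<forall>c::'l \<Rightarrow> complex. (\<forall>y\<in>cartan L. (\<Sum>i\<in>UNIV. c i * sroot L i y) = 0) \<longrightarrow> (\<forall>i. c i = 0)) \<and>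
     (\<forall>\<beta>. is_root L \<beta> \<longrightarrow> positive_root L \<beta> \<or> positive_root L (\<lambda>y. - \<beta> y))"

definition simple_lie_data :: "('g::ab_group_add, 'l::finite) lie_data \<Rightarrow> bool" where
  "simple_lie_data L \<longleftrightarrow>
     simple_lie_algebra (scal L) (lbr L) \<and>
     cartan_subalgebra L (cartan L) \<and>
     simple_roots L \<and>
     (\<forall>i. gen_e L i \<in> root_space L (sroot L i) \<and>
          gen_f L i \<in> root_space L (\<lambda>y. - sroot L i y) \<and>
          gen_h L i \<in> cartan L \<and>
          lbr L (gen_e L i) (gen_f L i) = gen_h L i \<and>
          sroot L i (gen_h L i) = 2)"

definition cartan_entry :: "('g, 'l) lie_data \<Rightarrow> 'l \<Rightarrow> 'l \<Rightarrow> complex" where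
  "cartan_entry L i j = sroot L j (gen_h L i)"

definition nilradical :: "('g::ab_group_add, 'l::finite) lie_data \<Rightarrow> 'g set" where
  "nilradical L = module.span (scal L) (\<Union>\<beta>\<in>{\<beta>. positive_root L \<beta>}. root_space L \<beta>)"

definition borel_subalgebra :: "('g::ab_group_add, 'l::finite) lie_data \<Rightarrow> 'g set" where
  "borel_subalgebra L = {y + x |x y. y \<in> cartan L \<and> x \<in> nilradical L}"

definition p_minus :: "('g::ab_group_add, 'l::finite) lie_data \<Rightarrow> 'g" where
  "p_minus L = (\<Sum>i\<in>UNIV. gen_f L i)"

definition fund_coweight :: "('g::ab_group_add, 'l) lie_data \<Rightarrow> 'l \<Rightarrow> 'g" where
  "fund_coweight L i = (THE y. y \<in> cartan L \<and> (\<forall>j. sroot L j y = (if j = i then 1 else 0)))"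

definition rho_check :: "('g::ab_group_add, 'l::finite) lie_data \<Rightarrow> 'g" where
  "rho_check L = (\<Sum>i\<in>UNIV. fund_coweight L i)"

definition invariant_inner_product ::
    "('g::ab_group_add, 'l) lie_data \<Rightarrow> ('g \<Rightarrow> 'g \<Rightarrow> complex) \<Rightarrow> bool" where
  "invariant_inner_product L \<nu> \<longleftrightarrow>
     (\<forall>x. linear_form L (\<nu> x)) \<and> (\<forall>x y. \<nu> x y = \<nu> y x) \<and>
     (\<forall>x y z. \<nu> (lbr L x y) z = \<nu> x (lbr L y z))"


section \<open>The groups \<open>B\<close> and \<open>N\<close>\<close>

text \<open>Exponential of an endomorphism of a finite-dimensional space, with convergence tested
  against all linear forms.\<close>

definition op_exp :: "('g::ab_group_add, 'l) lie_data \<Rightarrow> ('g \<Rightarrow> 'g) \<Rightarrow> 'g \<Rightarrow> 'g" where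
  "op_exp L A y = (THE z. \<forall>u. linear_form L u \<longrightarrow> (\<lambda>n. u ((A ^^ n) y) / fact n) sums u z)"

text \<open>The connected subgroup of \<open>GL(\<gg>)\<close> whose Lie algebra is the image under \<open>ad\<close> of
  a subalgebra \<open>S\<close>. The adjoint group is \<open>G = exp_group L UNIV\<close>, and its
  action on \<open>\<gg>\<close> is faithful, so subgroups of \<open>G\<close> are groups of bijections of \<open>\<gg>\<close>.\<close>

definition exp_group :: "('g::ab_group_add, 'l) lie_data \<Rightarrow> 'g set \<Rightarrow> ('g \<Rightarrow> 'g) set" where
  "exp_group L S = generate (BijGroup UNIV) {op_exp L (lbr L x) |x. x \<in> S}"

definition borel_group :: "('g::ab_group_add, 'l::finite) lie_data \<Rightarrow> ('g \<Rightarrow> 'g) set" where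
  "borel_group L = exp_group L (borel_subalgebra L)"

definition unipotent_group :: "('g::ab_group_add, 'l::finite) lie_data \<Rightarrow> ('g \<Rightarrow> 'g) set" where
  "unipotent_group L = derived (BijGroup UNIV) (borel_group L)"

text \<open>\<open>N[[t]]\<close> is the set of \<open>\<complex>[[t]]\<close>-points of the algebraic group \<open>N\<close>. Being unipotent,
  \<open>N\<close> is Zariski closed in \<open>End(\<gg>)\<close>, so its \<open>\<complex>[[t]]\<close>-points are the elements of
  \<open>End(\<gg>)[[t]]\<close> satisfying all polynomial equations that hold on \<open>N\<close>. An element
  \<open>\<Sum>n. \<gamma> n * t^n\<close> of \<open>End(\<gg>)[[t]]\<close> is represented by its coefficients, and the
  variable \<open>(u, y)\<close>, for a linear form \<open>u\<close> and \<open>y\<close> in \<open>\<gg>\<close>, stands for the matrix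
  coefficient \<open>A \<mapsto> u (A y)\<close>.\<close>

definition unipotent_loops ::
    "('g::ab_group_add, 'l::finite) lie_data \<Rightarrow> (nat \<Rightarrow> 'g \<Rightarrow> 'g) set" where
  "unipotent_loops L = {\<gamma>.
     (\<forall>n. Vector_Spaces.linear (scal L) (scal L) (\<gamma> n)) \<and>
     (\<forall>P::(('g \<Rightarrow> complex) \<times> 'g) cpoly.
        (\<forall>(u, y)\<in>pvars P. linear_form L u) \<longrightarrow>
        (\<forall>g\<in>unipotent_group L. peval (\<lambda>c. c) (\<lambda>(u, y). u (g y)) P = 0) \<longrightarrow>
        peval fps_const (\<lambda>(u, y). Abs_fps (\<lambda>n. u (\<gamma> n y))) P = 0)}"


section \<open>Opers on the disc\<close>

text \<open>An element \<open>\<Sum>n. A n * t^n\<close> of \<open>\<gg>[[t]]\<close> is represented by its coefficients \<open>A\<close>, and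
  the operator \<open>\<partial>\<^sub>t + A(t)\<close> by \<open>A\<close>.\<close>

definition v_part :: "('g::ab_group_add, 'l::finite) lie_data \<Rightarrow> (nat \<Rightarrow> 'g) \<Rightarrow> nat \<Rightarrow> 'g" where
  "v_part L A n = (if n = 0 then A 0 - p_minus L else A n)"

definition oper_connections :: "('g::ab_group_add, 'l::finite) lie_data \<Rightarrow> (nat \<Rightarrow> 'g) set" where
  "oper_connections L = {A. \<forall>n. v_part L A n \<in> borel_subalgebra L}"

text \<open>\<open>A' = \<gamma> A \<gamma>\<^sup>-\<^sup>1 - (\<partial>\<^sub>t\<gamma>) \<gamma>\<^sup>-\<^sup>1\<close>, read in \<open>End(\<gg>)[[t]]\<close> by means of \<open>ad\<close> (which is
  injective) and multiplied by \<open>\<gamma>\<close> from the right: \<open>(\<partial>\<^sub>t\<gamma>) + ad A' \<gamma> = \<gamma> ad A\<close>.\<close>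

definition gauge_transform ::
    "('g::ab_group_add, 'l) lie_data \<Rightarrow> (nat \<Rightarrow> 'g \<Rightarrow> 'g) \<Rightarrow> (nat \<Rightarrow> 'g) \<Rightarrow> (nat \<Rightarrow> 'g) \<Rightarrow> bool" where
  "gauge_transform L \<gamma> A A' \<longleftrightarrow> (\<forall>n y.
     scal L (of_nat (Suc n)) (\<gamma> (Suc n) y) + (\<Sum>i\<le>n. lbr L (A' i) (\<gamma> (n - i) y)) =
     (\<Sum>i\<le>n. \<gamma> (n - i) (lbr L (A i) y)))"

definition gauge_rel ::
    "('g::ab_group_add, 'l::finite) lie_data \<Rightarrow> ((nat \<Rightarrow> 'g) \<times> (nat \<Rightarrow> 'g)) set" where
  "gauge_rel L = {(A, A'). A \<in> oper_connections L \<and> A' \<in> oper_connections L \<and>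
     (\<exists>\<gamma>\<in>unipotent_loops L. gauge_transform L \<gamma> A A')}"

definition oper_class ::
    "('g::ab_group_add, 'l::finite) lie_data \<Rightarrow> (nat \<Rightarrow> 'g) \<Rightarrow> (nat \<Rightarrow> 'g) set" where
  "oper_class L A = gauge_rel L `` {A}"

definition opers :: "('g::ab_group_add, 'l::finite) lie_data \<Rightarrow> (nat \<Rightarrow> 'g) set set" where
  "opers L = oper_connections L // gauge_rel L"

text \<open>Functions on the quotient are the functions whose pullback to the space of operators
  is a polynomial in finitely many coordinates \<open>A \<mapsto> u (A n)\<close>, \<open>u\<close> a linear form.\<close>

definition fun_opers ::
    "('g::ab_group_add, 'l::finite) lie_data \<Rightarrow> ((nat \<Rightarrow> 'g) set \<Rightarrow> complex) set" where
  "fun_opers L = {F \<in> extensional (opers L).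
     \<exists>P::(('g \<Rightarrow> complex) \<times> nat) cpoly. (\<forall>(u, n)\<in>pvars P. linear_form L u) \<and>
       (\<forall>A\<in>oper_connections L. F (oper_class L A) = peval (\<lambda>c. c) (\<lambda>(u, n). u (A n)) P)}"


section \<open>Changes of coordinate\<close>

text \<open>Families of coordinate changes \<open>t = \<phi>(s)\<close> depending on a formal parameter \<open>\<epsilon>\<close>: here
  \<open>\<phi>\<close> lies in \<open>\<complex>[[s]][[\<epsilon>]]\<close>, with \<open>\<phi> $ a $ b\<close> the coefficient of \<open>\<epsilon>^a s^b\<close>, and
  \<open>\<phi>(0)\<close> vanishes at \<open>\<epsilon> = 0\<close>. A single coordinate change is a \<open>\<phi>\<close> independent of \<open>\<epsilon>\<close>.
  Elements of \<open>\<gg>[[s]][[\<epsilon>]]\<close> are represented by their coefficients in the same order.\<close>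

definition d_ds :: "complex fps fps \<Rightarrow> complex fps fps" where
  "d_ds \<phi> = Abs_fps (\<lambda>a. fps_deriv (\<phi> $ a))"

definition family_scale :: "('g::ab_group_add, 'l) lie_data \<Rightarrow>
    complex fps fps \<Rightarrow> (nat \<Rightarrow> nat \<Rightarrow> 'g) \<Rightarrow> nat \<Rightarrow> nat \<Rightarrow> 'g" where
  "family_scale L c w a b = (\<Sum>i\<le>a. \<Sum>j\<le>b. scal L (c $ i $ j) (w (a - i) (b - j)))"

text \<open>\<open>v(\<phi>(s)) = \<Sum>k. \<phi>^k * v k\<close>; since \<open>\<phi>\<close> lies in the ideal \<open>(s, \<epsilon>)\<close>, only \<open>k \<le> a + b\<close>
  contribute to the coefficient of \<open>\<epsilon>^a s^b\<close>.\<close>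

definition substitute :: "('g::ab_group_add, 'l) lie_data \<Rightarrow>
    (nat \<Rightarrow> 'g) \<Rightarrow> complex fps fps \<Rightarrow> nat \<Rightarrow> nat \<Rightarrow> 'g" where
  "substitute L v \<phi> a b = (\<Sum>k\<le>a + b. scal L ((\<phi> ^ k) $ a $ b) (v k))"

text \<open>The component of \<open>x\<close> in the eigenspace of \<open>ad \<rho>\<^sup>\<or>\<close> with eigenvalue \<open>k\<close>; on \<open>\<bb>\<close> all
  eigenvalues are natural numbers. The one-parameter subgroup \<open>\<rho>\<^sup>\<or>\<close> takes \<open>c\<close> to the operator
  multiplying this component by \<open>c^k\<close>.\<close>

definition degree_part :: "('g::ab_group_add, 'l::finite) lie_data \<Rightarrow> nat \<Rightarrow> 'g \<Rightarrow> 'g" where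
  "degree_part L k x = (THE y. \<exists>z::nat \<Rightarrow> 'g. finite {j. z j \<noteq> 0} \<and>
     (\<forall>j. lbr L (rho_check L) (z j) = scal L (of_nat j) (z j)) \<and> x = Sum_any z \<and> y = z k)"

definition rho_action :: "('g::ab_group_add, 'l::finite) lie_data \<Rightarrow>
    complex fps fps \<Rightarrow> (nat \<Rightarrow> nat \<Rightarrow> 'g) \<Rightarrow> nat \<Rightarrow> nat \<Rightarrow> 'g" where
  "rho_action L c w a b =
     Sum_any (\<lambda>k. family_scale L (c ^ k) (\<lambda>i j. degree_part L k (w i j)) a b)"

text \<open>The \<open>\<bb>\<close>-part of the transformed operator:
  \<open>\<phi>' \<rho>\<^sup>\<or>(\<phi>') v(\<phi>(s)) \<rho>\<^sup>\<or>(\<phi>')\<^sup>-\<^sup>1 - \<rho>\<^sup>\<or> \<phi>''/\<phi>'\<close>.\<close>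

definition coordinate_change :: "('g::ab_group_add, 'l::finite) lie_data \<Rightarrow>
    complex fps fps \<Rightarrow> (nat \<Rightarrow> 'g) \<Rightarrow> nat \<Rightarrow> nat \<Rightarrow> 'g" where
  "coordinate_change L \<phi> v a b =
     family_scale L (d_ds \<phi>) (rho_action L (d_ds \<phi>) (substitute L v \<phi>)) a b -
     scal L ((d_ds (d_ds \<phi>) * inverse (d_ds \<phi>)) $ a $ b) (rho_check L)"

text \<open>\<open>Der \<O> = \<complex>[[t]]\<partial>\<^sub>t\<close> acts on functions on opers by differentiating along coordinate changes. For the
  vector field \<open>\<xi>(t)\<partial>\<^sub>t\<close> the coordinate change is \<open>\<phi>(s) = s - \<epsilon> \<xi>(s)\<close>, the inverse of the
  infinitesimal flow; the sign makes the action a homomorphism of Lie algebras.\<close>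

definition oper_variation :: "('g::ab_group_add, 'l::finite) lie_data \<Rightarrow>
    complex fps \<Rightarrow> (nat \<Rightarrow> 'g) \<Rightarrow> nat \<Rightarrow> 'g" where
  "oper_variation L \<xi> v n =
     coordinate_change L (fps_const fps_X - fps_X * fps_const \<xi>) v 1 n"

definition der_opers :: "('g::ab_group_add, 'l::finite) lie_data \<Rightarrow>
    complex fps \<Rightarrow> ((nat \<Rightarrow> 'g) set \<Rightarrow> complex) \<Rightarrow> (nat \<Rightarrow> 'g) set \<Rightarrow> complex" where
  "der_opers L \<xi> F = (\<lambda>\<chi>\<in>opers L. THE d. \<forall>A\<in>\<chi>.
     ((\<lambda>\<epsilon>. F (oper_class L (\<lambda>n. A n + scal L \<epsilon> (oper_variation L \<xi> (v_part L A) n))))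
        has_field_derivative d) (at 0))"


section \<open>The classical W-algebra\<close>

text \<open>The variable \<open>(i, k)\<close> is \<open>\<b>'\<^bsub>i,-k-1\<^esub>\<close>, so \<open>\<pi>\<^sub>0\<close> is the whole type \<open>('l \<times> nat) cpoly\<close>.\<close>

definition bgen :: "'l \<Rightarrow> int \<Rightarrow> ('l \<times> nat) cpoly" where
  "bgen i n = pvar (i, nat (- n - 1))"

definition V_series :: "'l \<Rightarrow> ('l \<times> nat) cpoly fps" where
  "V_series i = fps_compose (Abs_fps (\<lambda>n. pconst (1 / fact n)))
     (Abs_fps (\<lambda>m. if m = 0 then 0 else pconst (- 1 / of_nat m) * bgen i (- int m)))"

text \<open>\<open>V_coeff i n\<close> for \<open>n \<le> 0\<close>.\<close>

definition V_coeff :: "'l \<Rightarrow> int \<Rightarrow> ('l \<times> nat) cpoly" where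
  "V_coeff i n = V_series i $ nat (- n)"

definition D_b :: "('g, 'l) lie_data \<Rightarrow> 'l \<Rightarrow> int \<Rightarrow> ('l \<times> nat) cpoly \<Rightarrow> ('l \<times> nat) cpoly" where
  "D_b L i m = derivation_of (\<lambda>(j, k). if - int k - 1 = m then pconst (cartan_entry L i j) else 0)"

text \<open>\<open>\<Sum>m\<le>0. V_coeff i m * D_b L i (m - 1)\<close>, a finite sum on each polynomial; here \<open>m = - k\<close>.\<close>

definition V_screening :: "('g, 'l) lie_data \<Rightarrow> 'l \<Rightarrow> ('l \<times> nat) cpoly \<Rightarrow> ('l \<times> nat) cpoly" where
  "V_screening L i p = Sum_any (\<lambda>k::nat. V_coeff i (- int k) * D_b L i (- int k - 1) p)"

text \<open>In the rescaled generators \<open>\<b>'\<close> the form \<open>\<nu>\<close> does not enter the formulas.\<close>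

definition classical_W ::
    "('g, 'l) lie_data \<Rightarrow> ('g \<Rightarrow> 'g \<Rightarrow> complex) \<Rightarrow> ('l \<times> nat) cpoly set" where
  "classical_W L \<nu> = (\<Inter>i. {p. V_screening L i p = 0})"

text \<open>The action of \<open>L\<^sub>n = - t^(n+1) \<partial>\<^sub>t\<close>, \<open>n \<ge> - 1\<close>.\<close>

definition L_pi :: "int \<Rightarrow> ('l \<times> nat) cpoly \<Rightarrow> ('l \<times> nat) cpoly" where
  "L_pi n = derivation_of (\<lambda>(i, k). let m = - int k - 1 in
     if n < - m then pconst (of_int (- m)) * bgen i (n + m)
     else if n = - m then pconst (of_int (- n * (n + 1)))
     else 0)"

text \<open>\<open>\<xi>(t)\<partial>\<^sub>t = - \<Sum>k. \<xi>\<^sub>k L\<^bsub>k-1\<^esub>\<close>; on each polynomial only finitely many terms are non-zero.\<close>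

definition der_pi :: "complex fps \<Rightarrow> ('l \<times> nat) cpoly \<Rightarrow> ('l \<times> nat) cpoly" where
  "der_pi \<xi> p = - Sum_any (\<lambda>k::nat. pconst (\<xi> $ k) * L_pi (int k - 1) p)"

end

theory Submission
  imports
    Defs
    "HOL-Analysis.Analysis"
    "HOL-Library.Function_Algebras"
    "HOL-Computational_Algebra.Fundamental_Theorem_Algebra"
begin

text \<open>
  Every oper is gauge equivalent to a Miura oper \<open>\<partial>\<^sub>t + p\<^sub>-\<^sub>1 + h(t)\<close> with \<open>h\<close> in \<open>\<hh>[[t]]\<close>. With
  \<open>u\<^sub>i = \<alpha>\<^sub>i(h)\<close> and \<open>\<b>'\<close> standing for the coefficients of the \<open>u\<^sub>i\<close>, a polynomial in \<open>\<pi>\<^sub>0\<close> is a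
  function on Miura opers, and the isomorphism assigns to \<open>q\<close> in the \<open>\<W>\<close>-algebra the function whose
  value at an oper is the value of \<open>q\<close> at any Miura oper in its class. The point is that the kernel of
  the screening operators consists exactly of the polynomials that take equal values at gauge
  equivalent Miura opers (\<open>W_gauge_invariant\<close>, \<open>W_gaugeI\<close>).

  For this, note that \<open>exp(x(t) e\<^sub>i)\<close> maps a Miura oper to a Miura oper exactly when \<open>x\<close> solves the
  Riccati equation \<open>x' = - u\<^sub>i x - x\<^sup>2\<close>, and then it adds \<open>x a\<^sub>i\<^sub>j\<close> to \<open>u\<^sub>j\<close>. The derivative of the solution
  in its initial value \<open>c = x(0)\<close> is \<open>exp(- \<integral>u\<^sub>i)\<close>, taken at the transformed Miura oper. So \<open>c\<close> is the
  time of a flow, and its vector field is the screening operator \<open>\<V>\<^sub>i[1]\<close>: being in its kernel is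
  being constant along the flow. Moreover a gauge transformation between two Miura opers is determined
  by its value at \<open>t = 0\<close> (\<open>miura_gauge_unique\<close>). This value is in \<open>N\<close>, which is generated by the
  \<open>exp(c e\<^sub>i)\<close>, so the gauge transformation is a composition of the special ones (\<open>screening_chain\<close>).

  The functions obtained in this way are polynomial because the passage to a Miura oper removes the
  part in \<open>\<nn>\<close> of one coefficient after the other, by polynomial formulas. All functions
  arise, because restricting a function on opers to Miura opers gives a gauge invariant polynomial
  in the \<open>u\<^sub>i\<close>.

  For the action of \<open>Der \<O>\<close>, the variation of \<open>A\<close> under \<open>\<xi>\<partial>\<^sub>t\<close> is \<open>- \<nabla>\<^sub>A(\<xi>A - \<xi>'\<rho>\<^sup>\<or>)\<close> with
  \<open>\<nabla>\<^sub>A = \<partial>\<^sub>t + ad A\<close> (\<open>variation_nabla\<close>). A gauge transformation respects these variations up to some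
  \<open>\<nabla>\<^sub>A z\<close> with \<open>z\<close> in \<open>\<nn>[[t]]\<close> (\<open>variation_gauge\<close>), and an invariant function has zero derivative in
  that direction. So the derivative of the function attached to \<open>q\<close> can be computed at a Miura oper.
  There the variation is \<open>u\<^sub>i \<mapsto> \<xi>'' - (\<xi>u\<^sub>i)'\<close>, which is the formula for the action on \<open>\<pi>\<^sub>0\<close>.

  All gauge theory is done in the group \<open>ULoop\<close> of unipotent automorphisms of the \<open>\<complex>[[t]]\<close>-Lie
  algebra \<open>\<gg>[[t]]\<close>, which is \<open>N[[t]]\<close> (\<open>unipotent_loops_ULoop\<close>, \<open>ULoop_unipotent_loops\<close>). This rests on
  three facts from the structure theory of \<open>\<gg>\<close>: derivations are inner, \<open>\<hh>\<close> is its own centralizer,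
  and \<open>\<nn>\<close> is generated by the \<open>e\<^sub>i\<close>. All of them use the Killing form, and the last
  one also a trace argument.
\<close>

(* the dollar sign denotes coefficients of power series *)
unbundle no vec_syntax

section \<open>Polynomials in arbitrarily many variables\<close>

definition monom_val :: "('x \<Rightarrow> 'r::comm_ring_1) \<Rightarrow> ('x \<Rightarrow>\<^sub>0 nat) \<Rightarrow> 'r" where
  "monom_val val m = (\<Prod>x\<in>Poly_Mapping.keys m. val x ^ Poly_Mapping.lookup m x)"

lemma monom_val_superset:
  assumes "finite S" "Poly_Mapping.keys m \<subseteq> S"
  shows "monom_val val m = (\<Prod>x\<in>S. val x ^ Poly_Mapping.lookup m x)"
  unfolding monom_val_def using assms
  by (intro prod.mono_neutral_left) (auto simp: in_keys_iff)

lemma monom_val_add: "monom_val val (m + n) = monom_val val m * monom_val val n"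
proof -
  let ?S = "Poly_Mapping.keys m \<union> Poly_Mapping.keys n"
  have "monom_val val (m + n) = (\<Prod>x\<in>?S. val x ^ Poly_Mapping.lookup (m + n) x)"
    by (rule monom_val_superset) (use keys_add[of m n] in auto)
  also have "\<dots> = (\<Prod>x\<in>?S. val x ^ Poly_Mapping.lookup m x) * (\<Prod>x\<in>?S. val x ^ Poly_Mapping.lookup n x)"
    by (simp add: lookup_add power_add prod.distrib)
  also have "\<dots> = monom_val val m * monom_val val n"
    by (simp add: monom_val_superset[of ?S m] monom_val_superset[of ?S n])
  finally show ?thesis .
qed

lemma monom_val_0 [simp]: "monom_val val 0 = 1"
  by (simp add: monom_val_def)

lemma monom_val_single: "monom_val val (Poly_Mapping.single v k) = val v ^ k"
  by (cases "k = 0") (simp_all add: monom_val_def)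

lemma peval_monom_val:
  "peval c val p = (\<Sum>m\<in>Poly_Mapping.keys p. c (Poly_Mapping.lookup p m) * monom_val val m)"
  by (simp add: peval_def monom_val_def)

lemma cpoly_sum_monomials:
  fixes p :: "'x cpoly"
  shows "p = (\<Sum>m\<in>Poly_Mapping.keys p. Poly_Mapping.single m (Poly_Mapping.lookup p m))"
  by (rule poly_mapping_eqI)
     (auto simp: lookup_sum lookup_single when_def in_keys_iff sum.delta' cong: if_cong)

text \<open>The structure map of a commutative \<open>\<complex>\<close>-algebra. It occurs for the algebras \<open>\<complex>\<close>, polynomials,
  and \<open>\<complex>[[t]]\<close>.\<close>

locale coeff_hom =
  fixes c :: "complex \<Rightarrow> 'r::comm_ring_1"
  assumes c_1: "c 1 = 1"
    and c_add: "c (a + b) = c a + c b"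
    and c_mult: "c (a * b) = c a * c b"
begin

lemma c_0: "c 0 = 0"
  using c_add[of 0 0] by simp

lemma peval_superset:
  assumes "finite S" "Poly_Mapping.keys p \<subseteq> S"
  shows "peval c val p = (\<Sum>m\<in>S. c (Poly_Mapping.lookup p m) * monom_val val m)"
  unfolding peval_monom_val using assms
  by (intro sum.mono_neutral_left) (auto simp: in_keys_iff c_0)

lemma peval_add: "peval c val (p + q) = peval c val p + peval c val q"
proof -
  let ?S = "Poly_Mapping.keys p \<union> Poly_Mapping.keys q"
  have "peval c val (p + q) = (\<Sum>m\<in>?S. c (Poly_Mapping.lookup (p + q) m) * monom_val val m)"
    by (rule peval_superset) (use keys_add[of p q] in auto)
  then show ?thesis
    by (simp add: lookup_add c_add sum.distrib distrib_right peval_superset[of ?S p] peval_superset[of ?S q])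
qed

lemma peval_0 [simp]: "peval c val 0 = 0"
  by (simp add: peval_def)

lemma peval_single: "peval c val (Poly_Mapping.single m a) = c a * monom_val val m"
  using peval_superset[of "{m}" "Poly_Mapping.single m a" val] by (simp split: if_splits)

lemma peval_sum: "peval c val (sum f A) = (\<Sum>a\<in>A. peval c val (f a))"
  by (induction A rule: infinite_finite_induct) (auto simp: peval_add)

lemma peval_uminus: "peval c val (- p) = - peval c val p"
  using peval_add[of val p "- p"] by (simp add: eq_neg_iff_add_eq_0 add.commute)

lemma peval_diff: "peval c val (p - q) = peval c val p - peval c val q"
  using peval_add[of val p "- q"] by (simp add: peval_uminus)

lemma peval_mult: "peval c val (p * q) = peval c val p * peval c val q"
proof -
  have "peval c val (p * q) = peval c val
     ((\<Sum>m\<in>Poly_Mapping.keys p. Poly_Mapping.single m (Poly_Mapping.lookup p m)) *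
      (\<Sum>m\<in>Poly_Mapping.keys q. Poly_Mapping.single m (Poly_Mapping.lookup q m)))"
    using cpoly_sum_monomials[of p] cpoly_sum_monomials[of q] by simp
  also have "\<dots> = peval c val p * peval c val q"
    unfolding sum_product mult_single peval_sum peval_single peval_monom_val[of c val p] peval_monom_val[of c val q]
    by (intro sum.cong refl) (simp add: c_mult monom_val_add)
  finally show ?thesis .
qed

lemma peval_pconst [simp]: "peval c val (pconst a) = c a"
  by (simp add: pconst_def peval_single)

lemma peval_pvar [simp]: "peval c val (pvar v) = val v"
  by (simp add: pvar_def peval_single monom_val_single c_1)

lemma peval_1 [simp]: "peval c val 1 = 1"
  using peval_pconst[of val 1] by (simp add: pconst_def c_1)

end

text \<open>Evaluation commutes with ring homomorphisms; applied to the target ring this is substitution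
  into a polynomial followed by evaluation, or evaluation of a curve at a point.\<close>

lemma hom_peval:
  fixes h :: "'r::comm_ring_1 \<Rightarrow> 's::comm_ring_1"
  assumes h0: "h 0 = 0" and h1: "h 1 = 1"
    and ha: "\<And>a b. h (a + b) = h a + h b" and hm: "\<And>a b. h (a * b) = h a * h b"
  shows "h (peval c val p) = peval (\<lambda>a. h (c a)) (\<lambda>v. h (val v)) p"
proof -
  have hs: "h (sum f A) = (\<Sum>a\<in>A. h (f a))" for f :: "'b \<Rightarrow> 'r" and A
    by (induction A rule: infinite_finite_induct) (auto simp: h0 ha)
  have hp: "h (prod f A) = (\<Prod>a\<in>A. h (f a))" for f :: "'b \<Rightarrow> 'r" and A
    by (induction A rule: infinite_finite_induct) (auto simp: h1 hm)
  have hq: "h (x ^ k) = h x ^ k" for x k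
    by (induction k) (auto simp: h1 hm)
  show ?thesis
    by (simp add: peval_def hs hp hq hm)
qed

lemma peval_cong:
  assumes "\<And>v. v \<in> pvars p \<Longrightarrow> val v = val' v"
  shows "peval c val p = peval c val' p"
  unfolding peval_def using assms
  by (intro sum.cong refl arg_cong2[where f="(*)"] prod.cong arg_cong2[where f="(^)"])
     (auto simp: pvars_def)

interpretation idh: coeff_hom "\<lambda>c::complex. c"
  by unfold_locales auto

interpretation pch: coeff_hom "pconst :: complex \<Rightarrow> 'x cpoly"
  by unfold_locales (auto simp: pconst_def single_add mult_single)

interpretation fch: coeff_hom "fps_const :: complex \<Rightarrow> complex fps"
  by unfold_locales auto

abbreviation pval :: "('x \<Rightarrow> complex) \<Rightarrow> 'x cpoly \<Rightarrow> complex" where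
  "pval \<equiv> peval (\<lambda>c. c)"

lemma pval_subst: "pval x (peval pconst R p) = pval (\<lambda>v. pval x (R v)) p"
  using hom_peval[of "pval x" pconst R p] by (simp add: idh.peval_add idh.peval_mult)

lemma finite_pvars: "finite (pvars p)"
  by (simp add: pvars_def)

lemma pvars_add: "pvars (p + q) \<subseteq> pvars p \<union> pvars q"
  using keys_add[of p q] by (auto simp: pvars_def)

lemma pvars_mult: "pvars (p * q) \<subseteq> pvars p \<union> pvars q"
proof
  fix x assume "x \<in> pvars (p * q)"
  then obtain m where m: "m \<in> Poly_Mapping.keys (p * q)" "x \<in> Poly_Mapping.keys m"
    by (auto simp: pvars_def)
  from m(1) keys_mult[of p q] obtain a b where "a \<in> Poly_Mapping.keys p" "b \<in> Poly_Mapping.keys q" "m = a + b"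
    by auto
  then show "x \<in> pvars p \<union> pvars q"
    using m(2) keys_add[of a b] by (auto simp: pvars_def)
qed

lemma pvars_pconst [simp]: "pvars (pconst a) = {}"
  by (auto simp: pvars_def pconst_def)

lemma pvars_uminus: "pvars (- p) = pvars p"
  by (simp add: pvars_def)

lemma pvars_pvar [simp]: "pvars (pvar v) = {v}"
  by (auto simp: pvars_def pvar_def)

lemma pvars_sum: "pvars (sum f A) \<subseteq> (\<Union>a\<in>A. pvars (f a))"
proof (induction A rule: infinite_finite_induct)
  case (insert x F)
  then show ?case using pvars_add[of "f x" "sum f F"] by auto
qed (auto simp: pvars_def)

lemma pvars_power: "pvars (p ^ k) \<subseteq> pvars p"
proof (induction k)
  case (Suc k)
  then show ?case using pvars_mult[of p "p ^ k"] by auto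
qed (auto simp: pvars_def)

lemma pvars_prod: "pvars (prod f A) \<subseteq> (\<Union>a\<in>A. pvars (f a))"
proof (induction A rule: infinite_finite_induct)
  case (insert x F)
  then show ?case using pvars_mult[of "f x" "prod f F"] by auto
qed (auto simp: pvars_def)

lemma pvars_peval: "pvars (peval pconst R p) \<subseteq> (\<Union>v\<in>pvars p. pvars (R v))"
proof -
  have "pvars (pconst (Poly_Mapping.lookup p m) * (\<Prod>x\<in>Poly_Mapping.keys m. R x ^ Poly_Mapping.lookup m x))
     \<subseteq> (\<Union>v\<in>pvars p. pvars (R v))" if m: "m \<in> Poly_Mapping.keys p" for m
  proof -
    have "pvars (\<Prod>x\<in>Poly_Mapping.keys m. R x ^ Poly_Mapping.lookup m x)
        \<subseteq> (\<Union>x\<in>Poly_Mapping.keys m. pvars (R x ^ Poly_Mapping.lookup m x))"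
      by (rule pvars_prod)
    also have "\<dots> \<subseteq> (\<Union>x\<in>Poly_Mapping.keys m. pvars (R x))"
      using pvars_power by fast
    also have "\<dots> \<subseteq> (\<Union>v\<in>pvars p. pvars (R v))"
      using m by (auto simp: pvars_def)
    finally show ?thesis
      using pvars_mult[of "pconst (Poly_Mapping.lookup p m)"
          "\<Prod>x\<in>Poly_Mapping.keys m. R x ^ Poly_Mapping.lookup m x"] by auto
  qed
  then show ?thesis
    unfolding peval_def
    using pvars_sum[of "\<lambda>m. pconst (Poly_Mapping.lookup p m) * (\<Prod>x\<in>Poly_Mapping.keys m. R x ^ Poly_Mapping.lookup m x)"
        "Poly_Mapping.keys p"] by blast
qed

subsection \<open>A polynomial that vanishes at all points is zero\<close>

text \<open>Induction on the number of variables: for fixed values of the other variables, a polynomial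
  in one variable that vanishes everywhere has zero coefficients.\<close>

lemma monomials_independent:
  assumes "finite V" "finite M" "\<And>m. m \<in> M \<Longrightarrow> Poly_Mapping.keys m \<subseteq> V"
    and "\<And>x. (\<Sum>m\<in>M. a m * monom_val x m) = (0::complex)" and "m \<in> M"
  shows "a m = 0"
  using assms
proof (induction V arbitrary: M a m rule: finite_induct)
  case empty
  have z: "n = 0" if "n \<in> M" for n
    using empty.prems(2)[OF that] by simp
  have "M = {0}" using z empty.prems(4) by blast
  moreover have "m = 0" using z empty.prems(4) by blast
  ultimately show ?case using empty.prems(3)[of "\<lambda>_. 0"] by simp
next
  case (insert v V)
  define red where "red = (\<lambda>m::'a \<Rightarrow>\<^sub>0 nat. m - Poly_Mapping.single v (Poly_Mapping.lookup m v))"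
  have lred: "Poly_Mapping.lookup (red m) w = (if w = v then 0 else Poly_Mapping.lookup m w)" for m w
    by (simp add: red_def lookup_minus lookup_single when_def)
  have red: "m = red m + Poly_Mapping.single v (Poly_Mapping.lookup m v)" for m
    by (rule poly_mapping_eqI) (simp add: lookup_add lred lookup_single when_def)
  have kred: "Poly_Mapping.keys (red m) \<subseteq> V" if "m \<in> M" for m
  proof
    fix x assume "x \<in> Poly_Mapping.keys (red m)"
    then have "x \<noteq> v" "x \<in> Poly_Mapping.keys m"
      unfolding in_keys_iff lred by (auto split: if_splits)
    then show "x \<in> V" using insert.prems(2)[OF that] by blast
  qed
  define D where "D = Max ((\<lambda>m. Poly_Mapping.lookup m v) ` M)"
  have D: "Poly_Mapping.lookup m v \<le> D" if "m \<in> M" for m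
    unfolding D_def using that insert.prems(1) by auto
  define e where "e = Poly_Mapping.lookup m v"
  define Me where "Me = (\<lambda>e. {m\<in>M. Poly_Mapping.lookup m v = e})"
  have fin: "finite (Me e)" for e using insert.prems(1) by (simp add: Me_def)
  have inj: "inj_on red (Me e)" for e
  proof (rule inj_onI)
    fix x y assume "x \<in> Me e" "y \<in> Me e" "red x = red y"
    then show "x = y" using red[of x, symmetric] red[of y, symmetric] by (simp add: Me_def)
  qed
  have key: "(\<Sum>m\<in>Me e. a m * monom_val x (red m)) = 0" for x
  proof -
    have "(\<Sum>e\<le>D. (\<Sum>m\<in>Me e. a m * monom_val x (red m)) * s ^ e) = 0" for s
    proof -
      define x' where "x' = x(v := s)"
      have mv: "monom_val x' m = monom_val x (red m) * s ^ Poly_Mapping.lookup m v" if "m \<in> M" for m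
      proof -
        have "monom_val x' m = monom_val x' (red m) * s ^ Poly_Mapping.lookup m v"
          using monom_val_add[of x' "red m" "Poly_Mapping.single v (Poly_Mapping.lookup m v)"]
          unfolding red[symmetric] by (simp add: monom_val_single x'_def)
        moreover have "monom_val x' (red m) = monom_val x (red m)"
          unfolding monom_val_def using kred[OF that] insert.hyps
          by (intro prod.cong) (auto simp: x'_def)
        ultimately show ?thesis by simp
      qed
      have "0 = (\<Sum>m\<in>M. a m * monom_val x' m)" using insert.prems(3) by simp
      also have "\<dots> = (\<Sum>m\<in>M. a m * monom_val x (red m) * s ^ Poly_Mapping.lookup m v)"
        by (intro sum.cong) (auto simp: mv)
      also have "\<dots> = (\<Sum>e\<le>D. \<Sum>m\<in>Me e. a m * monom_val x (red m) * s ^ Poly_Mapping.lookup m v)"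
        unfolding Me_def by (rule sum.group[symmetric]) (use insert.prems(1) D in auto)
      also have "\<dots> = (\<Sum>e\<le>D. (\<Sum>m\<in>Me e. a m * monom_val x (red m)) * s ^ e)"
        by (intro sum.cong refl) (auto simp: Me_def sum_distrib_right)
      finally show ?thesis by simp
    qed
    moreover have "e \<le> D" using D insert.prems(4) by (simp add: e_def)
    ultimately show ?thesis
      using zero_polynom_imp_zero_coeffs[of "\<lambda>e. \<Sum>m\<in>Me e. a m * monom_val x (red m)" D e] by simp
  qed
  define a' where "a' = (\<lambda>n. a (n + Poly_Mapping.single v e))"
  have a': "a m = a' (red m)" if "m \<in> Me e" for m
    using that red[of m, symmetric] by (simp add: a'_def Me_def)
  have s0: "(\<Sum>n\<in>red ` Me e. a' n * monom_val x n) = 0" for x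
  proof -
    have "(\<Sum>n\<in>red ` Me e. a' n * monom_val x n) = (\<Sum>m\<in>Me e. a' (red m) * monom_val x (red m))"
      by (subst sum.reindex[OF inj]) (simp add: comp_def)
    also have "\<dots> = (\<Sum>m\<in>Me e. a m * monom_val x (red m))"
      by (intro sum.cong refl) (simp only: a')
    finally show ?thesis using key[of x] by simp
  qed
  have mMe: "m \<in> Me e" using insert.prems(4) by (simp add: Me_def e_def)
  have kk: "Poly_Mapping.keys n \<subseteq> V" if "n \<in> red ` Me e" for n
    using that kred by (auto simp: Me_def)
  have "a' (red m) = 0"
    by (rule insert.IH[of "red ` Me e"]) (use fin kk s0 mMe in blast)+
  then show ?case using a'[OF mMe] by simp
qed

lemma pval_zero_imp_zero:
  assumes "\<And>x. pval x p = 0"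
  shows "p = 0"
proof (rule poly_mapping_eqI)
  fix m
  show "Poly_Mapping.lookup p m = Poly_Mapping.lookup 0 m"
  proof (cases "m \<in> Poly_Mapping.keys p")
    case True
    have "Poly_Mapping.lookup p m = 0"
    proof (rule monomials_independent[of "pvars p" "Poly_Mapping.keys p" "Poly_Mapping.lookup p"])
      show "(\<Sum>m\<in>Poly_Mapping.keys p. Poly_Mapping.lookup p m * monom_val x m) = 0" for x
        using assms[of x] unfolding peval_monom_val .
    qed (use True finite_pvars in \<open>auto simp: pvars_def\<close>)
    then show ?thesis by simp
  qed (simp add: in_keys_iff)
qed

lemma pval_inject:
  assumes "\<And>x. pval x p = pval x q"
  shows "p = q"
  using pval_zero_imp_zero[of "p - q"] assms by (simp add: idh.peval_diff)

subsection \<open>Directional derivatives\<close>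

text \<open>The value at \<open>x\<close> of \<open>\<Sum>v. D v * \<partial>p/\<partial>v\<close>.\<close>

definition pdir :: "('x \<Rightarrow> complex) \<Rightarrow> ('x \<Rightarrow> complex) \<Rightarrow> 'x cpoly \<Rightarrow> complex" where
  "pdir x D p = (\<Sum>m\<in>Poly_Mapping.keys p. \<Sum>v\<in>Poly_Mapping.keys m.
      Poly_Mapping.lookup p m * of_nat (Poly_Mapping.lookup m v) *
      monom_val x (m - Poly_Mapping.single v 1) * D v)"

lemma pdir_add: "pdir x (\<lambda>v. D v + E v) p = pdir x D p + pdir x E p"
  by (simp add: pdir_def distrib_left sum.distrib)

lemma pdir_scale: "pdir x (\<lambda>v. c * D v) p = c * pdir x D p"
  by (simp add: pdir_def sum_distrib_left mult_ac)

lemma pdir_0 [simp]: "pdir x (\<lambda>v. 0) p = 0"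
  by (simp add: pdir_def)

lemma pdir_sum: "pdir x (\<lambda>v. \<Sum>a\<in>A. D a v) p = (\<Sum>a\<in>A. pdir x (D a) p)"
  by (induction A rule: infinite_finite_induct) (auto simp: pdir_add)

lemma pdir_cong:
  assumes "\<And>v. v \<in> pvars p \<Longrightarrow> D v = E v"
  shows "pdir x D p = pdir x E p"
  unfolding pdir_def using assms by (intro sum.cong refl) (auto simp: pvars_def)

lemma pval_derivation_of: "pval x (derivation_of d p) = pdir x (\<lambda>v. pval x (d v)) p"
  by (simp add: derivation_of_def pdir_def idh.peval_sum idh.peval_mult idh.peval_single)

lemma has_field_derivative_pval:
  assumes "\<And>v. v \<in> pvars p \<Longrightarrow> ((\<lambda>s. X s v) has_field_derivative D v) (at s)"
  shows "((\<lambda>s. pval (X s) p) has_field_derivative pdir (X s) D p) (at s)"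
proof -
  have mono: "((\<lambda>s. monom_val (X s) m) has_field_derivative
      (\<Sum>v\<in>Poly_Mapping.keys m. of_nat (Poly_Mapping.lookup m v) *
      monom_val (X s) (m - Poly_Mapping.single v 1) * D v)) (at s)"
    if m: "m \<in> Poly_Mapping.keys p" for m
  proof -
    have "((\<lambda>s. monom_val (X s) m) has_field_derivative
       (\<Sum>v\<in>Poly_Mapping.keys m. of_nat (Poly_Mapping.lookup m v) * (D v * X s v ^ (Poly_Mapping.lookup m v - Suc 0)) *
          (\<Prod>w\<in>Poly_Mapping.keys m - {v}. X s w ^ Poly_Mapping.lookup m w))) (at s)"
      unfolding monom_val_def
      by (rule has_field_derivative_prod, rule DERIV_power, rule assms) (use m in \<open>auto simp: pvars_def\<close>)
    also have "(\<Sum>v\<in>Poly_Mapping.keys m. of_nat (Poly_Mapping.lookup m v) * (D v * X s v ^ (Poly_Mapping.lookup m v - Suc 0)) *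
          (\<Prod>w\<in>Poly_Mapping.keys m - {v}. X s w ^ Poly_Mapping.lookup m w)) =
       (\<Sum>v\<in>Poly_Mapping.keys m. of_nat (Poly_Mapping.lookup m v) *
      monom_val (X s) (m - Poly_Mapping.single v 1) * D v)"
    proof (intro sum.cong refl)
      fix v assume v: "v \<in> Poly_Mapping.keys m"
      have "monom_val (X s) (m - Poly_Mapping.single v 1) =
         (\<Prod>w\<in>Poly_Mapping.keys m. X s w ^ Poly_Mapping.lookup (m - Poly_Mapping.single v 1) w)"
        by (rule monom_val_superset) (auto simp: in_keys_iff lookup_minus)
      also have "\<dots> = X s v ^ (Poly_Mapping.lookup m v - Suc 0) *
         (\<Prod>w\<in>Poly_Mapping.keys m - {v}. X s w ^ Poly_Mapping.lookup m w)"
        using v by (subst prod.remove[of _ v]) (auto simp: lookup_minus lookup_single when_def intro!: prod.cong)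
      finally show "of_nat (Poly_Mapping.lookup m v) * (D v * X s v ^ (Poly_Mapping.lookup m v - Suc 0)) *
          (\<Prod>w\<in>Poly_Mapping.keys m - {v}. X s w ^ Poly_Mapping.lookup m w) =
          of_nat (Poly_Mapping.lookup m v) * monom_val (X s) (m - Poly_Mapping.single v 1) * D v"
        by simp
    qed
    finally show ?thesis .
  qed
  have "((\<lambda>s. pval (X s) p) has_field_derivative
     (\<Sum>m\<in>Poly_Mapping.keys p. Poly_Mapping.lookup p m * (\<Sum>v\<in>Poly_Mapping.keys m. of_nat (Poly_Mapping.lookup m v) *
      monom_val (X s) (m - Poly_Mapping.single v 1) * D v))) (at s)"
    unfolding peval_monom_val by (intro DERIV_sum DERIV_cmult mono)
  then show ?thesis
    by (simp add: pdir_def sum_distrib_left mult.assoc)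
qed

subsection \<open>Evaluation at power series\<close>

text \<open>Congruence modulo \<open>t^(n+1)\<close>. A coefficient of a polynomial in power series depends on
  finitely many coefficients of these, so power series may be replaced by polynomials there.\<close>

definition agree_upto :: "nat \<Rightarrow> complex fps \<Rightarrow> complex fps \<Rightarrow> bool" where
  "agree_upto n a b \<longleftrightarrow> (\<forall>j\<le>n. a $ j = b $ j)"

lemma agree_upto_mult: "agree_upto n a b \<Longrightarrow> agree_upto n c d \<Longrightarrow> agree_upto n (a * c) (b * d)"
  by (auto simp: agree_upto_def fps_mult_nth intro!: sum.cong)

lemma agree_upto_peval:
  assumes "\<And>v. v \<in> pvars p \<Longrightarrow> agree_upto n (f v) (g v)"
  shows "agree_upto n (peval fps_const f p) (peval fps_const g p)"
proof -
  have pw: "agree_upto n (a ^ k) (b ^ k)" if "agree_upto n a b" for a b k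
    by (induction k) (auto simp: agree_upto_mult that, simp add: agree_upto_def)
  have pr: "agree_upto n (prod a A) (prod b A)" if "\<And>i. i \<in> A \<Longrightarrow> agree_upto n (a i) (b i)" for a b and A :: "'b set"
    using that by (induction A rule: infinite_finite_induct) (auto simp: agree_upto_mult, simp_all add: agree_upto_def)
  have sm: "agree_upto n (sum a A) (sum b A)" if "\<And>i. i \<in> A \<Longrightarrow> agree_upto n (a i) (b i)" for a b and A :: "'b set"
    using that by (auto simp: agree_upto_def fps_sum_nth intro!: sum.cong)
  have cc: "agree_upto n (fps_const z) (fps_const z)" for z by (simp add: agree_upto_def)
  show ?thesis
    unfolding peval_def
    by (intro sm agree_upto_mult cc pr pw assms) (auto simp: pvars_def)
qed

text \<open>A polynomial identity that holds at all points of a polynomial curve holds for the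
  power series expansion of the curve.\<close>

lemma peval_polynomial_curve:
  assumes "\<And>\<tau>. pval (\<lambda>v. poly (f v) \<tau>) P = 0"
  shows "peval fps_const (\<lambda>v. fps_of_poly (f v)) P = 0"
proof -
  define Q where "Q = peval (\<lambda>a. [:a:]) f P"
  have "poly Q \<tau> = pval (\<lambda>v. poly (f v) \<tau>) P" for \<tau>
    unfolding Q_def using hom_peval[of "\<lambda>q. poly q \<tau>" "\<lambda>a. [:a:]" f P] by simp
  then have "Q = 0" using assms using poly_all_0_iff_0[of Q] by simp
  moreover have "fps_of_poly Q = peval fps_const (\<lambda>v. fps_of_poly (f v)) P"
    unfolding Q_def using hom_peval[of fps_of_poly "\<lambda>a. [:a:]" f P]
    by (simp add: fps_of_poly_add fps_of_poly_mult fps_of_poly_const)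
  ultimately show ?thesis by simp
qed

section \<open>Generalized eigenspaces and traces\<close>

locale complex_fd = finite_dimensional_vector_space scale Basis
  for scale :: "complex \<Rightarrow> 'g::ab_group_add \<Rightarrow> 'g" and Basis
begin

sublocale vsp: vector_space_pair scale scale ..

abbreviation lin :: "('g \<Rightarrow> 'g) \<Rightarrow> bool" where
  "lin T \<equiv> Vector_Spaces.linear scale scale T"

lemma linI: "(\<And>x y. T (x + y) = T x + T y) \<Longrightarrow> (\<And>c x. T (scale c x) = scale c (T x)) \<Longrightarrow> lin T"
  by (simp add: Vector_Spaces.linear_iff vector_space_axioms)

lemma lin_add: "lin T \<Longrightarrow> T (x + y) = T x + T y"
  by (simp add: Vector_Spaces.linear_iff)

lemma lin_scale: "lin T \<Longrightarrow> T (scale c x) = scale c (T x)"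
  by (simp add: Vector_Spaces.linear_iff)

lemma lin_0: "lin T \<Longrightarrow> T 0 = 0"
  using lin_scale[of T 0 0] by simp

lemma lin_neg: "lin T \<Longrightarrow> T (- x) = - T x"
  using lin_add[of T x "- x"] by (simp add: lin_0 eq_neg_iff_add_eq_0 add.commute)

lemma lin_diff: "lin T \<Longrightarrow> T (x - y) = T x - T y"
  using lin_add[of T x "- y"] by (simp add: lin_neg)

lemma lin_sum: "lin T \<Longrightarrow> T (sum f A) = (\<Sum>a\<in>A. T (f a))"
  by (induction A rule: infinite_finite_induct) (auto simp: lin_0 lin_add)

lemma lin_comp: "lin S \<Longrightarrow> lin T \<Longrightarrow> lin (\<lambda>x. S (T x))"
  by (rule linI) (auto simp: lin_add lin_scale)

lemma lin_diff_fun: "lin S \<Longrightarrow> lin T \<Longrightarrow> lin (\<lambda>x. S x - T x)"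
  by (rule linI) (auto simp: lin_add lin_scale scale_right_diff_distrib)

lemma lin_add_fun: "lin S \<Longrightarrow> lin T \<Longrightarrow> lin (\<lambda>x. S x + T x)"
  by (rule linI) (auto simp: lin_add lin_scale scale_right_distrib)

lemma lin_scale_fun: "lin (\<lambda>x. scale c x)"
  by (rule linI) (auto simp: scale_right_distrib scale_left_commute)

lemma lin_pow: "lin T \<Longrightarrow> lin (T ^^ m)"
proof (induction m)
  case 0
  then show ?case by (auto intro: linI)
next
  case (Suc m)
  then show ?case using lin_comp[of T "T ^^ m"] by (simp add: comp_def)
qed

lemma lin_shift: "lin T \<Longrightarrow> lin (\<lambda>x. T x - scale a x)"
  by (intro lin_diff_fun lin_scale_fun)

lemma pow_commute:
  assumes "\<And>x. S (T x) = T (S x)"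
  shows "S ((T ^^ m) x) = (T ^^ m) (S x)"
  by (induction m) (auto simp: assms)

definition gen_eig :: "('g \<Rightarrow> 'g) \<Rightarrow> complex \<Rightarrow> 'g set" where
  "gen_eig T a = {v. \<exists>m. ((\<lambda>x. T x - scale a x) ^^ m) v = 0}"

lemma gen_eig_mono:
  assumes "lin T" "((\<lambda>x. T x - scale a x) ^^ m) v = 0"
  shows "((\<lambda>x. T x - scale a x) ^^ (k + m)) v = 0"
  using assms lin_0[OF lin_pow[OF lin_shift[OF assms(1)]]] by (simp add: funpow_add)

lemma subspace_gen_eig: assumes "lin T" shows "subspace (gen_eig T a)"
proof (rule subspaceI)
  show "0 \<in> gen_eig T a" by (auto simp: gen_eig_def intro!: exI[of _ 0])
next
  fix x y assume "x \<in> gen_eig T a" "y \<in> gen_eig T a"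
  then obtain m n where "((\<lambda>x. T x - scale a x) ^^ m) x = 0" "((\<lambda>x. T x - scale a x) ^^ n) y = 0"
    by (auto simp: gen_eig_def)
  then have "((\<lambda>x. T x - scale a x) ^^ (n + m)) x = 0" "((\<lambda>x. T x - scale a x) ^^ (n + m)) y = 0"
    using gen_eig_mono[OF assms, where k=n and m=m] gen_eig_mono[OF assms, where k=m and m=n] by (auto simp: add.commute)
  then have "((\<lambda>x. T x - scale a x) ^^ (n + m)) (x + y) = 0"
    by (simp add: lin_add[OF lin_pow[OF lin_shift[OF assms]]])
  then show "x + y \<in> gen_eig T a" by (auto simp: gen_eig_def)
next
  fix c x assume "x \<in> gen_eig T a"
  then show "scale c x \<in> gen_eig T a"
    by (auto simp: gen_eig_def lin_scale[OF lin_pow[OF lin_shift[OF assms]]])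
qed

lemma gen_eig_commute:
  assumes "lin S" and "\<And>x. S (T x) = T (S x)" and "v \<in> gen_eig T a"
  shows "S v \<in> gen_eig T a"
proof -
  obtain m where m: "((\<lambda>x. T x - scale a x) ^^ m) v = 0" using assms(3) by (auto simp: gen_eig_def)
  have "((\<lambda>x. T x - scale a x) ^^ m) (S v) = S (((\<lambda>x. T x - scale a x) ^^ m) v)"
    by (rule pow_commute[symmetric]) (simp add: lin_diff lin_scale assms)
  then show ?thesis using m by (auto simp: gen_eig_def lin_0[OF assms(1)])
qed

lemma gen_eig_shift: "lin T \<Longrightarrow> v \<in> gen_eig T a \<Longrightarrow> T v - scale b v \<in> gen_eig T a"
  by (rule gen_eig_commute[OF lin_shift]) (auto simp: lin_diff lin_scale)

lemma eig_gen_eig: "T v = scale a v \<Longrightarrow> v \<in> gen_eig T a"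
  by (auto simp: gen_eig_def intro!: exI[of _ 1])

lemma gen_eig_disjoint:
  assumes T: "lin T" and ab: "a \<noteq> b" and v: "v \<in> gen_eig T a" "v \<in> gen_eig T b"
  shows "v = 0"
proof -
  obtain k where k: "((\<lambda>x. T x - scale a x) ^^ k) v = 0" using v by (auto simp: gen_eig_def)
  show ?thesis using k v
  proof (induction k arbitrary: v)
    case (Suc k)
    have "((\<lambda>x. T x - scale a x) ^^ k) (T v - scale a v) = 0"
      using Suc.prems(1) by (simp only: funpow_Suc_right comp_def)
    then have "T v - scale a v = 0"
      using Suc.IH[of "T v - scale a v"] Suc.prems T gen_eig_shift by blast
    then have Tv: "T v = scale a v" by simp
    have "((\<lambda>x. T x - scale b x) ^^ m) v = scale ((a - b) ^ m) v" for m
    proof (induction m)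
      case (Suc m)
      then show ?case
        by (simp add: lin_scale[OF T] Tv scale_left_diff_distrib algebra_simps)
    qed simp
    moreover obtain m where "((\<lambda>x. T x - scale b x) ^^ m) v = 0" using Suc.prems by (auto simp: gen_eig_def)
    ultimately show ?case using ab by auto
  qed simp
qed

lemma gen_eig_independent:
  assumes T: "lin T" and "finite A" "\<And>a. a \<in> A \<Longrightarrow> w a \<in> gen_eig T a" "(\<Sum>a\<in>A. w a) = 0" "a \<in> A"
  shows "w a = 0"
  using assms(2-)
proof (induction A arbitrary: w a rule: finite_induct)
  case (insert b A)
  obtain m where m: "((\<lambda>x. T x - scale b x) ^^ m) (w b) = 0"
    using insert.prems(1)[of b] by (auto simp: gen_eig_def)
  let ?N = "(\<lambda>x. T x - scale b x) ^^ m"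
  have lN: "lin ?N" by (intro lin_pow lin_shift T)
  have comm: "?N (T x) = T (?N x)" for x
    by (rule pow_commute[symmetric]) (simp add: lin_diff[OF T] lin_scale[OF T])
  have "(\<Sum>a\<in>A. ?N (w a)) = ?N (\<Sum>a\<in>insert b A. w a)"
    using m insert.hyps by (simp add: lin_sum[OF lN] lin_add[OF lN])
  then have s0: "(\<Sum>a\<in>A. ?N (w a)) = 0" using insert.prems(2) lin_0[OF lN] by simp
  have wA: "w a = 0" if a: "a \<in> A" for a
  proof -
    have "?N (w a) = 0"
    proof (rule insert.IH[of "\<lambda>a. ?N (w a)", OF _ s0 a])
      fix c assume c: "c \<in> A"
      show "?N (w c) \<in> gen_eig T c"
        by (rule gen_eig_commute[where S="?N" and T=T, OF lN]) (use comm insert.prems(1) c in simp_all)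
    qed
    then have "w a \<in> gen_eig T b" by (auto simp: gen_eig_def)
    moreover have "w a \<in> gen_eig T a" "a \<noteq> b" using insert.prems(1) a insert.hyps by auto
    ultimately show ?thesis using gen_eig_disjoint[OF T] by blast
  qed
  then have "w b = 0" using insert.prems(2) insert.hyps by simp
  then show ?case using wA insert.prems(3) by blast
qed simp

text \<open>On the generalized eigenspace for \<open>b\<close> the operator \<open>T - a\<close> is the sum of the non-zero scalar
  \<open>b - a\<close> and a nilpotent operator, so it can be inverted by descent.\<close>

lemma gen_eig_solve:
  assumes T: "lin T" and ab: "a \<noteq> b" and w: "w \<in> gen_eig T b"
  shows "\<exists>y\<in>gen_eig T b. T y - scale a y = w"
proof -
  obtain m where m: "((\<lambda>x. T x - scale b x) ^^ m) w = 0" using w by (auto simp: gen_eig_def)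
  show ?thesis using m w
  proof (induction m arbitrary: w)
    case 0
    then show ?case using lin_0[OF T] by (intro bexI[of _ 0]) auto
  next
    case (Suc m)
    let ?w = "T w - scale b w"
    have "((\<lambda>x. T x - scale b x) ^^ m) ?w = 0"
      using Suc.prems(1) by (simp only: funpow_Suc_right comp_def)
    then obtain y where y: "y \<in> gen_eig T b" "T y - scale a y = ?w"
      using Suc.IH[of ?w] Suc.prems(2) gen_eig_shift[OF T] by blast
    let ?c = "inverse (b - a)"
    have "scale ?c (w - y) \<in> gen_eig T b"
      using y(1) Suc.prems(2) subspace_gen_eig[OF T] by (simp add: subspace_diff subspace_scale)
    moreover have "T (scale ?c (w - y)) - scale a (scale ?c (w - y)) = w"
    proof -
      have "T (scale ?c (w - y)) - scale a (scale ?c (w - y)) = scale ?c ((T w - scale a w) - (T y - scale a y))"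
        by (simp add: lin_scale[OF T] lin_diff[OF T] scale_right_diff_distrib algebra_simps)
      also have "\<dots> = scale ?c (scale (b - a) w)"
        unfolding y(2) by (simp add: scale_left_diff_distrib algebra_simps)
      also have "\<dots> = w" using ab by simp
      finally show ?thesis .
    qed
    ultimately show ?case by blast
  qed
qed

lemma span_Union_decompose:
  assumes "\<And>a. subspace (E a)" "v \<in> span (\<Union>a. E a)"
  shows "\<exists>A w. finite A \<and> (\<forall>a. w a \<in> E a) \<and> (\<forall>a. a \<notin> A \<longrightarrow> w a = 0) \<and> v = (\<Sum>a\<in>A. w a)"
  using assms(2)
proof (induction rule: span_induct_alt)
  case base
  then show ?case
    by (intro exI[of _ "{}"] exI[of _ "\<lambda>_. 0"]) (auto simp: subspace_0 assms)
next
  case (step c x y)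
  then obtain a where a: "x \<in> E a" by auto
  from step(2) obtain A w where w: "finite A" "\<And>a. w a \<in> E a" "\<And>a. a \<notin> A \<Longrightarrow> w a = 0" "y = (\<Sum>a\<in>A. w a)"
    by auto
  let ?w = "\<lambda>a'. w a' + (if a' = a then scale c x else 0)"
  have "y = (\<Sum>a\<in>insert a A. w a)"
    unfolding w(4) using w by (intro sum.mono_neutral_left) auto
  then have "scale c x + y = (\<Sum>a'\<in>insert a A. ?w a')"
    using w(1) by (simp add: sum.distrib sum.delta add.commute)
  moreover have "?w a' \<in> E a'" for a'
    using a w(2) assms(1) by (auto simp: subspace_add subspace_scale)
  ultimately show ?case
    using w by (intro exI[of _ "insert a A"] exI[of _ ?w]) auto
qed

text \<open>The product of the operators \<open>T - a\<close>, applied to \<open>v\<close>.\<close>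

fun shift_prod :: "('g \<Rightarrow> 'g) \<Rightarrow> complex list \<Rightarrow> 'g \<Rightarrow> 'g" where
  "shift_prod T [] v = v"
| "shift_prod T (a # as) v = shift_prod T as (T v - scale a v)"

text \<open>If \<open>(T - a) v\<close> is a sum of generalized eigenvectors, then so is \<open>v\<close>: the components for
  other eigenvalues are hit by \<open>T - a\<close>, and after subtracting preimages some power of \<open>T - a\<close>
  kills the rest.\<close>

lemma shift_prod_zero_imp_span:
  assumes T: "lin T"
  shows "shift_prod T as v = 0 \<Longrightarrow> v \<in> span (\<Union>a. gen_eig T a)"
proof (induction as arbitrary: v)
  case Nil
  then show ?case by (simp add: span_zero)
next
  case (Cons a as)
  let ?G = "span (\<Union>a. gen_eig T a)"
  have "T v - scale a v \<in> ?G" using Cons.IH Cons.prems by simp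
  from span_Union_decompose[OF subspace_gen_eig[OF T] this] obtain A w where
    w: "finite A" "\<And>a. w a \<in> gen_eig T a" "\<And>a. a \<notin> A \<Longrightarrow> w a = 0" "T v - scale a v = (\<Sum>a\<in>A. w a)" by auto
  have "\<forall>b. \<exists>y\<in>gen_eig T b. b \<noteq> a \<longrightarrow> T y - scale a y = w b"
    using gen_eig_solve[OF T _ w(2)] w(2) by metis
  then obtain y where y: "\<And>b. y b \<in> gen_eig T b" "\<And>b. b \<noteq> a \<Longrightarrow> T (y b) - scale a (y b) = w b"
    by metis
  define z where "z = (\<Sum>b\<in>A - {a}. y b)"
  have "T z - scale a z = (\<Sum>b\<in>A - {a}. w b)"
    unfolding z_def by (simp add: lin_sum[OF T] scale_sum_right sum_subtractf[symmetric] y)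
  moreover have "(\<Sum>b\<in>A. w b) = w a + (\<Sum>b\<in>A - {a}. w b)"
    using w(1,3) by (cases "a \<in> A") (auto simp: sum.remove)
  ultimately have "T (v - z) - scale a (v - z) = w a"
    using w(4) by (simp add: lin_diff[OF T] scale_right_diff_distrib algebra_simps)
  moreover obtain m where "((\<lambda>x. T x - scale a x) ^^ m) (w a) = 0" using w(2)[of a] by (auto simp: gen_eig_def)
  ultimately have "((\<lambda>x. T x - scale a x) ^^ Suc m) (v - z) = 0"
    by (simp only: funpow_Suc_right comp_def)
  then have "v - z \<in> gen_eig T a" by (auto simp only: gen_eig_def)
  then have "v - z \<in> ?G" by (auto intro: span_base)
  moreover have "z \<in> ?G" unfolding z_def by (intro span_sum span_base) (use y in auto)
  ultimately have "(v - z) + z \<in> ?G" by (rule span_add)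
  then show ?case by simp
qed

text \<open>The vector \<open>q(T) v\<close>.\<close>

definition pact :: "('g \<Rightarrow> 'g) \<Rightarrow> complex poly \<Rightarrow> 'g \<Rightarrow> 'g" where
  "pact T q v = (\<Sum>i\<le>degree q. scale (coeff q i) ((T ^^ i) v))"

lemma pact_bound: "degree q \<le> n \<Longrightarrow> pact T q v = (\<Sum>i\<le>n. scale (coeff q i) ((T ^^ i) v))"
  unfolding pact_def by (intro sum.mono_neutral_left) (auto simp: coeff_eq_0)

lemma pact_factor:
  assumes T: "lin T"
  shows "pact T ([:-a, 1:] * r) v = pact T r (T v - scale a v)"
proof -
  define n where "n = degree r"
  have d: "degree ([:-a, 1:] * r) \<le> Suc n"
    using degree_mult_le[of "[:-a, 1:]" r] by (simp add: n_def)
  have c: "coeff ([:-a, 1:] * r) i = (case i of 0 \<Rightarrow> 0 | Suc j \<Rightarrow> coeff r j) - a * coeff r i" for i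
    by (simp add: coeff_pCons)
  have "pact T ([:-a, 1:] * r) v =
     (\<Sum>i\<le>Suc n. scale (case i of 0 \<Rightarrow> 0 | Suc j \<Rightarrow> coeff r j) ((T ^^ i) v)) - (\<Sum>i\<le>Suc n. scale (a * coeff r i) ((T ^^ i) v))"
    unfolding pact_bound[OF d] c by (simp only: scale_left_diff_distrib sum_subtractf)
  also have "(\<Sum>i\<le>Suc n. scale (case i of 0 \<Rightarrow> 0 | Suc j \<Rightarrow> coeff r j) ((T ^^ i) v)) = pact T r (T v)"
    by (subst sum.atMost_Suc_shift) (simp add: pact_bound[of r n] n_def funpow_swap1)
  also have "(\<Sum>i\<le>Suc n. scale (a * coeff r i) ((T ^^ i) v)) = pact T r (scale a v)"
    unfolding pact_bound[of r "Suc n", unfolded n_def, OF le_SucI[OF order_refl]] n_def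
    by (simp add: lin_scale[OF lin_pow[OF T]] mult.commute)
  finally show ?thesis
    by (simp add: pact_def lin_diff[OF lin_pow[OF T]] scale_right_diff_distrib sum_subtractf)
qed

lemma pact_zero_imp_shift_prod:
  assumes T: "lin T" and "q \<noteq> 0" "pact T q v = 0"
  shows "\<exists>as. shift_prod T as v = 0"
  using assms(2-)
proof (induction "degree q" arbitrary: q v)
  case 0
  then obtain c where "q = [:c:]" by (metis degree_0_id)
  then show ?case using 0 by (intro exI[of _ "[]"]) (auto simp: pact_def)
next
  case (Suc n)
  then have "\<not> constant (poly q)" by (simp add: constant_degree)
  then obtain a where "poly q a = 0" using fundamental_theorem_of_algebra by blast
  then obtain r where r: "q = [:-a, 1:] * r" by (auto simp: poly_eq_0_iff_dvd elim: dvdE)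
  have "r \<noteq> 0" using r Suc.prems by auto
  then have "degree q = Suc (degree r)" unfolding r by (subst degree_mult_eq) auto
  then have "n = degree r" using Suc.hyps by simp
  moreover have "pact T r (T v - scale a v) = 0" using Suc.prems r pact_factor[OF T] by simp
  ultimately obtain as where "shift_prod T as (T v - scale a v) = 0"
    using Suc.hyps(1)[of r] \<open>r \<noteq> 0\<close> by blast
  then show ?case by (intro exI[of _ "a # as"]) simp
qed

lemma span_image_indexed:
  assumes "x \<in> span (f ` {..<n::nat})"
  shows "\<exists>c. x = (\<Sum>i<n. scale (c i) (f i))"
  using assms
proof (induction rule: span_induct_alt)
  case base
  then show ?case by (intro exI[of _ "\<lambda>_. 0"]) simp
next
  case (step c x y)
  then obtain i d where i: "i < n" "x = f i" "y = (\<Sum>i<n. scale (d i) (f i))" by auto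
  have "(\<Sum>j<n. scale ((if j = i then c else 0) + d j) (f j)) =
        (\<Sum>j<n. (if j = i then scale c (f j) else 0) + scale (d j) (f j))"
    by (intro sum.cong) (auto simp: scale_left_distrib)
  also have "\<dots> = scale c x + y" using i by (simp add: sum.distrib)
  finally show ?case by metis
qed

text \<open>In finite dimension the vectors \<open>v\<close>, \<open>T v\<close>, \<open>T\<^sup>2 v\<close>, \<open>\<dots>\<close> are linearly dependent.\<close>

lemma exists_annihilator: "\<exists>q. q \<noteq> 0 \<and> pact T q v = 0"
proof -
  have "\<exists>n. (T ^^ n) v \<in> span ((\<lambda>i. (T ^^ i) v) ` {..<n})"
  proof (rule ccontr)
    assume "\<not> ?thesis"
    then have no: "(T ^^ n) v \<notin> span ((\<lambda>i. (T ^^ i) v) ` {..<n})" for n by blast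
    have "independent ((\<lambda>i. (T ^^ i) v) ` {..<n}) \<and> card ((\<lambda>i. (T ^^ i) v) ` {..<n}) = n" for n
    proof (induction n)
      case (Suc n)
      have "(T ^^ n) v \<notin> (\<lambda>i. (T ^^ i) v) ` {..<n}"
        using no[of n] span_superset[of "(\<lambda>i. (T ^^ i) v) ` {..<n}"] by (rule contra_subsetD[rotated])
      then show ?case using Suc no[of n] by (simp add: lessThan_Suc independent_insert)
    qed (simp add: independent_empty)
    from this[of "Suc (dim UNIV)"] show False
      using independent_card_le_dim[of "(\<lambda>i. (T ^^ i) v) ` {..<Suc (dim UNIV)}" UNIV] by simp
  qed
  then obtain n where "(T ^^ n) v \<in> span ((\<lambda>i. (T ^^ i) v) ` {..<n})" by blast
  then obtain c where c: "(T ^^ n) v = (\<Sum>i<n. scale (c i) ((T ^^ i) v))"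
    using span_image_indexed[of "(T ^^ n) v" "\<lambda>i. (T ^^ i) v" n] by blast
  define q where "q = monom 1 n - (\<Sum>i<n. monom (c i) i)"
  have cq: "coeff q j = (if j = n then 1 else 0) - (if j < n then c j else 0)" for j
    by (simp add: q_def coeff_sum coeff_diff sum.delta' if_distrib cong: if_cong)
  have "degree q \<le> n" by (rule degree_le) (simp add: cq)
  then have "pact T q v = (\<Sum>i\<le>n. scale (coeff q i) ((T ^^ i) v))" by (rule pact_bound)
  also have "\<dots> = (\<Sum>i<n. scale (- c i) ((T ^^ i) v)) + (T ^^ n) v"
    unfolding lessThan_Suc_atMost[symmetric] by (simp add: cq)
  also have "\<dots> = 0" unfolding c by (simp add: sum_negf)
  finally have "pact T q v = 0" .
  moreover have "q \<noteq> 0" using cq[of n] by auto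
  ultimately show ?thesis by blast
qed

lemma span_gen_eig: assumes "lin T" shows "span (\<Union>a. gen_eig T a) = UNIV"
proof -
  have "v \<in> span (\<Union>a. gen_eig T a)" for v
  proof -
    obtain q where "q \<noteq> 0" "pact T q v = 0" using exists_annihilator by metis
    then obtain as where "shift_prod T as v = 0" using pact_zero_imp_shift_prod[OF assms] by metis
    then show ?thesis by (rule shift_prod_zero_imp_span[OF assms])
  qed
  then show ?thesis by auto
qed

text \<open>The semisimple part of the Jordan decomposition. It is defined on a basis of generalized
  eigenvectors; it acts by the scalar \<open>a\<close> on all of the generalized eigenspace because these
  spaces are independent.\<close>

lemma semisimple_part:
  assumes T: "lin T"
  shows "\<exists>S. lin S \<and> (\<forall>a. \<forall>v\<in>gen_eig T a. S v = scale a v)"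
proof -
  obtain B where B: "B \<subseteq> (\<Union>a. gen_eig T a)" "independent B" "(\<Union>a. gen_eig T a) \<subseteq> span B"
    using maximal_independent_subset[of "\<Union>a. gen_eig T a"] by blast
  have fB: "finite B" by (rule finiteI_independent[OF B(2)])
  have sB: "span B = UNIV" using span_mono[OF B(3)] span_gen_eig[OF T] by (simp add: span_span top.extremum_unique)
  obtain \<alpha> where \<alpha>: "\<And>b. b \<in> B \<Longrightarrow> b \<in> gen_eig T (\<alpha> b)" using B(1) by (metis UN_E subsetD)
  obtain S where S: "lin S" "\<And>b. b \<in> B \<Longrightarrow> S b = scale (\<alpha> b) b"
    using vsp.linear_independent_extend[OF B(2), of "\<lambda>b. scale (\<alpha> b) b"] by blast
  have "S v = scale a v" if v: "v \<in> gen_eig T a" for a v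
  proof -
    define r where "r = representation B v"
    have vr: "v = (\<Sum>b\<in>B. scale (r b) b)"
      unfolding r_def using sum_representation_eq[OF B(2) _ fB order_refl, of v] sB by simp
    define w where "w = (\<lambda>c. \<Sum>b\<in>{b\<in>B. \<alpha> b = c}. scale (r b) b)"
    have wg: "w c \<in> gen_eig T c" for c
      unfolding w_def by (intro subspace_sum subspace_gen_eig T subspace_scale) (use \<alpha> in auto)
    define A where "A = insert a (\<alpha> ` B)"
    have fA: "finite A" using fB by (simp add: A_def)
    have vA: "v = (\<Sum>c\<in>A. w c)"
      unfolding vr w_def by (rule sum.group[symmetric]) (use fB in \<open>auto simp: A_def\<close>)
    define w' where "w' = (\<lambda>c. if c = a then w a - v else w c)"
    have "(\<Sum>c\<in>A. w' c) = (\<Sum>c\<in>A. w c - (if c = a then v else 0))"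
      by (intro sum.cong) (auto simp: w'_def)
    also have "\<dots> = 0" using fA vA by (simp add: sum_subtractf A_def)
    finally have s0: "(\<Sum>c\<in>A. w' c) = 0" .
    have "w' c \<in> gen_eig T c" for c
      using wg v subspace_gen_eig[OF T] by (auto simp: w'_def subspace_diff)
    then have z: "w' c = 0" if "c \<in> A" for c
      using gen_eig_independent[OF T fA _ s0 that] by blast
    have "S v = (\<Sum>b\<in>B. scale (\<alpha> b) (scale (r b) b))"
      by (subst vr) (simp add: lin_sum[OF S(1)] lin_scale[OF S(1)] S(2) mult.commute)
    also have "\<dots> = (\<Sum>c\<in>A. \<Sum>b\<in>{b\<in>B. \<alpha> b = c}. scale (\<alpha> b) (scale (r b) b))"
      by (rule sum.group[symmetric]) (use fB in \<open>auto simp: A_def\<close>)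
    also have "\<dots> = (\<Sum>c\<in>A. scale c (w c))"
      unfolding w_def scale_sum_right by (intro sum.cong) auto
    also have "\<dots> = (\<Sum>c\<in>A. if c = a then scale a v else 0)"
    proof (intro sum.cong refl)
      fix c assume "c \<in> A"
      then show "scale c (w c) = (if c = a then scale a v else 0)"
        using z[of c] by (cases "c = a") (simp_all add: w'_def)
    qed
    also have "\<dots> = scale a v" using fA by (simp add: A_def)
    finally show ?thesis .
  qed
  then show ?thesis using S(1) by blast
qed

definition diagonalizable :: "('g \<Rightarrow> 'g) \<Rightarrow> bool" where
  "diagonalizable T \<longleftrightarrow> span {v. \<exists>c. T v = scale c v} = UNIV"

text \<open>Decompose a common eigenvector of the operators in \<open>Y\<close> into eigenvectors of one more
  operator \<open>T y\<^sub>0\<close>. As \<open>T y\<close> commutes with \<open>T y\<^sub>0\<close>, the components are again eigenvectors of \<open>T y\<close>.\<close>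

lemma simultaneous_diagonalization:
  assumes "finite Y" "\<And>y. y \<in> Y \<Longrightarrow> lin (T y)" "\<And>y. y \<in> Y \<Longrightarrow> diagonalizable (T y)"
    and "\<And>y y' v. y \<in> Y \<Longrightarrow> y' \<in> Y \<Longrightarrow> T y (T y' v) = T y' (T y v)"
  shows "span {v. \<forall>y\<in>Y. \<exists>c. T y v = scale c v} = UNIV"
  using assms
proof (induction Y rule: finite_induct)
  case empty
  then show ?case by simp
next
  case (insert y0 Y)
  let ?J = "{v. \<forall>y\<in>insert y0 Y. \<exists>c. T y v = scale c v}"
  have IH: "span {v. \<forall>y\<in>Y. \<exists>c. T y v = scale c v} = UNIV"
    by (rule insert.IH) (use insert.prems in blast)+
  have T0: "lin (T y0)" using insert.prems by blast
  define E where "E = (\<lambda>a. {v. T y0 v = scale a v})"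
  have sE: "subspace (E a)" for a
    by (rule subspaceI) (auto simp: E_def lin_0[OF T0] lin_add[OF T0] lin_scale[OF T0] scale_right_distrib scale_left_commute)
  have UE: "span (\<Union>a. E a) = UNIV"
    using insert.prems(2)[of y0] by (simp add: diagonalizable_def E_def Collect_ex_eq[symmetric] UNION_eq)
  have "v \<in> span ?J" if v: "\<forall>y\<in>Y. \<exists>c. T y v = scale c v" for v
  proof -
    have "v \<in> span (\<Union>a. E a)" using UE by simp
    from span_Union_decompose[OF sE this] obtain A w where
      w: "finite A" "\<And>a. w a \<in> E a" "\<And>a. a \<notin> A \<Longrightarrow> w a = 0" "v = (\<Sum>a\<in>A. w a)" by auto
    have "w a \<in> ?J" if a: "a \<in> A" for a
    proof -
      have "\<exists>c. T y (w a) = scale c (w a)" if y: "y \<in> Y" for y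
      proof -
        obtain c where c: "T y v = scale c v" using v y by blast
        have Ty: "lin (T y)" using insert.prems y by blast
        let ?u = "\<lambda>a. T y (w a) - scale c (w a)"
        have "(\<Sum>a\<in>A. ?u a) = 0"
          using c unfolding w(4) by (simp add: lin_sum[OF Ty] sum_subtractf scale_sum_right)
        moreover have "?u a \<in> gen_eig (T y0) a" for a
        proof (rule eig_gen_eig)
          have "T y0 (T y (w a)) = T y (T y0 (w a))" using insert.prems(3)[of y0 y] y by blast
          then show "T y0 (?u a) = scale a (?u a)"
            using w(2)[of a] by (simp add: E_def lin_diff[OF T0] lin_scale[OF T0] lin_scale[OF Ty]
                scale_right_diff_distrib mult.commute)
        qed
        ultimately have "?u a = 0"
          using gen_eig_independent[OF T0 w(1), of ?u a] a by blast
        then show ?thesis by auto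
      qed
      then show ?thesis using w(2)[of a] by (auto simp: E_def)
    qed
    then show ?thesis unfolding w(4) by (intro span_sum span_base)
  qed
  then have "span {v. \<forall>y\<in>Y. \<exists>c. T y v = scale c v} \<subseteq> span ?J"
    by (intro span_minimal) auto
  then show ?case using IH by auto
qed

subsection \<open>Traces\<close>

text \<open>The trace of \<open>T\<close> on the subspace \<open>span B\<close>, for \<open>B\<close> independent and \<open>T\<close> mapping the subspace
  to itself.\<close>

definition tr :: "'g set \<Rightarrow> ('g \<Rightarrow> 'g) \<Rightarrow> complex" where
  "tr B T = (\<Sum>b\<in>B. representation B (T b) b)"

lemma rep_lin:
  assumes B: "independent B" and T: "lin T" and st: "\<And>b. b \<in> B \<Longrightarrow> T b \<in> span B" and v: "v \<in> span B"
  shows "representation B (T v) b = (\<Sum>c\<in>B. representation B v c * representation B (T c) b)"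
proof -
  have fB: "finite B" by (rule finiteI_independent[OF B])
  have "v = (\<Sum>c\<in>B. scale (representation B v c) c)"
    using sum_representation_eq[OF B v fB order_refl] by simp
  then have "T v = (\<Sum>c\<in>B. scale (representation B v c) (T c))"
    by (metis (no_types, lifting) lin_scale[OF T] lin_sum[OF T] sum.cong)
  then have "representation B (T v) = (\<lambda>b. \<Sum>c\<in>B. representation B (scale (representation B v c) (T c)) b)"
    using representation_sum[OF B, of B "\<lambda>c. scale (representation B v c) (T c)"] st span_scale by presburger
  then show ?thesis
    using representation_scale[OF B st] by (auto intro!: sum.cong)
qed

lemma tr_commute:
  assumes B: "independent B" and S: "lin S" and T: "lin T"
    and Sst: "\<And>b. b \<in> B \<Longrightarrow> S b \<in> span B" and Tst: "\<And>b. b \<in> B \<Longrightarrow> T b \<in> span B"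
  shows "tr B (\<lambda>x. S (T x)) = tr B (\<lambda>x. T (S x))"
proof -
  have "tr B (\<lambda>x. S (T x)) = (\<Sum>b\<in>B. \<Sum>c\<in>B. representation B (T b) c * representation B (S c) b)"
    unfolding tr_def by (intro sum.cong refl rep_lin B S Sst Tst)
  also have "\<dots> = (\<Sum>b\<in>B. \<Sum>c\<in>B. representation B (S b) c * representation B (T c) b)"
    by (subst sum.swap) (simp add: mult.commute)
  also have "\<dots> = tr B (\<lambda>x. T (S x))"
    unfolding tr_def by (intro sum.cong refl rep_lin[symmetric] B T Sst Tst)
  finally show ?thesis .
qed

lemma tr_diff:
  assumes B: "independent B" and "\<And>b. b \<in> B \<Longrightarrow> S b \<in> span B" "\<And>b. b \<in> B \<Longrightarrow> T b \<in> span B"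
  shows "tr B (\<lambda>x. S x - T x) = tr B S - tr B T"
  unfolding tr_def sum_subtractf[symmetric]
  by (intro sum.cong refl) (simp add: representation_diff[OF B] assms)

lemma tr_add:
  assumes B: "independent B" and "\<And>b. b \<in> B \<Longrightarrow> S b \<in> span B" "\<And>b. b \<in> B \<Longrightarrow> T b \<in> span B"
  shows "tr B (\<lambda>x. S x + T x) = tr B S + tr B T"
  unfolding tr_def sum.distrib[symmetric]
  by (intro sum.cong refl) (simp add: representation_add[OF B] assms)

lemma tr_scale:
  assumes B: "independent B" and "\<And>b. b \<in> B \<Longrightarrow> S b \<in> span B"
  shows "tr B (\<lambda>x. scale c (S x)) = c * tr B S"
  unfolding tr_def sum_distrib_left
  by (intro sum.cong refl) (simp add: representation_scale[OF B] assms)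

lemma tr_basis_change:
  assumes B: "independent B" "span B = UNIV" and C: "independent C" "span C = UNIV" and T: "lin T"
  shows "tr B T = tr C T"
proof -
  have fB: "finite B" and fC: "finite C" using B C finiteI_independent by auto
  let ?b = "representation B" and ?c = "representation C"
  have expand: "?b (T v) b = (\<Sum>c\<in>C. ?c (T v) c * ?b c b)" for v b
  proof -
    have "T v = (\<Sum>c\<in>C. scale (?c (T v) c) c)"
      using sum_representation_eq[OF C(1) _ fC order_refl, of "T v"] C(2) by simp
    then have "?b (T v) b = ?b (\<Sum>c\<in>C. scale (?c (T v) c) c) b" by simp
    also have "\<dots> = (\<Sum>c\<in>C. ?b (scale (?c (T v) c) c) b)"
      by (subst representation_sum[OF B(1)]) (simp_all add: B(2))
    also have "\<dots> = (\<Sum>c\<in>C. ?c (T v) c * ?b c b)"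
      using representation_scale[OF B(1)] B(2) by simp
    finally show ?thesis .
  qed
  have "tr B T = (\<Sum>b\<in>B. \<Sum>c\<in>C. ?c (T b) c * ?b c b)" unfolding tr_def expand ..
  also have "\<dots> = (\<Sum>c\<in>C. \<Sum>b\<in>B. ?b c b * ?c (T b) c)" by (subst sum.swap) (simp add: mult.commute)
  also have "\<dots> = (\<Sum>c\<in>C. ?c (T c) c)"
  proof (intro sum.cong refl)
    fix c
    have "c = (\<Sum>b\<in>B. scale (?b c b) b)"
      using sum_representation_eq[OF B(1) _ fB order_refl, of c] B(2) by simp
    then have "T c = (\<Sum>b\<in>B. scale (?b c b) (T b))"
      by (metis (no_types, lifting) lin_scale[OF T] lin_sum[OF T] sum.cong)
    then have "?c (T c) c = ?c (\<Sum>b\<in>B. scale (?b c b) (T b)) c" by simp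
    also have "\<dots> = (\<Sum>b\<in>B. ?c (scale (?b c b) (T b)) c)"
      by (subst representation_sum[OF C(1)]) (simp_all add: C(2))
    also have "\<dots> = (\<Sum>b\<in>B. ?b c b * ?c (T b) c)"
      using representation_scale[OF C(1)] C(2) by simp
    finally show "(\<Sum>b\<in>B. ?b c b * ?c (T b) c) = ?c (T c) c" by simp
  qed
  finally show ?thesis by (simp add: tr_def)
qed

text \<open>In a basis adapted to the kernels of the powers of \<open>T\<close>, the diagonal of \<open>T\<close> is zero.\<close>

lemma tr_nilpotent:
  assumes B: "independent B" "span B = UNIV" and T: "lin T" and nil: "\<And>v. (T ^^ m) v = 0"
  shows "tr B T = 0"
proof -
  have "\<exists>C. independent C \<and> C \<subseteq> {v. (T ^^ j) v = 0} \<and> {v. (T ^^ j) v = 0} \<subseteq> span C \<and>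
      (\<forall>b\<in>C. representation C (T b) b = 0)" for j
  proof (induction j)
    case 0
    then show ?case by (intro exI[of _ "{}"]) (auto simp: independent_empty)
  next
    case (Suc j)
    then obtain C where C: "independent C" "C \<subseteq> {v. (T ^^ j) v = 0}" "{v. (T ^^ j) v = 0} \<subseteq> span C"
      "\<And>b. b \<in> C \<Longrightarrow> representation C (T b) b = 0" by blast
    have "{v. (T ^^ j) v = 0} \<subseteq> {v. (T ^^ Suc j) v = 0}" using lin_0[OF T] by auto
    then have CS: "C \<subseteq> {v. (T ^^ Suc j) v = 0}" using C(2) by (rule order_trans[rotated])
    obtain D where D: "C \<subseteq> D" "D \<subseteq> {v. (T ^^ Suc j) v = 0}" "independent D"
      "{v. (T ^^ Suc j) v = 0} \<subseteq> span D"
      by (rule maximal_independent_subset_extend[OF CS C(1)])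
    have "representation D (T b) b = 0" if b: "b \<in> D" for b
    proof -
      have "(T ^^ j) (T b) = 0" using D(2) b by (auto simp: funpow_swap1)
      then have Tb: "T b \<in> span C" using C(3) by auto
      then have ext: "representation D (T b) = representation C (T b)"
        using representation_extend[OF D(3) _ D(1)] by blast
      show ?thesis
      proof (cases "b \<in> C")
        case True
        then show ?thesis using C(4) ext by simp
      next
        case False
        then have "representation C (T b) b = 0" using representation_ne_zero by blast
        then show ?thesis using ext by simp
      qed
    qed
    then show ?case using D by blast
  qed
  from this[of m] obtain C where C: "independent C" "span C = UNIV" "\<And>b. b \<in> C \<Longrightarrow> representation C (T b) b = 0"
    using nil by auto
  have "tr B T = tr C T" by (rule tr_basis_change[OF B C(1,2) T])
  also have "\<dots> = 0" using C(3) by (simp add: tr_def)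
  finally show ?thesis .
qed

end

section \<open>Structure of the simple Lie algebra\<close>

text \<open>A functional that vanishes on the common kernel of finitely many others is a combination of
  them. By induction it is one on the kernel of \<open>\<phi> k\<close>, and the coefficient of \<open>\<phi> k\<close> is then found
  at one vector outside this kernel.\<close>

lemma (in complex_fd) functional_in_span_of_functionals:
  assumes "finite I" and "subspace V"
    and "\<And>i. i \<in> I \<Longrightarrow> (\<forall>x\<in>V. \<forall>y\<in>V. \<phi> i (x + y) = \<phi> i x + \<phi> i y) \<and> (\<forall>c. \<forall>x\<in>V. \<phi> i (scale c x) = c * \<phi> i x)"
    and "\<forall>x\<in>V. \<forall>y\<in>V. \<psi> (x + y) = \<psi> x + \<psi> y" "\<forall>c. \<forall>x\<in>V. \<psi> (scale c x) = c * \<psi> x"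
    and "\<And>x. x \<in> V \<Longrightarrow> (\<And>i. i \<in> I \<Longrightarrow> \<phi> i x = 0) \<Longrightarrow> \<psi> x = 0"
  shows "\<exists>c. \<forall>x\<in>V. \<psi> x = (\<Sum>i\<in>I. c i * \<phi> i x)"
  using assms
proof (induction I arbitrary: V rule: finite_induct)
  case empty
  then show ?case by simp
next
  case (insert k I)
  define V' where "V' = {x\<in>V. \<phi> k x = 0}"
  have lk: "\<phi> k (x + y) = \<phi> k x + \<phi> k y" "\<phi> k (scale c x) = c * \<phi> k x" if "x \<in> V" "y \<in> V" for x y c
    using insert.prems(2)[of k] that by auto
  have "\<phi> k 0 = 0" using lk(2)[of 0 0 0] subspace_0[OF insert.prems(1)] by simp
  then have sV': "subspace V'"
    using insert.prems(1) lk by (auto simp: V'_def subspace_def)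
  have V'V: "V' \<subseteq> V" by (auto simp: V'_def)
  have "\<exists>c. \<forall>x\<in>V'. \<psi> x = (\<Sum>i\<in>I. c i * \<phi> i x)"
  proof (rule insert.IH[OF sV'])
    show "\<And>i. i \<in> I \<Longrightarrow> (\<forall>x\<in>V'. \<forall>y\<in>V'. \<phi> i (x + y) = \<phi> i x + \<phi> i y) \<and> (\<forall>c. \<forall>x\<in>V'. \<phi> i (scale c x) = c * \<phi> i x)"
      using insert.prems(2) V'V by blast
    show "\<forall>x\<in>V'. \<forall>y\<in>V'. \<psi> (x + y) = \<psi> x + \<psi> y" "\<forall>c. \<forall>x\<in>V'. \<psi> (scale c x) = c * \<psi> x"
      using insert.prems(3,4) V'V by blast+
    show "\<And>x. x \<in> V' \<Longrightarrow> (\<And>i. i \<in> I \<Longrightarrow> \<phi> i x = 0) \<Longrightarrow> \<psi> x = 0"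
      using insert.prems(5) by (auto simp: V'_def)
  qed
  then obtain c where c: "\<And>x. x \<in> V' \<Longrightarrow> \<psi> x = (\<Sum>i\<in>I. c i * \<phi> i x)" by blast
  show ?case
  proof (cases "\<forall>x\<in>V. \<phi> k x = 0")
    case True
    have "\<psi> x = (\<Sum>i\<in>insert k I. c i * \<phi> i x)" if "x \<in> V" for x
      using c[of x] that True insert.hyps by (simp add: V'_def)
    then show ?thesis by blast
  next
    case False
    then obtain y where y: "y \<in> V" "\<phi> k y \<noteq> 0" by blast
    define d where "d = (\<psi> y - (\<Sum>i\<in>I. c i * \<phi> i y)) / \<phi> k y"
    have "\<psi> x = (\<Sum>i\<in>insert k I. (c(k := d)) i * \<phi> i x)" if x: "x \<in> V" for x
    proof -
      define t where "t = \<phi> k x / \<phi> k y"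
      define z where "z = x + scale (- t) y"
      have ty: "scale (- t) y \<in> V" using y(1) insert.prems(1) by (simp add: subspace_scale subspace_neg)
      have z: "z \<in> V'"
        using x ty y insert.prems(1) lk(1)[OF x ty] lk(2)[OF y(1) y(1), of "- t"]
        by (auto simp: V'_def z_def t_def subspace_add simp del: scale_minus_left)
      have p1: "\<psi> z = \<psi> x - t * \<psi> y"
      proof -
        have "\<psi> z = \<psi> x + \<psi> (scale (- t) y)" unfolding z_def using insert.prems(3) x ty by blast
        also have "\<psi> (scale (- t) y) = (- t) * \<psi> y" using insert.prems(4) y(1) by blast
        finally show ?thesis by simp
      qed
      have p2: "\<phi> i z = \<phi> i x - t * \<phi> i y" if i: "i \<in> I" for i
      proof -
        have "\<phi> i z = \<phi> i x + \<phi> i (scale (- t) y)" unfolding z_def using insert.prems(2)[of i] i x ty by blast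
        also have "\<phi> i (scale (- t) y) = (- t) * \<phi> i y" using insert.prems(2)[of i] i y(1) by blast
        finally show ?thesis by simp
      qed
      have "\<psi> x = t * \<psi> y + (\<Sum>i\<in>I. c i * (\<phi> i x - t * \<phi> i y))"
        using c[OF z] p1 p2 by (simp add: algebra_simps)
      also have "\<dots> = t * (\<psi> y - (\<Sum>i\<in>I. c i * \<phi> i y)) + (\<Sum>i\<in>I. c i * \<phi> i x)"
        by (simp add: algebra_simps sum_subtractf sum_distrib_left)
      also have "t * (\<psi> y - (\<Sum>i\<in>I. c i * \<phi> i y)) = d * \<phi> k x"
        using y(2) by (simp add: t_def d_def)
      also have "(\<Sum>i\<in>I. c i * \<phi> i x) = (\<Sum>i\<in>I. (c(k := d)) i * \<phi> i x)"
        using insert.hyps by (intro sum.cong) auto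
      finally show ?thesis using insert.hyps by simp
    qed
    then show ?thesis by blast
  qed
qed

locale simple_lie =
  fixes L :: "('g::ab_group_add, 'l::finite) lie_data"
  assumes sld: "simple_lie_data L"
begin

abbreviation "sc \<equiv> scal L"
abbreviation "br \<equiv> lbr L"
abbreviation "H \<equiv> cartan L"
abbreviation "E \<equiv> gen_e L"
abbreviation "F \<equiv> gen_f L"
abbreviation "Hc \<equiv> gen_h L"
abbreviation "\<alpha> \<equiv> sroot L"
abbreviation "\<rho> \<equiv> rho_check L"

sublocale simple_lie_algebra "scal L" "lbr L"
  using sld by (simp add: simple_lie_data_def)

text \<open>An unspecified basis, through which the general theory of finite-dimensional spaces applies.\<close>

definition some_basis :: "'g set" where
  "some_basis = (SOME B. finite B \<and> independent B \<and> span B = UNIV)"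

lemma some_basis: "finite some_basis \<and> independent some_basis \<and> span some_basis = UNIV"
  unfolding some_basis_def
proof (rule someI_ex)
  obtain S where S: "finite S" "span S = UNIV" using finite_dimensional by blast
  obtain B where B: "B \<subseteq> S" "independent B" "S \<subseteq> span B" using maximal_independent_subset[of S] by blast
  have "finite B" using B(1) S(1) by (rule finite_subset)
  moreover have "span B = UNIV" using S(2) span_minimal[OF B(3)] by auto
  ultimately show "\<exists>B. finite B \<and> independent B \<and> span B = UNIV" using B(2) by blast
qed

sublocale complex_fd "scal L" some_basis
  using some_basis by unfold_locales auto

lemma lin_br: "lin (br x)"
  by (rule linI) (auto simp: bracket_add_right bracket_scale_right)

lemma lin_br_left: "lin (\<lambda>x. br x y)"
  by (rule linI) (auto simp: bracket_add_left bracket_scale_left)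

lemma br_0 [simp]: "br x 0 = 0" "br 0 x = 0"
  using lin_0[OF lin_br] lin_0[OF lin_br_left] by auto

lemma br_anti: "br x y = - br y x"
proof -
  have "0 = br (x + y) (x + y)" by (simp add: bracket_self)
  also have "\<dots> = br x y + br y x"
    by (simp only: bracket_add_left bracket_add_right) (simp add: bracket_self)
  finally show ?thesis by (simp add: eq_neg_iff_add_eq_0)
qed

lemma br_neg: "br (- x) y = - br x y" "br x (- y) = - br x y"
  using lin_neg[OF lin_br] lin_neg[OF lin_br_left] by auto

lemma br_diff: "br (x - y) z = br x z - br y z" "br x (y - z) = br x y - br x z"
  using lin_diff[OF lin_br] lin_diff[OF lin_br_left] by auto

lemma br_sum: "br (sum f A) z = (\<Sum>a\<in>A. br (f a) z)" "br z (sum f A) = (\<Sum>a\<in>A. br z (f a))"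
  using lin_sum[OF lin_br] lin_sum[OF lin_br_left] by auto

lemma br_derivation: "br x (br y z) = br (br x y) z + br y (br x z)"
proof -
  have a: "br y (br z x) = - br y (br x z)" by (subst br_anti[of z x]) (simp add: br_neg)
  have b: "br z (br x y) = - br (br x y) z" by (rule br_anti)
  have g: "A = C + B" if "A + - B + - C = 0" for A B C :: 'g
    using that by (simp add: algebra_simps)
  have "br x (br y z) + - br y (br x z) + - br (br x y) z = 0"
    unfolding a[symmetric] b[symmetric] by (rule jacobi)
  then show ?thesis by (rule g)
qed

lemma br_br_left: "br (br x y) z = br x (br y z) - br y (br x z)"
  using br_derivation[of x y z] by simp

text \<open>The centre is an ideal, and the algebra is not abelian.\<close>

lemma center_trivial:
  assumes "\<And>x. br y x = 0" shows "y = 0"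
proof -
  let ?Z = "{y. \<forall>x. br y x = 0}"
  have "subspace ?Z"
    by (rule subspaceI) (auto simp: bracket_add_left bracket_scale_left)
  moreover have "br x y \<in> ?Z" if "y \<in> ?Z" for x y
    using that by (simp add: br_br_left)
  ultimately have "?Z = {0} \<or> ?Z = UNIV" by (rule no_ideals)
  then show ?thesis using not_abelian assms by blast
qed

lemma cartan_facts:
  shows subspace_H: "subspace H"
    and H_abelian: "x \<in> H \<Longrightarrow> y \<in> H \<Longrightarrow> br x y = 0"
    and H_semisimple: "x \<in> H \<Longrightarrow> diagonalizable (br x)"
    and H_maximal: "toral_subalgebra L T \<Longrightarrow> H \<subseteq> T \<Longrightarrow> T = H"
  using sld by (auto simp: simple_lie_data_def cartan_subalgebra_def toral_subalgebra_def
      ad_semisimple_def diagonalizable_def)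

lemma chevalley:
  shows E_root: "E i \<in> root_space L (\<alpha> i)"
    and F_root: "F i \<in> root_space L (\<lambda>y. - \<alpha> i y)"
    and Hc_H: "Hc i \<in> H"
    and E_F: "br (E i) (F i) = Hc i"
    and \<alpha>_Hc: "\<alpha> i (Hc i) = 2"
  using sld by (auto simp: simple_lie_data_def)

lemma simple_roots_facts:
  shows \<alpha>_root: "is_root L (\<alpha> i)"
    and \<alpha>_indep: "(\<And>y. y \<in> H \<Longrightarrow> (\<Sum>i\<in>UNIV. c i * \<alpha> i y) = 0) \<Longrightarrow> c i = 0"
    and root_pos_or_neg: "is_root L \<beta> \<Longrightarrow> positive_root L \<beta> \<or> positive_root L (\<lambda>y. - \<beta> y)"
proof -
  have s: "simple_roots L" using sld by (simp add: simple_lie_data_def)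
  show "is_root L (\<alpha> i)" using s by (simp add: simple_roots_def)
  show "c i = 0" if "\<And>y. y \<in> H \<Longrightarrow> (\<Sum>i\<in>UNIV. c i * \<alpha> i y) = 0"
    using s that unfolding simple_roots_def by blast
  show "positive_root L \<beta> \<or> positive_root L (\<lambda>y. - \<beta> y)" if "is_root L \<beta>"
    using s that unfolding simple_roots_def by blast
qed

lemma root_spaceD: "v \<in> root_space L \<beta> \<Longrightarrow> y \<in> H \<Longrightarrow> br y v = sc (\<beta> y) v"
  by (simp add: root_space_def)

lemma weight_linear:
  assumes "v \<in> root_space L \<beta>" "v \<noteq> 0"
  shows "x \<in> H \<Longrightarrow> y \<in> H \<Longrightarrow> \<beta> (x + y) = \<beta> x + \<beta> y" and "x \<in> H \<Longrightarrow> \<beta> (sc c x) = c * \<beta> x"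
proof -
  assume xy: "x \<in> H" "y \<in> H"
  then have "x + y \<in> H" using subspace_H subspace_add by blast
  then have "sc (\<beta> (x + y)) v = sc (\<beta> x + \<beta> y) v"
    using root_spaceD[OF assms(1)] xy by (metis bracket_add_left scale_left_distrib)
  then show "\<beta> (x + y) = \<beta> x + \<beta> y" using assms(2) by (simp only: scale_cancel_right) simp
next
  assume x: "x \<in> H"
  then have "sc c x \<in> H" using subspace_H subspace_scale by blast
  then have "sc (\<beta> (sc c x)) v = sc (c * \<beta> x) v"
    using root_spaceD[OF assms(1)] x by (metis bracket_scale_left scale_scale)
  then show "\<beta> (sc c x) = c * \<beta> x" using assms(2) by (simp only: scale_cancel_right) simp
qed

lemma subspace_root_space: "subspace (root_space L \<beta>)"
  by (rule subspaceI)
     (auto simp: root_space_def bracket_add_right bracket_scale_right scale_right_distrib scale_left_commute)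

lemma \<alpha>_linear:
  shows \<alpha>_add: "x \<in> H \<Longrightarrow> y \<in> H \<Longrightarrow> \<alpha> i (x + y) = \<alpha> i x + \<alpha> i y"
    and \<alpha>_scale: "x \<in> H \<Longrightarrow> \<alpha> i (sc c x) = c * \<alpha> i x"
proof -
  have "0 \<in> root_space L (\<alpha> i)" by (rule subspace_0[OF subspace_root_space])
  then obtain v where v: "v \<in> root_space L (\<alpha> i)" "v \<noteq> 0"
    using \<alpha>_root[of i] by (auto simp: is_root_def)
  show "x \<in> H \<Longrightarrow> y \<in> H \<Longrightarrow> \<alpha> i (x + y) = \<alpha> i x + \<alpha> i y" by (rule weight_linear(1)[OF v])
  show "x \<in> H \<Longrightarrow> \<alpha> i (sc c x) = c * \<alpha> i x" by (rule weight_linear(2)[OF v])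
qed

subsection \<open>Weights and the principal grading\<close>

text \<open>A common eigenbasis of the generators diagonalizes all elements of the span.\<close>

lemma toral_span:
  assumes Y: "finite Y" and comm: "\<And>x y. x \<in> Y \<Longrightarrow> y \<in> Y \<Longrightarrow> br x y = 0"
    and diag: "\<And>x. x \<in> Y \<Longrightarrow> diagonalizable (br x)"
  shows "toral_subalgebra L (span Y)"
    and "span {v. \<forall>y\<in>span Y. \<exists>c. br y v = sc c v} = UNIV"
proof -
  have "span {v. \<forall>y\<in>Y. \<exists>c. br y v = sc c v} = UNIV"
  proof (rule simultaneous_diagonalization[OF Y lin_br diag])
    fix y y' v assume "y \<in> Y" "y' \<in> Y"
    then show "br y (br y' v) = br y' (br y v)" using br_derivation[of y y' v] comm[of y y'] by simp
  qed
  moreover have "\<exists>c. br y v = sc c v" if v: "\<forall>y\<in>Y. \<exists>c. br y v = sc c v" and y: "y \<in> span Y" for v y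
    using y
  proof (induction rule: span_induct_alt)
    case base
    then show ?case by (intro exI[of _ 0]) simp
  next
    case (step d x z)
    then obtain a b where "br x v = sc a v" "br z v = sc b v" using v by blast
    then have "br (sc d x + z) v = sc (d * a + b) v"
      by (simp add: bracket_add_left bracket_scale_left scale_left_distrib)
    then show ?case by blast
  qed
  ultimately show J: "span {v. \<forall>y\<in>span Y. \<exists>c. br y v = sc c v} = UNIV"
  proof -
    assume U: "span {v. \<forall>y\<in>Y. \<exists>c. br y v = sc c v} = UNIV"
      and ext: "\<And>v y. \<lbrakk>\<forall>y\<in>Y. \<exists>c. br y v = sc c v; y \<in> span Y\<rbrakk> \<Longrightarrow> \<exists>c. br y v = sc c v"
    have "{v. \<forall>y\<in>Y. \<exists>c. br y v = sc c v} \<subseteq> {v. \<forall>y\<in>span Y. \<exists>c. br y v = sc c v}"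
      using ext by blast
    from span_mono[OF this] show ?thesis unfolding U by blast
  qed
  have "ad_semisimple L x" if x: "x \<in> span Y" for x
  proof -
    have "{v. \<forall>y\<in>span Y. \<exists>c. br y v = sc c v} \<subseteq> {v. \<exists>c. br x v = sc c v}" using x by blast
    from span_mono[OF this] show ?thesis unfolding ad_semisimple_def J by auto
  qed
  moreover have "br x y = 0" if x: "x \<in> span Y" and y: "y \<in> span Y" for x y
    using x
  proof (induction rule: span_induct_alt)
    case (step c a b)
    have "br a y = 0" using y
      by (induction rule: span_induct_alt) (auto simp: bracket_add_right bracket_scale_right comm step)
    then show ?case using step by (simp add: bracket_add_left bracket_scale_left)
  qed simp
  ultimately show "toral_subalgebra L (span Y)" by (simp add: toral_subalgebra_def)
qed

lemma H_basis: obtains Y where "finite Y" "Y \<subseteq> H" "span Y = H"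
proof -
  obtain Y where "Y \<subseteq> H" "independent Y" "H \<subseteq> span Y" using maximal_independent_subset[of H] by blast
  then show ?thesis using that[of Y] finiteI_independent[of Y] span_minimal[OF _ subspace_H, of Y] by blast
qed

lemma span_root_spaces: "span (\<Union>\<beta>. root_space L \<beta>) = UNIV"
proof -
  obtain Y where Y: "finite Y" "Y \<subseteq> H" "span Y = H" by (rule H_basis)
  have "span {v. \<forall>y\<in>H. \<exists>c. br y v = sc c v} = UNIV"
    using toral_span(2)[of Y] Y H_abelian H_semisimple by (auto simp: subset_iff)
  moreover have "{v. \<forall>y\<in>H. \<exists>c. br y v = sc c v} \<subseteq> (\<Union>\<beta>. root_space L \<beta>)"
  proof
    fix v assume "v \<in> {v. \<forall>y\<in>H. \<exists>c. br y v = sc c v}"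
    then obtain \<beta> where "\<forall>y\<in>H. br y v = sc (\<beta> y) v" by (auto simp: bchoice_iff)
    then show "v \<in> (\<Union>\<beta>. root_space L \<beta>)" by (auto simp: root_space_def)
  qed
  ultimately show ?thesis using span_mono by blast
qed

text \<open>Every root is an integral combination of simple roots, so such an element acts by zero on
  all root spaces and is central.\<close>

lemma joint_kernel_trivial:
  assumes y: "y \<in> H" and z: "\<And>i. \<alpha> i y = 0"
  shows "y = 0"
proof (rule center_trivial)
  fix x
  have "br y v = 0" if v: "v \<in> root_space L \<beta>" for v \<beta>
  proof (cases "v = 0 \<or> \<beta> y = 0")
    case True
    then show ?thesis using root_spaceD[OF v y] by auto
  next
    case False
    then have "is_root L \<beta>" using v y by (auto simp: is_root_def)
    from root_pos_or_neg[OF this] have "\<beta> y = 0" using y z by (auto simp: positive_root_def)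
    then show ?thesis using False by simp
  qed
  then have "(\<Union>\<beta>. root_space L \<beta>) \<subseteq> {x. br y x = 0}" by blast
  moreover have "subspace {x. br y x = 0}"
    by (rule subspaceI) (auto simp: bracket_add_right bracket_scale_right)
  ultimately show "br y x = 0" using span_minimal[of _ "{x. br y x = 0}"] span_root_spaces by blast
qed

lemma coweight_exists: "\<exists>y\<in>H. \<forall>j. \<alpha> j y = (if j = i then 1 else 0)"
proof -
  have "\<exists>y\<in>H. (\<forall>j. j \<noteq> i \<longrightarrow> \<alpha> j y = 0) \<and> \<alpha> i y \<noteq> 0"
  proof (rule ccontr)
    assume no: "\<not> ?thesis"
    have "\<exists>c. \<forall>x\<in>H. \<alpha> i x = (\<Sum>j\<in>UNIV - {i}. c j * \<alpha> j x)"
      by (rule functional_in_span_of_functionals[OF _ subspace_H]) (use no \<alpha>_add \<alpha>_scale in auto)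
    then obtain c where c: "\<And>x. x \<in> H \<Longrightarrow> \<alpha> i x = (\<Sum>j\<in>UNIV - {i}. c j * \<alpha> j x)" by blast
    have "(\<Sum>j\<in>UNIV. (c(i := -1)) j * \<alpha> j x) = 0" if "x \<in> H" for x
      using c[OF that] by (subst sum.remove[of _ i]) (auto intro!: sum.cong)
    then have "(c(i := -1)) i = 0" by (rule \<alpha>_indep)
    then show False by simp
  qed
  then obtain y where y: "y \<in> H" "\<And>j. j \<noteq> i \<Longrightarrow> \<alpha> j y = 0" "\<alpha> i y \<noteq> 0" by blast
  have "sc (inverse (\<alpha> i y)) y \<in> H" using y subspace_H subspace_scale by blast
  then show ?thesis using y by (intro bexI[of _ "sc (inverse (\<alpha> i y)) y"]) (auto simp: \<alpha>_scale)
qed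

lemma \<alpha>_inj: "x \<in> H \<Longrightarrow> y \<in> H \<Longrightarrow> (\<And>i. \<alpha> i x = \<alpha> i y) \<Longrightarrow> x = y"
  using joint_kernel_trivial[of "x - y"] \<alpha>_add[of "x - y" y] subspace_diff[OF subspace_H, of x y] by simp

abbreviation "\<omega> \<equiv> fund_coweight L"

lemma fund_coweight: "\<omega> i \<in> H" "\<alpha> j (\<omega> i) = (if j = i then 1 else 0)"
proof -
  have "\<exists>!y. y \<in> H \<and> (\<forall>j. \<alpha> j y = (if j = i then 1 else 0))"
    using coweight_exists[of i] \<alpha>_inj by (metis (no_types, lifting))
  then have "\<omega> i \<in> H \<and> (\<forall>j. \<alpha> j (\<omega> i) = (if j = i then 1 else 0))"
    unfolding fund_coweight_def by (rule theI')
  then show "\<omega> i \<in> H" "\<alpha> j (\<omega> i) = (if j = i then 1 else 0)" by auto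
qed

lemma \<alpha>_0: "\<alpha> i 0 = 0"
  using \<alpha>_scale[of 0 i 0] subspace_0[OF subspace_H] by simp

lemma \<alpha>_sum: "(\<And>a. a \<in> A \<Longrightarrow> f a \<in> H) \<Longrightarrow> \<alpha> i (sum f A) = (\<Sum>a\<in>A. \<alpha> i (f a))"
proof (induction A rule: infinite_finite_induct)
  case (insert x A)
  then show ?case using \<alpha>_add[of "f x" "sum f A" i] subspace_sum[OF subspace_H, of A f] by simp
qed (auto simp: \<alpha>_0)

lemma \<rho>_H: "\<rho> \<in> H" and \<alpha>_\<rho>: "\<alpha> i \<rho> = 1"
proof -
  show "\<rho> \<in> H" unfolding rho_check_def by (intro subspace_sum subspace_H fund_coweight)
  show "\<alpha> i \<rho> = 1" unfolding rho_check_def by (subst \<alpha>_sum) (auto simp: fund_coweight)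
qed

lemma H_expand: "y \<in> H \<Longrightarrow> y = (\<Sum>i\<in>UNIV. sc (\<alpha> i y) (\<omega> i))"
proof (rule \<alpha>_inj)
  have w: "sc (\<alpha> i y) (\<omega> i) \<in> H" for i using fund_coweight subspace_H subspace_scale by blast
  then show "(\<Sum>i\<in>UNIV. sc (\<alpha> i y) (\<omega> i)) \<in> H" by (intro subspace_sum subspace_H)
  fix i assume "y \<in> H"
  show "\<alpha> i y = \<alpha> i (\<Sum>i\<in>UNIV. sc (\<alpha> i y) (\<omega> i))"
    by (subst \<alpha>_sum) (auto simp: w \<alpha>_scale fund_coweight if_distrib cong: if_cong)
qed

text \<open>The value is the height of the root, which is positive because the root is not zero.\<close>

lemma positive_root_degree:
  assumes "positive_root L \<beta>" shows "\<exists>k::nat. k > 0 \<and> \<beta> \<rho> = of_nat k"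
proof -
  obtain k :: "'l \<Rightarrow> nat" where k: "\<forall>y\<in>H. \<beta> y = (\<Sum>i\<in>UNIV. of_nat (k i) * \<alpha> i y)"
    using assms by (auto simp: positive_root_def)
  obtain y where y: "y \<in> H" "\<beta> y \<noteq> 0" using assms by (auto simp: positive_root_def is_root_def)
  have "\<beta> \<rho> = of_nat (\<Sum>i\<in>UNIV. k i)" using k \<rho>_H by (simp add: \<alpha>_\<rho>)
  moreover have "(\<Sum>i\<in>UNIV. k i) \<noteq> 0"
  proof
    assume "(\<Sum>i\<in>UNIV. k i) = 0"
    then have "\<beta> y = 0" using k y(1) by simp
    then show False using y(2) by simp
  qed
  ultimately show ?thesis by blast
qed

text \<open>A basis of weight vectors. Weight zero is allowed here: at this stage the centralizer of the
  Cartan subalgebra could still be larger than the Cartan subalgebra.\<close>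

definition WB :: "'g set" where
  "WB = (SOME B. B \<subseteq> (\<Union>\<beta>. root_space L \<beta>) \<and> independent B \<and> span B = UNIV)"

lemma WB: "WB \<subseteq> (\<Union>\<beta>. root_space L \<beta>)" "independent WB" "span WB = UNIV"
proof -
  obtain B where B: "B \<subseteq> (\<Union>\<beta>. root_space L \<beta>)" "independent B" "(\<Union>\<beta>. root_space L \<beta>) \<subseteq> span B"
    using maximal_independent_subset[of "\<Union>\<beta>. root_space L \<beta>"] by blast
  have "span B = UNIV" using span_minimal[OF B(3)] span_root_spaces by auto
  then have "\<exists>B. B \<subseteq> (\<Union>\<beta>. root_space L \<beta>) \<and> independent B \<and> span B = UNIV" using B by blast
  from someI_ex[OF this] show "WB \<subseteq> (\<Union>\<beta>. root_space L \<beta>)" "independent WB" "span WB = UNIV"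
    unfolding WB_def by auto
qed

lemma finite_WB: "finite WB"
  by (rule finiteI_independent[OF WB(2)])

abbreviation "rep \<equiv> representation WB"

lemma rep_sum: "(\<Sum>b\<in>WB. sc (rep v b) b) = v"
  using sum_representation_eq[OF WB(2) _ finite_WB order_refl, of v] WB(3) by simp

lemma rep_add: "rep (v + w) b = rep v b + rep w b"
  using representation_add[OF WB(2)] WB(3) by simp

lemma rep_scale: "rep (sc c v) b = c * rep v b"
  using representation_scale[OF WB(2)] WB(3) by simp

lemma rep_basis: "b \<in> WB \<Longrightarrow> rep b c = (if c = b then 1 else 0)"
  using representation_basis[OF WB(2)] by auto

lemma rep_0 [simp]: "rep 0 b = 0"
  by (simp add: representation_zero)

lemma rep_linear_sum: "rep (sum f A) b = (\<Sum>a\<in>A. rep (f a) b)"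
  by (induction A rule: infinite_finite_induct) (auto simp: rep_add)

lemma lin_eq_on_WB: "lin S \<Longrightarrow> lin T \<Longrightarrow> (\<And>b. b \<in> WB \<Longrightarrow> S b = T b) \<Longrightarrow> S v = T v"
  using vsp.linear_eq_on[of S T v WB] WB(3) by simp

definition wt :: "'g \<Rightarrow> 'g \<Rightarrow> complex" where
  "wt b = (SOME \<beta>. b \<in> root_space L \<beta>)"

lemma wt: "b \<in> WB \<Longrightarrow> b \<in> root_space L (wt b)"
proof -
  assume "b \<in> WB"
  then have "\<exists>\<beta>. b \<in> root_space L \<beta>" using WB(1) by blast
  then show ?thesis unfolding wt_def by (rule someI_ex)
qed

lemma WB_nonzero: "b \<in> WB \<Longrightarrow> b \<noteq> 0"
  using WB(2) dependent_zero by blast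

text \<open>The degree of a basis vector in the principal grading: the height of its weight, which is an
  integer by the choice of simple roots.\<close>

definition dg :: "'g \<Rightarrow> int" where
  "dg b = (SOME k. wt b \<rho> = of_int k)"

lemma
  assumes b: "b \<in> WB"
  shows dg: "br \<rho> b = sc (of_int (dg b)) b"
    and dg_0: "dg b = 0 \<Longrightarrow> y \<in> H \<Longrightarrow> br y b = 0"
    and dg_pos: "dg b > 0 \<Longrightarrow> positive_root L (wt b)"
proof -
  have *: "wt b \<rho> = of_int (dg b) \<and> (dg b = 0 \<longrightarrow> (\<forall>y\<in>H. wt b y = 0)) \<and> (dg b > 0 \<longrightarrow> positive_root L (wt b))"
  proof (cases "\<forall>y\<in>H. wt b y = 0")
    case True
    then have "wt b \<rho> = of_int 0" using \<rho>_H by simp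
    then have "wt b \<rho> = of_int (dg b)" unfolding dg_def by (rule someI)
    then have "dg b = 0" "wt b \<rho> = of_int (dg b)" using True \<rho>_H by auto
    then show ?thesis using True by simp
  next
    case False
    then have "is_root L (wt b)" using wt[OF b] WB_nonzero[OF b] by (auto simp: is_root_def)
    from root_pos_or_neg[OF this] show ?thesis
    proof
      assume pos: "positive_root L (wt b)"
      from positive_root_degree[OF this] obtain k :: nat where k: "k > 0" "wt b \<rho> = of_int (int k)" by auto
      then have "wt b \<rho> = of_int (dg b)" unfolding dg_def by (intro someI)
      moreover have "dg b = int k" using calculation k by (metis of_int_eq_iff)
      ultimately show ?thesis using pos k(1) by simp
    next
      assume "positive_root L (\<lambda>y. - wt b y)"
      from positive_root_degree[OF this] obtain k :: nat where k: "k > 0" "- wt b \<rho> = of_nat k" by auto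
      then have k': "wt b \<rho> = of_int (- int k)" by (metis minus_minus of_int_minus of_int_of_nat_eq)
      then have "wt b \<rho> = of_int (dg b)" unfolding dg_def by (intro someI)
      moreover have "dg b = - int k" using calculation k' by (metis of_int_eq_iff)
      ultimately show ?thesis using k(1) by simp
    qed
  qed
  show "br \<rho> b = sc (of_int (dg b)) b" using * root_spaceD[OF wt[OF b] \<rho>_H] by simp
  show "dg b = 0 \<Longrightarrow> y \<in> H \<Longrightarrow> br y b = 0" using * root_spaceD[OF wt[OF b]] by simp
  show "dg b > 0 \<Longrightarrow> positive_root L (wt b)" using * by simp
qed

text \<open>The principal grading. The elements \<open>e\<^sub>i\<close> have degree \<open>1\<close> and the \<open>f\<^sub>i\<close> degree \<open>-1\<close>.\<close>

definition gr :: "int \<Rightarrow> 'g set" where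
  "gr k = {v. br \<rho> v = sc (of_int k) v}"

definition proj :: "int \<Rightarrow> 'g \<Rightarrow> 'g" where
  "proj k v = (\<Sum>b\<in>{b\<in>WB. dg b = k}. sc (rep v b) b)"

lemma lin_proj: "lin (proj k)"
  by (rule linI) (simp_all add: proj_def rep_add rep_scale scale_left_distrib sum.distrib scale_sum_right)

lemma proj_linear [simp]: "proj k 0 = 0" "proj k (v + w) = proj k v + proj k w" "proj k (v - w) = proj k v - proj k w"
  "proj k (- v) = - proj k v" "proj k (sc c v) = sc c (proj k v)"
  using lin_0[OF lin_proj] lin_add[OF lin_proj] lin_diff[OF lin_proj] lin_neg[OF lin_proj] lin_scale[OF lin_proj] by auto

lemma proj_sum: "proj k (sum f A) = (\<Sum>a\<in>A. proj k (f a))"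
  by (rule lin_sum[OF lin_proj])

lemma subspace_gr: "subspace (gr k)"
  by (rule subspaceI) (auto simp: gr_def bracket_add_right bracket_scale_right scale_right_distrib scale_left_commute)

lemma WB_gr: "b \<in> WB \<Longrightarrow> b \<in> gr (dg b)"
  using dg by (simp add: gr_def)

lemma proj_gr: "proj k v \<in> gr k"
  unfolding proj_def by (intro subspace_sum subspace_gr subspace_scale) (use WB_gr in auto)

definition K :: int where "K = Max (insert 0 ((\<lambda>b. \<bar>dg b\<bar>) ` WB))"

lemma K: "0 \<le> K" "b \<in> WB \<Longrightarrow> \<bar>dg b\<bar> \<le> K"
  using finite_WB by (auto simp: K_def)

lemma proj_outside: "\<bar>k\<bar> > K \<Longrightarrow> proj k v = 0"
proof -
  assume "\<bar>k\<bar> > K"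
  then have "{b\<in>WB. dg b = k} = {}" using K(2) by force
  then show ?thesis by (simp only: proj_def sum.empty)
qed

lemma sum_proj: "(\<Sum>k\<in>{-K..K}. proj k v) = v"
proof -
  have "(\<Sum>k\<in>{-K..K}. proj k v) = (\<Sum>b\<in>WB. sc (rep v b) b)"
    unfolding proj_def by (rule sum.group) (use finite_WB K(2) in force)+
  then show ?thesis by (simp only: rep_sum)
qed

text \<open>The components of \<open>v\<close> are eigenvectors of \<open>ad \<rho>\<^sup>\<or>\<close> for different eigenvalues, hence
  independent.\<close>

lemma proj_of_gr:
  assumes "v \<in> gr k" shows "proj j v = (if j = k then v else 0)"
proof -
  have u: "proj i v = 0" if i: "i \<noteq> k" for i
  proof -
    have "(\<Sum>k'\<in>{-K..K}. br \<rho> (proj k' v) - sc (of_int k) (proj k' v)) = 0"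
      using assms sum_proj[of v]
      by (simp add: sum_subtractf scale_sum_right[symmetric] br_sum(2)[symmetric] gr_def)
    moreover have eig: "br \<rho> (proj k' v) - sc (of_int k) (proj k' v) = sc (of_int (k' - k)) (proj k' v)" for k'
      using proj_gr[of k' v] by (simp add: gr_def scale_left_diff_distrib)
    ultimately have s0: "(\<Sum>k'\<in>{-K..K}. sc (of_int (k' - k)) (proj k' v)) = 0" by simp
    show ?thesis
    proof (cases "i \<in> {-K..K}")
      case True
      define w where "w = (\<lambda>a::complex. \<Sum>k'\<in>{k'\<in>{-K..K}. of_int k' = a}. sc (of_int (k' - k)) (proj k' v))"
      have weq: "w (of_int k') = sc (of_int (k' - k)) (proj k' v)" if "k' \<in> {-K..K}" for k'
      proof -
        have "{k''\<in>{-K..K}. (of_int k''::complex) = of_int k'} = {k'}" using that by auto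
        then show ?thesis by (simp add: w_def)
      qed
      have "sum w (of_int ` {-K..K}) = (\<Sum>k'\<in>{-K..K}. sc (of_int (k' - k)) (proj k' v))"
        by (subst sum.reindex) (auto simp: inj_on_def weq)
      then have "sum w (of_int ` {-K..K}) = 0" using s0 by simp
      moreover have "w a \<in> gen_eig (br \<rho>) a" for a
        unfolding w_def using proj_gr
        by (intro subspace_sum subspace_gen_eig lin_br subspace_scale eig_gen_eig) (auto simp: gr_def)
      ultimately have "w (of_int i) = 0"
        using gen_eig_independent[OF lin_br, of "of_int ` {-K..K}" w \<rho> "of_int i"] True by blast
      then show ?thesis using weq[OF True] i by simp
    next
      case False
      then show ?thesis by (intro proj_outside) auto
    qed
  qed
  moreover have "proj k v = v"
  proof -
    have "v = (\<Sum>i\<in>{-K..K}. if i = k then proj k v else 0)"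
    proof -
      have "(\<Sum>i\<in>{-K..K}. proj i v) = (\<Sum>i\<in>{-K..K}. if i = k then proj k v else 0)"
        by (rule sum.cong) (simp_all add: u)
      then show ?thesis by (simp only: sum_proj)
    qed
    also have "\<dots> = proj k v" using proj_outside[of k v] by auto
    finally show ?thesis by simp
  qed
  ultimately show ?thesis by auto
qed

lemma proj_proj [simp]: "proj j (proj k v) = (if j = k then proj k v else 0)"
  by (rule proj_of_gr[OF proj_gr])

lemma gr_iff: "v \<in> gr k \<longleftrightarrow> proj k v = v"
  using proj_of_gr[of v k k] proj_gr[of k v] by auto

lemma gr_outside: "\<bar>k\<bar> > K \<Longrightarrow> v \<in> gr k \<Longrightarrow> v = 0"
  using proj_outside[of k v] by (simp add: gr_iff)

lemma br_gr: "x \<in> gr j \<Longrightarrow> y \<in> gr k \<Longrightarrow> br x y \<in> gr (j + k)"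
  by (simp add: gr_def br_derivation[of \<rho> x y] bracket_scale_left bracket_scale_right scale_left_distrib)

lemma H_gr0: "y \<in> H \<Longrightarrow> y \<in> gr 0"
  using H_abelian[OF \<rho>_H] by (simp add: gr_def)

lemma E_gr: "E i \<in> gr 1"
  using root_spaceD[OF E_root \<rho>_H, of i] by (simp add: gr_def \<alpha>_\<rho>)

lemma F_gr: "F i \<in> gr (-1)"
  using root_spaceD[OF F_root \<rho>_H, of i] by (simp add: gr_def \<alpha>_\<rho>)

text \<open>The height of a root is not zero, so the basis vectors of degree zero have weight zero.\<close>

lemma gr0_centralizes: "v \<in> gr 0 \<Longrightarrow> y \<in> H \<Longrightarrow> br y v = 0"
proof -
  assume v: "v \<in> gr 0" and y: "y \<in> H"
  have "v = proj 0 v" using v by (simp add: gr_iff)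
  also have "br y (proj 0 v) = 0"
    unfolding proj_def br_sum using dg_0 y by (auto simp: bracket_scale_right)
  finally show "br y v = 0" .
qed


subsection \<open>The Killing form\<close>

lemma lin_zero: "lin (\<lambda>_. 0)"
  by (rule linI) auto

definition killing :: "'g \<Rightarrow> 'g \<Rightarrow> complex" where
  "killing x y = tr WB (\<lambda>z. br x (br y z))"

lemma trW_commute: "lin S \<Longrightarrow> lin T \<Longrightarrow> tr WB (\<lambda>x. S (T x)) = tr WB (\<lambda>x. T (S x))"
  by (rule tr_commute[OF WB(2)]) (simp_all add: WB(3))

lemma trW_add: "tr WB (\<lambda>x. S x + T x) = tr WB S + tr WB T"
  by (rule tr_add[OF WB(2)]) (simp_all add: WB(3))

lemma trW_diff: "tr WB (\<lambda>x. S x - T x) = tr WB S - tr WB T"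
  by (rule tr_diff[OF WB(2)]) (simp_all add: WB(3))

lemma trW_scale: "tr WB (\<lambda>x. sc c (S x)) = c * tr WB S"
  by (rule tr_scale[OF WB(2)]) (simp_all add: WB(3))

lemma killing_sym: "killing x y = killing y x"
  unfolding killing_def by (intro trW_commute lin_br)

lemma killing_add: "killing (x + y) z = killing x z + killing y z" "killing z (x + y) = killing z x + killing z y"
proof -
  show *: "killing (x + y) z = killing x z + killing y z" for x y z
    by (simp add: killing_def bracket_add_left trW_add)
  show "killing z (x + y) = killing z x + killing z y" using * by (simp add: killing_sym[of z])
qed

lemma killing_scale: "killing (sc c x) z = c * killing x z" "killing z (sc c x) = c * killing z x"
proof -
  show *: "killing (sc c x) z = c * killing x z" for x z
    by (simp add: killing_def bracket_scale_left trW_scale)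
  show "killing z (sc c x) = c * killing z x" using * by (simp add: killing_sym[of z])
qed

lemma killing_0 [simp]: "killing 0 z = 0" "killing z 0 = 0"
  using killing_scale(1)[of 0 0 z] killing_scale(2)[of z 0 0] by auto

lemma killing_neg: "killing (- x) z = - killing x z" "killing z (- x) = - killing z x"
  using killing_add(1)[of x "- x" z] killing_add(2)[of z x "- x"] by (auto simp: eq_neg_iff_add_eq_0 add.commute)

lemma killing_diff: "killing (x - y) z = killing x z - killing y z" "killing z (x - y) = killing z x - killing z y"
  using killing_add(1)[of x "- y" z] killing_add(2)[of z x "- y"] by (auto simp: killing_neg)

lemma killing_sum: "killing (sum f A) z = (\<Sum>a\<in>A. killing (f a) z)" "killing z (sum f A) = (\<Sum>a\<in>A. killing z (f a))"
  by (induction A rule: infinite_finite_induct) (auto simp: killing_add)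

lemma killing_inv: "killing (br x y) z = killing x (br y z)"
proof -
  have c: "tr WB (\<lambda>w. br y (br x (br z w))) = tr WB (\<lambda>w. br x (br z (br y w)))"
    by (rule trW_commute[OF lin_br lin_comp[OF lin_br lin_br]])
  have "killing (br x y) z = tr WB (\<lambda>w. br x (br y (br z w))) - tr WB (\<lambda>w. br y (br x (br z w)))"
    by (simp add: killing_def br_br_left trW_diff)
  also have "\<dots> = tr WB (\<lambda>w. br x (br y (br z w)) - br x (br z (br y w)))"
    unfolding c trW_diff ..
  also have "\<dots> = killing x (br y z)"
    by (simp add: killing_def br_br_left br_diff)
  finally show ?thesis .
qed

lemma br_pow_gr: "x \<in> gr j \<Longrightarrow> v \<in> gr k \<Longrightarrow> (br x ^^ n) v \<in> gr (k + int n * j)"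
proof (induction n)
  case (Suc n)
  then have "br x ((br x ^^ n) v) \<in> gr (j + (k + int n * j))" by (intro br_gr) auto
  then show ?case by (simp add: algebra_simps)
qed simp

lemma last_nonzero:
  fixes f :: "'g \<Rightarrow> 'g"
  assumes "v \<noteq> 0" "(f ^^ N) v = 0" shows "\<exists>n. (f ^^ n) v \<noteq> 0 \<and> (f ^^ Suc n) v = 0"
  using assms by (induction N) auto

lemma gr_nonzero_bound: "v \<in> gr k \<Longrightarrow> v \<noteq> 0 \<Longrightarrow> \<bar>k\<bar> \<le> K"
  using gr_outside by (meson not_le)

text \<open>The eigenvalues of a coroot are integers: climb with \<open>e\<^sub>i\<close> to a highest weight vector \<open>w\<close>; the
  weight of \<open>w\<close> is the natural number \<open>m\<close> for which \<open>f\<^sub>i\<close> kills \<open>w\<close> after \<open>m + 1\<close> steps.\<close>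

lemma coroot_eigenvalue_integral:
  assumes b: "b \<noteq> 0" "b \<in> gr k" and \<mu>: "br (Hc i) b = sc \<mu> b"
  shows "\<exists>m. \<mu> = of_int m"
proof -
  have hE: "br (Hc i) (E i) = sc 2 (E i)" and hF: "br (Hc i) (F i) = sc (-2) (F i)"
    using root_spaceD[OF E_root Hc_H, of i i] root_spaceD[OF F_root Hc_H, of i i] \<alpha>_Hc by simp_all
  have k: "\<bar>k\<bar> \<le> K" using gr_nonzero_bound b by blast
  have "(br (E i) ^^ nat (2 * K + 1)) b \<in> gr (k + int (nat (2 * K + 1)) * 1)"
    by (intro br_pow_gr E_gr b)
  then have "(br (E i) ^^ nat (2 * K + 1)) b = 0" by (rule gr_outside[rotated]) (use k K(1) in auto)
  from last_nonzero[OF b(1) this] obtain n where n: "(br (E i) ^^ n) b \<noteq> 0" "(br (E i) ^^ Suc n) b = 0" by blast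
  define w where "w = (br (E i) ^^ n) b"
  define \<eta> where "\<eta> = \<mu> + 2 * of_nat n"
  have up: "br (Hc i) ((br (E i) ^^ m) b) = sc (\<mu> + 2 * of_nat m) ((br (E i) ^^ m) b)" for m
  proof (induction m)
    case (Suc m)
    have "br (Hc i) (br (E i) ((br (E i) ^^ m) b)) = sc 2 (br (E i) ((br (E i) ^^ m) b)) + sc (\<mu> + 2 * of_nat m) (br (E i) ((br (E i) ^^ m) b))"
      by (subst br_derivation) (simp add: hE bracket_scale_left bracket_scale_right Suc.IH)
    moreover have "2 + (\<mu> + 2 * of_nat m) = \<mu> + 2 * of_nat (Suc m)" by simp
    ultimately show ?case by (metis scale_left_distrib funpow.simps(2) comp_apply)
  qed (simp add: \<mu>)
  have w: "w \<noteq> 0" "br (E i) w = 0" "br (Hc i) w = sc \<eta> w"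
    using n up[of n] by (simp_all add: w_def \<eta>_def)
  have wgr: "w \<in> gr (k + int n * 1)" unfolding w_def by (intro br_pow_gr E_gr b)
  then have kn: "\<bar>k + int n\<bar> \<le> K" using gr_nonzero_bound w(1) by simp
  have "(br (F i) ^^ nat (2 * K + 1)) w \<in> gr (k + int n * 1 + int (nat (2 * K + 1)) * (- 1))"
    by (intro br_pow_gr F_gr wgr)
  then have "(br (F i) ^^ nat (2 * K + 1)) w = 0" by (rule gr_outside[rotated]) (use kn K(1) in auto)
  from last_nonzero[OF w(1) this] obtain m where m: "(br (F i) ^^ m) w \<noteq> 0" "(br (F i) ^^ Suc m) w = 0" by blast
  have down: "br (Hc i) ((br (F i) ^^ m) w) = sc (\<eta> - 2 * of_nat m) ((br (F i) ^^ m) w)" for m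
  proof (induction m)
    case (Suc m)
    have "br (Hc i) (br (F i) ((br (F i) ^^ m) w)) = sc (-2) (br (F i) ((br (F i) ^^ m) w)) + sc (\<eta> - 2 * of_nat m) (br (F i) ((br (F i) ^^ m) w))"
      by (subst br_derivation) (simp add: hF bracket_scale_left bracket_scale_right Suc.IH br_neg)
    moreover have "-2 + (\<eta> - 2 * of_nat m) = \<eta> - 2 * of_nat (Suc m)" by simp
    ultimately show ?case by (metis scale_left_distrib funpow.simps(2) comp_apply)
  qed (simp add: w)
  \<comment> \<open>The usual formula \<open>e f^(m+1) w = (m+1)(\<eta>-m) f^m w\<close> for a highest weight vector of weight \<open>\<eta>\<close>.\<close>
  have ef: "br (E i) ((br (F i) ^^ Suc m) w) = sc ((of_nat m + 1) * (\<eta> - of_nat m)) ((br (F i) ^^ m) w)" for m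
  proof (induction m)
    case 0
    then show ?case by (simp add: br_derivation[of "E i" "F i" w] E_F w)
  next
    case (Suc m)
    let ?u = "(br (F i) ^^ Suc m) w"
    have "br (E i) (br (F i) ?u) = sc (\<eta> - 2 * of_nat (Suc m)) ?u + br (F i) (br (E i) ?u)"
      by (subst br_derivation) (simp only: E_F down)
    also have "br (F i) (br (E i) ?u) = sc ((of_nat m + 1) * (\<eta> - of_nat m)) ?u"
      unfolding Suc.IH by (simp add: bracket_scale_right)
    finally have "br (E i) (br (F i) ?u) = sc ((\<eta> - 2 * of_nat (Suc m)) + (of_nat m + 1) * (\<eta> - of_nat m)) ?u"
      by (simp only: scale_left_distrib)
    also have "(\<eta> - 2 * of_nat (Suc m)) + (of_nat m + 1) * (\<eta> - of_nat m) = (of_nat (Suc m) + 1) * (\<eta> - of_nat (Suc m))"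
      by (simp add: algebra_simps)
    finally show ?case by simp
  qed
  have "sc ((of_nat m + 1) * (\<eta> - of_nat m)) ((br (F i) ^^ m) w) = 0"
    using ef[of m] unfolding m(2) by simp
  then have "(of_nat m + 1) * (\<eta> - of_nat m) = 0" using m(1) by (simp only: scale_eq_0_iff) simp
  moreover have "of_nat m + 1 \<noteq> (0::complex)" by (metis of_nat_Suc of_nat_neq_0 add.commute)
  ultimately have "\<eta> = of_nat m" by simp
  then have "\<mu> = of_int (int m - 2 * int n)" by (simp add: \<eta>_def algebra_simps)
  then show ?thesis by blast
qed

lemma Hc_nonzero: "Hc i \<noteq> 0"
  using \<alpha>_Hc[of i] \<alpha>_0[of i] by auto

text \<open>This is the trace of a square of an operator with integral eigenvalues, which are not all
  zero because the centre is trivial.\<close>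

lemma killing_coroot_nonzero: "killing (Hc i) (Hc i) \<noteq> 0"
proof
  assume z: "killing (Hc i) (Hc i) = 0"
  have brb: "br (Hc i) b = sc (wt b (Hc i)) b" if "b \<in> WB" for b
    using root_spaceD[OF wt[OF that] Hc_H] .
  have "\<forall>b\<in>WB. \<exists>m. wt b (Hc i) = of_int m"
    using coroot_eigenvalue_integral[OF WB_nonzero WB_gr brb] by blast
  then obtain m where m: "\<And>b. b \<in> WB \<Longrightarrow> wt b (Hc i) = of_int (m b)" by metis
  have "killing (Hc i) (Hc i) = (\<Sum>b\<in>WB. rep (br (Hc i) (br (Hc i) b)) b)" by (simp add: killing_def tr_def)
  also have "\<dots> = (\<Sum>b\<in>WB. of_int ((m b)\<^sup>2))"
    by (intro sum.cong refl) (simp add: brb bracket_scale_right rep_scale rep_basis m power2_eq_square)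
  also have "\<dots> = of_int (\<Sum>b\<in>WB. (m b)\<^sup>2)" by simp
  finally have "of_int (\<Sum>b\<in>WB. (m b)\<^sup>2) = (0::complex)" using z by simp
  then have "(\<Sum>b\<in>WB. (m b)\<^sup>2) = 0" by (simp only: of_int_eq_0_iff)
  then have "\<forall>b\<in>WB. (m b)\<^sup>2 = 0" by (subst (asm) sum_nonneg_eq_0_iff) (auto simp: finite_WB)
  then have "br (Hc i) b = 0" if "b \<in> WB" for b using brb[OF that] m[OF that] that by simp
  then have "br (Hc i) x = 0" for x
    using lin_eq_on_WB[OF lin_br lin_zero] by blast
  then have "Hc i = 0" by (rule center_trivial)
  then show False using Hc_nonzero by blast
qed

text \<open>The radical is an ideal, and it is not everything because of the coroots.\<close>

lemma killing_nondegenerate: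
  assumes "\<And>y. killing x y = 0" shows "x = 0"
proof -
  let ?R = "{x. \<forall>y. killing x y = 0}"
  have "subspace ?R" by (rule subspaceI) (auto simp: killing_add killing_scale)
  moreover have "br x y \<in> ?R" if "y \<in> ?R" for x y
  proof -
    have "killing (br x y) z = 0" for z
      using that killing_inv[of y x z] br_anti[of x y] by (simp add: killing_neg)
    then show ?thesis by blast
  qed
  ultimately have "?R = {0} \<or> ?R = UNIV" by (rule no_ideals)
  then show ?thesis using killing_coroot_nonzero assms by blast
qed

lemma killing_representable:
  assumes add: "\<And>x y. \<phi> (x + y) = \<phi> x + \<phi> y" and sca: "\<And>c x. \<phi> (sc c x) = c * \<phi> x"
  shows "\<exists>x. \<forall>y. killing x y = \<phi> y"
proof -
  define Km where "Km = (\<lambda>x. \<Sum>b\<in>WB. sc (killing x b) b)"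
  have lK: "lin Km"
    by (rule linI) (simp_all add: Km_def killing_add killing_scale scale_left_distrib sum.distrib scale_sum_right)
  have repK: "rep (\<Sum>b\<in>WB. sc (f b) b) b = f b" if "b \<in> WB" for f b
  proof -
    have "rep (\<Sum>b\<in>WB. sc (f b) b) b = (\<Sum>c\<in>WB. if c = b then f c else 0)"
      unfolding rep_linear_sum by (intro sum.cong refl) (simp add: rep_scale rep_basis)
    then show ?thesis using that finite_WB by simp
  qed
  have ext: "(\<Sum>b\<in>WB. rep y b * f b) = g y"
    if "\<And>x y. g (x + y) = g x + g y" "\<And>c x. g (sc c x) = c * g x" "\<And>b. b \<in> WB \<Longrightarrow> f b = g b"
    for f g :: "'g \<Rightarrow> complex" and y
  proof -
    have g0: "g 0 = 0" using that(2)[of 0 0] by simp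
    have gs: "g (sum h A) = (\<Sum>a\<in>A. g (h a))" for h and A :: "'g set"
      by (induction A rule: infinite_finite_induct) (auto simp: g0 that(1))
    have "g y = g (\<Sum>b\<in>WB. sc (rep y b) b)" by (simp only: rep_sum)
    then show ?thesis by (simp add: gs that)
  qed
  have "inj Km"
  proof (rule injI)
    fix x y assume "Km x = Km y"
    then have b: "killing x b = killing y b" if "b \<in> WB" for b
      using repK[OF that, of "killing x"] repK[OF that, of "killing y"] by (simp add: Km_def)
    have "killing (x - y) z = 0" for z
      using ext[of "killing y" "killing x" z, OF _ _ b] ext[of "killing x" "killing x" z]
      by (simp add: killing_diff killing_add killing_scale)
    then show "x = y" using killing_nondegenerate[of "x - y"] by simp
  qed
  then have "surj Km" by (rule linear_inj_imp_surj[OF lK])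
  then obtain x where x: "Km x = (\<Sum>b\<in>WB. sc (\<phi> b) b)" by (metis surjD)
  have "killing x b = \<phi> b" if "b \<in> WB" for b
    using repK[OF that, of "killing x"] repK[OF that, of \<phi>] x by (simp add: Km_def)
  then have "killing x y = \<phi> y" for y
    using ext[of \<phi> "killing x" y, OF add sca] ext[of "killing x" "killing x" y, OF killing_add(2) killing_scale(2)] by simp
  then show ?thesis by blast
qed

text \<open>By nondegeneracy there is \<open>d\<close> such that the trace of \<open>X \<circ> ad x\<close> vanishes for all \<open>x\<close>, where
  \<open>X = D - ad d\<close>. Since \<open>ad (X z)\<close> is the commutator of \<open>X\<close> and \<open>ad z\<close>, the Killing form of \<open>X z\<close>
  and \<open>y\<close> is the trace of \<open>X \<circ> ad [z, y]\<close>, so \<open>X z = 0\<close>.\<close>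

lemma derivation_inner:
  assumes D: "lin D" and der: "\<And>x y. D (br x y) = br (D x) y + br x (D y)"
  shows "\<exists>d. \<forall>v. D v = br d v"
proof -
  obtain d where d: "\<And>x. killing d x = tr WB (\<lambda>z. br x (D z))"
    using killing_representable[of "\<lambda>x. tr WB (\<lambda>z. br x (D z))"]
    by (auto simp: bracket_add_left bracket_scale_left trW_add trW_scale)
  define X where "X = (\<lambda>v. D v - br d v)"
  have lX: "lin X" unfolding X_def by (intro lin_diff_fun D lin_br)
  have derX: "br (X z) u = X (br z u) - br z (X u)" for z u
    using der[of z u] br_derivation[of d z u] by (simp add: X_def br_diff)
  have trX: "tr WB (\<lambda>z. br x (X z)) = 0" for x
    using d[of x] by (simp add: X_def br_diff trW_diff killing_def[symmetric] killing_sym[of x])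
  have "X z = 0" for z
  proof (rule killing_nondegenerate)
    fix y
    have "killing (X z) y = tr WB (\<lambda>w. X (br z (br y w))) - tr WB (\<lambda>w. br z (X (br y w)))"
      by (simp add: killing_def derX trW_diff)
    also have "tr WB (\<lambda>w. X (br z (br y w))) = tr WB (\<lambda>w. br z (br y (X w)))"
      by (rule trW_commute[OF lX lin_comp[OF lin_br lin_br]])
    also have "tr WB (\<lambda>w. br z (X (br y w))) = tr WB (\<lambda>w. br y (br z (X w)))"
      by (rule trW_commute[OF lin_comp[OF lin_br lX] lin_br])
    also have "tr WB (\<lambda>w. br z (br y (X w))) - tr WB (\<lambda>w. br y (br z (X w))) = tr WB (\<lambda>w. br (br z y) (X w))"
      by (simp add: br_br_left trW_diff)
    finally show "killing (X z) y = 0" by (simp add: trX)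
  qed
  then have "D v = br d v" for v by (simp add: X_def)
  then show ?thesis by blast
qed

text \<open>Invariance of the Killing form under \<open>\<rho>\<^sup>\<or>\<close>.\<close>

lemma killing_gr: "x \<in> gr j \<Longrightarrow> y \<in> gr k \<Longrightarrow> j + k \<noteq> 0 \<Longrightarrow> killing x y = 0"
proof -
  assume x: "x \<in> gr j" and y: "y \<in> gr k" and jk: "j + k \<noteq> 0"
  have "of_int j * killing x y = killing (br \<rho> x) y" using x by (simp add: gr_def killing_scale)
  also have "\<dots> = - killing x (br \<rho> y)"
    using killing_inv[of x \<rho> y] br_anti[of \<rho> x] by (simp add: killing_neg)
  also have "\<dots> = - of_int k * killing x y" using y by (simp add: gr_def killing_scale)
  finally have "of_int (j + k) * killing x y = 0" by (simp add: algebra_simps)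
  then show ?thesis using jk by (simp only: mult_eq_0_iff of_int_eq_0_iff) simp
qed

lemma killing_zero_on_dual_degree:
  assumes x: "x \<in> gr k" and z: "\<And>y. y \<in> gr (- k) \<Longrightarrow> killing x y = 0"
  shows "x = 0"
proof (rule killing_nondegenerate)
  fix y
  have "killing x (proj j y) = 0" for j
    using killing_gr[OF x proj_gr, of j y] z[OF proj_gr, of y] by (cases "j = - k") auto
  then have "killing x (\<Sum>j\<in>{-K..K}. proj j y) = 0" by (simp add: killing_sum)
  then show "killing x y = 0" by (simp only: sum_proj)
qed

subsection \<open>The Cartan subalgebra is its own centralizer\<close>

lemma br_gen_eig:
  assumes "v \<in> gen_eig (br x) a" "w \<in> gen_eig (br x) b"
  shows "br v w \<in> gen_eig (br x) (a + b)"
proof -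
  let ?N = "\<lambda>a u. br x u - sc a u"
  obtain m n where "(?N a ^^ m) v = 0" "(?N b ^^ n) w = 0" using assms by (auto simp: gen_eig_def)
  then show ?thesis
  proof (induction "m + n" arbitrary: m n v w)
    case 0
    then show ?case using subspace_0[OF subspace_gen_eig[OF lin_br]] by simp
  next
    case (Suc r)
    show ?case
    proof (cases "m = 0 \<or> n = 0")
      case True
      then have "v = 0 \<or> w = 0" using Suc.prems by auto
      then show ?thesis using subspace_0[OF subspace_gen_eig[OF lin_br]] by auto
    next
      case False
      then obtain m' n' where mn: "m = Suc m'" "n = Suc n'" by (metis not0_implies_Suc)
      have v': "(?N a ^^ m') (?N a v) = 0" and w': "(?N b ^^ n') (?N b w) = 0"
        using Suc.prems unfolding mn by (simp_all only: funpow_Suc_right comp_def)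
      have r: "r = m' + n" "r = m + n'" using Suc.hyps(2) mn by auto
      have "br (?N a v) w \<in> gen_eig (br x) (a + b)" "br v (?N b w) \<in> gen_eig (br x) (a + b)"
        using Suc.hyps(1)[OF r(1) v' Suc.prems(2)] Suc.hyps(1)[OF r(2) Suc.prems(1) w'] by auto
      then have "br (?N a v) w + br v (?N b w) \<in> gen_eig (br x) (a + b)"
        by (rule subspace_add[OF subspace_gen_eig[OF lin_br]])
      also have "br (?N a v) w + br v (?N b w) = ?N (a + b) (br v w)"
        using br_derivation[of x v w]
        by (simp add: br_diff bracket_scale_left bracket_scale_right scale_left_distrib algebra_simps)
      finally obtain k where "(?N (a + b) ^^ k) (?N (a + b) (br v w)) = 0" by (auto simp: gen_eig_def)
      then have "(?N (a + b) ^^ Suc k) (br v w) = 0" by (simp only: funpow_Suc_right comp_def)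
      then show ?thesis by (auto simp only: gen_eig_def)
    qed
  qed
qed

lemma span_gen_eig_induct:
  assumes T: "lin T" and S: "lin S" "lin S'" and "\<And>a v. v \<in> gen_eig T a \<Longrightarrow> S v = S' v"
  shows "S v = S' v"
  using vsp.linear_eq_on[OF S, of v "\<Union>a. gen_eig T a"] span_gen_eig[OF T] assms(4) by auto

text \<open>Otherwise the Cartan subalgebra together with \<open>s\<close> would span a larger toral subalgebra.\<close>

lemma toral_maximal:
  assumes s: "\<And>y. y \<in> H \<Longrightarrow> br s y = 0" and d: "diagonalizable (br s)"
  shows "s \<in> H"
proof -
  obtain Y where Y: "finite Y" "Y \<subseteq> H" "span Y = H" by (rule H_basis)
  have "toral_subalgebra L (span (insert s Y))"
  proof (rule toral_span)
    show "finite (insert s Y)" using Y by simp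
    show "diagonalizable (br x)" if "x \<in> insert s Y" for x
      using that d H_semisimple Y(2) by blast
    show "br x y = 0" if "x \<in> insert s Y" "y \<in> insert s Y" for x y
      using that s H_abelian Y(2) bracket_self br_anti[of x s] by auto
  qed
  moreover have "H \<subseteq> span (insert s Y)" using Y(3) span_mono[of Y "insert s Y"] by blast
  ultimately have "span (insert s Y) = H" by (rule H_maximal)
  then show ?thesis using span_base[of s "insert s Y"] by blast
qed

text \<open>The semisimple part of \<open>ad x\<close> is a derivation, because brackets of generalized eigenvectors
  are generalized eigenvectors for the sum of the eigenvalues. So it is \<open>ad s\<close> for some \<open>s\<close>, which
  commutes with the Cartan subalgebra and lies in it by maximality.\<close>

lemma centralizer_jordan:
  assumes x: "x \<in> gr 0"
  shows "\<exists>s\<in>H. \<exists>m. \<forall>v. (br (x - s) ^^ m) v = 0"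
proof -
  let ?T = "br x"
  obtain S where S: "lin S" "\<And>a v. v \<in> gen_eig ?T a \<Longrightarrow> S v = sc a v"
    using semisimple_part[OF lin_br] by blast
  have der: "S (br v w) = br (S v) w + br v (S w)" for v w
  proof (rule span_gen_eig_induct[OF lin_br, of "\<lambda>v. S (br v w)" "\<lambda>v. br (S v) w + br v (S w)" x v])
    fix a v assume v: "v \<in> gen_eig ?T a"
    show "S (br v w) = br (S v) w + br v (S w)"
    proof (rule span_gen_eig_induct[OF lin_br, of "\<lambda>w. S (br v w)" "\<lambda>w. br (S v) w + br v (S w)" x w])
      fix b w assume w: "w \<in> gen_eig ?T b"
      show "S (br v w) = br (S v) w + br v (S w)"
        using S(2)[OF v] S(2)[OF w] S(2)[OF br_gen_eig[OF v w]]
        by (simp add: bracket_scale_left bracket_scale_right scale_left_distrib)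
    qed (rule lin_comp[OF S(1) lin_br] lin_add_fun[OF lin_br lin_comp[OF lin_br S(1)]])+
  qed (rule lin_comp[OF S(1) lin_br_left] lin_add_fun[OF lin_comp[OF lin_br_left S(1)] lin_br_left])+
  then obtain s where s: "\<And>v. S v = br s v" using derivation_inner[OF S(1) der] by blast
  have sy: "br s y = 0" if y: "y \<in> H" for y
  proof (rule center_trivial)
    fix v
    have xy: "br x y = 0" using gr0_centralizes[OF x y] br_anti[of x y] by simp
    have "S (br y v) = br y (S v)"
    proof (rule span_gen_eig_induct[OF lin_br, of "\<lambda>v. S (br y v)" "\<lambda>v. br y (S v)" x v])
      fix a v assume v: "v \<in> gen_eig ?T a"
      have "br y (br x u) = br x (br y u)" for u using br_derivation[of x y u] xy by simp
      then have "br y v \<in> gen_eig ?T a" by (rule gen_eig_commute[OF lin_br _ v])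
      then show "S (br y v) = br y (S v)" using S(2) v by (simp add: bracket_scale_right)
    qed (rule lin_comp[OF S(1) lin_br] lin_comp[OF lin_br S(1)])+
    then show "br (br s y) v = 0" using br_derivation[of s y v] s by simp
  qed
  have "diagonalizable (br s)"
  proof -
    have "(\<Union>a. gen_eig ?T a) \<subseteq> {v. \<exists>c. br s v = sc c v}" using S(2) s by auto
    from span_mono[OF this] show ?thesis using span_gen_eig[OF lin_br, of x] by (auto simp: diagonalizable_def)
  qed
  then have sH: "s \<in> H" using toral_maximal sy by blast
  let ?N = "br (x - s)"
  have "\<exists>m. (?N ^^ m) v = 0" for v
  proof -
    have "v \<in> span (\<Union>a. gen_eig ?T a)" using span_gen_eig[OF lin_br] by simp
    then show ?thesis
    proof (induction rule: span_induct_alt)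
      case base
      then show ?case by (intro exI[of _ 0]) simp
    next
      case (step c u w)
      then obtain a where a: "u \<in> gen_eig ?T a" by blast
      have N: "(?N ^^ m) u \<in> gen_eig ?T a \<and> (?N ^^ m) u = ((\<lambda>z. br x z - sc a z) ^^ m) u" for m
      proof (induction m)
        case (Suc m)
        have "br s ((?N ^^ m) u) = sc a ((?N ^^ m) u)" using Suc.IH S(2) s by metis
        then have "?N ((?N ^^ m) u) = br x ((?N ^^ m) u) - sc a ((?N ^^ m) u)"
          using br_diff(1)[of x s "(?N ^^ m) u"] by metis
        moreover have "br x ((?N ^^ m) u) - sc a ((?N ^^ m) u) \<in> gen_eig ?T a"
          using Suc.IH by (intro gen_eig_shift[OF lin_br]) blast
        ultimately show ?case using Suc.IH by simp
      qed (use a in simp)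
      obtain m where m: "(?N ^^ m) u = 0" using a N by (auto simp: gen_eig_def)
      obtain n where n: "(?N ^^ n) w = 0" using step.IH by blast
      have l: "lin (?N ^^ k)" for k by (rule lin_pow[OF lin_br])
      have "(?N ^^ (m + n)) u = 0"
        using m lin_0[OF l] by (subst add.commute) (simp add: funpow_add)
      moreover have "(?N ^^ (m + n)) w = 0" using n lin_0[OF l] by (simp add: funpow_add)
      ultimately have "(?N ^^ (m + n)) (sc c u + w) = 0" by (simp add: lin_add[OF l] lin_scale[OF l])
      then show ?case by blast
    qed
  qed
  then obtain mf where mf: "\<And>v. (?N ^^ mf v) v = 0" by metis
  define M where "M = Max (mf ` WB)"
  have "(?N ^^ M) b = 0" if "b \<in> WB" for b
  proof -
    have "mf b \<le> M" using that finite_WB by (simp add: M_def)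
    then have "(?N ^^ M) b = (?N ^^ (M - mf b)) ((?N ^^ mf b) b)"
      by (metis add.commute comp_apply funpow_add le_add_diff_inverse)
    then show ?thesis using mf lin_0[OF lin_pow[OF lin_br]] by simp
  qed
  then have "(?N ^^ M) v = 0" for v
    using lin_eq_on_WB[OF lin_pow[OF lin_br] lin_zero] by blast
  then show ?thesis using sH by blast
qed

lemma pow_comp_commute:
  assumes "\<And>v. S (T v) = T (S v)"
  shows "((\<lambda>v. S (T v)) ^^ m) v = (S ^^ m) ((T ^^ m) v)"
proof (induction m)
  case (Suc m)
  have "T ((S ^^ m) u) = (S ^^ m) (T u)" for u by (rule pow_commute) (simp add: assms)
  then show ?case using Suc by simp
qed simp

text \<open>An element of degree zero is \<open>s + n\<close> with \<open>s\<close> in the Cartan subalgebra and \<open>n\<close> nilpotent.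
  The Killing form of \<open>n\<close> with anything in the Cartan subalgebra is the trace of a product of
  commuting operators, one of them nilpotent, hence zero. For the same reason the form vanishes on
  \<open>(n, n)\<close>. Since the sum of two such \<open>n\<close> is again nilpotent, polarization shows that \<open>n\<close> is
  orthogonal to everything of degree zero.\<close>

lemma gr0_eq_H: "gr 0 = H"
proof
  show "H \<subseteq> gr 0" using H_gr0 by blast
  define nil where "nil = (\<lambda>n. n \<in> gr 0 \<and> (\<exists>m. \<forall>v. (br n ^^ m) v = 0))"
  have nH: "killing n h = 0" if n: "nil n" and h: "h \<in> H" for n h
  proof -
    obtain m where m: "\<And>v. (br n ^^ m) v = 0" using n by (auto simp: nil_def)
    have c: "br n (br h v) = br h (br n v)" for v
      using br_derivation[of n h v] gr0_centralizes[OF _ h, of n] br_anti[of n h] n by (simp add: nil_def)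
    have "((\<lambda>v. br n (br h v)) ^^ m) v = 0" for v
      using pow_comp_commute[of "br n" "br h", OF c] m by simp
    then show ?thesis
      unfolding killing_def using tr_nilpotent[OF WB(2,3) lin_comp[OF lin_br lin_br]] by blast
  qed
  have nn: "killing n n = 0" if n: "nil n" for n
  proof -
    obtain m where m: "\<And>v. (br n ^^ m) v = 0" using n by (auto simp: nil_def)
    have "((\<lambda>v. br n (br n v)) ^^ m) v = 0" for v
      using pow_comp_commute[of "br n" "br n" m v] m by simp
    then show ?thesis
      unfolding killing_def using tr_nilpotent[OF WB(2,3) lin_comp[OF lin_br lin_br]] by blast
  qed
  have jordan: "\<exists>s n. s \<in> H \<and> nil n \<and> x = s + n" if x: "x \<in> gr 0" for x
  proof -
    obtain s m where s: "s \<in> H" "\<forall>v. (br (x - s) ^^ m) v = 0" using centralizer_jordan[OF x] by blast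
    have "x - s \<in> gr 0" using x H_gr0[OF s(1)] subspace_diff[OF subspace_gr] by blast
    then show ?thesis using s by (intro exI[of _ s] exI[of _ "x - s"]) (auto simp: nil_def)
  qed
  have sH: "s = 0" if s: "s \<in> H" and z: "\<And>h. h \<in> H \<Longrightarrow> killing s h = 0" for s
  proof (rule killing_zero_on_dual_degree[OF H_gr0[OF s]])
    fix y assume "y \<in> gr (- 0)"
    then obtain h n where "h \<in> H" "nil n" "y = h + n" using jordan[of y] by auto
    then show "killing s y = 0" using z[of h] nH[of n s] s by (simp add: killing_add killing_sym[of s n])
  qed
  \<comment> \<open>The component of \<open>n + n'\<close> in the Cartan subalgebra is orthogonal to the Cartan subalgebra.\<close>
  have plus: "nil (n + n')" if n: "nil n" and n': "nil n'" for n n'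
  proof -
    have "n + n' \<in> gr 0" using n n' subspace_add[OF subspace_gr] by (simp add: nil_def)
    then obtain s n'' where s: "s \<in> H" "nil n''" "n + n' = s + n''" using jordan by blast
    have "killing s h = 0" if h: "h \<in> H" for h
    proof -
      have "killing s h + killing n'' h = killing n h + killing n' h" using s(3) by (metis killing_add(1))
      then show ?thesis using nH[OF s(2) h] nH[OF n h] nH[OF n' h] by simp
    qed
    then have "s = 0" using sH[OF s(1)] by blast
    then show ?thesis using s by simp
  qed
  \<comment> \<open>Polarization of \<open>nn\<close>, which applies to \<open>n\<close>, \<open>n'\<close> and \<open>n + n'\<close>.\<close>
  have nil0: "n = 0" if n: "nil n" for n
  proof (rule killing_zero_on_dual_degree[of n 0])
    show "n \<in> gr 0" using n by (simp add: nil_def)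
    fix y assume "y \<in> gr (- 0)"
    then obtain h n' where y: "h \<in> H" "nil n'" "y = h + n'" using jordan[of y] by auto
    have "killing (n + n') (n + n') = 0" using nn plus n y(2) by blast
    then have "2 * killing n n' = 0"
      using nn[OF n] nn[OF y(2)] by (simp add: killing_add killing_sym[of n' n])
    then show "killing n y = 0" using y nH[OF n] by (simp add: killing_add)
  qed
  show "gr 0 \<subseteq> H"
  proof
    fix x assume "x \<in> gr 0"
    then obtain s n where "s \<in> H" "nil n" "x = s + n" using jordan by blast
    then show "x \<in> H" using nil0[OF \<open>nil n\<close>] by simp
  qed
qed

subsection \<open>The positive part is generated by the simple root vectors\<close>

text \<open>The Killing form identifies \<open>h\<^sub>i\<close> with a non-zero multiple of \<open>\<alpha>\<^sub>i\<close>.\<close>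

lemma rho_in_coroot_span: "\<exists>r. \<rho> = (\<Sum>i\<in>UNIV. sc (r i) (Hc i))"
proof -
  define c where "c = (\<lambda>i. killing (E i) (F i))"
  have hc: "killing (Hc i) y = c i * \<alpha> i y" if y: "y \<in> H" for i y
  proof -
    have "br (F i) y = sc (\<alpha> i y) (F i)"
      using root_spaceD[OF F_root y, of i] br_anti[of "F i" y] by (simp add: scale_minus_left)
    then show ?thesis using killing_inv[of "E i" "F i" y] by (simp add: E_F c_def killing_scale)
  qed
  have c0: "c i \<noteq> 0" for i
  proof
    assume "c i = 0"
    then have "Hc i = 0" using killing_zero_on_dual_degree[OF H_gr0[OF Hc_H], of i] hc gr0_eq_H by simp
    then show False using Hc_nonzero by blast
  qed
  have "\<exists>r. \<forall>y\<in>H. killing \<rho> y = (\<Sum>i\<in>UNIV. r i * killing (Hc i) y)"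
  proof (rule functional_in_span_of_functionals[OF _ subspace_H])
    fix y assume y: "y \<in> H" and "\<And>i. i \<in> (UNIV::'l set) \<Longrightarrow> killing (Hc i) y = 0"
    then have "\<alpha> i y = 0" for i using hc[OF y, of i] c0[of i] by simp
    then have "y = 0" by (rule joint_kernel_trivial[OF y])
    then show "killing \<rho> y = 0" by simp
  qed (auto simp: killing_add killing_scale)
  then obtain r where r: "\<And>y. y \<in> H \<Longrightarrow> killing \<rho> y = (\<Sum>i\<in>UNIV. r i * killing (Hc i) y)" by blast
  let ?s = "\<Sum>i\<in>UNIV. sc (r i) (Hc i)"
  have sH: "?s \<in> H" by (intro subspace_sum subspace_H subspace_scale Hc_H)
  have "\<rho> - ?s = 0"
  proof (rule killing_zero_on_dual_degree)
    show "\<rho> - ?s \<in> gr 0" using sH \<rho>_H subspace_diff[OF subspace_H] H_gr0 by blast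
    fix y assume "y \<in> gr (- 0)"
    then have "y \<in> H" using gr0_eq_H by simp
    then show "killing (\<rho> - ?s) y = 0" using r by (simp add: killing_diff killing_sum killing_scale)
  qed
  then show ?thesis by (intro exI[of _ r]) simp
qed

text \<open>The iterated brackets of elements \<open>f\<^sub>i\<close> with an element of \<open>Z\<close>.\<close>

inductive_set fwords :: "'g set \<Rightarrow> 'g set" for Z where
  fw_base: "z \<in> Z \<Longrightarrow> z \<in> fwords Z"
| fw_step: "s \<in> fwords Z \<Longrightarrow> br (F i) s \<in> fwords Z"

lemma br_span_subset:
  assumes "\<And>s. s \<in> A \<Longrightarrow> br x s \<in> span A" "v \<in> span A"
  shows "br x v \<in> span A"
  using assms(2)
proof (induction rule: span_induct_alt)
  case base
  then show ?case by (simp add: span_zero)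
next
  case (step c a b)
  then show ?case
    using assms(1)[of a] by (simp add: bracket_add_right bracket_scale_right span_add span_scale)
qed

text \<open>The elements \<open>f\<^sub>i\<close> generate from all such \<open>x\<close> a subspace in negative degrees that is stable under
  the \<open>e\<^sub>i\<close>, \<open>f\<^sub>i\<close> and the Cartan subalgebra. The trace of \<open>ad \<rho>\<^sup>\<or>\<close> on it is zero, since \<open>\<rho>\<^sup>\<or>\<close> is a
  combination of the commutators \<open>[e\<^sub>i, f\<^sub>i]\<close>. But this trace is a sum of negative degrees.\<close>

lemma no_negative_singular_vector:
  assumes k: "k \<ge> 1" and x: "x \<in> gr (- k)" and e: "\<And>i. br (E i) x = 0"
  shows "x = 0"
proof -
  define Z where "Z = {z\<in>gr (- k). \<forall>i. br (E i) z = 0}"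
  let ?W = "fwords Z"
  have deg: "\<exists>j\<ge>k. s \<in> gr (- j)" if "s \<in> ?W" for s
    using that
  proof (induction rule: fwords.induct)
    case (fw_base z)
    then show ?case by (auto simp: Z_def)
  next
    case (fw_step s i)
    then obtain j where "j \<ge> k" "s \<in> gr (- j)" by blast
    then show ?case using br_gr[OF F_gr, of s "- j" i] by (intro exI[of _ "j + 1"]) (auto simp: algebra_simps)
  qed
  have Fst: "br (F i) v \<in> span ?W" if "v \<in> span ?W" for i v
    by (rule br_span_subset[OF _ that]) (auto intro: span_base fwords.fw_step)
  have Hst: "br h s \<in> span ?W" if "s \<in> ?W" "h \<in> H" for s h
    using that
  proof (induction arbitrary: h rule: fwords.induct)
    case (fw_base z)
    have "br (E i) (br h z) = 0" for i
    proof -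
      have "br (E i) h = - sc (\<alpha> i h) (E i)"
        using root_spaceD[OF E_root fw_base(2), of i] br_anti[of "E i" h] by simp
      then show ?thesis
        using fw_base(1) by (subst br_derivation) (simp add: Z_def br_neg bracket_scale_left)
    qed
    moreover have "br h z \<in> gr (0 + - k)" using fw_base by (intro br_gr H_gr0) (auto simp: Z_def)
    ultimately have "br h z \<in> Z" by (simp add: Z_def)
    then show ?case by (intro span_base fwords.fw_base)
  next
    case (fw_step s i)
    have "br h (F i) = sc (- \<alpha> i h) (F i)" using root_spaceD[OF F_root fw_step.prems] .
    then have "br h (br (F i) s) = sc (- \<alpha> i h) (br (F i) s) + br (F i) (br h s)"
      by (subst br_derivation) (simp add: bracket_scale_left br_neg)
    moreover have "sc (- \<alpha> i h) (br (F i) s) \<in> span ?W"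
      by (intro span_scale span_base fwords.fw_step fw_step.hyps)
    ultimately show ?case by (metis span_add Fst[OF fw_step.IH[OF fw_step.prems]])
  qed
  have Est: "br (E i) s \<in> span ?W" if "s \<in> ?W" for s i
    using that
  proof (induction arbitrary: i rule: fwords.induct)
    case (fw_base z)
    then show ?case by (simp add: Z_def span_zero)
  next
    case (fw_step s j)
    have "br (E i) (F j) \<in> gr (1 + - 1)" by (intro br_gr E_gr F_gr)
    then have "br (E i) (F j) \<in> H" using gr0_eq_H by simp
    then have "br (br (E i) (F j)) s \<in> span ?W" using Hst fw_step.hyps by blast
    moreover have "br (F j) (br (E i) s) \<in> span ?W" using Fst fw_step.IH by blast
    ultimately show ?case by (subst br_derivation) (rule span_add)
  qed
  obtain B where B: "B \<subseteq> ?W" "independent B" "?W \<subseteq> span B" using maximal_independent_subset[of ?W] by blast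
  have fB: "finite B" using B(2) by (rule finiteI_independent)
  have sB: "span B = span ?W" using span_mono[OF B(1)] span_minimal[OF B(3)] by auto
  \<comment> \<open>On the stable subspace \<open>ad h\<^sub>i\<close> is a commutator.\<close>
  have tH: "tr B (br (Hc i)) = 0" for i
  proof -
    have st: "br (E i) b \<in> span B" "br (F i) b \<in> span B" if "b \<in> span B" for b
      using that br_span_subset[of ?W "E i", OF Est] Fst unfolding sB by auto
    have "br (Hc i) = (\<lambda>v. br (E i) (br (F i) v) - br (F i) (br (E i) v))"
      by (rule ext) (simp only: E_F[symmetric] br_br_left)
    then have "tr B (br (Hc i)) = tr B (\<lambda>v. br (E i) (br (F i) v) - br (F i) (br (E i) v))"
      by (rule arg_cong)
    also have "\<dots> = tr B (\<lambda>v. br (E i) (br (F i) v)) - tr B (\<lambda>v. br (F i) (br (E i) v))"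
      by (rule tr_diff[OF B(2)]) (auto intro: st span_base)
    also have "\<dots> = 0"
      using tr_commute[OF B(2) lin_br lin_br st] by (simp add: span_base)
    finally show ?thesis .
  qed
  obtain r where r: "\<rho> = (\<Sum>i\<in>UNIV. sc (r i) (Hc i))" using rho_in_coroot_span by blast
  have Hb: "br (Hc i) b \<in> span B" if "b \<in> B" for i b
    using Hst[OF _ Hc_H] that B(1) unfolding sB by blast
  have "br \<rho> = (\<lambda>v. \<Sum>i\<in>UNIV. sc (r i) (br (Hc i) v))"
    by (rule ext) (simp add: r br_sum bracket_scale_left)
  then have "tr B (br \<rho>) = tr B (\<lambda>v. \<Sum>i\<in>UNIV. sc (r i) (br (Hc i) v))"
    by (rule arg_cong)
  also have "\<dots> = (\<Sum>i\<in>UNIV. r i * tr B (br (Hc i)))"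
  proof -
    have "representation B (\<Sum>i\<in>UNIV. sc (r i) (br (Hc i) b)) b = (\<Sum>i\<in>UNIV. r i * representation B (br (Hc i) b) b)"
      if b: "b \<in> B" for b
      by (subst representation_sum[OF B(2)])
         (simp_all add: representation_scale[OF B(2) Hb[OF b]] span_scale Hb[OF b])
    then show ?thesis
      by (simp add: tr_def sum_distrib_left) (subst sum.swap, simp)
  qed
  also have "\<dots> = 0" by (simp add: tH)
  finally have t0: "tr B (br \<rho>) = 0" .
  have "\<forall>b\<in>B. \<exists>j\<ge>k. b \<in> gr (- j)" using deg B(1) by blast
  then obtain j where j: "\<And>b. b \<in> B \<Longrightarrow> j b \<ge> k \<and> b \<in> gr (- j b)" by metis
  have "tr B (br \<rho>) = (\<Sum>b\<in>B. of_int (- j b))"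
    unfolding tr_def
  proof (intro sum.cong refl)
    fix b assume b: "b \<in> B"
    have "br \<rho> b = sc (of_int (- j b)) b" using j[OF b] by (simp add: gr_def)
    then show "representation B (br \<rho> b) b = of_int (- j b)"
      using representation_scale[OF B(2) span_base[OF b], of "of_int (- j b)"] representation_basis[OF B(2) b]
      by (simp del: scale_minus_left)
  qed
  then have "of_int (\<Sum>b\<in>B. - j b) = (0::complex)" using t0 by simp
  then have "(\<Sum>b\<in>B. j b) = 0" by (simp only: of_int_eq_0_iff sum_negf neg_equal_0_iff_equal)
  moreover have "(\<Sum>b\<in>B. j b) \<ge> (\<Sum>b\<in>B. 1)" by (rule sum_mono) (use j k in force)
  ultimately have "B = {}" using fB by simp
  then have "?W \<subseteq> {0}" using B(3) by simp
  moreover have "x \<in> ?W" by (rule fwords.fw_base) (use x e in \<open>simp add: Z_def\<close>)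
  ultimately show ?thesis by blast
qed

text \<open>If the brackets spanned a proper subspace of \<open>gr k\<close>, a functional on \<open>gr k\<close> vanishing on it
  would be represented under the Killing form by a non-zero element of degree \<open>-k\<close> that commutes
  with all \<open>e\<^sub>i\<close>.\<close>

lemma gr_generated:
  assumes k: "k \<ge> 1"
  shows "gr k \<subseteq> span {br (E i) y |i y. y \<in> gr (k - 1)}"
proof
  fix y0 assume y0: "y0 \<in> gr k"
  let ?A = "{br (E i) y |i y. y \<in> gr (k - 1)}"
  show "y0 \<in> span ?A"
  proof (rule ccontr)
    assume no: "y0 \<notin> span ?A"
    obtain B where B: "B \<subseteq> ?A" "independent B" "?A \<subseteq> span B" using maximal_independent_subset[of ?A] by blast
    have "y0 \<notin> span B" using no span_mono[OF B(1)] by blast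
    then have ind: "independent (insert y0 B)" using B(2) by (rule independent_insertI)
    obtain g where g: "lin g" "\<And>b. b \<in> insert y0 B \<Longrightarrow> g b = (if b = y0 then y0 else 0)"
      using vsp.linear_independent_extend[OF ind, of "\<lambda>b. if b = y0 then y0 else 0"] by blast
    have "g b = 0" if "b \<in> B" for b
      using g(2)[of b] that \<open>y0 \<notin> span B\<close> span_base[of b B] by auto
    then have gB: "g v = 0" if "v \<in> span B" for v
      using vsp.linear_eq_on[OF g(1) lin_zero that] by blast
    have y00: "y0 \<noteq> 0" using no span_zero by blast
    then obtain b where b: "rep y0 b \<noteq> 0"
      using rep_sum[of y0] by (metis (no_types, lifting) scale_zero_left sum.neutral)
    \<comment> \<open>A functional of degree \<open>k\<close> that is zero on the span but not at \<open>y0\<close>.\<close>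
    define \<phi> where "\<phi> = (\<lambda>v. rep (g (proj k v)) b)"
    obtain x where x: "\<And>y. killing x y = \<phi> y"
      using killing_representable[of \<phi>]
      by (auto simp: \<phi>_def lin_add[OF g(1)] lin_scale[OF g(1)] rep_add rep_scale)
    have \<phi>0: "\<phi> y = 0" if "y \<in> gr j" "j \<noteq> k" for y j
      using that by (simp add: \<phi>_def proj_of_gr lin_0[OF g(1)])
    have "br (E i) x = 0" for i
    proof (rule killing_nondegenerate)
      fix y
      have "killing (br x (E i)) (proj j y) = 0" for j
      proof -
        have gr: "br (E i) (proj j y) \<in> gr (1 + j)" by (intro br_gr E_gr proj_gr)
        have "\<phi> (br (E i) (proj j y)) = 0"
        proof (cases "j = k - 1")
          case True
          then have "br (E i) (proj j y) \<in> ?A" using proj_gr by blast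
          then have "g (br (E i) (proj j y)) = 0" using gB B(3) by blast
          moreover have "proj k (br (E i) (proj j y)) = br (E i) (proj j y)"
            using gr True by (simp add: gr_iff)
          ultimately show ?thesis by (simp add: \<phi>_def)
        next
          case False
          then show ?thesis using \<phi>0[OF gr] by simp
        qed
        then show ?thesis by (simp add: killing_inv x)
      qed
      then have "killing (br x (E i)) (\<Sum>j\<in>{-K..K}. proj j y) = 0" by (simp add: killing_sum)
      then have "killing (br x (E i)) y = 0" by (simp only: sum_proj)
      then show "killing (br (E i) x) y = 0" by (subst br_anti) (simp add: killing_neg)
    qed
    moreover have "x \<in> gr (- k)"
    proof -
      have "br \<rho> x + sc (of_int k) x = 0"
      proof (rule killing_nondegenerate)
        fix y
        have "killing (br x \<rho>) (proj j y) = of_int k * killing x (proj j y)" for j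
        proof -
          have "killing (br x \<rho>) (proj j y) = of_int j * killing x (proj j y)"
            using proj_gr[of j y] by (simp add: killing_inv gr_def killing_scale)
          then show ?thesis using \<phi>0[OF proj_gr, of j y] x by (cases "j = k") auto
        qed
        then have "killing (br x \<rho>) (\<Sum>j\<in>{-K..K}. proj j y) = of_int k * killing x (\<Sum>j\<in>{-K..K}. proj j y)"
          by (simp add: killing_sum sum_distrib_left)
        then have "killing (br x \<rho>) y = of_int k * killing x y" by (simp only: sum_proj)
        then show "killing (br \<rho> x + sc (of_int k) x) y = 0"
          by (subst br_anti) (simp add: killing_diff killing_add killing_neg killing_scale)
      qed
      then show ?thesis by (simp add: gr_def eq_neg_iff_add_eq_0)
    qed
    ultimately have "x = 0" using no_negative_singular_vector[OF k] by blast
    then have "\<phi> y0 = 0" using x[of y0] by simp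
    moreover have "\<phi> y0 = rep y0 b" using y0 g(2)[of y0] by (simp add: \<phi>_def gr_iff)
    ultimately show False using b by simp
  qed
qed

lemma gr1_eq: "gr 1 = span (range E)"
proof
  have "{br (E i) y |i y. y \<in> gr (1 - 1)} \<subseteq> span (range E)"
  proof clarify
    fix i y assume "y \<in> gr (1 - 1)"
    then have y: "y \<in> H" using gr0_eq_H by simp
    have "br (E i) y = sc (- \<alpha> i y) (E i)"
      using root_spaceD[OF E_root y, of i] br_anti[of "E i" y] by simp
    then show "br (E i) y \<in> span (range E)" by (simp only:) (intro span_scale span_base rangeI)
  qed
  from span_minimal[OF this subspace_span] show "gr 1 \<subseteq> span (range E)"
    using gr_generated[of 1] by auto
  show "span (range E) \<subseteq> gr 1" by (rule span_minimal) (auto simp: subspace_gr E_gr)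
qed

subsection \<open>The filtration by degree\<close>

definition Fil :: "int \<Rightarrow> 'g set" where
  "Fil k = {v. \<forall>j<k. proj j v = 0}"

lemma subspace_Fil: "subspace (Fil k)"
  by (rule subspaceI) (auto simp: Fil_def)

lemma Fil_mono: "j \<le> k \<Longrightarrow> v \<in> Fil k \<Longrightarrow> v \<in> Fil j"
  by (auto simp: Fil_def)

lemma gr_Fil: "v \<in> gr k \<Longrightarrow> j \<le> k \<Longrightarrow> v \<in> Fil j"
  by (auto simp: Fil_def proj_of_gr)

lemma Fil_bottom: "k \<le> - K \<Longrightarrow> v \<in> Fil k"
  by (auto simp: Fil_def intro: proj_outside)

lemma Fil_top: "k > K \<Longrightarrow> v \<in> Fil k \<Longrightarrow> v = 0"
proof -
  assume k: "k > K" and v: "v \<in> Fil k"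
  have "(\<Sum>j\<in>{-K..K}. proj j v) = 0" using v k by (intro sum.neutral) (auto simp: Fil_def)
  then show ?thesis by (simp only: sum_proj)
qed

lemma Fil_sum_proj: "v \<in> Fil k \<Longrightarrow> v = (\<Sum>j\<in>{k..K}. proj j v)"
proof -
  assume v: "v \<in> Fil k"
  have "(\<Sum>j\<in>{-K..K}. proj j v) = (\<Sum>j\<in>{k..K}. proj j v)"
    by (rule sum.mono_neutral_cong) (use v in \<open>auto simp: Fil_def intro: proj_outside\<close>)
  then show ?thesis by (simp only: sum_proj)
qed

lemma Fil_induct [consumes 1, case_names zero add gr]:
  assumes "v \<in> Fil k" and "P 0" "\<And>x y. P x \<Longrightarrow> P y \<Longrightarrow> P (x + y)" and "\<And>j v. j \<ge> k \<Longrightarrow> v \<in> gr j \<Longrightarrow> P v"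
  shows "P v"
proof -
  have "P (\<Sum>j\<in>A. proj j v)" if "finite A" "A \<subseteq> {k..K}" for A
    using that
  proof (induction A rule: finite_induct)
    case (insert j A)
    then have "P (proj j v)" using assms(4)[OF _ proj_gr] by simp
    then show ?case using insert assms(3) by simp
  qed (simp add: assms(2))
  then show ?thesis using Fil_sum_proj[OF assms(1)] by (metis finite_atLeastAtMost_int order_refl)
qed

lemma br_Fil: assumes "x \<in> Fil j" "y \<in> Fil k" shows "br x y \<in> Fil (j + k)"
  using assms(1)
proof (induction rule: Fil_induct)
  case (gr i x)
  show ?case using assms(2)
  proof (induction rule: Fil_induct)
    case (gr i' y)
    then show ?case using br_gr[OF \<open>x \<in> gr i\<close> gr(2)] \<open>j \<le> i\<close> by (intro gr_Fil) auto
  qed (auto simp: bracket_add_right subspace_0 subspace_add subspace_Fil)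
qed (auto simp: bracket_add_left subspace_0 subspace_add subspace_Fil)

lemma Fil_split: "v \<in> Fil k \<Longrightarrow> v - proj k v \<in> Fil (k + 1)"
  by (auto simp: Fil_def)

lemma Fil_subspace_rules:
  "0 \<in> Fil k" "v \<in> Fil k \<Longrightarrow> w \<in> Fil k \<Longrightarrow> v + w \<in> Fil k" "v \<in> Fil k \<Longrightarrow> w \<in> Fil k \<Longrightarrow> v - w \<in> Fil k"
  "v \<in> Fil k \<Longrightarrow> sc c v \<in> Fil k" "v \<in> Fil k \<Longrightarrow> - v \<in> Fil k"
  by (auto simp: Fil_def)

lemma Fil_sum: "(\<And>a. a \<in> A \<Longrightarrow> f a \<in> Fil k) \<Longrightarrow> sum f A \<in> Fil k"
  by (rule subspace_sum[OF subspace_Fil])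

lemma nilradical_eq: "nilradical L = Fil 1"
proof
  have "(\<Union>\<beta>\<in>{\<beta>. positive_root L \<beta>}. root_space L \<beta>) \<subseteq> Fil 1"
  proof clarify
    fix \<beta> v assume \<beta>: "positive_root L \<beta>" and v: "v \<in> root_space L \<beta>"
    obtain k :: nat where k: "k > 0" "\<beta> \<rho> = of_nat k" using positive_root_degree[OF \<beta>] by blast
    then have "v \<in> gr (int k)" using root_spaceD[OF v \<rho>_H] by (simp add: gr_def)
    then show "v \<in> Fil 1" by (rule gr_Fil) (use k in auto)
  qed
  then show "nilradical L \<subseteq> Fil 1" unfolding nilradical_def by (rule span_minimal[OF _ subspace_Fil])
  show "Fil 1 \<subseteq> nilradical L"
  proof
    fix v assume "v \<in> Fil 1"
    then show "v \<in> nilradical L"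
    proof (induction rule: Fil_induct)
      case (gr j v)
      have "v = proj j v" using gr by (simp add: gr_iff)
      also have "\<dots> \<in> nilradical L"
        unfolding proj_def nilradical_def
      proof (intro span_sum span_scale span_base)
        fix b assume "b \<in> {b\<in>WB. dg b = j}"
        then have "positive_root L (wt b)" "b \<in> root_space L (wt b)" using dg_pos[of b] wt[of b] gr(1) by auto
        then show "b \<in> (\<Union>\<beta>\<in>{\<beta>. positive_root L \<beta>}. root_space L \<beta>)" by blast
      qed
      finally show ?case .
    qed (auto simp: nilradical_def span_zero span_add)
  qed
qed

lemma borel_eq: "borel_subalgebra L = Fil 0"
proof
  show "borel_subalgebra L \<subseteq> Fil 0"
    unfolding borel_subalgebra_def nilradical_eq
    using gr_Fil[OF H_gr0] Fil_mono[of 0 1] by (auto intro!: Fil_subspace_rules)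
  show "Fil 0 \<subseteq> borel_subalgebra L"
  proof
    fix v assume v: "v \<in> Fil 0"
    have "v - proj 0 v \<in> Fil 1" using Fil_split[OF v] by simp
    moreover have "proj 0 v \<in> H" using proj_gr[of 0 v] gr0_eq_H by simp
    moreover have "v = proj 0 v + (v - proj 0 v)" by simp
    ultimately show "v \<in> borel_subalgebra L" unfolding borel_subalgebra_def nilradical_eq by blast
  qed
qed

lemma p_minus_gr: "p_minus L \<in> gr (- 1)"
  unfolding p_minus_def by (intro subspace_sum subspace_gr F_gr)

section \<open>The unipotent group\<close>


lemma linear_form_iff: "linear_form L u \<longleftrightarrow> (\<forall>x y. u (x + y) = u x + u y) \<and> (\<forall>c x. u (sc c x) = c * u x)"
proof -
  have "vector_space ((*) :: complex \<Rightarrow> complex \<Rightarrow> complex)" by unfold_locales (auto simp: algebra_simps)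
  then show ?thesis by (simp add: linear_form_def Vector_Spaces.linear_iff vector_space_axioms)
qed

lemma lf: assumes "linear_form L u"
  shows lf_add: "u (x + y) = u x + u y" and lf_scale: "u (sc c x) = c * u x" and lf_0: "u 0 = 0"
    and lf_diff: "u (x - y) = u x - u y" and lf_sum: "u (sum f A) = (\<Sum>a\<in>A. u (f a))"
    and lf_neg: "u (- x) = - u x"
proof -
  show add: "u (x + y) = u x + u y" for x y using assms by (simp add: linear_form_iff)
  show sca: "u (sc c x) = c * u x" for x c using assms by (simp add: linear_form_iff)
  show z: "u 0 = 0" using sca[of 0 0] by simp
  show neg: "u (- x) = - u x" for x using add[of x "- x"] z by (simp add: eq_neg_iff_add_eq_0 add.commute)
  show "u (x - y) = u x - u y" using add[of x "- y"] neg by simp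
  show "u (sum f A) = (\<Sum>a\<in>A. u (f a))"
    by (induction A rule: infinite_finite_induct) (auto simp: z add)
qed

lemma linear_form_rep: "linear_form L (\<lambda>v. rep v b)"
  by (simp add: linear_form_iff rep_add rep_scale)

lemma linear_form_rep_proj: "linear_form L (\<lambda>v. rep (proj j v) b)"
  by (simp add: linear_form_iff rep_add rep_scale)

lemma linear_form_comp: "linear_form L u \<Longrightarrow> lin T \<Longrightarrow> linear_form L (\<lambda>v. u (T v))"
  by (simp add: linear_form_iff lin_add lin_scale)

lemma rep_eqI: "(\<And>b. b \<in> WB \<Longrightarrow> rep v b = rep w b) \<Longrightarrow> v = w"
proof -
  assume a: "\<And>b. b \<in> WB \<Longrightarrow> rep v b = rep w b"
  have "(\<Sum>b\<in>WB. sc (rep v b) b) = (\<Sum>b\<in>WB. sc (rep w b) b)" by (intro sum.cong refl) (simp add: a)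
  then show ?thesis by (simp only: rep_sum)
qed

lemma linear_forms_separate: "(\<And>u. linear_form L u \<Longrightarrow> u v = u w) \<Longrightarrow> v = w"
  by (rule rep_eqI) (use linear_form_rep in blast)

lemma linear_forms_detect_Fil:
  assumes "\<And>u. linear_form L u \<Longrightarrow> (\<And>w. w \<in> Fil k \<Longrightarrow> u w = 0) \<Longrightarrow> u v = 0"
  shows "v \<in> Fil k"
  unfolding Fil_def
proof clarify
  fix j assume j: "j < k"
  show "proj j v = 0"
    by (rule rep_eqI) (use assms[OF linear_form_rep_proj] j in \<open>auto simp: Fil_def\<close>)
qed

lemma Fil_linear_map:
  assumes T: "lin T" and b: "\<And>b. b \<in> WB \<Longrightarrow> T b \<in> Fil (dg b + m)" and v: "v \<in> Fil k"
  shows "T v \<in> Fil (k + m)"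
  using v
proof (induction rule: Fil_induct)
  case (gr j v)
  have "T v = T (proj j v)" using gr by (simp add: gr_iff)
  also have "\<dots> = (\<Sum>b\<in>{b\<in>WB. dg b = j}. sc (rep v b) (T b))"
    by (simp add: proj_def lin_sum[OF T] lin_scale[OF T])
  also have "\<dots> \<in> Fil (k + m)"
  proof (intro Fil_sum Fil_subspace_rules(4))
    fix c assume "c \<in> {b \<in> WB. dg b = j}"
    then show "T c \<in> Fil (k + m)" using b[of c] gr(1) Fil_mono[of "k + m" "dg c + m"] by simp
  qed
  finally show ?case .
qed (auto simp: lin_0[OF T] lin_add[OF T] Fil_subspace_rules)

subsection \<open>Exponentials\<close>

text \<open>Divided powers of \<open>ad x\<close>; in terms of them the Leibniz rule has no binomial coefficients.\<close>

definition dpow :: "'g \<Rightarrow> nat \<Rightarrow> 'g \<Rightarrow> 'g" where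
  "dpow x n v = sc (1 / fact n) ((br x ^^ n) v)"

lemma dpow_0 [simp]: "dpow x 0 v = v"
  by (simp add: dpow_def)

lemma lin_dpow: "lin (dpow x n)"
  unfolding dpow_def by (rule lin_comp[OF lin_scale_fun lin_pow[OF lin_br]])

lemma dpow_Suc: "sc (of_nat (Suc n)) (dpow x (Suc n) v) = br x (dpow x n v)"
proof -
  have "(of_nat (Suc n) :: complex) * (1 / fact (Suc n)) = 1 / fact n"
    by (simp add: divide_simps del: of_nat_Suc)
  then show ?thesis by (simp add: dpow_def bracket_scale_right del: of_nat_Suc)
qed

lemma dpow_leibniz: "dpow x n (br v w) = (\<Sum>i\<le>n. br (dpow x i v) (dpow x (n - i) w))"
proof (induction n)
  case (Suc n)
  let ?f = "\<lambda>i j. br (dpow x i v) (dpow x j w)"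
  have "sc (of_nat (Suc n)) (dpow x (Suc n) (br v w)) = (\<Sum>i\<le>n. br x (?f i (n - i)))"
    by (simp only: dpow_Suc Suc.IH br_sum)
  also have "\<dots> = (\<Sum>i\<le>n. sc (of_nat (Suc i)) (?f (Suc i) (n - i)) + sc (of_nat (Suc (n - i))) (?f i (Suc (n - i))))"
    by (intro sum.cong refl) (simp only: br_derivation[of x] dpow_Suc[symmetric] bracket_scale_left bracket_scale_right)
  also have "\<dots> = (\<Sum>i\<le>n. sc (of_nat (Suc i)) (?f (Suc i) (n - i))) + (\<Sum>i\<le>n. sc (of_nat (Suc n - i)) (?f i (Suc n - i)))"
    unfolding sum.distrib by (intro arg_cong2[where f="(+)"] sum.cong refl) (auto simp: Suc_diff_le simp del: of_nat_Suc)
  also have "(\<Sum>i\<le>n. sc (of_nat (Suc i)) (?f (Suc i) (n - i))) = (\<Sum>i\<le>Suc n. sc (of_nat i) (?f i (Suc n - i)))"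
    by (subst sum.atMost_Suc_shift) simp
  also have "(\<Sum>i\<le>n. sc (of_nat (Suc n - i)) (?f i (Suc n - i))) = (\<Sum>i\<le>Suc n. sc (of_nat (Suc n - i)) (?f i (Suc n - i)))"
    by simp
  also have "(\<Sum>i\<le>Suc n. sc (of_nat i) (?f i (Suc n - i))) + (\<Sum>i\<le>Suc n. sc (of_nat (Suc n - i)) (?f i (Suc n - i))) =
      (\<Sum>i\<le>Suc n. sc (of_nat (Suc n)) (?f i (Suc n - i)))"
    unfolding sum.distrib[symmetric]
    by (intro sum.cong refl) (simp add: scale_left_distrib[symmetric] of_nat_add[symmetric] del: of_nat_Suc of_nat_add)
  also have "\<dots> = sc (of_nat (Suc n)) (\<Sum>i\<le>Suc n. ?f i (Suc n - i))" by (simp only: scale_sum_right)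
  finally show ?case by (simp only: scale_cancel_left) (simp del: of_nat_Suc add: of_nat_neq_0)
qed simp

text \<open>A norm on \<open>\<gg>\<close>, used only to show that the exponential series converges.\<close>

definition nrm :: "'g \<Rightarrow> real" where "nrm v = (\<Sum>b\<in>WB. norm (rep v b))"

lemma nrm_pow: "\<exists>M\<ge>0. \<forall>n v. nrm ((br x ^^ n) v) \<le> M ^ n * nrm v"
proof -
  define M where "M = (\<Sum>b\<in>WB. \<Sum>c\<in>WB. norm (rep (br x c) b))"
  have M0: "M \<ge> 0" unfolding M_def by (intro sum_nonneg) auto
  have n0: "nrm v \<ge> 0" for v unfolding nrm_def by (intro sum_nonneg) auto
  have step: "nrm (br x v) \<le> M * nrm v" for v
  proof -
    have "norm (rep (br x v) b) \<le> (\<Sum>c\<in>WB. norm (rep (br x c) b)) * nrm v" for b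
    proof -
      have "rep (br x v) b = (\<Sum>c\<in>WB. rep v c * rep (br x c) b)"
        by (rule rep_lin[OF WB(2) lin_br]) (simp_all add: WB(3))
      then have "norm (rep (br x v) b) \<le> (\<Sum>c\<in>WB. norm (rep v c) * norm (rep (br x c) b))"
        by (simp add: norm_mult[symmetric] sum_norm_le norm_sum)
      also have "\<dots> \<le> (\<Sum>c\<in>WB. nrm v * norm (rep (br x c) b))"
        unfolding nrm_def by (intro sum_mono mult_right_mono member_le_sum) (auto simp: finite_WB)
      finally show ?thesis by (simp add: sum_distrib_left mult.commute)
    qed
    then show ?thesis unfolding nrm_def[of "br x v"] M_def sum_distrib_right by (intro sum_mono)
  qed
  have "nrm ((br x ^^ n) v) \<le> M ^ n * nrm v" for n v
  proof (induction n)
    case (Suc n)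
    have "nrm (br x ((br x ^^ n) v)) \<le> M * (M ^ n * nrm v)"
      using step[of "(br x ^^ n) v"] mult_left_mono[OF Suc M0] by linarith
    then show ?case by simp
  qed simp
  then show ?thesis using M0 by blast
qed

lemma dpow_summable: "summable (\<lambda>n. norm (rep (dpow x n v) b))"
proof (cases "b \<in> WB")
  case True
  obtain M where M: "M \<ge> 0" "\<And>n v. nrm ((br x ^^ n) v) \<le> M ^ n * nrm v" using nrm_pow by blast
  have "norm (rep (dpow x n v) b) \<le> inverse (fact n) * M ^ n * nrm v" for n
  proof -
    have "norm (rep ((br x ^^ n) v) b) \<le> nrm ((br x ^^ n) v)"
      unfolding nrm_def using True finite_WB by (intro member_le_sum) auto
    also have "\<dots> \<le> M ^ n * nrm v" by (rule M)
    finally have "(inverse (fact n) :: real) * norm (rep ((br x ^^ n) v) b) \<le> inverse (fact n) * (M ^ n * nrm v)"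
      by (intro mult_left_mono) auto
    then show ?thesis by (simp add: dpow_def rep_scale norm_mult norm_divide norm_inverse norm_fact divide_inverse mult.assoc)
  qed
  then have "norm (norm (rep (dpow x n v) b)) \<le> inverse (fact n) * M ^ n * nrm v" for n
    unfolding real_norm_def abs_norm_cancel .
  moreover have "summable (\<lambda>n. inverse (fact n) * M ^ n * nrm v)"
    by (intro summable_mult2 summable_exp)
  ultimately show ?thesis by (rule summable_comparison_test'[rotated])
next
  case False
  then have "rep w b = 0" for w using representation_ne_zero by blast
  then show ?thesis by simp
qed

abbreviation "Ad \<equiv> \<lambda>x. op_exp L (br x)"

lemma Ad_unique:
  assumes "\<And>u. linear_form L u \<Longrightarrow> (\<lambda>n. u (dpow x n y)) sums u z"
  shows "Ad x y = z"
  unfolding op_exp_def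
proof (rule the_equality)
  show "\<forall>u. linear_form L u \<longrightarrow> (\<lambda>n. u ((br x ^^ n) y) / fact n) sums u z"
    using assms by (auto simp: dpow_def lf_scale)
  fix z' assume z': "\<forall>u. linear_form L u \<longrightarrow> (\<lambda>n. u ((br x ^^ n) y) / fact n) sums u z'"
  show "z' = z"
  proof (rule linear_forms_separate)
    fix u assume u: "linear_form L u"
    have "(\<lambda>n. u ((br x ^^ n) y) / fact n) sums u z" using assms[OF u] by (simp add: dpow_def lf_scale[OF u])
    then show "u z' = u z" using z' u sums_unique2 by blast
  qed
qed

lemma Ad_sums: "linear_form L u \<Longrightarrow> (\<lambda>n. u (dpow x n y)) sums u (Ad x y)"
proof -
  define z where "z = (\<Sum>b\<in>WB. sc (suminf (\<lambda>n. rep (dpow x n y) b)) b)"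
  have *: "(\<lambda>n. u (dpow x n y)) sums u z" if u: "linear_form L u" for u
  proof -
    have "(\<lambda>n. \<Sum>b\<in>WB. rep (dpow x n y) b * u b) sums (\<Sum>b\<in>WB. (suminf (\<lambda>n. rep (dpow x n y) b)) * u b)"
      by (rule sums_sum, rule sums_mult2, rule summable_sums, rule summable_norm_cancel, rule dpow_summable)
    moreover have "(\<Sum>b\<in>WB. rep (dpow x n y) b * u b) = u (dpow x n y)" for n
    proof -
      have "u (dpow x n y) = u (\<Sum>b\<in>WB. sc (rep (dpow x n y) b) b)" by (simp only: rep_sum)
      then show ?thesis by (simp add: lf_sum[OF u] lf_scale[OF u])
    qed
    ultimately show ?thesis by (simp add: z_def lf_sum[OF u] lf_scale[OF u])
  qed
  then have "Ad x y = z" by (rule Ad_unique)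
  then show "linear_form L u \<Longrightarrow> (\<lambda>n. u (dpow x n y)) sums u (Ad x y)" using * by simp
qed

lemma lin_Ad: "lin (Ad x)"
proof (rule linI)
  show "Ad x (v + w) = Ad x v + Ad x w" for v w
    by (rule Ad_unique) (auto simp: lin_add[OF lin_dpow] lf_add intro!: sums_add Ad_sums)
  show "Ad x (sc c v) = sc c (Ad x v)" for c v
    by (rule Ad_unique) (auto simp: lin_scale[OF lin_dpow] lf_scale intro!: sums_mult intro: Ad_sums)
qed

text \<open>The Leibniz rule for divided powers, and Cauchy products of the absolutely convergent series
  of coordinates.\<close>

lemma Ad_bracket: "Ad x (br v w) = br (Ad x v) (Ad x w)"
proof (rule Ad_unique)
  fix u assume u: "linear_form L u"
  let ?a = "\<lambda>b n. rep (dpow x n v) b" and ?b = "\<lambda>c n. rep (dpow x n w) c"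
  have expand: "u (br s t) = (\<Sum>b\<in>WB. \<Sum>c\<in>WB. rep s b * rep t c * u (br b c))" for s t
  proof -
    have "u (br s t) = u (br (\<Sum>b\<in>WB. sc (rep s b) b) (\<Sum>c\<in>WB. sc (rep t c) c))" by (simp only: rep_sum)
    then show ?thesis
      by (simp only: br_sum bracket_scale_left bracket_scale_right scale_sum_right lf_sum[OF u] lf_scale[OF u])
         (subst sum.swap, simp add: mult_ac)
  qed
  have s: "(\<lambda>n. (\<Sum>i\<le>n. ?a b i * ?b c (n - i)) * u (br b c)) sums (rep (Ad x v) b * rep (Ad x w) c * u (br b c))" for b c
  proof -
    have "(\<lambda>n. \<Sum>i\<le>n. ?a b i * ?b c (n - i)) sums ((suminf (\<lambda>n. ?a b n)) * (suminf (\<lambda>n. ?b c n)))"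
      by (intro Cauchy_product_sums dpow_summable)
    moreover have "(suminf (\<lambda>n. rep (dpow x n s) b)) = rep (Ad x s) b" for s b
      using Ad_sums[OF linear_form_rep] by (simp add: sums_iff)
    ultimately show ?thesis by (intro sums_mult2) simp
  qed
  have "(\<lambda>n. \<Sum>b\<in>WB. \<Sum>c\<in>WB. (\<Sum>i\<le>n. ?a b i * ?b c (n - i)) * u (br b c)) sums
      (\<Sum>b\<in>WB. \<Sum>c\<in>WB. rep (Ad x v) b * rep (Ad x w) c * u (br b c))"
    by (intro sums_sum s)
  moreover have "(\<Sum>b\<in>WB. \<Sum>c\<in>WB. (\<Sum>i\<le>n. ?a b i * ?b c (n - i)) * u (br b c)) = u (dpow x n (br v w))" for n
  proof -
    have "u (dpow x n (br v w)) = (\<Sum>i\<le>n. \<Sum>b\<in>WB. \<Sum>c\<in>WB. ?a b i * ?b c (n - i) * u (br b c))"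
      by (simp only: dpow_leibniz lf_sum[OF u]) (rule sum.cong[OF refl], rule expand)
    also have "\<dots> = (\<Sum>b\<in>WB. \<Sum>i\<le>n. \<Sum>c\<in>WB. ?a b i * ?b c (n - i) * u (br b c))" by (rule sum.swap)
    also have "\<dots> = (\<Sum>b\<in>WB. \<Sum>c\<in>WB. \<Sum>i\<le>n. ?a b i * ?b c (n - i) * u (br b c))"
      by (intro sum.cong refl sum.swap)
    finally show ?thesis by (simp add: sum_distrib_right)
  qed
  ultimately show "(\<lambda>n. u (dpow x n (br v w))) sums u (br (Ad x v) (Ad x w))"
    by (simp add: expand[of "Ad x v"])
qed

lemma Ad_fixes: "Ad x x = x"
proof (rule Ad_unique)
  fix u assume u: "linear_form L u"
  have "dpow x (Suc n) x = 0" for n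
    using lin_0[OF lin_pow[OF lin_br]] by (simp add: dpow_def funpow_swap1 bracket_self)
  then have "u (dpow x n x) = 0" if "n \<notin> {0}" for n
    using that lf_0[OF u] by (cases n) auto
  then have "(\<lambda>n. u (dpow x n x)) sums (\<Sum>n\<in>{0}. u (dpow x n x))" by (intro sums_finite) auto
  then show "(\<lambda>n. u (dpow x n x)) sums u x" by simp
qed

text \<open>A bracket preserving linear map is injective unless it is zero, because its kernel is an ideal.\<close>

lemma automorphism_bij:
  assumes g: "lin g" and br: "\<And>x y. g (br x y) = br (g x) (g y)" and nz: "g v \<noteq> 0"
  shows "bij g"
proof -
  have "subspace {x. g x = 0}"
    by (rule subspaceI) (auto simp: lin_0[OF g] lin_add[OF g] lin_scale[OF g])
  then have "{x. g x = 0} = {0} \<or> {x. g x = 0} = UNIV" by (rule no_ideals) (simp add: br)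
  then have k: "{x. g x = 0} = {0}" using nz by blast
  have "inj g"
  proof (rule injI)
    fix x y assume "g x = g y"
    then have "g (x - y) = 0" by (simp add: lin_diff[OF g])
    then have "x - y = 0" using k by blast
    then show "x = y" by simp
  qed
  then show ?thesis using linear_inj_imp_surj[OF g] by (simp add: bij_def)
qed

lemma bij_Ad: "bij (Ad x)"
proof (cases "x = 0")
  case True
  have "Ad x v = v" for v
  proof (rule Ad_unique)
    fix u assume u: "linear_form L u"
    have "dpow x (Suc n) v = 0" for n using True by (simp add: dpow_def)
    then have "u (dpow x n v) = 0" if "n \<notin> {0}" for n
      using that lf_0[OF u] by (cases n) auto
    then have "(\<lambda>n. u (dpow x n v)) sums (\<Sum>n\<in>{0}. u (dpow x n v))" by (intro sums_finite) auto
    then show "(\<lambda>n. u (dpow x n v)) sums u v" by simp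
  qed
  then have "Ad x = id" by auto
  then show ?thesis by simp
next
  case False
  then show ?thesis using automorphism_bij[OF lin_Ad Ad_bracket, of x x] Ad_fixes by simp
qed

subsection \<open>Automorphisms compatible with the filtration\<close>

definition Aut :: "('g \<Rightarrow> 'g) set" where
  "Aut = {g. lin g \<and> bij g \<and> (\<forall>x y. g (br x y) = br (g x) (g y))}"

abbreviation ginv :: "('g \<Rightarrow> 'g) \<Rightarrow> 'g \<Rightarrow> 'g" where
  "ginv \<equiv> inv_into UNIV"

text \<open>Automorphisms that are triangular for the principal filtration. The diagonal entries \<open>\<theta>\<close> are
  multiplicative, so commutators have diagonal \<open>1\<close>; this is how the derived group of \<open>B\<close> is seen
  to be unipotent.\<close>

definition BAut :: "(('g \<Rightarrow> 'g) \<times> ('g \<Rightarrow> complex)) set" where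
  "BAut = {(g, \<theta>). g \<in> Aut \<and> (\<forall>b\<in>WB. \<theta> b \<noteq> 0 \<and> g b - sc (\<theta> b) b \<in> Fil (dg b + 1))}"

text \<open>The unipotent automorphisms. They will turn out to be exactly the group \<open>N\<close>.\<close>

definition UAut :: "('g \<Rightarrow> 'g) set" where
  "UAut = {g\<in>Aut. \<forall>k. \<forall>v\<in>Fil k. g v - v \<in> Fil (k + 1)}"

lemma Aut_inv: "g \<in> Aut \<Longrightarrow> ginv g \<in> Aut"
proof -
  assume "g \<in> Aut"
  then have g: "lin g" "bij g" "\<And>x y. g (br x y) = br (g x) (g y)" by (auto simp: Aut_def)
  have gi: "g (ginv g x) = x" "ginv g (g x) = x" for x
    using g(2) by (simp_all add: bij_is_surj bij_is_inj surj_f_inv_f)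
  have eq: "ginv g x = y" if "x = g y" for x y using that gi by simp
  have "lin (ginv g)"
    by (rule linI) (rule eq, simp add: lin_add[OF g(1)] lin_scale[OF g(1)] gi)+
  moreover have "ginv g (br x y) = br (ginv g x) (ginv g y)" for x y
    by (rule eq) (simp add: g gi)
  ultimately show "ginv g \<in> Aut" using bij_imp_bij_inv[OF g(2)] by (auto simp: Aut_def)
qed

lemma Aut_comp: "g \<in> Aut \<Longrightarrow> h \<in> Aut \<Longrightarrow> g \<circ> h \<in> Aut"
  using lin_comp[of g h] by (auto simp: Aut_def bij_comp comp_def intro: bij_comp[unfolded comp_def])

lemma Aut_id: "id \<in> Aut"
  by (auto simp: Aut_def intro: linI)

lemma AutD: "g \<in> Aut \<Longrightarrow> lin g" "g \<in> Aut \<Longrightarrow> bij g" "g \<in> Aut \<Longrightarrow> g (br x y) = br (g x) (g y)"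
  by (auto simp: Aut_def)

lemma Aut_inverse: "g \<in> Aut \<Longrightarrow> g (ginv g x) = x" "g \<in> Aut \<Longrightarrow> ginv g (g x) = x"
  by (simp_all add: AutD(2) bij_is_surj bij_is_inj surj_f_inv_f)

lemma BAut_diff: "(g, \<theta>) \<in> BAut \<Longrightarrow> v \<in> Fil k \<Longrightarrow> g v \<in> Fil k"
proof -
  assume g: "(g, \<theta>) \<in> BAut" and v: "v \<in> Fil k"
  have "g b \<in> Fil (dg b + 0)" if b: "b \<in> WB" for b
  proof -
    have "g b - sc (\<theta> b) b \<in> Fil (dg b)"
      using g b by (intro Fil_mono[of "dg b" "dg b + 1"]) (auto simp: BAut_def)
    moreover have "sc (\<theta> b) b \<in> Fil (dg b)" by (intro Fil_subspace_rules(4) gr_Fil[OF WB_gr[OF b]]) simp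
    ultimately have "(g b - sc (\<theta> b) b) + sc (\<theta> b) b \<in> Fil (dg b)" by (rule Fil_subspace_rules(2))
    then show ?thesis by simp
  qed
  from Fil_linear_map[of g, OF _ this v] show ?thesis using g by (auto simp: BAut_def Aut_def)
qed

lemma BAut_comp: "(g, \<theta>) \<in> BAut \<Longrightarrow> (h, \<psi>) \<in> BAut \<Longrightarrow> (g \<circ> h, \<lambda>b. \<theta> b * \<psi> b) \<in> BAut"
proof -
  assume g: "(g, \<theta>) \<in> BAut" and h: "(h, \<psi>) \<in> BAut"
  have l: "lin g" using g by (auto simp: BAut_def Aut_def)
  have "g (h b) - sc (\<theta> b * \<psi> b) b \<in> Fil (dg b + 1)" if b: "b \<in> WB" for b
  proof -
    have "g (h b - sc (\<psi> b) b) + sc (\<psi> b) (g b - sc (\<theta> b) b) \<in> Fil (dg b + 1)"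
      using g h b
      by (intro Fil_subspace_rules(2) Fil_subspace_rules(4)[of "g b - sc (\<theta> b) b"] BAut_diff[OF g]) (auto simp: BAut_def)
    then show ?thesis by (simp add: lin_diff[OF l] lin_scale[OF l] scale_right_diff_distrib mult.commute)
  qed
  then show ?thesis using g h by (auto simp: BAut_def Aut_comp)
qed

lemma BAut_inv: "(g, \<theta>) \<in> BAut \<Longrightarrow> (ginv g, \<lambda>b. inverse (\<theta> b)) \<in> BAut"
proof -
  assume g: "(g, \<theta>) \<in> BAut"
  then have gA: "g \<in> Aut" by (auto simp: BAut_def)
  have l: "lin g" "lin (ginv g)" using gA Aut_inv AutD(1) by auto
  text \<open>The inverse preserves the filtration by descending induction on the degree.\<close>
  have pres: "ginv g v \<in> Fil k" if "v \<in> Fil k" for v k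
    using that
  proof (induction "nat (K + 1 - k)" arbitrary: v k)
    case 0
    then have "v = 0" using Fil_top[of k v] by auto
    then show ?case by (simp add: lin_0[OF l(2)] Fil_subspace_rules)
  next
    case (Suc m)
    have IH: "ginv g v \<in> Fil (k + 1)" if "v \<in> Fil (k + 1)" for v
      by (rule Suc.hyps(1)[OF _ that]) (use Suc.hyps(2) in auto)
    have b: "ginv g b \<in> Fil (dg b)" if b: "b \<in> WB" "dg b = k" for b
    proof -
      have "g b - sc (\<theta> b) b \<in> Fil (k + 1)" "\<theta> b \<noteq> 0" using g b by (auto simp: BAut_def)
      then have "ginv g (g b - sc (\<theta> b) b) \<in> Fil k" using IH Fil_mono[of k "k + 1"] by auto
      then have "b - sc (\<theta> b) (ginv g b) \<in> Fil k"
        by (simp add: lin_diff[OF l(2)] lin_scale[OF l(2)] Aut_inverse[OF gA])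
      from Fil_subspace_rules(3)[OF gr_Fil[OF WB_gr[OF b(1)], of k] this]
      have "sc (\<theta> b) (ginv g b) \<in> Fil k" using b(2) by simp
      from Fil_subspace_rules(4)[OF this, of "inverse (\<theta> b)"]
      show ?thesis using \<open>\<theta> b \<noteq> 0\<close> b(2) by simp
    qed
    have "ginv g (proj k v) \<in> Fil k"
      unfolding proj_def lin_sum[OF l(2)] lin_scale[OF l(2)]
      by (intro Fil_sum Fil_subspace_rules) (use b in auto)
    moreover have "ginv g (v - proj k v) \<in> Fil k"
      using IH[OF Fil_split[OF Suc.prems]] Fil_mono[of k "k + 1"] by auto
    ultimately have "ginv g (v - proj k v) + ginv g (proj k v) \<in> Fil k" by (intro Fil_subspace_rules)
    then show ?case by (simp add: lin_diff[OF l(2)])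
  qed
  have "ginv g b - sc (inverse (\<theta> b)) b \<in> Fil (dg b + 1)" if b: "b \<in> WB" for b
  proof -
    have c: "g b - sc (\<theta> b) b \<in> Fil (dg b + 1)" "\<theta> b \<noteq> 0" using g b by (auto simp: BAut_def)
    have "sc (- inverse (\<theta> b)) (ginv g (g b - sc (\<theta> b) b)) \<in> Fil (dg b + 1)"
      by (intro Fil_subspace_rules pres c)
    moreover have "sc (- inverse (\<theta> b)) (ginv g (g b - sc (\<theta> b) b)) = ginv g b - sc (inverse (\<theta> b)) b"
      using c(2) by (simp add: lin_diff[OF l(2)] lin_scale[OF l(2)] Aut_inverse[OF gA] scale_right_diff_distrib)
    ultimately show ?thesis by simp
  qed
  then show ?thesis using g Aut_inv[OF gA] by (auto simp: BAut_def)
qed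

lemma UAut_eq: "g \<in> UAut \<longleftrightarrow> (g, \<lambda>b. 1) \<in> BAut"
proof
  assume "g \<in> UAut"
  then show "(g, \<lambda>b. 1) \<in> BAut"
    using gr_Fil[OF WB_gr] by (auto simp: UAut_def BAut_def)
next
  assume g: "(g, \<lambda>b. 1) \<in> BAut"
  then have l: "lin (\<lambda>v. g v - v)" using linI[of "\<lambda>v. v"] by (auto simp: BAut_def Aut_def intro: lin_diff_fun)
  have "g v - v \<in> Fil (k + 1)" if "v \<in> Fil k" for v k
    by (rule Fil_linear_map[OF l _ that]) (use g in \<open>auto simp: BAut_def\<close>)
  then show "g \<in> UAut" using g by (auto simp: UAut_def BAut_def)
qed

lemma UAut_comp: "g \<in> UAut \<Longrightarrow> h \<in> UAut \<Longrightarrow> g \<circ> h \<in> UAut"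
  using BAut_comp[of g "\<lambda>b. 1" h "\<lambda>b. 1"] by (simp add: UAut_eq)

lemma UAut_inv: "g \<in> UAut \<Longrightarrow> ginv g \<in> UAut"
  using BAut_inv[of g "\<lambda>b. 1"] by (simp add: UAut_eq)

lemma UAut_id: "id \<in> UAut"
  by (auto simp: UAut_def Aut_id Fil_subspace_rules)

lemma UAut_Fil: "g \<in> UAut \<Longrightarrow> v \<in> Fil k \<Longrightarrow> g v \<in> Fil k"
  using BAut_diff by (auto simp: UAut_eq)

text \<open>Modulo higher degree \<open>x\<close> acts on a weight vector through its component in the Cartan
  subalgebra.\<close>

lemma Ad_BAut: assumes x: "x \<in> Fil 0" shows "(Ad x, \<lambda>b. exp (wt b (proj 0 x))) \<in> BAut"
proof -
  define h where "h = proj 0 x"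
  have h: "h \<in> H" using proj_gr[of 0 x] gr0_eq_H by (simp add: h_def)
  have xh: "x - h \<in> Fil 1" using Fil_split[OF x] by (simp add: h_def)
  have "Ad x b - sc (exp (wt b h)) b \<in> Fil (dg b + 1)" if b: "b \<in> WB" for b
  proof (rule linear_forms_detect_Fil)
    fix u assume u: "linear_form L u" and uF: "\<And>w. w \<in> Fil (dg b + 1) \<Longrightarrow> u w = 0"
    have "(br x ^^ n) b - sc (wt b h ^ n) b \<in> Fil (dg b + 1)" for n
    proof (induction n)
      case (Suc n)
      have "br x ((br x ^^ n) b - sc (wt b h ^ n) b) \<in> Fil (0 + (dg b + 1))"
        by (rule br_Fil[OF x Suc])
      moreover have "sc (wt b h ^ n) (br (x - h) b) \<in> Fil (1 + dg b)"
        by (intro Fil_subspace_rules br_Fil[OF xh] gr_Fil[OF WB_gr[OF b]]) simp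
      ultimately have "br x ((br x ^^ n) b - sc (wt b h ^ n) b) + sc (wt b h ^ n) (br (x - h) b) \<in> Fil (dg b + 1)"
        by (intro Fil_subspace_rules(2)) (simp_all only: add.commute add_0)
      then show ?case
        using root_spaceD[OF wt[OF b] h]
        by (simp add: br_diff bracket_scale_right scale_right_diff_distrib mult.commute)
    qed (simp add: Fil_subspace_rules)
    then have "u ((br x ^^ n) b) = wt b h ^ n * u b" for n
      using uF[of "(br x ^^ n) b - sc (wt b h ^ n) b"] by (simp add: lf_diff[OF u] lf_scale[OF u])
    then have "(\<lambda>n. wt b h ^ n / fact n * u b) sums u (Ad x b)"
      using Ad_sums[OF u, of x b] by (simp add: dpow_def lf_scale[OF u])
    moreover have "(\<lambda>n. wt b h ^ n / fact n * u b) sums (exp (wt b h) * u b)"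
      using sums_mult2[OF exp_converges[of "wt b h"], of "u b"]
      by (simp add: scaleR_conv_of_real divide_inverse mult_ac)
    ultimately have "u (Ad x b) = exp (wt b h) * u b" by (rule sums_unique2)
    then show "u (Ad x b - sc (exp (wt b h)) b) = 0" by (simp add: lf_diff[OF u] lf_scale[OF u])
  qed
  then show ?thesis by (simp add: BAut_def Aut_def lin_Ad bij_Ad Ad_bracket h_def)
qed

abbreviation "BG \<equiv> BijGroup (UNIV :: 'g set)"

lemma BG_mult: "bij g \<Longrightarrow> bij h \<Longrightarrow> g \<otimes>\<^bsub>BG\<^esub> h = g \<circ> h"
  by (rule ext) (simp add: BijGroup_def Bij_def compose_def)

lemma BG_inv: "bij g \<Longrightarrow> inv\<^bsub>BG\<^esub> g = ginv g"
  by (subst inv_BijGroup) (simp_all add: Bij_def restrict_def)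

lemma BG_one: "\<one>\<^bsub>BG\<^esub> = id"
  by (auto simp: BijGroup_def id_def)

lemma BAut_bij: "(g, \<theta>) \<in> BAut \<Longrightarrow> bij g"
  by (auto simp: BAut_def Aut_def)

lemma BAut_id: "(id, \<lambda>b. 1) \<in> BAut"
  using UAut_id by (simp add: UAut_eq)

lemma borel_group_BAut: assumes "g \<in> borel_group L" shows "\<exists>\<theta>. (g, \<theta>) \<in> BAut"
proof -
  have "\<exists>\<theta>. (g, \<theta>) \<in> BAut" if "g \<in> generate BG {Ad x |x. x \<in> Fil 0}" for g
    using that
  proof (induction rule: generate.induct)
    case one
    then show ?case unfolding BG_one using BAut_id by blast
  next
    case (incl h)
    then show ?case using Ad_BAut by blast
  next
    case (inv h)
    then obtain \<theta> where h: "(h, \<theta>) \<in> BAut" using Ad_BAut by blast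
    then show ?case using BAut_inv[OF h] by (auto simp: BG_inv[OF BAut_bij[OF h]])
  next
    case (eng h1 h2)
    then obtain \<theta> \<psi> where h: "(h1, \<theta>) \<in> BAut" "(h2, \<psi>) \<in> BAut" by blast
    show ?case unfolding BG_mult[OF h[THEN BAut_bij]] using BAut_comp[OF h] by blast
  qed
  then show ?thesis using assms by (simp add: borel_group_def exp_group_def borel_eq)
qed

lemma unipotent_group_UAut: assumes "g \<in> unipotent_group L" shows "g \<in> UAut"
  using assms unfolding unipotent_group_def derived_def
proof (induction rule: generate.induct)
  case one
  show ?case unfolding BG_one by (rule UAut_id)
next
  case (eng h1 h2)
  then have "bij h1" "bij h2" by (auto simp: UAut_def Aut_def)
  then show ?case using eng UAut_comp by (metis BG_mult)
next
  have *: "h \<in> UAut" if "h \<in> derived_set BG (borel_group L)" for h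
  proof -
    obtain h1 h2 where h: "h1 \<in> borel_group L" "h2 \<in> borel_group L"
      "h = h1 \<otimes>\<^bsub>BG\<^esub> h2 \<otimes>\<^bsub>BG\<^esub> inv\<^bsub>BG\<^esub> h1 \<otimes>\<^bsub>BG\<^esub> inv\<^bsub>BG\<^esub> h2" using \<open>h \<in> derived_set BG (borel_group L)\<close> by auto
    obtain \<theta> \<psi> where b: "(h1, \<theta>) \<in> BAut" "(h2, \<psi>) \<in> BAut" using borel_group_BAut h by blast
    have bb: "bij h1" "bij h2" "bij (ginv h1)" "bij (ginv h2)"
      using b BAut_bij bij_imp_bij_inv by blast+
    have "h = h1 \<circ> h2 \<circ> ginv h1 \<circ> ginv h2"
      using h(3) by (simp add: BG_mult BG_inv bb bij_comp)
    moreover have "(h1 \<circ> h2 \<circ> ginv h1 \<circ> ginv h2, \<lambda>b. \<theta> b * \<psi> b * inverse (\<theta> b) * inverse (\<psi> b)) \<in> BAut"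
      by (intro BAut_comp BAut_inv b)
    moreover have "\<theta> b * \<psi> b * inverse (\<theta> b) * inverse (\<psi> b) = 1" if "b \<in> WB" for b
    proof -
      have "\<theta> b \<noteq> 0" "\<psi> b \<noteq> 0" using b that by (auto simp: BAut_def)
      then show ?thesis by (simp add: field_simps)
    qed
    ultimately have "(h, \<lambda>b. 1) \<in> BAut"
      by (simp add: BAut_def)
    then show ?thesis by (simp add: UAut_eq)
  qed
  case (incl h)
  then show ?case by (rule *)
  case (inv h)
  then have "h \<in> UAut" by (rule *)
  then show ?case by (simp add: BG_inv UAut_inv UAut_def Aut_def) (use UAut_inv in \<open>auto simp: UAut_def Aut_def\<close>)
qed


subsection \<open>Exponentials of nilpotent elements\<close>

lemma br_pow_Fil: "x \<in> Fil m \<Longrightarrow> v \<in> Fil k \<Longrightarrow> (br x ^^ n) v \<in> Fil (k + int n * m)"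
proof (induction n)
  case (Suc n)
  then have "br x ((br x ^^ n) v) \<in> Fil (m + (k + int n * m))" by (intro br_Fil) auto
  then show ?case by (simp add: algebra_simps)
qed simp

text \<open>A bound for the order of nilpotency of \<open>ad x\<close>, for \<open>x\<close> in \<open>\<nn>\<close>: each application raises the
  degree, and the degrees lie between \<open>-K\<close> and \<open>K\<close>.\<close>

definition NN :: nat where "NN = nat (3 * K)"

lemma dpow_zero: "x \<in> Fil 1 \<Longrightarrow> n > NN \<Longrightarrow> dpow x n v = 0"
proof -
  assume x: "x \<in> Fil 1" and n: "n > NN"
  have "(br x ^^ n) v \<in> Fil (- K + int n * 1)" by (intro br_pow_Fil x Fil_bottom) simp
  moreover have "- K + int n * 1 > K" using n K(1) by (simp add: NN_def)
  ultimately have "(br x ^^ n) v = 0" using Fil_top[of "- K + int n * 1" "(br x ^^ n) v"] by blast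
  then show ?thesis by (simp add: dpow_def)
qed

lemma Ad_nilpotent: "x \<in> Fil 1 \<Longrightarrow> Ad x v = (\<Sum>n\<le>NN. dpow x n v)"
proof (rule Ad_unique)
  fix u assume x: "x \<in> Fil 1" and u: "linear_form L u"
  have "(\<lambda>n. u (dpow x n v)) sums (\<Sum>n\<in>{..NN}. u (dpow x n v))"
    by (rule sums_finite) (use dpow_zero[OF x] lf_0[OF u] in auto)
  then show "(\<lambda>n. u (dpow x n v)) sums u (\<Sum>n\<le>NN. dpow x n v)" by (simp add: lf_sum[OF u])
qed

lemma Ad_UAut: "x \<in> Fil 1 \<Longrightarrow> Ad x \<in> UAut"
proof -
  assume x: "x \<in> Fil 1"
  have "(Ad x, \<lambda>b. exp (wt b (proj 0 x))) \<in> BAut" by (rule Ad_BAut) (rule Fil_mono[OF _ x], simp)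
  moreover have "wt b (proj 0 x) = 0" if b: "b \<in> WB" for b
  proof -
    have "proj 0 x = 0" using x by (simp add: Fil_def)
    then show ?thesis
      using weight_linear(2)[OF wt[OF b] WB_nonzero[OF b], of 0 0] subspace_0[OF subspace_H] by simp
  qed
  ultimately show ?thesis by (simp add: UAut_eq BAut_def)
qed

lemma Aut_dpow: "g \<in> Aut \<Longrightarrow> g (dpow z n v) = dpow (g z) n (g v)"
proof -
  assume g: "g \<in> Aut"
  have "g ((br z ^^ n) v) = (br (g z) ^^ n) (g v)" by (induction n) (simp_all add: AutD[OF g])
  then show ?thesis by (simp add: dpow_def lin_scale[OF AutD(1)[OF g]])
qed

lemma Aut_Ad: "g \<in> Aut \<Longrightarrow> g (Ad z v) = Ad (g z) (g v)"
proof (rule Ad_unique[symmetric])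
  fix u assume g: "g \<in> Aut" and u: "linear_form L u"
  show "(\<lambda>n. u (dpow (g z) n (g v))) sums u (g (Ad z v))"
    using Ad_sums[OF linear_form_comp[OF u AutD(1)[OF g]], of z v] by (simp add: Aut_dpow[OF g])
qed

lemma dpow_scale: "dpow (sc s z) n v = sc (s ^ n) (dpow z n v)"
proof -
  have "(br (sc s z) ^^ n) v = sc (s ^ n) ((br z ^^ n) v)"
    by (induction n) (simp_all add: bracket_scale_left bracket_scale_right mult.commute)
  then show ?thesis by (simp add: dpow_def mult.commute)
qed

lemma dpow_dpow: "dpow z i (dpow z j v) = sc (of_nat ((i + j) choose i)) (dpow z (i + j) v)"
proof -
  have "fact i * fact j * ((i + j) choose i) = (fact (i + j) :: nat)"
    using binomial_fact_lemma[of i "i + j"] by simp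
  then have "(of_nat (fact i * fact j * ((i + j) choose i)) :: complex) = of_nat (fact (i + j))" by simp
  then have f: "(fact i * fact j * of_nat ((i + j) choose i) :: complex) = fact (i + j)"
    by (simp only: of_nat_mult of_nat_fact)
  have c: "1 / fact i * (1 / fact j) = of_nat ((i + j) choose i) * (1 / fact (i + j) :: complex)"
    unfolding f[symmetric] by (simp add: divide_simps)
  have "dpow z i (dpow z j v) = sc (1 / fact i * (1 / fact j)) ((br z ^^ (i + j)) v)"
    by (simp add: dpow_def lin_scale[OF lin_pow[OF lin_br]] funpow_add)
  then show ?thesis unfolding c by (simp add: dpow_def)
qed

lemma sum_square_triangle:
  fixes f :: "nat \<Rightarrow> nat \<Rightarrow> 'x::comm_monoid_add"
  assumes "\<And>i j. i + j > N \<Longrightarrow> f i j = 0"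
  shows "(\<Sum>i\<le>N. \<Sum>j\<le>N. f i j) = (\<Sum>n\<le>N. \<Sum>i\<le>n. f i (n - i))"
proof -
  have "(\<Sum>i\<le>N. \<Sum>j\<le>N. f i j) = (\<Sum>(i, j)\<in>{..N} \<times> {..N}. f i j)" by (rule sum.cartesian_product)
  also have "\<dots> = (\<Sum>(i, j)\<in>{(i, j). i + j \<le> N}. f i j)"
  proof (rule sum.mono_neutral_right)
    show "\<forall>p\<in>{..N} \<times> {..N} - {(i, j). i + j \<le> N}. (case p of (i, j) \<Rightarrow> f i j) = 0"
      by (auto, metis assms not_le)
  qed auto
  also have "\<dots> = (\<Sum>n\<le>N. \<Sum>i\<le>n. f i (n - i))" by (rule sum.triangle_reindex_eq)
  finally show ?thesis .
qed

lemma Ad_add: assumes z: "z \<in> Fil 1" shows "Ad (sc s z) (Ad (sc t z) v) = Ad (sc (s + t) z) v"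
proof -
  have zs: "sc c z \<in> Fil 1" for c by (rule Fil_subspace_rules(4)[OF z])
  let ?f = "\<lambda>i j. sc (s ^ i * t ^ j * of_nat ((i + j) choose i)) (dpow z (i + j) v)"
  have "Ad (sc s z) (Ad (sc t z) v) = (\<Sum>i\<le>NN. \<Sum>j\<le>NN. ?f i j)"
    unfolding Ad_nilpotent[OF zs] lin_sum[OF lin_dpow] dpow_scale lin_scale[OF lin_dpow] dpow_dpow
    by (simp only: scale_sum_right scale_scale mult_ac)
  also have "\<dots> = (\<Sum>n\<le>NN. \<Sum>i\<le>n. ?f i (n - i))"
    by (rule sum_square_triangle) (simp add: dpow_zero[OF z])
  also have "\<dots> = (\<Sum>n\<le>NN. dpow (sc (s + t) z) n v)"
  proof (intro sum.cong refl)
    fix n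
    have "(\<Sum>i\<le>n. ?f i (n - i)) = (\<Sum>i\<le>n. sc (s ^ i * t ^ (n - i) * of_nat (n choose i)) (dpow z n v))"
      by (intro sum.cong refl) simp
    also have "\<dots> = sc (\<Sum>i\<le>n. s ^ i * t ^ (n - i) * of_nat (n choose i)) (dpow z n v)"
      by (simp only: scale_sum_left)
    also have "(\<Sum>i\<le>n. s ^ i * t ^ (n - i) * of_nat (n choose i)) = (s + t) ^ n"
      unfolding binomial_ring by (simp add: mult_ac)
    finally show "(\<Sum>i\<le>n. ?f i (n - i)) = dpow (sc (s + t) z) n v" by (simp add: dpow_scale)
  qed
  finally show ?thesis by (simp only: Ad_nilpotent[OF zs])
qed

lemma Ad_zero: "Ad 0 v = v"
proof -
  have "dpow 0 (Suc n) v = 0" for n by (simp add: dpow_def)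
  then have "(\<Sum>n\<le>NN. dpow 0 n v) = (\<Sum>n\<le>NN. if n = 0 then v else 0)"
    by (intro sum.cong refl) (metis dpow_0 not0_implies_Suc)
  then show ?thesis by (simp add: Ad_nilpotent Fil_subspace_rules)
qed

lemma ginv_Ad: assumes z: "z \<in> Fil 1" shows "ginv (Ad z) = Ad (- z)"
proof (rule inv_unique_comp)
  show "Ad z \<circ> Ad (- z) = id"
  proof
    fix v show "(Ad z \<circ> Ad (- z)) v = id v" using Ad_add[OF z, of 1 "-1" v] by (simp add: Ad_zero)
  qed
  show "Ad (- z) \<circ> Ad z = id"
  proof
    fix v show "(Ad (- z) \<circ> Ad z) v = id v" using Ad_add[OF z, of "-1" 1 v] by (simp add: Ad_zero)
  qed
qed

text \<open>For \<open>y\<close> of degree \<open>k \<ge> 1\<close>, \<open>exp y\<close> is the commutator of \<open>exp \<rho>\<^sup>\<or>\<close> and \<open>exp z\<close> for a multiple \<open>z\<close>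
  of \<open>y\<close>: conjugation by \<open>exp \<rho>\<^sup>\<or>\<close> multiplies \<open>z\<close> by \<open>e^k\<close>.\<close>

lemma Ad_unipotent_group: assumes y: "y \<in> gr k" and k: "k \<ge> 1" shows "Ad y \<in> unipotent_group L"
proof -
  define q where "q = exp (of_int k :: complex)"
  have q: "q \<noteq> 1" using k by (auto simp: q_def exp_eq_1)
  define z where "z = sc (1 / (q - 1)) y"
  have zgr: "z \<in> gr k" using y subspace_scale[OF subspace_gr] by (simp add: z_def)
  have z1: "z \<in> Fil 1" by (rule gr_Fil[OF zgr k])
  \<comment> \<open>\<open>z\<close> has degree \<open>k\<close>, so \<open>exp (ad \<rho>\<^sup>\<or>)\<close> multiplies it by \<open>e^k = q\<close>.\<close>
  have az: "Ad \<rho> z = sc q z"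
  proof (rule Ad_unique)
    fix u assume u: "linear_form L u"
    have "(br \<rho> ^^ n) z = sc (of_int k ^ n) z" for n
      using zgr by (induction n) (simp_all add: gr_def bracket_scale_right mult.commute)
    then have "u (dpow \<rho> n z) = of_int k ^ n / fact n * u z" for n by (simp add: dpow_def lf_scale[OF u])
    moreover have "(\<lambda>n. of_int k ^ n / fact n * u z) sums (exp (of_int k) * u z)"
      using sums_mult2[OF exp_converges[of "of_int k"], of "u z"]
      by (simp add: scaleR_conv_of_real divide_inverse mult_ac)
    ultimately show "(\<lambda>n. u (dpow \<rho> n z)) sums u (sc q z)" by (simp add: lf_scale[OF u] q_def)
  qed
  have A: "Ad \<rho> \<in> Aut" by (simp add: Aut_def lin_Ad bij_Ad Ad_bracket)
  have "Ad \<rho> \<in> borel_group L" "Ad z \<in> borel_group L"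
    unfolding borel_group_def exp_group_def borel_eq
    using gr_Fil[OF H_gr0[OF \<rho>_H]] gr_Fil[OF zgr, of 0] k by (auto intro!: generate.incl)
  then have "Ad \<rho> \<otimes>\<^bsub>BG\<^esub> Ad z \<otimes>\<^bsub>BG\<^esub> inv\<^bsub>BG\<^esub> (Ad \<rho>) \<otimes>\<^bsub>BG\<^esub> inv\<^bsub>BG\<^esub> (Ad z) \<in> unipotent_group L"
    unfolding unipotent_group_def derived_def by (intro generate.incl) blast
  moreover have "Ad \<rho> \<otimes>\<^bsub>BG\<^esub> Ad z \<otimes>\<^bsub>BG\<^esub> inv\<^bsub>BG\<^esub> (Ad \<rho>) \<otimes>\<^bsub>BG\<^esub> inv\<^bsub>BG\<^esub> (Ad z) = Ad \<rho> \<circ> Ad z \<circ> ginv (Ad \<rho>) \<circ> ginv (Ad z)"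
    by (simp add: BG_mult BG_inv bij_Ad bij_imp_bij_inv bij_comp)
  moreover have "\<dots> = Ad y"
  proof
    fix v
    have "Ad \<rho> (Ad z (ginv (Ad \<rho>) (ginv (Ad z) v))) = Ad (sc q z) (Ad (- z) v)"
      unfolding Aut_Ad[OF A] Aut_inverse(1)[OF A] az ginv_Ad[OF z1] ..
    also have "\<dots> = Ad (sc (q - 1) z) v" using Ad_add[OF z1, of q "- 1" v] by simp
    also have "sc (q - 1) z = y" using q by (simp add: z_def)
    finally show "(Ad \<rho> \<circ> Ad z \<circ> ginv (Ad \<rho>) \<circ> ginv (Ad z)) v = Ad y v" by simp
  qed
  ultimately show ?thesis by metis
qed

lemma unipotent_group_comp: "g \<in> unipotent_group L \<Longrightarrow> h \<in> unipotent_group L \<Longrightarrow> g \<circ> h \<in> unipotent_group L"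
proof -
  assume g: "g \<in> unipotent_group L" and h: "h \<in> unipotent_group L"
  then have "bij g" "bij h" using unipotent_group_UAut by (auto simp: UAut_def Aut_def)
  then have "g \<circ> h = g \<otimes>\<^bsub>BG\<^esub> h" by (rule BG_mult[symmetric])
  also have "\<dots> \<in> unipotent_group L"
    using g h unfolding unipotent_group_def derived_def by (rule generate.eng)
  finally show ?thesis .
qed

lemma unipotent_group_id: "id \<in> unipotent_group L"
  using generate.one[of BG] unfolding unipotent_group_def derived_def BG_one .

subsection \<open>Generation by the simple root subgroups\<close>

text \<open>The group generated by the \<open>exp(c e\<^sub>i)\<close>, built up one factor at a time so that inductions
  follow words in the generators.\<close>

inductive_set Egrp :: "('g \<Rightarrow> 'g) set" where
  Egrp_id: "id \<in> Egrp"
| Egrp_step: "g \<in> Egrp \<Longrightarrow> Ad (sc c (E i)) \<circ> g \<in> Egrp"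

lemma cE_gr: "sc c (E i) \<in> gr 1"
  using E_gr subspace_scale[OF subspace_gr] by blast

lemma cE_Fil: "sc c (E i) \<in> Fil 1"
  by (rule gr_Fil[OF cE_gr]) simp

lemma Egrp_unipotent: "g \<in> Egrp \<Longrightarrow> g \<in> unipotent_group L"
  by (induction rule: Egrp.induct)
     (rule unipotent_group_id, rule unipotent_group_comp[OF Ad_unipotent_group[OF cE_gr]], simp_all)

lemma Egrp_UAut: "g \<in> Egrp \<Longrightarrow> g \<in> UAut"
  by (rule unipotent_group_UAut[OF Egrp_unipotent])

lemma Egrp_comp: "g \<in> Egrp \<Longrightarrow> h \<in> Egrp \<Longrightarrow> g \<circ> h \<in> Egrp"
  by (induction rule: Egrp.induct) (auto simp: comp_assoc intro: Egrp.intros)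

lemma Egrp_inv: "g \<in> Egrp \<Longrightarrow> ginv g \<in> Egrp"
proof (induction rule: Egrp.induct)
  case Egrp_id
  show ?case unfolding inv_id by (rule Egrp.Egrp_id)
next
  case (Egrp_step g c i)
  have "ginv (Ad (sc c (E i)) \<circ> g) = ginv g \<circ> ginv (Ad (sc c (E i)))"
    using Egrp_UAut[OF Egrp_step.hyps] by (intro o_inv_distrib bij_Ad) (auto simp: UAut_def Aut_def)
  also have "ginv (Ad (sc c (E i))) = Ad (sc (- c) (E i))" by (simp add: ginv_Ad[OF cE_Fil])
  also have "\<dots> = Ad (sc (- c) (E i)) \<circ> id" by simp
  finally show ?case using Egrp_comp[OF Egrp_step.IH Egrp.Egrp_step[OF Egrp.Egrp_id]] by metis
qed

text \<open>That is, \<open>g = 1 + ad y + \<dots>\<close> up to terms that raise degrees by more than \<open>k\<close>.\<close>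

definition lead :: "int \<Rightarrow> ('g \<Rightarrow> 'g) \<Rightarrow> 'g \<Rightarrow> bool" where
  "lead k g y \<longleftrightarrow> y \<in> gr k \<and> (\<forall>j. \<forall>v\<in>Fil j. g v - v - br y v \<in> Fil (j + k + 1))"

lemma lead_Fil: "lead k g y \<Longrightarrow> v \<in> Fil j \<Longrightarrow> g v - v \<in> Fil (j + k)"
proof -
  assume l: "lead k g y" and v: "v \<in> Fil j"
  have "br y v \<in> Fil (k + j)" using l v by (intro br_Fil gr_Fil[of y k]) (auto simp: lead_def)
  moreover have "g v - v - br y v \<in> Fil (j + k)"
    using l v by (intro Fil_mono[of "j + k" "j + k + 1"]) (auto simp: lead_def)
  ultimately have "(g v - v - br y v) + br y v \<in> Fil (j + k)" by (intro Fil_subspace_rules(2)) (simp_all add: add.commute)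
  then show ?thesis by simp
qed

text \<open>Let \<open>z\<close> be the component of degree \<open>k\<close> of \<open>g \<rho>\<^sup>\<or> - \<rho>\<^sup>\<or>\<close>. Comparing the components of degree
  \<open>j + k\<close> in \<open>g [\<rho>\<^sup>\<or>, v] = [g \<rho>\<^sup>\<or>, g v]\<close> for \<open>v\<close> of degree \<open>j\<close> gives \<open>y = - z / k\<close>.\<close>

lemma lead_exists:
  assumes g: "g \<in> Aut" and k: "k \<ge> 1" and lev: "\<And>j v. v \<in> Fil j \<Longrightarrow> g v - v \<in> Fil (j + k)"
  shows "\<exists>y. lead k g y"
proof -
  define Z where "Z = g \<rho> - \<rho>"
  define z where "z = proj k Z"
  define y where "y = sc (- 1 / of_int k) z"
  have ZF: "Z \<in> Fil k" using lev[of \<rho> 0] gr_Fil[OF H_gr0[OF \<rho>_H]] by (simp add: Z_def)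
  have zgr: "z \<in> gr k" by (simp add: z_def proj_gr)
  have ygr: "y \<in> gr k" unfolding y_def by (rule subspace_scale[OF subspace_gr zgr])
  have homog: "g v - v - br y v \<in> Fil (j + k + 1)" if v: "v \<in> gr j" for v j
  proof -
    define T where "T = g v - v"
    have TF: "T \<in> Fil (j + k)" using lev[OF gr_Fil[OF v]] by (simp add: T_def)
    have "sc (of_int j) (v + T) = g (br \<rho> v)"
      using v by (simp add: T_def gr_def lin_scale[OF AutD(1)[OF g]])
    also have "\<dots> = br (\<rho> + Z) (v + T)" by (simp add: AutD(3)[OF g] Z_def T_def)
    also have "\<dots> = sc (of_int j) v + br \<rho> T + br Z v + br Z T"
      using v by (simp add: bracket_add_left bracket_add_right gr_def)
    finally have eq: "sc (of_int j) T = br \<rho> T + br Z v + br Z T"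
      by (simp add: scale_right_distrib)
    have "br Z T \<in> Fil (j + k + 1)"
      using br_Fil[OF ZF TF] k by (intro Fil_mono[of "j + k + 1" "k + (j + k)"]) auto
    then have p1: "proj (j + k) (br Z T) = 0" by (simp add: Fil_def)
    have "Z - z \<in> Fil (k + 1)" using Fil_split[OF ZF] by (simp add: z_def)
    then have "br (Z - z) v \<in> Fil (k + 1 + j)" by (rule br_Fil) (rule gr_Fil[OF v order_refl])
    then have "proj (j + k) (br (Z - z) v) = 0" by (simp add: Fil_def)
    moreover have "proj (j + k) (br z v) = br z v"
      using br_gr[OF zgr v] by (simp add: gr_iff add.commute)
    ultimately have p2: "proj (j + k) (br Z v) = br z v" by (simp add: br_diff)
    have "proj (j + k) (br \<rho> T) = br \<rho> (proj (j + k) T)"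
    proof -
      have "proj (j + k) (br \<rho> T) = proj (j + k) (\<Sum>i\<in>{-K..K}. br \<rho> (proj i T))"
        by (simp only: br_sum(2)[symmetric] sum_proj)
      also have "\<dots> = proj (j + k) (\<Sum>i\<in>{-K..K}. sc (of_int i) (proj i T))"
        using proj_gr by (simp add: gr_def)
      also have "\<dots> = (\<Sum>i\<in>{-K..K}. if i = j + k then sc (of_int (j + k)) (proj (j + k) T) else 0)"
        unfolding proj_sum by (intro sum.cong refl) auto
      also have "\<dots> = sc (of_int (j + k)) (proj (j + k) T)"
      proof -
        have "proj (j + k) T = 0" if "j + k \<notin> {-K..K}" using that by (intro proj_outside) auto
        then show ?thesis by (auto simp: sum.delta')
      qed
      also have "\<dots> = br \<rho> (proj (j + k) T)" using proj_gr[of "j + k" T] by (simp add: gr_def)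
      finally show ?thesis .
    qed
    then have p3: "proj (j + k) (br \<rho> T) = sc (of_int (j + k)) (proj (j + k) T)"
      using proj_gr[of "j + k" T] by (simp add: gr_def)
    have "sc (of_int j) (proj (j + k) T) = sc (of_int (j + k)) (proj (j + k) T) + br z v"
      using arg_cong[OF eq, of "proj (j + k)"] p1 p2 p3 by simp
    then have "sc (of_int k) (proj (j + k) T) = - br z v"
      by (simp add: scale_left_distrib eq_neg_iff_add_eq_0)
    then have "proj (j + k) T = sc (1 / of_int k) (- br z v)"
      using k by (metis scale_scale scale_one nonzero_divide_eq_eq of_int_eq_0_iff not_one_le_zero)
    then have pT: "proj (j + k) T = br y v" by (simp add: y_def bracket_scale_left br_neg)
    have "T - br y v \<in> Fil (j + k + 1)" unfolding pT[symmetric] by (rule Fil_split[OF TF])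
    then show ?thesis by (simp add: T_def)
  qed
  have "g v - v - br y v \<in> Fil (j + k + 1)" if "v \<in> Fil j" for v j
    using that
  proof (induction rule: Fil_induct)
    case zero
    then show ?case by (simp add: lin_0[OF AutD(1)[OF g]] Fil_subspace_rules)
  next
    case (add v w)
    have "(g v - v - br y v) + (g w - w - br y w) \<in> Fil (j + k + 1)"
      by (rule Fil_subspace_rules(2)[OF add])
    then show ?case by (simp add: lin_add[OF AutD(1)[OF g]] bracket_add_right algebra_simps)
  next
    case (gr i v)
    then show ?case using homog[OF gr(2)] Fil_mono[of "j + k + 1" "i + k + 1"] by simp
  qed
  then show ?thesis using ygr by (auto simp: lead_def)
qed

lemma lead_comp: "lead k g y \<Longrightarrow> lead k h w \<Longrightarrow> k \<ge> 1 \<Longrightarrow> lead k (g \<circ> h) (y + w)"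
  unfolding lead_def
proof (intro conjI allI ballI)
  assume g: "y \<in> gr k \<and> (\<forall>j. \<forall>v\<in>Fil j. g v - v - br y v \<in> Fil (j + k + 1))"
    and h: "w \<in> gr k \<and> (\<forall>j. \<forall>v\<in>Fil j. h v - v - br w v \<in> Fil (j + k + 1))" and k: "k \<ge> 1"
  show "y + w \<in> gr k" using g h subspace_add[OF subspace_gr] by blast
  fix j v assume v: "v \<in> Fil j"
  have hv: "h v - v \<in> Fil (j + k)" by (rule lead_Fil[of k h w]) (use h v in \<open>auto simp: lead_def\<close>)
  then have "h v - v \<in> Fil j" using k by (intro Fil_mono[of j "j + k"]) auto
  then have "(h v - v) + v \<in> Fil j" using v by (rule Fil_subspace_rules(2))
  then have hvF: "h v \<in> Fil j" by simp
  have "br y (h v - v) \<in> Fil (k + (j + k))" using g hv by (intro br_Fil gr_Fil[of y k]) auto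
  then have a: "br y (h v - v) \<in> Fil (j + k + 1)" by (rule Fil_mono[rotated]) (use k in simp)
  have "(g (h v) - h v - br y (h v)) + (h v - v - br w v) + br y (h v - v) \<in> Fil (j + k + 1)"
    by (intro Fil_subspace_rules(2)[OF Fil_subspace_rules(2)] a) (use g h v hvF in auto)
  then show "(g \<circ> h) v - v - br (y + w) v \<in> Fil (j + k + 1)"
    by (simp add: bracket_add_left br_diff algebra_simps)
qed

lemma lead_id: "lead k id 0"
  by (simp add: lead_def subspace_0[OF subspace_gr] Fil_subspace_rules)

lemma lead_inv: "g \<in> UAut \<Longrightarrow> lead k g y \<Longrightarrow> k \<ge> 1 \<Longrightarrow> lead k (ginv g) (- y)"
  unfolding lead_def
proof (intro conjI allI ballI)
  assume g: "g \<in> UAut" and l: "y \<in> gr k \<and> (\<forall>j. \<forall>v\<in>Fil j. g v - v - br y v \<in> Fil (j + k + 1))" and k: "k \<ge> 1"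
  show "- y \<in> gr k" using l subspace_neg[OF subspace_gr] by blast
  fix j v assume v: "v \<in> Fil j"
  define w where "w = ginv g v"
  have gw: "g w = v" using g by (simp add: w_def UAut_def Aut_inverse)
  have w: "w \<in> Fil j" unfolding w_def by (rule UAut_Fil[OF UAut_inv[OF g] v])
  have "g w - w \<in> Fil (j + k)" by (rule lead_Fil[of k g y]) (use l w in \<open>auto simp: lead_def\<close>)
  then have "br y (g w - w) \<in> Fil (k + (j + k))" using l by (intro br_Fil gr_Fil[of y k]) auto
  then have "br y (g w - w) \<in> Fil (j + k + 1)" by (rule Fil_mono[rotated]) (use k in simp)
  then have "br y (g w - w) - (g w - w - br y w) \<in> Fil (j + k + 1)"
    by (rule Fil_subspace_rules(3)) (use l w in auto)
  then show "ginv g v - v - br (- y) v \<in> Fil (j + k + 1)"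
    unfolding gw w_def[symmetric] by (simp add: br_neg br_diff algebra_simps)
qed

lemma lead_Ad: assumes y: "y \<in> gr k" and k: "k \<ge> 1" shows "lead k (Ad y) y"
  unfolding lead_def
proof (intro conjI allI ballI y)
  fix j v assume v: "v \<in> Fil j"
  have y1: "y \<in> Fil 1" by (rule gr_Fil[OF y k])
  have d2: "dpow y n v \<in> Fil (j + k + 1)" if n: "n \<ge> 2" for n
  proof -
    have "(br y ^^ n) v \<in> Fil (j + int n * k)" by (intro br_pow_Fil gr_Fil[OF y] v) simp
    moreover have "int n * k \<ge> k + 1"
    proof -
      have "2 * k \<le> int n * k" using n k by (intro mult_right_mono) auto
      then show ?thesis using k by linarith
    qed
    ultimately show ?thesis unfolding dpow_def by (intro Fil_subspace_rules(4)) (rule Fil_mono[rotated], assumption, simp)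
  qed
  have "Ad y v = (\<Sum>n\<le>NN + 1. dpow y n v)"
    by (simp add: Ad_nilpotent[OF y1] dpow_zero[OF y1])
  also have "\<dots> = v + br y v + (\<Sum>n\<in>{2..NN + 1}. dpow y n v)"
  proof -
    have "{..NN + 1} = {0, 1} \<union> {2..NN + 1}" by auto
    then show ?thesis by (simp add: sum.union_disjoint) (simp add: dpow_def)
  qed
  finally have "Ad y v - v - br y v = (\<Sum>n\<in>{2..NN + 1}. dpow y n v)" by simp
  also have "\<dots> \<in> Fil (j + k + 1)" by (intro Fil_sum d2) simp
  finally show "Ad y v - v - br y v \<in> Fil (j + k + 1)" .
qed

text \<open>In leading order, \<open>(1 + X)(1 + Z)(1 + X)\<^sup>-\<^sup>1(1 + Z)\<^sup>-\<^sup>1\<close> is \<open>1 + [X, Z]\<close>.\<close>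

lemma lead_commutator:
  assumes a: "a \<in> UAut" "lead 1 a x" and b: "b \<in> UAut" "lead k b z" and k: "k \<ge> 1"
  shows "lead (k + 1) (a \<circ> b \<circ> ginv a \<circ> ginv b) (br x z)"
  unfolding lead_def
proof (intro conjI allI ballI)
  have x: "x \<in> gr 1" and z: "z \<in> gr k" using a b by (auto simp: lead_def)
  show "br x z \<in> gr (k + 1)" using br_gr[OF x z] by (simp add: add.commute)
  fix j v assume v: "v \<in> Fil j"
  have aA: "a \<in> Aut" and bA: "b \<in> Aut" using a b by (auto simp: UAut_def)
  define w where "w = ginv a (ginv b v)"
  have w: "w \<in> Fil j" unfolding w_def by (intro UAut_Fil[OF UAut_inv] a b v)
  have vw: "v = b (a w)" by (simp add: w_def Aut_inverse aA bA)
  define P where "P = (\<lambda>u. a u - u)"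
  define Q where "Q = (\<lambda>u. b u - u)"
  have P: "P u - br x u \<in> Fil (i + 2)" if "u \<in> Fil i" for u i
    using a(2) that unfolding lead_def P_def by (metis add.assoc one_add_one)
  have Q: "Q u - br z u \<in> Fil (i + k + 1)" if "u \<in> Fil i" for u i
    using b(2) that by (auto simp: lead_def Q_def)
  have PF: "P u \<in> Fil (i + 1)" if "u \<in> Fil i" for u i unfolding P_def by (rule lead_Fil[OF a(2) that])
  have QF: "Q u \<in> Fil (i + k)" if "u \<in> Fil i" for u i unfolding Q_def by (rule lead_Fil[OF b(2) that])
  have xF: "br x u \<in> Fil (i + 1)" if "u \<in> Fil i" for u i
    using br_Fil[OF gr_Fil[OF x order_refl] that] by (simp add: add.commute)
  have zF: "br z u \<in> Fil (i + k)" if "u \<in> Fil i" for u i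
    using br_Fil[OF gr_Fil[OF z order_refl] that] by (simp add: add.commute)
  let ?n = "j + (k + 1) + 1"
  have t1: "P (Q w) - br x (Q w) \<in> Fil ?n"
    using P[OF QF[OF w]] by (rule Fil_mono[rotated]) simp
  have t2: "br x (Q w - br z w) \<in> Fil ?n"
    using xF[OF Q[OF w]] by (rule Fil_mono[rotated]) simp
  have t3: "Q (P w) - br z (P w) \<in> Fil ?n"
    using Q[OF PF[OF w]] by (rule Fil_mono[rotated]) simp
  have t4: "br z (P w - br x w) \<in> Fil ?n"
    using zF[OF P[OF w]] by (rule Fil_mono[rotated]) simp
  have "v - w = Q (a w) + P w" by (simp add: vw P_def Q_def)
  moreover have "a w \<in> Fil j" by (rule UAut_Fil[OF a(1) w])
  then have "Q (a w) \<in> Fil (j + 1)" using QF k by (intro Fil_mono[of "j + 1" "j + k"]) auto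
  ultimately have "v - w \<in> Fil (j + 1)" using PF[OF w] Fil_subspace_rules(2) by metis
  then have "br (br x z) (v - w) \<in> Fil ((1 + k) + (j + 1))"
    by (intro br_Fil gr_Fil[OF br_gr[OF x z]]) simp
  then have t5: "br (br x z) (v - w) \<in> Fil ?n" by (simp add: algebra_simps)
  have "(a \<circ> b \<circ> ginv a \<circ> ginv b) v - v = a (b w) - b (a w)" using vw by (simp add: w_def)
  also have "\<dots> = P (Q w) - Q (P w)"
    by (simp add: P_def Q_def lin_diff[OF AutD(1)[OF aA]] lin_diff[OF AutD(1)[OF bA]])
  finally have "(a \<circ> b \<circ> ginv a \<circ> ginv b) v - v - br (br x z) v =
     ((P (Q w) - br x (Q w)) + br x (Q w - br z w)) - ((Q (P w) - br z (P w)) + br z (P w - br x w)) - br (br x z) (v - w)"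
    by (simp add: br_diff br_br_left algebra_simps)
  also have "\<dots> \<in> Fil ?n" by (intro Fil_subspace_rules(2,3) t1 t2 t3 t4 t5)
  finally show "(a \<circ> b \<circ> ginv a \<circ> ginv b) v - v - br (br x z) v \<in> Fil ?n" .
qed

text \<open>Leading terms add up under multiplication. So degree one is covered by the generators, and
  commutators with \<open>exp e\<^sub>i\<close> lead from one degree to the next by \<open>gr_generated\<close>.\<close>

lemma leading_terms_of_Egrp: "y \<in> gr (int (Suc k)) \<Longrightarrow> \<exists>h\<in>Egrp. lead (int (Suc k)) h y"
proof (induction k arbitrary: y)
  case 0
  then have "y \<in> span (range E)" using gr1_eq by simp
  then have "\<exists>h\<in>Egrp. lead 1 h y"
  proof (induction rule: span_induct_alt)
    case base
    then show ?case using lead_id Egrp_id by blast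
  next
    case (step c x y)
    then obtain i h where h: "x = E i" "h \<in> Egrp" "lead 1 h y" by blast
    then have "lead 1 (Ad (sc c (E i)) \<circ> h) (sc c (E i) + y)" by (intro lead_comp lead_Ad cE_gr) auto
    then show ?case using h Egrp_step by blast
  qed
  then show ?case by simp
next
  case (Suc k)
  let ?k = "int (Suc k)"
  have "y \<in> span {br (E i) z |i z. z \<in> gr ?k}"
    using gr_generated[of "int (Suc (Suc k))"] Suc.prems by auto
  then have "\<exists>h\<in>Egrp. lead (?k + 1) h y"
  proof (induction rule: span_induct_alt)
    case base
    then show ?case using lead_id Egrp_id by blast
  next
    case (step c x y)
    then obtain i z h where h: "x = br (E i) z" "z \<in> gr ?k" "h \<in> Egrp" "lead (?k + 1) h y" by blast
    have "sc c z \<in> gr ?k" using h(2) subspace_scale[OF subspace_gr] by blast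
    then obtain b where b: "b \<in> Egrp" "lead ?k b (sc c z)" using Suc.IH by blast
    have a: "Ad (sc 1 (E i)) \<in> Egrp" using Egrp_step[OF Egrp_id, of 1 i] by simp
    let ?c = "Ad (sc 1 (E i)) \<circ> b \<circ> ginv (Ad (sc 1 (E i))) \<circ> ginv b"
    have "lead (?k + 1) ?c (br (sc 1 (E i)) (sc c z))"
      by (rule lead_commutator[OF Egrp_UAut[OF a] lead_Ad[OF cE_gr] Egrp_UAut[OF b(1)] b(2)]) auto
    then have "lead (?k + 1) (?c \<circ> h) (sc c x + y)"
      using h by (intro lead_comp) (auto simp: bracket_scale_right)
    moreover have "?c \<circ> h \<in> Egrp" by (intro Egrp_comp Egrp_inv a b h)
    ultimately show ?case by blast
  qed
  then show ?case by (simp add: add.commute)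
qed

text \<open>Divide by an element of the subgroup with the same leading term, until the filtration is
  exhausted.\<close>

lemma UAut_Egrp: assumes "g \<in> UAut" shows "g \<in> Egrp"
proof -
  have "g \<in> Egrp" if "g \<in> UAut" "k \<ge> 1" "\<And>j v. v \<in> Fil j \<Longrightarrow> g v - v \<in> Fil (j + k)" for g k
    using that
  proof (induction "nat (2 * K + 1 - k)" arbitrary: g k)
    case 0
    have "g v - v \<in> Fil (- K + k)" for v using 0(4)[of v "- K"] Fil_bottom[of "- K" v] by simp
    then have "g v - v = 0" for v using Fil_top[of "- K + k" "g v - v"] 0(1) by simp
    then have "g = id" by (auto simp: id_def)
    then show ?case using Egrp_id by (simp only:)
  next
    case (Suc m)
    have gA: "g \<in> Aut" using Suc.prems by (simp add: UAut_def)
    obtain y where y: "lead k g y" using lead_exists[OF gA Suc.prems(2,3)] by blast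
    have "k = int (Suc (nat (k - 1)))" using Suc.prems(2) by simp
    then obtain h where h: "h \<in> Egrp" "lead k h y"
      using leading_terms_of_Egrp[of y "nat (k - 1)"] y by (metis lead_def)
    have "lead k (ginv h \<circ> g) (- y + y)"
      by (intro lead_comp lead_inv Egrp_UAut h y Suc.prems(2))
    then have l: "\<And>j v. v \<in> Fil j \<Longrightarrow> (ginv h \<circ> g) v - v \<in> Fil (j + (k + 1))"
      by (auto simp: lead_def add.assoc)
    have U: "ginv h \<circ> g \<in> UAut" by (rule UAut_comp[OF UAut_inv[OF Egrp_UAut[OF h(1)]] Suc.prems(1)])
    have "ginv h \<circ> g \<in> Egrp"
      by (rule Suc.hyps(1)[of "k + 1", OF _ U _ l]) (use Suc.hyps(2) Suc.prems(2) in simp_all)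
    then have "h \<circ> (ginv h \<circ> g) \<in> Egrp" by (rule Egrp_comp[OF h(1)])
    moreover have "h \<circ> (ginv h \<circ> g) = g"
      using Egrp_UAut[OF h(1)] by (auto simp: UAut_def Aut_inverse)
    ultimately show ?case by simp
  qed
  from this[of g 1] show ?thesis using assms by (simp add: UAut_def)
qed

lemma unipotent_group_eq: "unipotent_group L = UAut"
  using unipotent_group_UAut UAut_Egrp Egrp_unipotent by blast

end

section \<open>Loops\<close>

context simple_lie begin

text \<open>Elements of \<open>\<gg>[[t]]\<close> are sequences of coefficients. The next definitions are multiplication
  by a power series, the bracket, \<open>\<partial>\<^sub>t\<close>, the constant series, and the coefficientwise extension of
  an operator on \<open>\<gg>\<close>.\<close>

definition tmul :: "complex fps \<Rightarrow> (nat \<Rightarrow> 'g) \<Rightarrow> nat \<Rightarrow> 'g" where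
  "tmul c v n = (\<Sum>i\<le>n. sc (c $ i) (v (n - i)))"

definition sbr :: "(nat \<Rightarrow> 'g) \<Rightarrow> (nat \<Rightarrow> 'g) \<Rightarrow> nat \<Rightarrow> 'g" where
  "sbr v w n = (\<Sum>i\<le>n. br (v i) (w (n - i)))"

definition sder :: "(nat \<Rightarrow> 'g) \<Rightarrow> nat \<Rightarrow> 'g" where
  "sder v n = sc (of_nat (Suc n)) (v (Suc n))"

definition cst :: "'g \<Rightarrow> nat \<Rightarrow> 'g" where
  "cst y n = (if n = 0 then y else 0)"

definition liftop :: "('g \<Rightarrow> 'g) \<Rightarrow> (nat \<Rightarrow> 'g) \<Rightarrow> nat \<Rightarrow> 'g" where
  "liftop T v n = T (v n)"

text \<open>Coordinates turn identities in \<open>\<gg>[[t]]\<close> into identities in the ring \<open>\<complex>[[t]]\<close>.\<close>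

definition coord :: "(nat \<Rightarrow> 'g) \<Rightarrow> 'g \<Rightarrow> complex fps" where
  "coord v b = Abs_fps (\<lambda>n. rep (v n) b)"

lemma coord_eqI: "(\<And>b. b \<in> WB \<Longrightarrow> coord v b = coord w b) \<Longrightarrow> v = w"
proof
  fix n assume a: "\<And>b. b \<in> WB \<Longrightarrow> coord v b = coord w b"
  show "v n = w n"
  proof (rule rep_eqI)
    fix b assume "b \<in> WB"
    from arg_cong[OF a[OF this], of "\<lambda>f. f $ n"] show "rep (v n) b = rep (w n) b" by (simp add: coord_def)
  qed
qed

lemma rep_minus: "rep (v - w) b = rep v b - rep w b" "rep (- v) b = - rep v b"
  using lf_diff[OF linear_form_rep] lf_neg[OF linear_form_rep] by auto

lemma coord_add: "coord (v + w) b = coord v b + coord w b"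
  by (rule fps_ext) (simp add: coord_def rep_add)

lemma coord_diff: "coord (v - w) b = coord v b - coord w b"
  by (rule fps_ext) (simp add: coord_def rep_minus)

lemma coord_neg: "coord (- v) b = - coord v b"
  by (rule fps_ext) (simp add: coord_def rep_minus)

lemma coord_0: "coord 0 b = 0"
  by (rule fps_ext) (simp add: coord_def)

lemma coord_sum: "coord (sum f A) b = (\<Sum>a\<in>A. coord (f a) b)"
  using sum_comp_morphism[of "\<lambda>v. coord v b" f A] by (simp add: coord_0 coord_add comp_def)

lemma coord_tmul: "coord (tmul c v) b = c * coord v b"
  by (rule fps_ext) (simp add: coord_def tmul_def fps_mult_nth rep_linear_sum rep_scale atLeast0AtMost)

lemma coord_sder: "coord (sder v) b = fps_deriv (coord v b)"
  by (rule fps_ext) (simp add: coord_def sder_def rep_scale)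

lemma coord_cst: "b \<in> WB \<Longrightarrow> coord (cst b) c = (if c = b then 1 else 0)"
  by (rule fps_ext) (simp add: coord_def cst_def rep_basis)

lemma linear_form_bracket:
  assumes u: "linear_form L u"
  shows "u (br s t) = (\<Sum>b\<in>WB. \<Sum>c\<in>WB. u (br b c) * rep s b * rep t c)"
proof -
  have "u (br s t) = u (br (\<Sum>b\<in>WB. sc (rep s b) b) (\<Sum>c\<in>WB. sc (rep t c) c))" by (simp only: rep_sum)
  then show ?thesis
    by (simp only: br_sum bracket_scale_left bracket_scale_right scale_sum_right lf_sum[OF u] lf_scale[OF u])
       (subst sum.swap, simp add: mult_ac)
qed

lemma coord_sbr: "coord (sbr v w) b = (\<Sum>c\<in>WB. \<Sum>d\<in>WB. fps_const (rep (br c d) b) * coord v c * coord w d)"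
proof (rule fps_ext)
  fix n
  have "coord (sbr v w) b $ n = (\<Sum>i\<le>n. \<Sum>c\<in>WB. \<Sum>d\<in>WB. rep (br c d) b * rep (v i) c * rep (w (n - i)) d)"
    unfolding coord_def sbr_def fps_nth_Abs_fps rep_linear_sum
    by (intro sum.cong refl linear_form_bracket[OF linear_form_rep])
  also have "\<dots> = (\<Sum>c\<in>WB. \<Sum>i\<le>n. \<Sum>d\<in>WB. rep (br c d) b * rep (v i) c * rep (w (n - i)) d)" by (rule sum.swap)
  also have "\<dots> = (\<Sum>c\<in>WB. \<Sum>d\<in>WB. \<Sum>i\<le>n. rep (br c d) b * rep (v i) c * rep (w (n - i)) d)"
    by (intro sum.cong refl sum.swap)
  also have "\<dots> = (\<Sum>c\<in>WB. \<Sum>d\<in>WB. fps_const (rep (br c d) b) * coord v c * coord w d) $ n"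
    unfolding fps_sum_nth mult.assoc fps_mult_left_const_nth
    by (simp add: fps_mult_nth coord_def atLeast0AtMost sum_distrib_left)
  finally show "coord (sbr v w) b $ n = (\<Sum>c\<in>WB. \<Sum>d\<in>WB. fps_const (rep (br c d) b) * coord v c * coord w d) $ n" .
qed

lemma tmul_simps:
  "tmul c (v + w) = tmul c v + tmul c w" "tmul (c + d) v = tmul c v + tmul d v"
  "tmul c (tmul d v) = tmul (c * d) v" "tmul 1 v = v" "tmul 0 v = 0" "tmul c 0 = 0"
  "tmul c (v - w) = tmul c v - tmul c w" "tmul (- c) v = - tmul c v"
  by (rule coord_eqI, simp add: coord_add coord_diff coord_neg coord_tmul coord_0 algebra_simps)+

lemma tmul_sum: "tmul c (sum f A) = (\<Sum>a\<in>A. tmul c (f a))"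
  using sum_comp_morphism[of "tmul c" f A] by (simp add: tmul_simps(1,6) comp_def)

lemma sder_simps:
  "sder (v + w) = sder v + sder w" "sder (v - w) = sder v - sder w" "sder 0 = 0" "sder (cst y) = 0"
  "sder (tmul c v) = tmul (fps_deriv c) v + tmul c (sder v)"
      apply (rule coord_eqI, simp add: coord_add coord_diff coord_0 coord_sder)
     apply (rule coord_eqI, simp add: coord_add coord_diff coord_0 coord_sder)
    apply (rule coord_eqI, simp add: coord_add coord_diff coord_0 coord_sder)
   apply (rule ext, simp add: sder_def cst_def)
  apply (rule coord_eqI, simp add: coord_add coord_sder coord_tmul)
  done

lemma sbr_simps:
  "sbr (v + w) x = sbr v x + sbr w x" "sbr x (v + w) = sbr x v + sbr x w"
  "sbr (v - w) x = sbr v x - sbr w x" "sbr x (v - w) = sbr x v - sbr x w"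
  "sbr (tmul c v) w = tmul c (sbr v w)" "sbr v (tmul c w) = tmul c (sbr v w)"
  "sbr 0 v = 0" "sbr v 0 = 0"
  by (rule coord_eqI, simp add: coord_add coord_diff coord_0 coord_sbr coord_tmul distrib_left distrib_right sum.distrib
      sum_subtractf right_diff_distrib left_diff_distrib sum_distrib_left mult_ac)+

lemma sbr_sum: "sbr (sum f A) v = (\<Sum>a\<in>A. sbr (f a) v)" "sbr v (sum f A) = (\<Sum>a\<in>A. sbr v (f a))"
  using sum_comp_morphism[of "\<lambda>w. sbr w v" f A] sum_comp_morphism[of "sbr v" f A]
  by (simp_all add: sbr_simps(1,2,7,8) comp_def)

lemma sbr_anti: "sbr v w = - sbr w v"
proof (rule coord_eqI)
  fix b
  have "coord (- sbr w v) b = (\<Sum>c\<in>WB. \<Sum>d\<in>WB. - (fps_const (rep (br c d) b) * coord w c * coord v d))"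
    by (simp add: coord_neg coord_sbr sum_negf)
  also have "\<dots> = (\<Sum>d\<in>WB. \<Sum>c\<in>WB. - (fps_const (rep (br c d) b) * coord w c * coord v d))" by (rule sum.swap)
  also have "\<dots> = (\<Sum>d\<in>WB. \<Sum>c\<in>WB. fps_const (rep (br d c) b) * coord v d * coord w c)"
  proof (intro sum.cong refl)
    fix c d
    have "rep (br d c) b = - rep (br c d) b" using br_anti[of d c] by (simp add: rep_minus)
    then show "- (fps_const (rep (br c d) b) * coord w c * coord v d) = fps_const (rep (br d c) b) * coord v d * coord w c"
      by (simp add: fps_const_neg[symmetric] mult_ac del: fps_const_neg)
  qed
  finally show "coord (sbr v w) b = coord (- sbr w v) b" by (simp add: coord_sbr)
qed

lemma sbr_self: "sbr v v = 0"
proof -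
  have "coord (sbr v v) b = 0" for b
    using arg_cong[OF sbr_anti[of v v], of "\<lambda>x. coord x b"] by (simp add: coord_neg)
  then show ?thesis by (intro coord_eqI) (simp add: coord_0)
qed

lemma sbr_cst: "sbr (cst y) v = liftop (br y) v"
proof
  fix n
  have "(\<Sum>i\<le>n. br (cst y i) (v (n - i))) = (\<Sum>i\<le>n. if i = 0 then br y (v n) else 0)"
    by (intro sum.cong) (auto simp: cst_def)
  then show "sbr (cst y) v n = liftop (br y) v n" by (simp add: sbr_def liftop_def)
qed

lemma sbr_cst_right: "sbr v (cst y) = (\<lambda>n. br (v n) y)"
proof -
  have "sbr v (cst y) = - liftop (br y) v" using sbr_anti[of v "cst y"] by (simp add: sbr_cst)
  then show ?thesis by (auto simp: liftop_def br_anti[of y])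
qed

lemma liftop_simps:
  assumes "lin T"
  shows "liftop T (v + w) = liftop T v + liftop T w" "liftop T (tmul c v) = tmul c (liftop T v)"
    "liftop T (cst y) = cst (T y)" "liftop T (sder v) = sder (liftop T v)" "liftop T (v - w) = liftop T v - liftop T w"
  by (auto simp: liftop_def tmul_def cst_def sder_def lin_add[OF assms] lin_sum[OF assms] lin_scale[OF assms]
      lin_0[OF assms] lin_diff[OF assms])

lemma series_expand: "v = (\<Sum>b\<in>WB. tmul (coord v b) (cst b))"
proof (rule coord_eqI)
  fix c assume c: "c \<in> WB"
  have "coord (\<Sum>b\<in>WB. tmul (coord v b) (cst b)) c = (\<Sum>b\<in>WB. if b = c then coord v c else 0)"
    unfolding coord_sum by (intro sum.cong refl) (auto simp: coord_tmul coord_cst)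
  then show "coord v c = coord (\<Sum>b\<in>WB. tmul (coord v b) (cst b)) c" using c finite_WB by simp
qed

definition tlin :: "((nat \<Rightarrow> 'g) \<Rightarrow> nat \<Rightarrow> 'g) \<Rightarrow> bool" where
  "tlin T \<longleftrightarrow> (\<forall>v w. T (v + w) = T v + T w) \<and> (\<forall>c v. T (tmul c v) = tmul c (T v))"

lemma tlinD: assumes "tlin T"
  shows "T (v + w) = T v + T w" "T (tmul c v) = tmul c (T v)" "T 0 = 0" "T (v - w) = T v - T w"
    "T (sum f A) = (\<Sum>a\<in>A. T (f a))" "T (- v) = - T v"
proof -
  show add: "T (v + w) = T v + T w" for v w using assms by (simp add: tlin_def)
  show mul: "T (tmul c v) = tmul c (T v)" for c v using assms by (simp add: tlin_def)
  show z: "T 0 = 0" using mul[of 0 0] by (simp add: tmul_simps)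
  show neg: "T (- v) = - T v" for v using mul[of "- 1" v] by (simp add: tmul_simps)
  show "T (v - w) = T v - T w" using add[of v "- w"] neg by simp
  show "T (sum f A) = (\<Sum>a\<in>A. T (f a))"
    using sum_comp_morphism[of T f A] by (simp add: z add comp_def)
qed

lemma tlin_ext:
  assumes "tlin S" "tlin T" "\<And>b. b \<in> WB \<Longrightarrow> S (cst b) = T (cst b)"
  shows "S v = T v"
proof -
  have "S (\<Sum>b\<in>WB. tmul (coord v b) (cst b)) = T (\<Sum>b\<in>WB. tmul (coord v b) (cst b))"
    by (simp add: tlinD(5)[OF assms(1)] tlinD(5)[OF assms(2)] tlinD(2)[OF assms(1)] tlinD(2)[OF assms(2)] assms(3))
  then show ?thesis by (simp only: series_expand[symmetric])
qed

lemma tlin_liftop: "lin T \<Longrightarrow> tlin (liftop T)"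
  by (simp add: tlin_def liftop_simps)

definition SFil :: "int \<Rightarrow> (nat \<Rightarrow> 'g) set" where
  "SFil k = {v. \<forall>n. v n \<in> Fil k}"

lemma SFil_rules:
  "0 \<in> SFil k" "v \<in> SFil k \<Longrightarrow> w \<in> SFil k \<Longrightarrow> v + w \<in> SFil k" "v \<in> SFil k \<Longrightarrow> w \<in> SFil k \<Longrightarrow> v - w \<in> SFil k"
  "v \<in> SFil k \<Longrightarrow> tmul c v \<in> SFil k" "v \<in> SFil k \<Longrightarrow> - v \<in> SFil k" "y \<in> Fil k \<Longrightarrow> cst y \<in> SFil k"
  "v \<in> SFil k \<Longrightarrow> sder v \<in> SFil k"
  by (auto simp: SFil_def tmul_def cst_def sder_def intro!: Fil_subspace_rules(2-5) Fil_sum) (auto simp: Fil_subspace_rules(1))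

lemma SFil_sum: "(\<And>a. a \<in> A \<Longrightarrow> f a \<in> SFil k) \<Longrightarrow> sum f A \<in> SFil k"
  by (induction A rule: infinite_finite_induct) (auto simp: SFil_rules)

lemma SFil_mono: "j \<le> k \<Longrightarrow> v \<in> SFil k \<Longrightarrow> v \<in> SFil j"
  using Fil_mono by (auto simp: SFil_def)

lemma SFil_top: "k > K \<Longrightarrow> v \<in> SFil k \<Longrightarrow> v = 0"
  using Fil_top by (auto simp: SFil_def)

lemma SFil_bottom: "k \<le> - K \<Longrightarrow> v \<in> SFil k"
  using Fil_bottom by (auto simp: SFil_def)

lemma SFil_coord: "v \<in> SFil k \<Longrightarrow> b \<in> WB \<Longrightarrow> dg b < k \<Longrightarrow> coord v b = 0"
proof (rule fps_ext)
  fix n assume v: "v \<in> SFil k" and b: "b \<in> WB" "dg b < k"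
  have "proj (dg b) (v n) = 0" using v b by (auto simp: SFil_def Fil_def)
  then have "rep (proj (dg b) (v n)) b = 0" by simp
  moreover have "rep (proj (dg b) (v n)) b = (\<Sum>c\<in>{c\<in>WB. dg c = dg b}. if c = b then rep (v n) b else 0)"
    unfolding proj_def rep_linear_sum by (intro sum.cong refl) (auto simp: rep_scale rep_basis)
  ultimately show "coord v b $ n = 0 $ n" using b finite_WB by (simp add: coord_def)
qed

text \<open>The unipotent automorphisms of the \<open>\<complex>[[t]]\<close>-Lie algebra \<open>\<gg>[[t]]\<close>. This description of \<open>N[[t]]\<close>
  avoids its polynomial equations.\<close>

definition ULoop :: "((nat \<Rightarrow> 'g) \<Rightarrow> nat \<Rightarrow> 'g) set" where
  "ULoop = {T. tlin T \<and> (\<forall>v w. T (sbr v w) = sbr (T v) (T w)) \<and> (\<forall>k. \<forall>v\<in>SFil k. T v - v \<in> SFil (k + 1))}"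

lemma ULoopD: "T \<in> ULoop \<Longrightarrow> tlin T" "T \<in> ULoop \<Longrightarrow> T (sbr v w) = sbr (T v) (T w)"
  "T \<in> ULoop \<Longrightarrow> v \<in> SFil k \<Longrightarrow> T v - v \<in> SFil (k + 1)"
  by (auto simp: ULoop_def)

lemma ULoop_SFil: "T \<in> ULoop \<Longrightarrow> v \<in> SFil k \<Longrightarrow> T v \<in> SFil k"
proof -
  assume T: "T \<in> ULoop" and v: "v \<in> SFil k"
  have "(T v - v) + v \<in> SFil k"
    using SFil_mono[OF _ ULoopD(3)[OF T v]] v by (intro SFil_rules(2)) auto
  then show ?thesis by simp
qed

text \<open>By linearity it suffices to consider constant series in the basis.\<close>

lemma ULoopI:
  assumes T: "tlin T" and br: "\<And>b c. b \<in> WB \<Longrightarrow> c \<in> WB \<Longrightarrow> T (sbr (cst b) (cst c)) = sbr (T (cst b)) (T (cst c))"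
    and F: "\<And>b. b \<in> WB \<Longrightarrow> T (cst b) - cst b \<in> SFil (dg b + 1)"
  shows "T \<in> ULoop"
proof -
  have "T (sbr v w) = sbr (T v) (T w)" for v w
  proof (rule tlin_ext[of "\<lambda>v. T (sbr v w)" "\<lambda>v. sbr (T v) (T w)"])
    show "tlin (\<lambda>v. T (sbr v w))" "tlin (\<lambda>v. sbr (T v) (T w))"
      by (auto simp: tlin_def sbr_simps tlinD[OF T])
    fix b assume b: "b \<in> WB"
    show "T (sbr (cst b) w) = sbr (T (cst b)) (T w)"
    proof (rule tlin_ext[of "\<lambda>w. T (sbr (cst b) w)" "\<lambda>w. sbr (T (cst b)) (T w)"])
      show "tlin (\<lambda>w. T (sbr (cst b) w))" "tlin (\<lambda>w. sbr (T (cst b)) (T w))"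
        by (auto simp: tlin_def sbr_simps tlinD[OF T])
    qed (rule br[OF b])
  qed
  moreover have "T v - v \<in> SFil (k + 1)" if v: "v \<in> SFil k" for v k
  proof -
    have "T v - v = T (\<Sum>b\<in>WB. tmul (coord v b) (cst b)) - (\<Sum>b\<in>WB. tmul (coord v b) (cst b))"
      by (simp only: series_expand[symmetric])
    also have "\<dots> = (\<Sum>b\<in>WB. tmul (coord v b) (T (cst b) - cst b))"
      by (simp add: tlinD(5)[OF T] tlinD(2)[OF T] tmul_simps sum_subtractf)
    also have "\<dots> \<in> SFil (k + 1)"
    proof (rule SFil_sum)
      fix b assume b: "b \<in> WB"
      show "tmul (coord v b) (T (cst b) - cst b) \<in> SFil (k + 1)"
      proof (cases "dg b < k")
        case True
        then show ?thesis using SFil_coord[OF v b] by (simp add: tmul_simps SFil_rules)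
      next
        case False
        then show ?thesis using F[OF b] SFil_mono[of "k + 1" "dg b + 1"] by (intro SFil_rules(4)) auto
      qed
    qed
    finally show ?thesis .
  qed
  ultimately show ?thesis using T by (simp add: ULoop_def)
qed

lemma ULoop_id: "(\<lambda>v. v) \<in> ULoop"
  by (auto simp: ULoop_def tlin_def SFil_rules)

lemma ULoop_comp: "S \<in> ULoop \<Longrightarrow> T \<in> ULoop \<Longrightarrow> (\<lambda>v. S (T v)) \<in> ULoop"
proof -
  assume S: "S \<in> ULoop" and T: "T \<in> ULoop"
  have "S (T v) - v \<in> SFil (k + 1)" if v: "v \<in> SFil k" for v k
  proof -
    have "(S (T v) - T v) + (T v - v) \<in> SFil (k + 1)"
      by (intro SFil_rules(2) ULoopD(3)[OF S] ULoopD(3)[OF T] ULoop_SFil[OF T] v)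
    then show ?thesis by simp
  qed
  then show ?thesis using S T by (simp add: ULoop_def tlin_def)
qed

lemma ULoop_injective: assumes T: "T \<in> ULoop" and v: "T v = 0" shows "v = 0"
proof -
  have "v \<in> SFil (- K + int n)" for n
  proof (induction n)
    case 0
    then show ?case by (simp add: SFil_bottom)
  next
    case (Suc n)
    have "- (T v - v) \<in> SFil (- K + int n + 1)" by (intro SFil_rules(5) ULoopD(3)[OF T Suc])
    then show ?case using v by (simp add: algebra_simps)
  qed
  from SFil_top[OF _ this[of "nat (2 * K + 1)"]] show ?thesis using K(1) by simp
qed

text \<open>Successive approximation: \<open>w\<close> is its own preimage up to a term in the next step of the
  filtration.\<close>

lemma ULoop_surjective: assumes T: "T \<in> ULoop" and w: "w \<in> SFil k" shows "\<exists>v\<in>SFil k. T v = w"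
  using w
proof (induction "nat (K + 1 - k)" arbitrary: w k)
  case 0
  then have "w = 0" using SFil_top[of k w] by simp
  then show ?case using tlinD(3)[OF ULoopD(1)[OF T]] SFil_rules(1) by blast
next
  case (Suc m)
  have "- (T w - w) \<in> SFil (k + 1)" by (intro SFil_rules(5) ULoopD(3)[OF T Suc.prems])
  then have "w - T w \<in> SFil (k + 1)" by simp
  moreover have "m = nat (K + 1 - (k + 1))" using Suc.hyps(2) by linarith
  ultimately obtain v where v: "v \<in> SFil (k + 1)" "T v = w - T w" using Suc.hyps(1) by blast
  have "T (v + w) = w" using v(2) by (simp add: tlinD(1)[OF ULoopD(1)[OF T]])
  moreover have "v + w \<in> SFil k" using v(1) Suc.prems SFil_mono[of k "k + 1"] by (intro SFil_rules(2)) auto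
  ultimately show ?case by blast
qed

lemma ULoop_inverse:
  assumes T: "T \<in> ULoop"
  obtains S where "S \<in> ULoop" "\<And>v. S (T v) = v" "\<And>v. T (S v) = v"
proof -
  have "\<exists>v. T v = w" for w using ULoop_surjective[OF T SFil_bottom[OF order_refl]] by blast
  then obtain S where TS: "\<And>w. T (S w) = w" by metis
  have inj: "v = w" if "T v = T w" for v w
    using ULoop_injective[OF T, of "v - w"] that by (simp add: tlinD(4)[OF ULoopD(1)[OF T]])
  have ST: "S (T v) = v" for v by (rule inj) (rule TS)
  note tl = tlinD[OF ULoopD(1)[OF T]]
  have "tlin S"
    unfolding tlin_def by (intro conjI allI; rule inj) (simp_all add: tl TS)
  moreover have "S (sbr v w) = sbr (S v) (S w)" for v w
    by (rule inj) (simp add: TS ULoopD(2)[OF T])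
  moreover have "S v - v \<in> SFil (k + 1)" if v: "v \<in> SFil k" for v k
  proof -
    obtain w where w: "w \<in> SFil k" "T w = v" using ULoop_surjective[OF T v] by blast
    then have "S v = w" using ST by auto
    moreover have "- (T w - w) \<in> SFil (k + 1)" by (intro SFil_rules(5) ULoopD(3)[OF T w(1)])
    ultimately show ?thesis using w(2) by simp
  qed
  ultimately have "S \<in> ULoop" by (simp add: ULoop_def)
  then show ?thesis using that ST TS by blast
qed

subsection \<open>Coefficients of loops\<close>

text \<open>A \<open>\<complex>[[t]]\<close>-linear operator on \<open>\<gg>[[t]]\<close> is the same as an element of \<open>End(\<gg>)[[t]]\<close>. Here
  \<open>coeff_op\<close> extracts its coefficients, and \<open>loop_op\<close> recovers the operator.\<close>

definition coeff_op :: "((nat \<Rightarrow> 'g) \<Rightarrow> nat \<Rightarrow> 'g) \<Rightarrow> nat \<Rightarrow> 'g \<Rightarrow> 'g" where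
  "coeff_op T n y = T (cst y) n"

definition loop_op :: "(nat \<Rightarrow> 'g \<Rightarrow> 'g) \<Rightarrow> (nat \<Rightarrow> 'g) \<Rightarrow> nat \<Rightarrow> 'g" where
  "loop_op \<gamma> v n = (\<Sum>i\<le>n. \<gamma> i (v (n - i)))"

lemma cst_add: "cst (x + y) = cst x + cst y" and cst_scale: "cst (sc c x) = tmul (fps_const c) (cst x)"
  and cst_br: "cst (br x y) = sbr (cst x) (cst y)"
proof -
  show "cst (x + y) = cst x + cst y" by (rule ext) (simp add: cst_def)
  show "cst (sc c x) = tmul (fps_const c) (cst x)"
  proof
    fix n
    have "(\<Sum>i\<le>n. sc (fps_const c $ i) (cst x (n - i))) = (\<Sum>i\<le>n. if i = 0 then sc c (cst x n) else 0)"
      by (intro sum.cong) auto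
    then show "cst (sc c x) n = tmul (fps_const c) (cst x) n" by (simp add: tmul_def) (simp add: cst_def)
  qed
  show "cst (br x y) = sbr (cst x) (cst y)" by (simp add: sbr_cst liftop_simps[OF lin_br])
qed

lemma lin_coeff_op: "tlin T \<Longrightarrow> lin (coeff_op T n)"
proof (rule linI)
  assume T: "tlin T"
  show "coeff_op T n (x + y) = coeff_op T n x + coeff_op T n y" for x y by (simp add: coeff_op_def cst_add tlinD[OF T])
  show "coeff_op T n (sc c x) = sc c (coeff_op T n x)" for c x
  proof -
    have "tmul (fps_const c) v n = sc c (v n)" for v
    proof -
      have "(\<Sum>i\<le>n. sc (fps_const c $ i) (v (n - i))) = (\<Sum>i\<le>n. if i = 0 then sc c (v n) else 0)"
        by (intro sum.cong) auto
      then show ?thesis by (simp add: tmul_def)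
    qed
    then show ?thesis by (simp add: coeff_op_def cst_scale tlinD[OF T])
  qed
qed

lemma coeff_op_loop_op: "(\<And>n. lin (\<gamma> n)) \<Longrightarrow> coeff_op (loop_op \<gamma>) = \<gamma>"
proof (intro ext)
  fix n y assume l: "\<And>n. lin (\<gamma> n)"
  have "(\<Sum>i\<le>n. \<gamma> i (cst y (n - i))) = (\<Sum>i\<le>n. if i = n then \<gamma> n y else 0)"
    by (intro sum.cong) (auto simp: cst_def lin_0[OF l])
  then show "coeff_op (loop_op \<gamma>) n y = \<gamma> n y" by (simp add: coeff_op_def loop_op_def)
qed

lemma tlin_loop_op: assumes l: "\<And>n. lin (\<gamma> n)" shows "tlin (loop_op \<gamma>)"
proof -
  have c: "coord (loop_op \<gamma> v) b = (\<Sum>c\<in>WB. Abs_fps (\<lambda>n. rep (\<gamma> n c) b) * coord v c)" for v b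
  proof (rule fps_ext)
    fix n
    have "rep (\<gamma> i (v (n - i))) b = (\<Sum>c\<in>WB. rep (\<gamma> i c) b * rep (v (n - i)) c)" for i
      unfolding mult.commute[of "rep (\<gamma> i _) b"] by (rule rep_lin[OF WB(2) l]) (simp_all add: WB(3))
    then have "coord (loop_op \<gamma> v) b $ n = (\<Sum>i\<le>n. \<Sum>c\<in>WB. rep (\<gamma> i c) b * rep (v (n - i)) c)"
      by (simp add: coord_def loop_op_def rep_linear_sum)
    also have "\<dots> = (\<Sum>c\<in>WB. \<Sum>i\<le>n. rep (\<gamma> i c) b * rep (v (n - i)) c)" by (rule sum.swap)
    also have "\<dots> = (\<Sum>c\<in>WB. Abs_fps (\<lambda>n. rep (\<gamma> n c) b) * coord v c) $ n"
      by (simp add: fps_sum_nth fps_mult_nth coord_def atLeast0AtMost)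
    finally show "coord (loop_op \<gamma> v) b $ n = (\<Sum>c\<in>WB. Abs_fps (\<lambda>n. rep (\<gamma> n c) b) * coord v c) $ n" .
  qed
  show ?thesis
    unfolding tlin_def
    by (intro conjI allI; rule coord_eqI)
       (simp_all add: c coord_add coord_tmul distrib_left sum.distrib sum_distrib_left mult.left_commute)
qed

lemma loop_op_coeff_op: assumes T: "tlin T" shows "loop_op (coeff_op T) = T"
proof
  fix v
  show "loop_op (coeff_op T) v = T v"
  proof (rule tlin_ext[OF tlin_loop_op[OF lin_coeff_op[OF T]] T])
    fix b
    have "loop_op (coeff_op T) (cst b) n = T (cst b) n" for n
      using coeff_op_loop_op[of "coeff_op T", OF lin_coeff_op[OF T]] by (metis coeff_op_def)
    then show "loop_op (coeff_op T) (cst b) = T (cst b)" by blast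
  qed
qed

lemma tlin_nth: "tlin T \<Longrightarrow> T v n = (\<Sum>i\<le>n. coeff_op T i (v (n - i)))"
  using loop_op_coeff_op[of T] by (metis loop_op_def)

lemma coeff_op_comp: "tlin S \<Longrightarrow> coeff_op (\<lambda>v. S (T v)) n y = (\<Sum>i\<le>n. coeff_op S i (coeff_op T (n - i) y))"
  using tlin_nth[of S "T (cst y)" n] by (simp add: coeff_op_def)

definition nabla :: "(nat \<Rightarrow> 'g) \<Rightarrow> (nat \<Rightarrow> 'g) \<Rightarrow> nat \<Rightarrow> 'g" where
  "nabla A v = sder v + sbr A v"

lemma nabla_tmul: "nabla A (tmul c v) = tmul (fps_deriv c) v + tmul c (nabla A v)"
  by (simp add: nabla_def sder_simps sbr_simps tmul_simps algebra_simps)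

lemma nabla_add: "nabla A (v + w) = nabla A v + nabla A w"
  by (simp add: nabla_def sder_simps sbr_simps algebra_simps)

lemma nabla_diff: "nabla A (v - w) = nabla A v - nabla A w"
  by (simp add: nabla_def sder_simps sbr_simps algebra_simps)

text \<open>Both sides are the equation \<open>\<partial>\<^sub>t \<gamma> + ad A' \<gamma> = \<gamma> ad A\<close>, by linearity over \<open>\<complex>[[t]]\<close>.\<close>

lemma gauge_transform_iff:
  assumes T: "tlin T"
  shows "gauge_transform L (coeff_op T) A A' \<longleftrightarrow> (\<forall>v. nabla A' (T v) = T (nabla A v))"
proof -
  have 1: "nabla A' (T (cst y)) n = sc (of_nat (Suc n)) (coeff_op T (Suc n) y) + (\<Sum>i\<le>n. br (A' i) (coeff_op T (n - i) y))" for y n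
    by (simp add: nabla_def sder_def sbr_def coeff_op_def)
  have 2: "T (nabla A (cst y)) n = (\<Sum>i\<le>n. coeff_op T (n - i) (br (A i) y))" for y n
  proof -
    have "T (nabla A (cst y)) n = (\<Sum>i\<le>n. coeff_op T i (br (A (n - i)) y))"
      by (simp add: nabla_def sder_simps sbr_cst_right tlin_nth[OF T])
    also have "\<dots> = (\<Sum>i\<le>n. coeff_op T (n - i) (br (A i) y))"
      by (rule sum.reindex_bij_witness[of _ "\<lambda>i. n - i" "\<lambda>i. n - i"]) auto
    finally show ?thesis .
  qed
  have "gauge_transform L (coeff_op T) A A' \<longleftrightarrow> (\<forall>y. nabla A' (T (cst y)) = T (nabla A (cst y)))"
    unfolding gauge_transform_def fun_eq_iff 1 2 by blast
  also have "\<dots> \<longleftrightarrow> (\<forall>v. nabla A' (T v) = T (nabla A v))"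
  proof
    assume c: "\<forall>y. nabla A' (T (cst y)) = T (nabla A (cst y))"
    let ?D = "\<lambda>v. nabla A' (T v) - T (nabla A v)"
    have "tlin ?D"
      by (auto simp: tlin_def tlinD[OF T] nabla_add nabla_tmul tmul_simps)
    moreover have "tlin (\<lambda>v. 0)" by (simp add: tlin_def tmul_simps)
    ultimately have "?D v = 0" for v by (rule tlin_ext) (simp add: c)
    then show "\<forall>v. nabla A' (T v) = T (nabla A v)" by simp
  qed blast
  finally show ?thesis .
qed

subsection \<open>The group of loops in the unipotent group\<close>

text \<open>The group \<open>N\<close> satisfies the polynomial equations \<open>u(g [x, y]) = u([g x, g y])\<close>, as well as
  \<open>u(g v) = u(v)\<close> for \<open>v\<close> in a step of the filtration and \<open>u\<close> vanishing on the next step. For an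
  element of \<open>End(\<gg>)[[t]]\<close> these equations say that it is in \<open>ULoop\<close>.\<close>

lemma unipotent_loops_ULoop:
  assumes \<gamma>: "\<gamma> \<in> unipotent_loops L" shows "loop_op \<gamma> \<in> ULoop"
proof -
  have l: "lin (\<gamma> n)" for n using \<gamma> by (simp add: unipotent_loops_def)
  let ?f = "\<lambda>(u, y). Abs_fps (\<lambda>n. u (\<gamma> n y))"
  have eqs: "peval fps_const ?f P = 0"
    if "\<forall>(u, y)\<in>pvars P. linear_form L u" "\<And>g. g \<in> UAut \<Longrightarrow> pval (\<lambda>(u, y). u (g y)) P = 0" for P
    using \<gamma> that by (auto simp: unipotent_loops_def unipotent_group_eq)
  let ?r = "\<lambda>b v. rep v b"
  \<comment> \<open>The equation \<open>u(g [x, y]) = \<Sum>b c. u [b, c] * (g x)\<^sub>b * (g y)\<^sub>c\<close>, compared coefficientwise.\<close>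
  have bracket: "u (\<gamma> n (br x y)) = (\<Sum>i\<le>n. u (br (\<gamma> i x) (\<gamma> (n - i) y)))" if u: "linear_form L u" for u n x y
  proof -
    define Q where "Q = (\<Sum>b\<in>WB. \<Sum>c\<in>WB. pconst (u (br b c)) * pvar (?r b, x) * pvar (?r c, y))"
    have "pvars Q \<subseteq> (\<Union>b\<in>WB. pvars (\<Sum>c\<in>WB. pconst (u (br b c)) * pvar (?r b, x) * pvar (?r c, y)))"
      unfolding Q_def by (rule pvars_sum)
    also have "\<dots> \<subseteq> (\<Union>b\<in>WB. \<Union>c\<in>WB. pvars (pconst (u (br b c)) * pvar (?r b, x) * pvar (?r c, y)))"
      by (intro UN_mono order_refl pvars_sum)
    also have "\<dots> \<subseteq> (\<Union>b\<in>WB. \<Union>c\<in>WB. {(?r b, x), (?r c, y)})"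
    proof (intro UN_mono order_refl)
      fix b c
      show "pvars (pconst (u (br b c)) * pvar (?r b, x) * pvar (?r c, y)) \<subseteq> {(?r b, x), (?r c, y)}"
        using pvars_mult[of "pconst (u (br b c)) * pvar (?r b, x)" "pvar (?r c, y)"]
          pvars_mult[of "pconst (u (br b c))" "pvar (?r b, x)"] by auto
    qed
    finally have vQ: "pvars Q \<subseteq> (\<Union>b\<in>WB. \<Union>c\<in>WB. {(?r b, x), (?r c, y)})" .
    have "pvars (pvar (u, br x y) + - Q) \<subseteq> {(u, br x y)} \<union> pvars Q"
      using pvars_add[of "pvar (u, br x y)" "- Q"] unfolding pvars_uminus pvars_pvar .
    then have v: "\<forall>(u, y)\<in>pvars (pvar (u, br x y) + - Q). linear_form L u"
      using vQ u linear_form_rep by fast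
    have "peval fps_const ?f (pvar (u, br x y) + - Q) = 0"
    proof (rule eqs[OF v])
      fix g assume "g \<in> UAut"
      then have "u (g (br x y)) = u (br (g x) (g y))" by (simp add: UAut_def AutD)
      then show "pval (\<lambda>(u, y). u (g y)) (pvar (u, br x y) + - Q) = 0"
        by (simp add: Q_def idh.peval_diff idh.peval_sum idh.peval_mult linear_form_bracket[OF u, of "g x"])
    qed
    then have "Abs_fps (\<lambda>n. u (\<gamma> n (br x y))) = (\<Sum>b\<in>WB. \<Sum>c\<in>WB. fps_const (u (br b c)) * coord (\<lambda>n. \<gamma> n x) b * coord (\<lambda>n. \<gamma> n y) c)"
      by (simp add: Q_def fch.peval_diff fch.peval_sum fch.peval_mult coord_def)
    from arg_cong[OF this, of "\<lambda>f. f $ n"]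
    have "u (\<gamma> n (br x y)) = (\<Sum>b\<in>WB. \<Sum>c\<in>WB. \<Sum>i\<le>n. u (br b c) * rep (\<gamma> i x) b * rep (\<gamma> (n - i) y) c)"
      unfolding fps_sum_nth mult.assoc fps_mult_left_const_nth
      by (simp add: fps_mult_nth coord_def atLeast0AtMost sum_distrib_left)
    also have "\<dots> = (\<Sum>b\<in>WB. \<Sum>i\<le>n. \<Sum>c\<in>WB. u (br b c) * rep (\<gamma> i x) b * rep (\<gamma> (n - i) y) c)"
      by (intro sum.cong refl sum.swap)
    also have "\<dots> = (\<Sum>i\<le>n. \<Sum>b\<in>WB. \<Sum>c\<in>WB. u (br b c) * rep (\<gamma> i x) b * rep (\<gamma> (n - i) y) c)" by (rule sum.swap)
    also have "\<dots> = (\<Sum>i\<le>n. u (br (\<gamma> i x) (\<gamma> (n - i) y)))"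
      by (intro sum.cong refl linear_form_bracket[OF u, symmetric])
    finally show ?thesis .
  qed
  have fil: "u (\<gamma> n v) = (if n = 0 then u v else 0)"
    if u: "linear_form L u" and uF: "\<And>w. w \<in> Fil (k + 1) \<Longrightarrow> u w = 0" and v: "v \<in> Fil k" for u n v k
  proof -
    have "pvars (pvar (u, v) + pconst (- u v)) \<subseteq> {(u, v)}"
      using pvars_add[of "pvar (u, v)" "pconst (- u v)"] by simp
    then have vv: "\<forall>(u, y)\<in>pvars (pvar (u, v) + pconst (- u v)). linear_form L u" using u by fast
    have "peval fps_const ?f (pvar (u, v) + pconst (- u v)) = 0"
    proof (rule eqs[OF vv])
      fix g assume "g \<in> UAut"
      then have "u (g v - v) = 0" using uF v by (simp add: UAut_def)
      then show "pval (\<lambda>(u, y). u (g y)) (pvar (u, v) + pconst (- u v)) = 0"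
        by (simp add: idh.peval_add lf_diff[OF u])
    qed
    then have "Abs_fps (\<lambda>n. u (\<gamma> n v)) + fps_const (- u v) = 0" by (simp add: fch.peval_add)
    from arg_cong[OF this, of "\<lambda>f. f $ n"] show ?thesis by (simp split: if_splits)
  qed
  show ?thesis
  proof (rule ULoopI[OF tlin_loop_op[OF l]])
    have c: "loop_op \<gamma> (cst y) n = \<gamma> n y" for y n using coeff_op_loop_op[of \<gamma>, OF l] by (metis coeff_op_def)
    fix b assume b: "b \<in> WB"
    show "loop_op \<gamma> (sbr (cst b) (cst c')) = sbr (loop_op \<gamma> (cst b)) (loop_op \<gamma> (cst c'))" for c'
    proof
      fix n
      show "loop_op \<gamma> (sbr (cst b) (cst c')) n = sbr (loop_op \<gamma> (cst b)) (loop_op \<gamma> (cst c')) n"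
        unfolding cst_br[symmetric] sbr_def c
        by (rule linear_forms_separate) (simp add: bracket lf_sum)
    qed
    have bF: "b \<in> Fil (dg b)" by (rule gr_Fil[OF WB_gr[OF b] order_refl])
    have "\<gamma> n b - (if n = 0 then b else 0) \<in> Fil (dg b + 1)" for n
    proof (rule linear_forms_detect_Fil)
      fix u assume u: "linear_form L u" "\<And>w. w \<in> Fil (dg b + 1) \<Longrightarrow> u w = 0"
      show "u (\<gamma> n b - (if n = 0 then b else 0)) = 0"
        using fil[OF u bF, of n] by (simp add: lf_diff[OF u(1)] lf_0[OF u(1)])
    qed
    then show "loop_op \<gamma> (cst b) - cst b \<in> SFil (dg b + 1)" by (simp add: SFil_def c cst_def)
  qed
qed

end

lemma sum_fun_apply: "sum f A x = (\<Sum>a\<in>A. f a x)" for f :: "'a \<Rightarrow> 'b \<Rightarrow> 'c::comm_monoid_add"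
  using sum_comp_morphism[of "\<lambda>g. g x" f A] by (simp add: comp_def)

context simple_lie begin

subsection \<open>Elementary loops\<close>

lemma tmul_cst: "tmul c (cst y) n = sc (c $ n) y"
proof -
  have "(\<Sum>i\<le>n. sc (c $ i) (cst y (n - i))) = (\<Sum>i\<le>n. if i = n then sc (c $ n) y else 0)"
    by (intro sum.cong) (auto simp: cst_def)
  then show ?thesis by (simp add: tmul_def)
qed

text \<open>\<open>exp(x(t) ad y)\<close> for a power series \<open>x\<close> and a fixed \<open>y\<close> in \<open>\<nn>\<close>.\<close>

definition exp_loop :: "complex fps \<Rightarrow> 'g \<Rightarrow> (nat \<Rightarrow> 'g) \<Rightarrow> nat \<Rightarrow> 'g" where
  "exp_loop x y v = (\<Sum>l\<le>NN. tmul (x ^ l) (liftop (dpow y l) v))"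

lemma tlin_exp_loop: "tlin (exp_loop x y)"
  by (simp add: tlin_def exp_loop_def liftop_simps[OF lin_dpow] tmul_simps(1) sum.distrib tmul_sum tmul_simps(3) mult.commute)

lemma dpow_Fil: "y \<in> Fil 1 \<Longrightarrow> v \<in> Fil k \<Longrightarrow> dpow y l v \<in> Fil (k + int l)"
  using br_pow_Fil[of y 1 v k l] by (auto simp: dpow_def intro: Fil_subspace_rules(4))

lemma liftop_dpow_sbr:
  "liftop (dpow y l) (sbr v w) = (\<Sum>i\<le>l. sbr (liftop (dpow y i) v) (liftop (dpow y (l - i)) w))"
proof
  fix n
  have "dpow y l (\<Sum>j\<le>n. br (v j) (w (n - j))) = (\<Sum>j\<le>n. \<Sum>i\<le>l. br (dpow y i (v j)) (dpow y (l - i) (w (n - j))))"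
    by (simp only: lin_sum[OF lin_dpow] dpow_leibniz)
  also have "\<dots> = (\<Sum>i\<le>l. \<Sum>j\<le>n. br (dpow y i (v j)) (dpow y (l - i) (w (n - j))))" by (rule sum.swap)
  also have "\<dots> = (\<Sum>i\<le>l. sbr (liftop (dpow y i) v) (liftop (dpow y (l - i)) w)) n"
    unfolding sum_fun_apply by (simp add: sbr_def liftop_def)
  finally show "liftop (dpow y l) (sbr v w) n = (\<Sum>i\<le>l. sbr (liftop (dpow y i) v) (liftop (dpow y (l - i)) w)) n"
    by (simp add: liftop_def sbr_def)
qed

lemma exp_loop_sbr: assumes y: "y \<in> Fil 1" shows "exp_loop x y (sbr v w) = sbr (exp_loop x y v) (exp_loop x y w)"
proof -
  let ?D = "\<lambda>l. liftop (dpow y l)"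
  let ?f = "\<lambda>i j. tmul (x ^ i * x ^ j) (sbr (?D i v) (?D j w))"
  have z: "?f i j = 0" if ij: "i + j > NN" for i j
  proof -
    have "br (dpow y i (v a)) (dpow y j (w b)) = 0" for a b
    proof (rule Fil_top)
      show "br (dpow y i (v a)) (dpow y j (w b)) \<in> Fil ((- K + int i) + (- K + int j))"
        by (intro br_Fil dpow_Fil y Fil_bottom) auto
      show "K < (- K + int i) + (- K + int j)" using ij by (simp add: NN_def)
    qed
    then have "sbr (?D i v) (?D j w) = 0" by (intro ext) (simp add: sbr_def liftop_def)
    then show ?thesis by (simp add: tmul_simps)
  qed
  have "sbr (exp_loop x y v) (exp_loop x y w) = (\<Sum>i\<le>NN. \<Sum>j\<le>NN. ?f i j)"
    by (simp add: exp_loop_def sbr_sum sbr_simps tmul_simps(3) tmul_sum) (subst sum.swap, simp add: mult.commute)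
  also have "\<dots> = (\<Sum>l\<le>NN. \<Sum>i\<le>l. ?f i (l - i))" by (rule sum_square_triangle) (rule z)
  also have "\<dots> = (\<Sum>l\<le>NN. tmul (x ^ l) (?D l (sbr v w)))"
    unfolding liftop_dpow_sbr tmul_sum by (intro sum.cong refl) (simp add: power_add[symmetric])
  finally show ?thesis by (simp add: exp_loop_def)
qed

lemma exp_loop_ULoop: assumes y: "y \<in> Fil 1" shows "exp_loop x y \<in> ULoop"
  unfolding ULoop_def
proof (intro CollectI conjI allI ballI tlin_exp_loop exp_loop_sbr y)
  fix k v assume v: "v \<in> SFil k"
  have "exp_loop x y v = tmul (x ^ 0) (liftop (dpow y 0) v) + (\<Sum>l\<in>{1..NN}. tmul (x ^ l) (liftop (dpow y l) v))"
    unfolding exp_loop_def by (simp only: atMost_atLeast0) (subst sum.atLeast_Suc_atMost, simp_all)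
  moreover have "liftop (dpow y 0) v = v" by (rule ext) (simp add: liftop_def)
  ultimately have "exp_loop x y v - v = (\<Sum>l\<in>{1..NN}. tmul (x ^ l) (liftop (dpow y l) v))" by (simp add: tmul_simps)
  also have "\<dots> \<in> SFil (k + 1)"
  proof (intro SFil_sum SFil_rules(4))
    fix l assume l: "l \<in> {1..NN}"
    have "dpow y l (v n) \<in> Fil (k + 1)" for n
      using dpow_Fil[OF y, of "v n" k l] v l by (intro Fil_mono[of "k + 1" "k + int l"]) (auto simp: SFil_def)
    then show "liftop (dpow y l) v \<in> SFil (k + 1)" by (simp add: SFil_def liftop_def)
  qed
  finally show "exp_loop x y v - v \<in> SFil (k + 1)" .
qed

text \<open>The element \<open>y\<close> commutes with itself, so \<open>\<partial>\<^sub>t exp(x y) = x' y exp(x y)\<close>.\<close>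

lemma sder_exp_loop: assumes y: "y \<in> Fil 1"
  shows "sder (exp_loop x y v) = tmul (fps_deriv x) (liftop (br y) (exp_loop x y v)) + exp_loop x y (sder v)"
proof -
  let ?D = "\<lambda>l. liftop (dpow y l)"
  have sder_sum: "sder (sum f A) = (\<Sum>a\<in>A. sder (f a))" for f and A :: "nat set"
    using sum_comp_morphism[of sder f A] by (simp add: sder_simps(1,3) comp_def)
  have "sder (exp_loop x y v) = (\<Sum>l\<le>NN. tmul (fps_deriv (x ^ l)) (?D l v)) + exp_loop x y (sder v)"
    by (simp add: exp_loop_def sder_sum sder_simps(5) sum.distrib liftop_simps[OF lin_dpow])
  also have "(\<Sum>l\<le>NN. tmul (fps_deriv (x ^ l)) (?D l v)) = tmul (fps_deriv x) (liftop (br y) (exp_loop x y v))"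
  proof -
    have st: "tmul (fps_deriv (x ^ Suc l)) (?D (Suc l) v) = tmul (fps_deriv x) (tmul (x ^ l) (liftop (br y) (?D l v)))" for l
    proof -
      have "liftop (br y) (?D l v) = tmul (of_nat (Suc l)) (?D (Suc l) v)"
      proof
        fix n
        have "tmul (of_nat (Suc l)) (?D (Suc l) v) n = sc (of_nat (Suc l)) (dpow y (Suc l) (v n))"
        proof -
          have "(of_nat (Suc l) :: complex fps) = fps_const (of_nat (Suc l))" by (rule fps_of_nat[symmetric])
          moreover have "(\<Sum>i\<le>n. sc (fps_const (of_nat (Suc l)) $ i) (?D (Suc l) v (n - i))) =
             (\<Sum>i\<le>n. if i = 0 then sc (of_nat (Suc l)) (?D (Suc l) v n) else 0)"
            by (intro sum.cong) auto
          ultimately show ?thesis by (simp add: tmul_def liftop_def)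
        qed
        then show "liftop (br y) (?D l v) n = tmul (of_nat (Suc l)) (?D (Suc l) v) n"
          by (simp only: dpow_Suc liftop_def)
      qed
      moreover have "fps_deriv (x ^ Suc l) = of_nat (Suc l) * (fps_deriv x * x ^ l)"
        by (subst fps_deriv_power) (simp add: fps_of_nat mult_ac del: of_nat_Suc)
      ultimately show ?thesis by (simp only: tmul_simps(3) mult_ac)
    qed
    have top: "liftop (br y) (?D NN v) = 0"
      using dpow_zero[OF y, of "Suc NN"] by (auto simp: liftop_def dpow_Suc[symmetric])
    have "(\<Sum>l\<le>NN. tmul (fps_deriv (x ^ l)) (?D l v)) = (\<Sum>l<NN. tmul (fps_deriv (x ^ Suc l)) (?D (Suc l) v))"
    proof -
      have "(\<Sum>l\<le>NN. f l) = f 0 + (\<Sum>l<NN. f (Suc l))" for f :: "nat \<Rightarrow> nat \<Rightarrow> 'g"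
        by (simp only: sum.lessThan_Suc_shift lessThan_Suc_atMost[symmetric])
      then show ?thesis by (simp add: tmul_simps)
    qed
    also have "\<dots> = (\<Sum>l<NN. tmul (fps_deriv x) (tmul (x ^ l) (liftop (br y) (?D l v))))" by (simp only: st)
    also have "\<dots> = (\<Sum>l\<le>NN. tmul (fps_deriv x) (tmul (x ^ l) (liftop (br y) (?D l v))))"
    proof -
      have "(\<Sum>l\<le>NN. f l) = (\<Sum>l<NN. f l) + f NN" for f :: "nat \<Rightarrow> nat \<Rightarrow> 'g"
        by (simp only: sum.lessThan_Suc lessThan_Suc_atMost[symmetric])
      then show ?thesis by (simp add: top tmul_simps)
    qed
    also have "\<dots> = tmul (fps_deriv x) (liftop (br y) (exp_loop x y v))"
    proof -
      have "liftop (br y) (sum f A) = (\<Sum>a\<in>A. liftop (br y) (f a))" for f and A :: "nat set"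
        by (rule tlinD(5)[OF tlin_liftop[OF lin_br]])
      then show ?thesis by (simp add: exp_loop_def tmul_sum liftop_simps[OF lin_br])
    qed
    finally show ?thesis .
  qed
  finally show ?thesis .
qed

text \<open>The gauge transform \<open>g A g\<^sup>-\<^sup>1 - (\<partial>\<^sub>t g) g\<^sup>-\<^sup>1\<close> for \<open>g = exp(x(t) y)\<close>.\<close>

definition exp_gauge :: "complex fps \<Rightarrow> 'g \<Rightarrow> (nat \<Rightarrow> 'g) \<Rightarrow> nat \<Rightarrow> 'g" where
  "exp_gauge x y A = exp_loop x y A - tmul (fps_deriv x) (cst y)"

lemma exp_loop_intertwines: "y \<in> Fil 1 \<Longrightarrow> nabla (exp_gauge x y A) (exp_loop x y v) = exp_loop x y (nabla A v)"
  by (simp add: nabla_def exp_gauge_def sder_exp_loop sbr_simps sbr_cst exp_loop_sbr tlinD(1)[OF tlin_exp_loop])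

lemma exp_loop_low:
  assumes "\<And>j. j < m \<Longrightarrow> x $ j = 0" "m \<ge> 1" "n < m"
  shows "exp_loop x y v n = v n"
proof -
  have t: "tmul (x ^ l) w n = (if l = 0 then w n else 0)" for l w
  proof (cases l)
    case 0
    then show ?thesis by (simp add: tmul_simps)
  next
    case (Suc l')
    have "(x ^ l) $ i = 0" if "i \<le> n" for i
    proof -
      have "(x * x ^ l') $ i = 0"
        unfolding fps_mult_nth using assms that by (intro sum.neutral) auto
      then show ?thesis using Suc by simp
    qed
    then show ?thesis using Suc by (simp add: tmul_def)
  qed
  have "exp_loop x y v n = (\<Sum>l\<le>NN. if l = 0 then liftop (dpow y 0) v n else 0)"
    unfolding exp_loop_def sum_fun_apply t by (intro sum.cong) auto
  then show ?thesis by (simp add: liftop_def)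
qed

lemma exp_loop_zero: "exp_loop x 0 v = v"
proof
  fix n
  have "dpow 0 (Suc l) z = 0" for l z by (simp add: dpow_def)
  then have "tmul (x ^ l) (liftop (dpow 0 l) v) n = (if l = 0 then v n else 0)" for l
    by (cases l) (simp_all add: tmul_simps liftop_def tmul_def)
  then show "exp_loop x 0 v n = v n" unfolding exp_loop_def sum_fun_apply by simp
qed

lemma coeff_op_exp_loop: "coeff_op (exp_loop x y) n z = (\<Sum>l\<le>NN. sc ((x ^ l) $ n) (dpow y l z))"
  unfolding coeff_op_def exp_loop_def sum_fun_apply by (simp add: liftop_simps[OF lin_dpow] tmul_cst)

subsection \<open>Every unipotent loop is a limit of polynomial loops\<close>

text \<open>Loops that are polynomial in \<open>t\<close> and have values in the unipotent group at all points \<open>\<tau>\<close> of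
  the complex plane.\<close>

definition polyloop :: "((nat \<Rightarrow> 'g) \<Rightarrow> nat \<Rightarrow> 'g) \<Rightarrow> bool" where
  "polyloop G \<longleftrightarrow> (\<exists>d. (\<forall>n>d. \<forall>y. coeff_op G n y = 0) \<and> (\<forall>\<tau>. (\<lambda>y. \<Sum>n\<le>d. sc (\<tau> ^ n) (coeff_op G n y)) \<in> UAut))"

lemma polyloop_comp:
  assumes G: "tlin G" "polyloop G" and G': "tlin G'" "polyloop G'"
  shows "polyloop (\<lambda>v. G (G' v))"
proof -
  obtain d where d: "\<And>n y. n > d \<Longrightarrow> coeff_op G n y = 0" "\<And>\<tau>. (\<lambda>y. \<Sum>n\<le>d. sc (\<tau> ^ n) (coeff_op G n y)) \<in> UAut"
    using G(2) by (auto simp: polyloop_def)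
  obtain d' where d': "\<And>n y. n > d' \<Longrightarrow> coeff_op G' n y = 0" "\<And>\<tau>. (\<lambda>y. \<Sum>n\<le>d'. sc (\<tau> ^ n) (coeff_op G' n y)) \<in> UAut"
    using G'(2) by (auto simp: polyloop_def)
  have l: "lin (coeff_op G n)" for n by (rule lin_coeff_op[OF G(1)])
  have z: "coeff_op G i (coeff_op G' j y) = 0" if "i + j > d + d'" for i j y
    using that d(1)[of i] d'(1)[of j y] lin_0[OF l] by (cases "i > d") auto
  show ?thesis
    unfolding polyloop_def
  proof (intro exI[of _ "d + d'"] conjI allI impI)
    fix n y assume n: "n > d + d'"
    show "coeff_op (\<lambda>v. G (G' v)) n y = 0"
      unfolding coeff_op_comp[OF G(1), of G'] by (intro sum.neutral ballI z) (use n in auto)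
  next
    fix \<tau> :: complex
    let ?g = "\<lambda>y. \<Sum>n\<le>d. sc (\<tau> ^ n) (coeff_op G n y)" and ?g' = "\<lambda>y. \<Sum>n\<le>d'. sc (\<tau> ^ n) (coeff_op G' n y)"
    have "(\<lambda>y. \<Sum>n\<le>d + d'. sc (\<tau> ^ n) (coeff_op (\<lambda>v. G (G' v)) n y)) = ?g \<circ> ?g'"
    proof
      fix y
      have "(\<Sum>n\<le>d + d'. sc (\<tau> ^ n) (coeff_op (\<lambda>v. G (G' v)) n y)) =
          (\<Sum>n\<le>d + d'. \<Sum>i\<le>n. sc (\<tau> ^ (i + (n - i))) (coeff_op G i (coeff_op G' (n - i) y)))"
        unfolding coeff_op_comp[OF G(1), of G'] scale_sum_right by (intro sum.cong refl) simp
      also have "\<dots> = (\<Sum>i\<le>d + d'. \<Sum>j\<le>d + d'. sc (\<tau> ^ (i + j)) (coeff_op G i (coeff_op G' j y)))"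
        by (rule sum_square_triangle[symmetric, where f="\<lambda>i j. sc (\<tau> ^ (i + j)) (coeff_op G i (coeff_op G' j y))"]) (simp add: z)
      also have "\<dots> = (\<Sum>i\<le>d. \<Sum>j\<le>d + d'. sc (\<tau> ^ (i + j)) (coeff_op G i (coeff_op G' j y)))"
        by (intro sum.mono_neutral_right) (auto simp: d(1))
      also have "\<dots> = (\<Sum>i\<le>d. \<Sum>j\<le>d'. sc (\<tau> ^ (i + j)) (coeff_op G i (coeff_op G' j y)))"
        by (intro sum.cong refl sum.mono_neutral_right) (auto simp: d'(1) lin_0[OF l])
      also have "\<dots> = ?g (?g' y)"
        by (simp add: lin_sum[OF l] lin_scale[OF l] scale_sum_right power_add)
      finally show "(\<Sum>n\<le>d + d'. sc (\<tau> ^ n) (coeff_op (\<lambda>v. G (G' v)) n y)) = (?g \<circ> ?g') y" by simp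
    qed
    then show "(\<lambda>y. \<Sum>n\<le>d + d'. sc (\<tau> ^ n) (coeff_op (\<lambda>v. G (G' v)) n y)) \<in> UAut"
      by (rule ssubst[where P="\<lambda>f. f \<in> UAut"]) (rule UAut_comp[OF d(2) d'(2)])
  qed
qed

lemma polyloop_exp_loop: assumes y: "y \<in> Fil 1" shows "polyloop (exp_loop (fps_X ^ m) y)"
  unfolding polyloop_def
proof (intro exI[of _ "m * NN"] conjI allI impI)
  have c: "coeff_op (exp_loop (fps_X ^ m) y) n z = (\<Sum>l\<le>NN. if n = m * l then dpow y l z else 0)" for n z
    unfolding coeff_op_exp_loop power_mult[symmetric] by (intro sum.cong refl) auto
  fix n z assume n: "n > m * NN"
  have "n \<noteq> m * l" if "l \<le> NN" for l using n mult_le_mono2[OF that, of m] by linarith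
  then show "coeff_op (exp_loop (fps_X ^ m) y) n z = 0" unfolding c by (intro sum.neutral) auto
next
  have c: "coeff_op (exp_loop (fps_X ^ m) y) n z = (\<Sum>l\<le>NN. if n = m * l then dpow y l z else 0)" for n z
    unfolding coeff_op_exp_loop power_mult[symmetric] by (intro sum.cong refl) auto
  fix \<tau> :: complex
  have "(\<Sum>n\<le>m * NN. sc (\<tau> ^ n) (coeff_op (exp_loop (fps_X ^ m) y) n z)) = Ad (sc (\<tau> ^ m) y) z" for z
  proof -
    have "(\<Sum>n\<le>m * NN. sc (\<tau> ^ n) (coeff_op (exp_loop (fps_X ^ m) y) n z)) =
        (\<Sum>n\<le>m * NN. \<Sum>l\<le>NN. if n = m * l then sc (\<tau> ^ n) (dpow y l z) else 0)"
      unfolding c scale_sum_right by (intro sum.cong refl) auto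
    also have "\<dots> = (\<Sum>l\<le>NN. \<Sum>n\<le>m * NN. if n = m * l then sc (\<tau> ^ n) (dpow y l z) else 0)" by (rule sum.swap)
    also have "\<dots> = (\<Sum>l\<le>NN. sc (\<tau> ^ (m * l)) (dpow y l z))"
      by (intro sum.cong refl) (simp add: sum.delta')
    also have "\<dots> = (\<Sum>l\<le>NN. dpow (sc (\<tau> ^ m) y) l z)" by (simp add: dpow_scale power_mult)
    finally show ?thesis by (simp add: Ad_nilpotent[OF Fil_subspace_rules(4)[OF y]])
  qed
  then show "(\<lambda>z. \<Sum>n\<le>m * NN. sc (\<tau> ^ n) (coeff_op (exp_loop (fps_X ^ m) y) n z)) \<in> UAut"
    using Ad_UAut[OF Fil_subspace_rules(4)[OF y]] by simp
qed

lemma liftop_ULoop: assumes g: "g \<in> UAut" shows "liftop g \<in> ULoop" and "polyloop (liftop g)" and "coeff_op (liftop g) 0 = g"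
proof -
  have gA: "g \<in> Aut" using g by (simp add: UAut_def)
  note l = AutD(1)[OF gA]
  have c: "coeff_op (liftop g) n y = (if n = 0 then g y else 0)" for n y by (simp add: coeff_op_def liftop_simps(3)[OF l]) (simp add: cst_def)
  show "liftop g \<in> ULoop"
    using g AutD(3)[OF gA] tlin_liftop[OF l]
    by (auto simp: ULoop_def SFil_def liftop_def sbr_def lin_sum[OF l] UAut_def)
  show "polyloop (liftop g)"
    unfolding polyloop_def by (intro exI[of _ 0]) (use g c in simp)
  show "coeff_op (liftop g) 0 = g" using c by auto
qed

lemma coeff_op_0_UAut: assumes T: "T \<in> ULoop" shows "coeff_op T 0 \<in> UAut"
proof -
  have l: "lin (coeff_op T 0)" by (rule lin_coeff_op[OF ULoopD(1)[OF T]])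
  have br: "coeff_op T 0 (br x y) = br (coeff_op T 0 x) (coeff_op T 0 y)" for x y
    by (simp add: coeff_op_def cst_br ULoopD(2)[OF T]) (simp add: sbr_def)
  have F: "coeff_op T 0 v - v \<in> Fil (k + 1)" if v: "v \<in> Fil k" for v k
    using ULoopD(3)[OF T SFil_rules(6)[OF v]] by (auto simp: SFil_def coeff_op_def cst_def dest!: spec[of _ 0])
  have "coeff_op T 0 \<rho> - \<rho> \<in> Fil 1" using F[of \<rho> 0] gr_Fil[OF H_gr0[OF \<rho>_H]] by simp
  then have "proj 0 (coeff_op T 0 \<rho>) = \<rho>" using proj_of_gr[OF H_gr0[OF \<rho>_H], of 0] by (simp add: Fil_def)
  moreover have "\<rho> \<noteq> 0" using \<alpha>_\<rho> \<alpha>_0 by (metis zero_neq_one)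
  ultimately have "coeff_op T 0 \<rho> \<noteq> 0" by auto
  then have "bij (coeff_op T 0)" by (rule automorphism_bij[OF l br])
  then show ?thesis using l br F by (auto simp: UAut_def Aut_def)
qed

text \<open>The derivation is \<open>ad d\<close>. Applied to \<open>\<rho>\<^sup>\<or>\<close> the hypothesis removes the components of \<open>d\<close> in
  negative degree. The component of degree zero preserves degrees, so it acts by zero.\<close>

lemma filtered_derivation_inner:
  assumes D: "lin D" and der: "\<And>x y. D (br x y) = br (D x) y + br x (D y)"
    and F: "\<And>k v. v \<in> Fil k \<Longrightarrow> D v \<in> Fil (k + 1)"
  shows "\<exists>y\<in>Fil 1. D = br y"
proof -
  obtain d where d: "\<And>v. D v = br d v" using derivation_inner[OF D der] by blast
  have dneg: "proj j d = 0" if j: "j < 0" for j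
  proof -
    have "D \<rho> \<in> Fil (0 + 1)" by (rule F, rule gr_Fil[OF H_gr0[OF \<rho>_H]]) simp
    then have "proj j (br d \<rho>) = 0" using j by (simp add: d Fil_def)
    moreover have "br d \<rho> = (\<Sum>i\<in>{-K..K}. sc (- of_int i) (proj i d))"
    proof -
      have "br d \<rho> = br (\<Sum>i\<in>{-K..K}. proj i d) \<rho>" by (simp only: sum_proj)
      also have "\<dots> = (\<Sum>i\<in>{-K..K}. - br \<rho> (proj i d))" unfolding br_sum by (intro sum.cong refl br_anti)
      finally show ?thesis using proj_gr by (simp add: gr_def)
    qed
    ultimately have "(\<Sum>i\<in>{-K..K}. if i = j then sc (- of_int j) (proj j d) else 0) = 0"
      by (simp add: proj_sum if_distrib cong: if_cong)
    then show ?thesis using j proj_outside[of j d] by (cases "j \<in> {-K..K}") auto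
  qed
  have h: "proj 0 d \<in> H" using proj_gr[of 0 d] gr0_eq_H by simp
  have d0: "d - proj 0 d \<in> Fil 1" 
  proof -
    have "d \<in> Fil 0" by (simp add: Fil_def dneg)
    then show ?thesis using Fil_split[of d 0] by simp
  qed
  have "br (proj 0 d) b = 0" if b: "b \<in> WB" for b
  proof -
    have bF: "b \<in> Fil (dg b)" by (rule gr_Fil[OF WB_gr[OF b] order_refl])
    have "br (d - proj 0 d) b \<in> Fil (1 + dg b)" by (rule br_Fil[OF d0 bF])
    then have "br d b - br (d - proj 0 d) b \<in> Fil (dg b + 1)"
      using F[OF bF] by (intro Fil_subspace_rules(3)) (simp_all add: d add.commute)
    then have "br (proj 0 d) b \<in> Fil (dg b + 1)" by (simp add: br_diff)
    moreover have "br (proj 0 d) b \<in> gr (0 + dg b)" by (intro br_gr proj_gr WB_gr b)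
    ultimately show ?thesis by (auto simp: Fil_def gr_iff)
  qed
  then have "br (proj 0 d) v = 0" for v using lin_eq_on_WB[OF lin_br lin_zero] by blast
  then have "proj 0 d = 0" by (rule center_trivial)
  then show ?thesis using d0 d by (intro bexI[of _ d]) auto
qed

text \<open>Correct one coefficient at a time. If \<open>G\<close> agrees with \<open>T\<close> up to order \<open>n\<close>, then the
  coefficient of \<open>t^(n+1)\<close> in \<open>T G\<^sup>-\<^sup>1\<close> is a derivation that raises degrees, so it is \<open>ad y\<close> with
  \<open>y\<close> in \<open>\<nn>\<close>, and \<open>exp(t^(n+1) y) G\<close> is the next approximation.\<close>

lemma polyloop_approximation: "T \<in> ULoop \<Longrightarrow> \<exists>G\<in>ULoop. polyloop G \<and> (\<forall>j\<le>n. coeff_op G j = coeff_op T j)"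
proof (induction n)
  case 0
  then show ?case using liftop_ULoop[OF coeff_op_0_UAut[OF 0]] by (intro bexI[of _ "liftop (coeff_op T 0)"]) auto
next
  case (Suc n)
  note T = Suc.prems
  obtain G where G: "G \<in> ULoop" "polyloop G" "\<And>j. j \<le> n \<Longrightarrow> coeff_op G j = coeff_op T j" using Suc by blast
  obtain G' where G': "G' \<in> ULoop" "\<And>v. G' (G v) = v" "\<And>v. G (G' v) = v" using ULoop_inverse[OF G(1)] by metis
  define R where "R = (\<lambda>v. T (G' v))"
  have R: "R \<in> ULoop" unfolding R_def by (rule ULoop_comp[OF T G'(1)])
  have TR: "T = (\<lambda>v. R (G v))" by (simp add: R_def G'(2))
  have cT: "coeff_op T j y = (\<Sum>i\<le>j. coeff_op R i (coeff_op G (j - i) y))" for j y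
    using coeff_op_comp[OF ULoopD(1)[OF R], of G j y] unfolding TR[symmetric] .
  have bG: "bij (coeff_op G 0)" using coeff_op_0_UAut[OF G(1)] by (simp add: UAut_def Aut_def)
  have surjG: "\<exists>z. y = coeff_op G 0 z" for y using bij_is_surj[OF bG] by (metis surjD)
  have R0: "coeff_op R 0 y = y" for y
  proof -
    obtain z where z: "y = coeff_op G 0 z" using surjG by blast
    have "coeff_op G 0 z = coeff_op R 0 (coeff_op G 0 z)" using cT[of 0 z] G(3)[of 0] by simp
    then show ?thesis by (simp only: z)
  qed
  have Rj: "coeff_op R j y = 0" if "1 \<le> j" "j \<le> n" for j y
    using that
  proof (induction j arbitrary: y rule: less_induct)
    case (less j)
    obtain z where z: "y = coeff_op G 0 z" using surjG by blast
    have "coeff_op G j z = (\<Sum>i\<le>j. coeff_op R i (coeff_op G (j - i) z))" using cT[of j z] G(3)[of j] less.prems by simp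
    also have "\<dots> = (\<Sum>i\<in>{0, j}. coeff_op R i (coeff_op G (j - i) z))"
      using less.IH less.prems by (intro sum.mono_neutral_right) auto
    also have "\<dots> = coeff_op G j z + coeff_op R j y" using less.prems z by (simp add: R0)
    finally show ?case by simp
  qed
  define D where "D = coeff_op R (Suc n)"
  have "\<exists>y\<in>Fil 1. D = br y"
  proof (rule filtered_derivation_inner)
    show "lin D" unfolding D_def by (rule lin_coeff_op[OF ULoopD(1)[OF R]])
    show "D (br x y) = br (D x) y + br x (D y)" for x y
    proof -
      have "D (br x y) = (\<Sum>i\<le>Suc n. br (coeff_op R i x) (coeff_op R (Suc n - i) y))"
        by (simp add: D_def coeff_op_def cst_br ULoopD(2)[OF R] sbr_def del: sum.atMost_Suc)
      also have "\<dots> = (\<Sum>i\<in>{0, Suc n}. br (coeff_op R i x) (coeff_op R (Suc n - i) y))"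
        using Rj by (intro sum.mono_neutral_right) auto
      finally show ?thesis by (simp add: R0 D_def add.commute)
    qed
    show "D v \<in> Fil (k + 1)" if v: "v \<in> Fil k" for k v
      using ULoopD(3)[OF R SFil_rules(6)[OF v]] by (auto simp: SFil_def D_def coeff_op_def cst_def dest!: spec[of _ "Suc n"])
  qed
  then obtain y where y: "y \<in> Fil 1" "D = br y" by blast
  let ?X = "exp_loop (fps_X ^ Suc n) y"
  have Xlow: "coeff_op ?X j z = (if j = 0 then z else 0)" if "j \<le> n" for j z
    using exp_loop_low[of "Suc n" "fps_X ^ Suc n" j y "cst z"] that by (simp add: coeff_op_def cst_def del: power_Suc)
  have Xtop: "coeff_op ?X (Suc n) z = br y z" for z
  proof -
    have "coeff_op ?X (Suc n) z = (\<Sum>l\<le>NN. if l = 1 then dpow y 1 z else 0)"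
    proof -
      have "(Suc n = Suc n * l) = (l = 1)" for l by (metis mult_cancel_left mult.right_neutral nat.simps(3))
      then show ?thesis
        unfolding coeff_op_exp_loop power_mult[symmetric] by (intro sum.cong refl) (auto simp del: power_Suc mult_Suc)
    qed
    moreover have "dpow y 1 z = br y z" by (simp add: dpow_def)
    moreover have "dpow y 1 z = 0" if "\<not> 1 \<le> NN" using dpow_zero[OF y(1)] that by simp
    ultimately show ?thesis by auto
  qed
  have "coeff_op (\<lambda>v. ?X (G v)) j = coeff_op T j" if j: "j \<le> Suc n" for j
  proof
    fix z
    have c: "coeff_op (\<lambda>v. ?X (G v)) j z = (\<Sum>i\<le>j. coeff_op ?X i (coeff_op G (j - i) z))" by (rule coeff_op_comp[OF tlin_exp_loop])
    have "coeff_op ?X i w = coeff_op R i w" if "i \<le> j" for i w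
    proof (cases "i \<le> n")
      case True
      then show ?thesis using Xlow[OF True] R0 Rj[of i w] by (cases "i = 0") auto
    next
      case False
      then have "i = Suc n" using that j by simp
      then show ?thesis using Xtop y(2) D_def by simp
    qed
    then show "coeff_op (\<lambda>v. ?X (G v)) j z = coeff_op T j z" unfolding c cT by (intro sum.cong) auto
  qed
  moreover have "(\<lambda>v. ?X (G v)) \<in> ULoop" by (rule ULoop_comp[OF exp_loop_ULoop[OF y(1)] G(1)])
  moreover have "polyloop (\<lambda>v. ?X (G v))"
    by (rule polyloop_comp[OF tlin_exp_loop polyloop_exp_loop[OF y(1)] ULoopD(1)[OF G(1)] G(2)])
  ultimately show ?case by blast
qed

text \<open>An equation of \<open>N\<close> holds at all points of a polynomial loop, so it holds for its expansion
  in \<open>t\<close>. Each coefficient of the equation involves finitely many coefficients of the loop, so it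
  carries over to limits of polynomial loops.\<close>

lemma ULoop_unipotent_loops: assumes T: "T \<in> ULoop" shows "coeff_op T \<in> unipotent_loops L"
  unfolding unipotent_loops_def
proof (intro CollectI conjI allI impI lin_coeff_op ULoopD(1) T)
  fix P :: "(('g \<Rightarrow> complex) \<times> 'g) cpoly"
  assume lP: "\<forall>(u, y)\<in>pvars P. linear_form L u"
    and P0: "\<forall>g\<in>unipotent_group L. pval (\<lambda>(u, y). u (g y)) P = 0"
  show "peval fps_const (\<lambda>(u, y). Abs_fps (\<lambda>n. u (coeff_op T n y))) P = 0"
  proof (rule fps_ext)
    fix n
    obtain G where G: "G \<in> ULoop" "polyloop G" "\<And>j. j \<le> n \<Longrightarrow> coeff_op G j = coeff_op T j"
      using polyloop_approximation[OF T, of n] by blast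
    obtain d where d: "\<And>n y. n > d \<Longrightarrow> coeff_op G n y = 0" "\<And>\<tau>. (\<lambda>y. \<Sum>n\<le>d. sc (\<tau> ^ n) (coeff_op G n y)) \<in> UAut"
      using G(2) by (auto simp: polyloop_def)
    define f where "f = (\<lambda>(u :: 'g \<Rightarrow> complex, y). \<Sum>n\<le>d. monom (u (coeff_op G n y)) n)"
    have "pval (\<lambda>v. poly (f v) \<tau>) P = 0" for \<tau>
    proof -
      have "pval (\<lambda>v. poly (f v) \<tau>) P = pval (\<lambda>(u, y). u (\<Sum>n\<le>d. sc (\<tau> ^ n) (coeff_op G n y))) P"
      proof (rule peval_cong)
        fix v assume "v \<in> pvars P"
        then obtain u y where v: "v = (u, y)" "linear_form L u" using lP by (cases v) auto
        show "poly (f v) \<tau> = (case v of (u, y) \<Rightarrow> u (\<Sum>n\<le>d. sc (\<tau> ^ n) (coeff_op G n y)))"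
          by (simp add: v f_def poly_sum poly_monom lf_sum[OF v(2)] lf_scale[OF v(2)] mult.commute)
      qed
      then show ?thesis using P0 d(2)[of \<tau>] by (simp add: unipotent_group_eq)
    qed
    then have "peval fps_const (\<lambda>v. fps_of_poly (f v)) P = 0" by (rule peval_polynomial_curve)
    moreover have "agree_upto n (peval fps_const (\<lambda>(u, y). Abs_fps (\<lambda>n. u (coeff_op T n y))) P)
        (peval fps_const (\<lambda>v. fps_of_poly (f v)) P)"
    proof (rule agree_upto_peval)
      fix v assume "v \<in> pvars P"
      then obtain u y where v: "v = (u, y)" "linear_form L u" using lP by (cases v) auto
      have "u (coeff_op T j y) = coeff (f v) j" if j: "j \<le> n" for j
      proof -
        have "coeff (f v) j = (\<Sum>n\<le>d. if n = j then u (coeff_op G j y) else 0)"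
          unfolding f_def v by (simp add: coeff_sum if_distrib cong: if_cong sum.cong)
        also have "\<dots> = u (coeff_op G j y)" using d(1)[of j y] lf_0[OF v(2)] by auto
        finally show ?thesis using G(3)[OF j] by simp
      qed
      then show "agree_upto n (case v of (u, y) \<Rightarrow> Abs_fps (\<lambda>n. u (coeff_op T n y))) (fps_of_poly (f v))"
        by (simp add: agree_upto_def v)
    qed
    ultimately show "peval fps_const (\<lambda>(u, y). Abs_fps (\<lambda>n. u (coeff_op T n y))) P $ n = 0 $ n"
      by (simp add: agree_upto_def)
  qed
qed


section \<open>Miura normal form of opers\<close>

abbreviation "pm \<equiv> cst (p_minus L)"
abbreviation "Conn \<equiv> oper_connections L"

lemma Conn_iff: "A \<in> Conn \<longleftrightarrow> A - pm \<in> SFil 0"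
  by (auto simp: oper_connections_def borel_eq SFil_def v_part_def cst_def)

lemma v_part_eq: "v_part L A = A - pm"
  by (auto simp: v_part_def cst_def)

lemma pm_SFil: "pm \<in> SFil (-1)"
  by (intro SFil_rules(6) gr_Fil[OF p_minus_gr]) simp

lemma Conn_SFil: "A \<in> Conn \<Longrightarrow> A \<in> SFil (-1)"
proof -
  assume "A \<in> Conn"
  then have "(A - pm) + pm \<in> SFil (-1)"
    by (intro SFil_rules(2) pm_SFil SFil_mono[of "-1" 0]) (auto simp: Conn_iff)
  then show ?thesis by simp
qed

lemma Conn_add: "A \<in> Conn \<Longrightarrow> z \<in> SFil 0 \<Longrightarrow> A + z \<in> Conn"
  using SFil_rules(2)[of "A - pm" 0 z] by (simp add: Conn_iff algebra_simps)

lemma ULoop_Conn: "T \<in> ULoop \<Longrightarrow> A \<in> Conn \<Longrightarrow> T A \<in> Conn"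
  using Conn_add[of A "T A - A"] ULoopD(3)[of T A "-1"] Conn_SFil[of A] by simp

lemma gauge_rel_iff:
  "(A, A') \<in> gauge_rel L \<longleftrightarrow> A \<in> Conn \<and> A' \<in> Conn \<and> (\<exists>T\<in>ULoop. \<forall>v. nabla A' (T v) = T (nabla A v))"
proof
  assume "(A, A') \<in> gauge_rel L"
  then obtain \<gamma> where g: "A \<in> Conn" "A' \<in> Conn" "\<gamma> \<in> unipotent_loops L" "gauge_transform L \<gamma> A A'"
    by (auto simp: gauge_rel_def)
  have T: "loop_op \<gamma> \<in> ULoop" by (rule unipotent_loops_ULoop[OF g(3)])
  have "coeff_op (loop_op \<gamma>) = \<gamma>" using g(3) by (intro coeff_op_loop_op) (simp add: unipotent_loops_def)
  then have "\<forall>v. nabla A' (loop_op \<gamma> v) = loop_op \<gamma> (nabla A v)"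
    using gauge_transform_iff[OF ULoopD(1)[OF T], of A A'] g(4) by simp
  then show "A \<in> Conn \<and> A' \<in> Conn \<and> (\<exists>T\<in>ULoop. \<forall>v. nabla A' (T v) = T (nabla A v))" using T g by blast
next
  assume "A \<in> Conn \<and> A' \<in> Conn \<and> (\<exists>T\<in>ULoop. \<forall>v. nabla A' (T v) = T (nabla A v))"
  then obtain T where T: "A \<in> Conn" "A' \<in> Conn" "T \<in> ULoop" "\<forall>v. nabla A' (T v) = T (nabla A v)" by blast
  then have "gauge_transform L (coeff_op T) A A'" using gauge_transform_iff[OF ULoopD(1)[OF T(3)]] by blast
  then show "(A, A') \<in> gauge_rel L" using T ULoop_unipotent_loops[OF T(3)] by (auto simp: gauge_rel_def)
qed

lemma gauge_refl: "A \<in> Conn \<Longrightarrow> (A, A) \<in> gauge_rel L"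
  using ULoop_id by (auto simp: gauge_rel_iff)

lemma gauge_sym: "(A, A') \<in> gauge_rel L \<Longrightarrow> (A', A) \<in> gauge_rel L"
proof -
  assume "(A, A') \<in> gauge_rel L"
  then obtain T where T: "A \<in> Conn" "A' \<in> Conn" "T \<in> ULoop" "\<And>v. nabla A' (T v) = T (nabla A v)"
    by (auto simp: gauge_rel_iff)
  obtain S where S: "S \<in> ULoop" "\<And>v. S (T v) = v" "\<And>v. T (S v) = v" using ULoop_inverse[OF T(3)] by metis
  have "nabla A (S v) = S (nabla A' v)" for v
  proof -
    have "T (nabla A (S v)) = nabla A' v" by (simp add: T(4)[symmetric] S(3))
    then show ?thesis by (metis S(2))
  qed
  then show ?thesis using T S by (auto simp: gauge_rel_iff)
qed

lemma gauge_trans: "(A, B) \<in> gauge_rel L \<Longrightarrow> (B, C) \<in> gauge_rel L \<Longrightarrow> (A, C) \<in> gauge_rel L"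
proof -
  assume "(A, B) \<in> gauge_rel L" "(B, C) \<in> gauge_rel L"
  then obtain S T where T: "A \<in> Conn" "C \<in> Conn" "T \<in> ULoop" "S \<in> ULoop" "\<And>v. nabla B (T v) = T (nabla A v)"
    "\<And>v. nabla C (S v) = S (nabla B v)"
    by (auto simp: gauge_rel_iff)
  have "\<forall>v. nabla C (S (T v)) = S (T (nabla A v))" by (simp add: T)
  then show ?thesis unfolding gauge_rel_iff
    by (intro conjI T(1,2) bexI[of _ "\<lambda>v. S (T v)"] ULoop_comp[OF T(4,3)])
qed

lemma gauge_rel_Conn: "(A, A') \<in> gauge_rel L \<Longrightarrow> A \<in> Conn \<and> A' \<in> Conn"
  by (simp add: gauge_rel_iff)

lemma oper_class_eq: "(A, A') \<in> gauge_rel L \<Longrightarrow> oper_class L A = oper_class L A'"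
  unfolding oper_class_def using gauge_sym gauge_trans by blast

lemma opers_class: "A \<in> Conn \<Longrightarrow> oper_class L A \<in> opers L"
  unfolding opers_def oper_class_def by (rule quotientI)

lemma opersE: assumes "\<chi> \<in> opers L" obtains A where "A \<in> Conn" "\<chi> = oper_class L A"
  using assms unfolding opers_def oper_class_def by (auto elim: quotientE)

lemma oper_class_mem: "A' \<in> oper_class L A \<longleftrightarrow> (A, A') \<in> gauge_rel L"
  by (simp add: oper_class_def)

lemma exp_gauge_Conn: "y \<in> Fil 1 \<Longrightarrow> A \<in> Conn \<Longrightarrow> exp_gauge x y A \<in> Conn"
proof -
  assume y: "y \<in> Fil 1" and A: "A \<in> Conn"
  have "y \<in> Fil 0" using y by (rule Fil_mono[rotated]) simp
  from Conn_add[OF ULoop_Conn[OF exp_loop_ULoop[OF y] A] SFil_rules(5)[OF SFil_rules(4)[OF SFil_rules(6)[OF this]]]]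
  have "exp_loop x y A + - tmul (fps_deriv x) (cst y) \<in> Conn" .
  then show ?thesis by (simp add: exp_gauge_def)
qed

lemma exp_gauge_rel: "y \<in> Fil 1 \<Longrightarrow> A \<in> Conn \<Longrightarrow> (A, exp_gauge x y A) \<in> gauge_rel L"
  unfolding gauge_rel_iff using exp_gauge_Conn exp_loop_ULoop exp_loop_intertwines by blast

subsection \<open>Normalization, one power of \<open>t\<close> at a time\<close>

text \<open>The component in \<open>\<nn>\<close> of the coefficient of \<open>t^m\<close>.\<close>

definition nil_part :: "nat \<Rightarrow> (nat \<Rightarrow> 'g) \<Rightarrow> 'g" where
  "nil_part m A = (A m - pm m) - proj 0 (A m - pm m)"

text \<open>The series \<open>t^(m+1)/(m+1)\<close>, with derivative \<open>t^m\<close>. For \<open>y\<close> in \<open>\<nn>\<close> the gauge transformation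
  by \<open>exp(t^(m+1)/(m+1) y)\<close> subtracts \<open>y\<close> from the coefficient of \<open>t^m\<close> and does not change the
  coefficients before it.\<close>

definition step_param :: "nat \<Rightarrow> complex fps" where
  "step_param m = fps_const (1 / of_nat (Suc m)) * fps_X ^ Suc m"

definition step :: "nat \<Rightarrow> (nat \<Rightarrow> 'g) \<Rightarrow> nat \<Rightarrow> 'g" where
  "step m A = exp_gauge (step_param m) (nil_part m A) A"

lemma step_param_nth: "step_param m $ n = (if n = Suc m then 1 / of_nat (Suc m) else 0)"
  by (simp add: step_param_def del: power_Suc)

lemma step_param_deriv: "fps_deriv (step_param m) $ n = (if n = m then 1 else 0)"
  by (simp add: step_param_nth del: of_nat_Suc)

lemma nil_part_Fil: "A \<in> Conn \<Longrightarrow> nil_part m A \<in> Fil 1"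
  using Fil_split[of "A m - pm m" 0] by (auto simp: nil_part_def Conn_iff SFil_def)

lemma step_low: "j \<le> m \<Longrightarrow> step m A j = (if j = m then A m - nil_part m A else A j)"
  using exp_loop_low[of "Suc m" "step_param m" j "nil_part m A" A]
  by (simp add: step_def exp_gauge_def tmul_cst step_param_nth step_param_deriv del: fps_deriv_nth)

fun iter_step :: "nat \<Rightarrow> (nat \<Rightarrow> 'g) \<Rightarrow> nat \<Rightarrow> 'g" where
  "iter_step 0 A = A"
| "iter_step (Suc m) A = step m (iter_step m A)"

text \<open>The accumulated gauge transformation of the first \<open>m\<close> normalization steps.\<close>

fun iter_op :: "nat \<Rightarrow> (nat \<Rightarrow> 'g) \<Rightarrow> (nat \<Rightarrow> 'g) \<Rightarrow> nat \<Rightarrow> 'g" where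
  "iter_op 0 A v = v"
| "iter_op (Suc m) A v = exp_loop (step_param m) (nil_part m (iter_step m A)) (iter_op m A v)"

lemma iter_step_Conn: "A \<in> Conn \<Longrightarrow> iter_step m A \<in> Conn"
  by (induction m) (auto simp: step_def intro: exp_gauge_Conn nil_part_Fil)

lemma iter_op_ULoop: "A \<in> Conn \<Longrightarrow> iter_op m A \<in> ULoop"
proof (induction m)
  case 0
  have "iter_op 0 A = (\<lambda>v. v)" by (rule ext) simp
  then show ?case by (simp only: ULoop_id)
next
  case (Suc m)
  have "iter_op (Suc m) A = (\<lambda>v. exp_loop (step_param m) (nil_part m (iter_step m A)) (iter_op m A v))" by (rule ext) simp
  moreover have "\<dots> \<in> ULoop"
    by (rule ULoop_comp[OF exp_loop_ULoop Suc.IH[OF Suc.prems]]) (intro nil_part_Fil iter_step_Conn Suc.prems)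
  ultimately show ?case by (simp only:)
qed

lemma iter_op_intertwines: "A \<in> Conn \<Longrightarrow> nabla (iter_step m A) (iter_op m A v) = iter_op m A (nabla A v)"
proof (induction m)
  case (Suc m)
  have n: "nil_part m (iter_step m A) \<in> Fil 1" by (rule nil_part_Fil[OF iter_step_Conn[OF Suc.prems]])
  show ?case
    using exp_loop_intertwines[OF n, of "step_param m" "iter_step m A" "iter_op m A v"] Suc
    by (simp add: step_def)
qed simp

lemma iter_step_stable: "n < m \<Longrightarrow> iter_step m A n = iter_step (Suc n) A n"
proof (induction m)
  case (Suc m)
  then show ?case using step_low[of n m "iter_step m A"] by (cases "n = m") auto
qed simp

lemma iter_op_stable: "n \<le> m \<Longrightarrow> iter_op m A v n = iter_op n A v n"
proof (induction m)
  case (Suc m)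
  show ?case
  proof (cases "n = Suc m")
    case False
    then have "n \<le> m" using Suc.prems by simp
    then show ?thesis
      using Suc.IH exp_loop_low[of "Suc m" "step_param m" n] by (simp add: step_param_nth)
  qed simp
qed simp

text \<open>The coefficient of \<open>t^n\<close> no longer changes after step \<open>n\<close>.\<close>

definition miura_lim :: "(nat \<Rightarrow> 'g) \<Rightarrow> nat \<Rightarrow> 'g" where
  "miura_lim A n = iter_step (Suc n) A n"

definition op_lim :: "(nat \<Rightarrow> 'g) \<Rightarrow> (nat \<Rightarrow> 'g) \<Rightarrow> nat \<Rightarrow> 'g" where
  "op_lim A v n = iter_op n A v n"

lemma op_lim_eq: "n \<le> m \<Longrightarrow> op_lim A v n = iter_op m A v n"
  unfolding op_lim_def by (rule iter_op_stable[symmetric])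

lemma op_lim_ULoop: assumes A: "A \<in> Conn" shows "op_lim A \<in> ULoop"
proof -
  note G = iter_op_ULoop[OF A]
  have "tlin (op_lim A)"
    unfolding tlin_def
  proof (intro conjI allI ext)
    show "op_lim A (v + w) n = (op_lim A v + op_lim A w) n" for v w n
      by (simp add: op_lim_def tlinD(1)[OF ULoopD(1)[OF G]])
    show "op_lim A (tmul c v) n = tmul c (op_lim A v) n" for c v n
    proof -
      have "op_lim A (tmul c v) n = (\<Sum>i\<le>n. sc (c $ i) (iter_op n A v (n - i)))"
        by (simp add: op_lim_def tlinD(2)[OF ULoopD(1)[OF G]]) (simp add: tmul_def)
      then show ?thesis by (simp add: tmul_def op_lim_eq[of _ n])
    qed
  qed
  moreover have "op_lim A (sbr v w) = sbr (op_lim A v) (op_lim A w)" for v w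
  proof
    fix n
    have "op_lim A (sbr v w) n = (\<Sum>i\<le>n. br (iter_op n A v i) (iter_op n A w (n - i)))"
      by (simp add: op_lim_def ULoopD(2)[OF G]) (simp add: sbr_def)
    then show "op_lim A (sbr v w) n = sbr (op_lim A v) (op_lim A w) n" by (simp add: sbr_def op_lim_eq[of _ n])
  qed
  moreover have "op_lim A v - v \<in> SFil (k + 1)" if v: "v \<in> SFil k" for v k
    using ULoopD(3)[OF G v] by (auto simp: SFil_def op_lim_def)
  ultimately show ?thesis by (simp add: ULoop_def)
qed

lemma op_lim_intertwines: assumes A: "A \<in> Conn" shows "nabla (miura_lim A) (op_lim A v) = op_lim A (nabla A v)"
proof
  fix n
  have "nabla (miura_lim A) (op_lim A v) n = nabla (iter_step (Suc n) A) (iter_op (Suc n) A v) n"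
  proof -
    have "op_lim A v j = iter_op (Suc n) A v j" if "j \<le> Suc n" for j using op_lim_eq[OF that] .
    moreover have "miura_lim A j = iter_step (Suc n) A j" if "j \<le> n" for j
      using iter_step_stable[of j "Suc n" A] that by (simp add: miura_lim_def)
    ultimately show ?thesis by (simp add: nabla_def sder_def sbr_def)
  qed
  also have "\<dots> = iter_op (Suc n) A (nabla A v) n" by (simp only: iter_op_intertwines[OF A])
  also have "\<dots> = op_lim A (nabla A v) n" by (rule op_lim_eq[symmetric]) simp
  finally show "nabla (miura_lim A) (op_lim A v) n = op_lim A (nabla A v) n" .
qed

lemma miura_lim_H: assumes A: "A \<in> Conn" shows "miura_lim A n - pm n \<in> H"
proof -
  let ?B = "iter_step n A"
  have "miura_lim A n = ?B n - nil_part n ?B" by (simp add: miura_lim_def step_low)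
  then have "miura_lim A n - pm n = proj 0 (?B n - pm n)" by (simp add: nil_part_def)
  moreover have "proj 0 (?B n - pm n) \<in> H" using proj_gr gr0_eq_H by blast
  ultimately show ?thesis by (simp only:)
qed

lemma miura_lim_Conn: "A \<in> Conn \<Longrightarrow> miura_lim A \<in> Conn"
  using miura_lim_H gr_Fil[OF H_gr0] by (auto simp: Conn_iff SFil_def)

lemma miura_lim_gauge: "A \<in> Conn \<Longrightarrow> (A, miura_lim A) \<in> gauge_rel L"
  unfolding gauge_rel_iff using miura_lim_Conn op_lim_ULoop op_lim_intertwines by blast

lemma miura_lim_fixed:
  assumes "\<And>n. A n - pm n \<in> H" shows "miura_lim A = A"
proof -
  have "nil_part m A = 0" for m using H_gr0[OF assms, of m] by (simp add: nil_part_def gr_iff del: proj_linear)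
  then have "step m A = A" for m by (simp add: step_def exp_gauge_def exp_loop_zero) (auto simp: tmul_cst)
  then have "iter_step m A = A" for m by (induction m) auto
  then show ?thesis by (auto simp: miura_lim_def)
qed

subsection \<open>Coordinates on Miura opers\<close>

text \<open>Defined on all of \<open>\<gg>\<close> through the component in the Cartan subalgebra, so that it is a linear
  form, as coordinates of connections have to be.\<close>

definition cartan_coord :: "'l \<Rightarrow> 'g \<Rightarrow> complex" where
  "cartan_coord i v = \<alpha> i (proj 0 v)"

lemma linear_form_cartan_coord: "linear_form L (cartan_coord i)"
proof -
  have h: "proj 0 v \<in> H" for v using proj_gr[of 0 v] gr0_eq_H by simp
  show ?thesis by (simp add: linear_form_iff cartan_coord_def \<alpha>_add[OF h h] \<alpha>_scale[OF h])
qed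

text \<open>The Miura oper with \<open>\<alpha>\<^sub>i\<close>-coordinates \<open>u\<^sub>i = \<Sum>n. x (i, n) * t^n\<close>.\<close>

definition miura :: "('l \<times> nat \<Rightarrow> complex) \<Rightarrow> nat \<Rightarrow> 'g" where
  "miura x n = pm n + (\<Sum>i\<in>UNIV. sc (x (i, n)) (\<omega> i))"

lemma miura_H: "miura x n - pm n \<in> H"
  by (simp add: miura_def) (intro subspace_sum subspace_H subspace_scale fund_coweight)

lemma miura_Conn: "miura x \<in> Conn"
  using miura_H gr_Fil[OF H_gr0] by (auto simp: Conn_iff SFil_def)

lemma cartan_coord_H: "y \<in> H \<Longrightarrow> cartan_coord i y = \<alpha> i y"
  using H_gr0 by (simp add: cartan_coord_def gr_iff)

lemma cartan_coord_pm: "cartan_coord i (pm n) = 0"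
  using proj_of_gr[OF p_minus_gr, of 0] by (simp add: cartan_coord_def cst_def \<alpha>_0)

lemma cartan_coord_miura: "cartan_coord i (miura x n) = x (i, n)"
proof -
  have "cartan_coord i (miura x n) = cartan_coord i (pm n) + cartan_coord i (miura x n - pm n)"
    using lf_diff[OF linear_form_cartan_coord, of i "miura x n" "pm n"] by simp
  also have "\<dots> = \<alpha> i (\<Sum>j\<in>UNIV. sc (x (j, n)) (\<omega> j))"
    using cartan_coord_H[OF miura_H] by (simp add: cartan_coord_pm) (simp add: miura_def)
  also have "\<dots> = x (i, n)"
    by (subst \<alpha>_sum) (auto simp: \<alpha>_scale fund_coweight subspace_scale[OF subspace_H] if_distrib cong: if_cong)
  finally show ?thesis .
qed

lemma miura_of_H:
  assumes "\<And>n. A n - pm n \<in> H" shows "A = miura (\<lambda>(i, n). cartan_coord i (A n))"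
proof
  fix n
  have "A n - pm n = (\<Sum>i\<in>UNIV. sc (\<alpha> i (A n - pm n)) (\<omega> i))" by (rule H_expand[OF assms])
  also have "\<dots> = (\<Sum>i\<in>UNIV. sc (cartan_coord i (A n)) (\<omega> i))"
    using cartan_coord_H[OF assms[of n]] lf_diff[OF linear_form_cartan_coord, of _ "A n" "pm n"]
    by (simp add: cartan_coord_pm)
  finally show "A n = miura (\<lambda>(i, n). cartan_coord i (A n)) n" by (simp add: miura_def algebra_simps)
qed

definition miura_coords :: "(nat \<Rightarrow> 'g) \<Rightarrow> 'l \<times> nat \<Rightarrow> complex" where
  "miura_coords A = (\<lambda>(i, n). cartan_coord i (miura_lim A n))"

lemma miura_coords_gauge: "A \<in> Conn \<Longrightarrow> (A, miura (miura_coords A)) \<in> gauge_rel L"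
  using miura_lim_gauge[of A] miura_of_H[of "miura_lim A", OF miura_lim_H] by (simp add: miura_coords_def)

lemma miura_coords_miura: "miura_coords (miura x) = x"
  by (auto simp: miura_coords_def miura_lim_fixed[OF miura_H] cartan_coord_miura)

subsection \<open>Polynomial functions of a connection\<close>

definition polyc :: "((nat \<Rightarrow> 'g) \<Rightarrow> complex) \<Rightarrow> bool" where
  "polyc f \<longleftrightarrow> (\<exists>P::(('g \<Rightarrow> complex) \<times> nat) cpoly. (\<forall>(u, n)\<in>pvars P. linear_form L u) \<and>
      (\<forall>A. f A = pval (\<lambda>(u, n). u (A n)) P))"

lemma polyc_const: "polyc (\<lambda>A. c)"
  unfolding polyc_def by (intro exI[of _ "pconst c"]) simp

lemma polyc_coord: "linear_form L u \<Longrightarrow> polyc (\<lambda>A. u (A n))"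
  unfolding polyc_def by (intro exI[of _ "pvar (u, n)"]) simp

lemma polyc_add: "polyc f \<Longrightarrow> polyc g \<Longrightarrow> polyc (\<lambda>A. f A + g A)"
proof -
  assume "polyc f" "polyc g"
  then obtain P Q where P: "\<forall>(u, n)\<in>pvars P. linear_form L u" "\<And>A. f A = pval (\<lambda>(u, n). u (A n)) P"
    and Q: "\<forall>(u, n)\<in>pvars Q. linear_form L u" "\<And>A. g A = pval (\<lambda>(u, n). u (A n)) Q"
    by (auto simp: polyc_def)
  show ?thesis
    unfolding polyc_def
    by (intro exI[of _ "P + Q"] conjI) (use P Q pvars_add[of P Q] in \<open>auto simp: idh.peval_add\<close>)
qed

lemma polyc_mult: "polyc f \<Longrightarrow> polyc g \<Longrightarrow> polyc (\<lambda>A. f A * g A)"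
proof -
  assume "polyc f" "polyc g"
  then obtain P Q where P: "\<forall>(u, n)\<in>pvars P. linear_form L u" "\<And>A. f A = pval (\<lambda>(u, n). u (A n)) P"
    and Q: "\<forall>(u, n)\<in>pvars Q. linear_form L u" "\<And>A. g A = pval (\<lambda>(u, n). u (A n)) Q"
    by (auto simp: polyc_def)
  show ?thesis
    unfolding polyc_def
    by (intro exI[of _ "P * Q"] conjI) (use P Q pvars_mult[of P Q] in \<open>auto simp: idh.peval_mult\<close>)
qed

lemma polyc_sum: "(\<And>a. a \<in> I \<Longrightarrow> polyc (f a)) \<Longrightarrow> polyc (\<lambda>A. \<Sum>a\<in>I. f a A)"
proof (induction I rule: infinite_finite_induct)
  case (insert i I)
  have "polyc (\<lambda>A. f i A + (\<Sum>a\<in>I. f a A))" by (rule polyc_add) (use insert in blast)+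
  then show ?case using insert.hyps by simp
qed (simp_all add: polyc_const)

definition polyv :: "((nat \<Rightarrow> 'g) \<Rightarrow> 'g) \<Rightarrow> bool" where
  "polyv f \<longleftrightarrow> (\<forall>b\<in>WB. polyc (\<lambda>A. rep (f A) b))"

lemma polyv_coord: "polyv (\<lambda>A. A n)"
  unfolding polyv_def using polyc_coord[OF linear_form_rep] by blast

lemma polyv_const: "polyv (\<lambda>A. c)"
  unfolding polyv_def using polyc_const by blast

lemma polyv_add: "polyv f \<Longrightarrow> polyv g \<Longrightarrow> polyv (\<lambda>A. f A + g A)"
  unfolding polyv_def rep_add by (intro ballI polyc_add) auto

lemma polyv_sum: "(\<And>a. a \<in> I \<Longrightarrow> polyv (f a)) \<Longrightarrow> polyv (\<lambda>A. \<Sum>a\<in>I. f a A)"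
  unfolding polyv_def rep_linear_sum by (intro ballI polyc_sum) auto

lemma polyc_linear_form: assumes u: "linear_form L u" and f: "polyv f" shows "polyc (\<lambda>A. u (f A))"
proof -
  have "u (f A) = (\<Sum>b\<in>WB. rep (f A) b * u b)" for A
  proof -
    have "u (f A) = u (\<Sum>b\<in>WB. sc (rep (f A) b) b)" by (simp only: rep_sum)
    then show ?thesis by (simp add: lf_sum[OF u] lf_scale[OF u])
  qed
  moreover have "polyc (\<lambda>A. \<Sum>b\<in>WB. rep (f A) b * u b)"
    using f by (intro polyc_sum polyc_mult polyc_const) (auto simp: polyv_def)
  ultimately show ?thesis by presburger
qed

lemma polyv_linear: "lin T \<Longrightarrow> polyv f \<Longrightarrow> polyv (\<lambda>A. T (f A))"
  unfolding polyv_def[of "\<lambda>A. T (f A)"]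
  by (intro ballI) (rule polyc_linear_form[OF linear_form_comp[OF linear_form_rep]])

lemma polyv_br: assumes f: "polyv f" and g: "polyv g" shows "polyv (\<lambda>A. br (f A) (g A))"
  unfolding polyv_def
proof
  fix b
  have eq: "rep (br (f A) (g A)) b = (\<Sum>c\<in>WB. \<Sum>d\<in>WB. rep (br c d) b * rep (f A) c * rep (g A) d)" for A
    by (rule linear_form_bracket[OF linear_form_rep])
  show "polyc (\<lambda>A. rep (br (f A) (g A)) b)"
    unfolding eq using f g by (intro polyc_sum polyc_mult polyc_const) (auto simp: polyv_def)
qed

lemma polyv_dpow: "polyv f \<Longrightarrow> polyv g \<Longrightarrow> polyv (\<lambda>A. dpow (f A) l (g A))"
proof -
  assume f: "polyv f" and g: "polyv g"
  have "polyv (\<lambda>A. (br (f A) ^^ l) (g A))"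
  proof (induction l)
    case (Suc l)
    then show ?case using polyv_br[OF f Suc] by simp
  qed (simp add: g)
  then show ?thesis unfolding dpow_def by (rule polyv_linear[OF lin_scale_fun])
qed

lemma polyv_scale: "polyv f \<Longrightarrow> polyv (\<lambda>A. sc c (f A))"
  by (rule polyv_linear[OF lin_scale_fun])

lemma polyv_diff: "polyv f \<Longrightarrow> polyv g \<Longrightarrow> polyv (\<lambda>A. f A - g A)"
  using polyv_add[of f "\<lambda>A. sc (-1) (g A)"] polyv_scale[of g "-1"] by simp

text \<open>The exponentials are finite sums, so each normalization step is polynomial in the
  coefficients.\<close>

lemma polyv_iter_step: "polyv (\<lambda>A. iter_step m A n)"
proof (induction m arbitrary: n)
  case 0
  then show ?case by (simp add: polyv_coord)
next
  case (Suc m)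
  have nil: "polyv (\<lambda>A. nil_part m (iter_step m A))"
    unfolding nil_part_def by (intro polyv_diff polyv_linear[OF lin_proj] Suc polyv_const)
  have "iter_step (Suc m) A n = (\<Sum>l\<le>NN. \<Sum>i\<le>n. sc ((step_param m ^ l) $ i) (dpow (nil_part m (iter_step m A)) l (iter_step m A (n - i))))
      - sc (fps_deriv (step_param m) $ n) (nil_part m (iter_step m A))" for A
    by (simp add: step_def exp_gauge_def tmul_cst exp_loop_def sum_fun_apply) (simp add: tmul_def liftop_def)
  moreover have "polyv (\<lambda>A. (\<Sum>l\<le>NN. \<Sum>i\<le>n. sc ((step_param m ^ l) $ i) (dpow (nil_part m (iter_step m A)) l (iter_step m A (n - i))))
      - sc (fps_deriv (step_param m) $ n) (nil_part m (iter_step m A)))"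
    by (intro polyv_diff polyv_sum polyv_scale polyv_dpow nil Suc)
  ultimately show ?case by presburger
qed

lemma polyc_miura_coords: "polyc (\<lambda>A. miura_coords A v)"
  by (cases v) (auto simp: miura_coords_def miura_lim_def simp del: iter_step.simps
      intro!: polyc_linear_form[OF linear_form_cartan_coord] polyv_iter_step)

lemma polyc_pval: "(\<And>v. polyc (\<lambda>A. f A v)) \<Longrightarrow> polyc (\<lambda>A. pval (f A) q)"
proof -
  assume "\<And>v. polyc (\<lambda>A. f A v)"
  then have "\<forall>v. \<exists>P::(('g \<Rightarrow> complex) \<times> nat) cpoly. (\<forall>(u, n)\<in>pvars P. linear_form L u) \<and>
      (\<forall>A. f A v = pval (\<lambda>(u, n). u (A n)) P)" by (simp add: polyc_def)
  then obtain R where R: "\<And>v. \<forall>(u, n)\<in>pvars (R v). linear_form L u" "\<And>v A. f A v = pval (\<lambda>(u, n). u (A n)) (R v)"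
    by metis
  show ?thesis
    unfolding polyc_def
  proof (intro exI[of _ "peval pconst R q"] conjI allI)
    show "\<forall>(u, n)\<in>pvars (peval pconst R q). linear_form L u" using pvars_peval[of R q] R(1) by blast
    show "pval (f A) q = pval (\<lambda>(u, n). u (A n)) (peval pconst R q)" for A
      unfolding pval_subst R(2)[symmetric] by simp
  qed
qed

text \<open>Curves in \<open>\<gg>[[t]]\<close> are differentiated against linear forms on the coefficients, which is all that
  a polynomial function sees. Derivatives are needed at the parameter zero only.\<close>

definition curve_derivative :: "(complex \<Rightarrow> nat \<Rightarrow> 'g) \<Rightarrow> (nat \<Rightarrow> 'g) \<Rightarrow> bool" where
  "curve_derivative c \<delta> \<longleftrightarrow> (\<forall>u n. linear_form L u \<longrightarrow> ((\<lambda>\<epsilon>. u (c \<epsilon> n)) has_field_derivative u (\<delta> n)) (at 0))"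

lemma polyc_differential:
  assumes f: "polyc f"
  shows "\<exists>D. (\<forall>\<delta> \<delta>'. D (\<delta> + \<delta>') = D \<delta> + D \<delta>') \<and>
     (\<forall>c \<delta>. c 0 = A \<longrightarrow> curve_derivative c \<delta> \<longrightarrow> ((\<lambda>\<epsilon>. f (c \<epsilon>)) has_field_derivative D \<delta>) (at 0))"
proof -
  obtain P where P: "\<forall>(u, n)\<in>pvars P. linear_form L u" "\<And>A. f A = pval (\<lambda>(u, n). u (A n)) P"
    using f by (auto simp: polyc_def)
  define D where "D = (\<lambda>\<delta>. pdir (\<lambda>(u, n). u (A n)) (\<lambda>(u, n). u (\<delta> n)) P)"
  show ?thesis
  proof (intro exI[of _ D] conjI allI impI)
    fix \<delta> \<delta>'
    have "D (\<delta> + \<delta>') = pdir (\<lambda>(u, n). u (A n)) (\<lambda>v. (case v of (u, n) \<Rightarrow> u (\<delta> n)) + (case v of (u, n) \<Rightarrow> u (\<delta>' n))) P"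
      unfolding D_def
    proof (rule pdir_cong)
      fix v assume "v \<in> pvars P"
      then obtain u n where v: "v = (u, n)" "linear_form L u" using P(1) by (cases v) auto
      show "(case v of (u, n) \<Rightarrow> u ((\<delta> + \<delta>') n)) = (case v of (u, n) \<Rightarrow> u (\<delta> n)) + (case v of (u, n) \<Rightarrow> u (\<delta>' n))"
        by (simp add: v lf_add)
    qed
    then show "D (\<delta> + \<delta>') = D \<delta> + D \<delta>'" by (simp add: D_def pdir_add)
  next
    fix c \<delta> assume c0: "c 0 = A" and c: "curve_derivative c \<delta>"
    have "((\<lambda>\<epsilon>. pval (\<lambda>(u, n). u (c \<epsilon> n)) P) has_field_derivative
        pdir (\<lambda>(u, n). u (c 0 n)) (\<lambda>(u, n). u (\<delta> n)) P) (at 0)"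
    proof (rule has_field_derivative_pval)
      fix v assume "v \<in> pvars P"
      then obtain u n where v: "v = (u, n)" "linear_form L u" using P(1) by (cases v) auto
      show "((\<lambda>s. case v of (u, n) \<Rightarrow> u (c s n)) has_field_derivative (case v of (u, n) \<Rightarrow> u (\<delta> n))) (at 0)"
        using c v by (simp add: curve_derivative_def)
    qed
    then show "((\<lambda>\<epsilon>. f (c \<epsilon>)) has_field_derivative D \<delta>) (at 0)" by (simp add: P(2) D_def c0)
  qed
qed

end

section \<open>Screening operators\<close>

lemma derivation_of_zero: "(\<And>v. v \<in> pvars p \<Longrightarrow> d v = 0) \<Longrightarrow> derivation_of d p = 0"
  unfolding derivation_of_def
proof (intro sum.neutral ballI)
  fix m v assume d: "\<And>v. v \<in> pvars p \<Longrightarrow> d v = 0" and m: "m \<in> Poly_Mapping.keys p" "v \<in> Poly_Mapping.keys m"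
  have "v \<in> pvars p" using m by (auto simp: pvars_def)
  then have "d v = 0" by (rule d)
  then show "Poly_Mapping.single (m - Poly_Mapping.single v 1) (Poly_Mapping.lookup p m * of_nat (Poly_Mapping.lookup m v)) * d v = 0"
    by (simp only: mult_zero_right)
qed

definition useries :: "('l \<times> nat \<Rightarrow> complex) \<Rightarrow> 'l \<Rightarrow> complex fps" where
  "useries x i = Abs_fps (\<lambda>n. x (i, n))"

text \<open>The value at \<open>x\<close> of the generating series of the \<open>V_coeff\<close>; it is \<open>exp(- \<integral>u\<^sub>i)\<close>.\<close>

definition wseries :: "('l \<times> nat \<Rightarrow> complex) \<Rightarrow> 'l \<Rightarrow> complex fps" where
  "wseries x i = Abs_fps (\<lambda>k. pval x (V_series i $ k))"

lemma wseries_ode: "wseries x i $ 0 = 1" "fps_deriv (wseries x i) = - useries x i * wseries x i"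
proof -
  define mp where "mp = (\<lambda>f. Abs_fps (\<lambda>n. pval x (f $ n)))"
  have mp_mult: "mp (f * g) = mp f * mp g" for f g
    by (rule fps_ext) (simp add: mp_def fps_mult_nth idh.peval_sum idh.peval_mult)
  have mp_1: "mp 1 = 1" by (rule fps_ext) (simp add: mp_def)
  have mp_pow: "mp (f ^ n) = mp f ^ n" for f n
    by (induction n) (simp_all add: mp_1 mp_mult)
  define b where "b = Abs_fps (\<lambda>m. if m = 0 then 0 else pconst (- 1 / of_nat m) * bgen i (- int m))"
  define c where "c = Abs_fps (\<lambda>m. if m = 0 then 0 else - x (i, m - 1) / of_nat m)"
  have bc: "mp b = c"
    by (rule fps_ext) (simp add: mp_def b_def c_def bgen_def idh.peval_mult nat_diff_distrib)
  have e: "fps_exp (1::complex) = Abs_fps (\<lambda>n. 1 / fact n)" by (rule fps_ext) simp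
  have w: "wseries x i = fps_exp 1 oo c"
  proof (rule fps_ext)
    fix n
    have "(fps_exp 1 oo c) $ n = (\<Sum>j=0..n. 1 / fact j * (mp (b ^ j) $ n))"
      by (simp add: fps_compose_nth mp_pow bc)
    then show "wseries x i $ n = (fps_exp 1 oo c) $ n"
      by (simp add: wseries_def V_series_def b_def[symmetric] fps_compose_nth idh.peval_sum idh.peval_mult mp_def)
  qed
  have c0: "c $ 0 = 0" by (simp add: c_def)
  show "wseries x i $ 0 = 1" by (simp add: w)
  have "fps_deriv c = - useries x i" by (rule fps_ext) (simp add: c_def useries_def field_simps del: of_nat_Suc)
  then show "fps_deriv (wseries x i) = - useries x i * wseries x i"
    unfolding w by (simp add: fps_compose_deriv[OF c0] mult.commute)
qed

text \<open>In the coordinates \<open>u\<^sub>j\<close> the screening operator is the derivative along the vector field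
  \<open>u\<^sub>j \<mapsto> a\<^sub>i\<^sub>j exp(- \<integral>u\<^sub>i)\<close>.\<close>

lemma pval_V_screening:
  "pval x (V_screening L i p) = pdir x (\<lambda>(j, k). wseries x i $ k * cartan_entry L i j) p"
proof -
  define S where "S = snd ` pvars p"
  have fS: "finite S" by (simp add: S_def finite_pvars)
  have "V_screening L i p = (\<Sum>k\<in>S. V_coeff i (- int k) * D_b L i (- int k - 1) p)"
    unfolding V_screening_def
  proof (rule Sum_any.expand_superset[OF fS])
    have "D_b L i (- int k - 1) p = 0" if "k \<notin> S" for k
      unfolding D_b_def by (rule derivation_of_zero) (use that in \<open>force simp: S_def\<close>)
    then show "{k. V_coeff i (- int k) * D_b L i (- int k - 1) p \<noteq> 0} \<subseteq> S" by force
  qed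
  then have "pval x (V_screening L i p) = (\<Sum>k\<in>S. wseries x i $ k * pdir x (\<lambda>(j, k'). if k' = k then cartan_entry L i j else 0) p)"
    by (simp add: idh.peval_sum idh.peval_mult V_coeff_def wseries_def D_b_def pval_derivation_of case_prod_unfold
        if_distrib[of "pval x"] cong: if_cong)
  also have "\<dots> = pdir x (\<lambda>v. \<Sum>k\<in>S. wseries x i $ k * (case v of (j, k') \<Rightarrow> if k' = k then cartan_entry L i j else 0)) p"
    by (simp add: pdir_sum pdir_scale)
  also have "\<dots> = pdir x (\<lambda>(j, k). wseries x i $ k * cartan_entry L i j) p"
  proof (rule pdir_cong)
    fix v assume v: "v \<in> pvars p"
    obtain j k where jk: "v = (j, k)" by fastforce
    have "k \<in> S" using v jk by (force simp: S_def)
    then show "(\<Sum>k\<in>S. wseries x i $ k * (case v of (j, k') \<Rightarrow> if k' = k then cartan_entry L i j else 0)) =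
       (case v of (j, k) \<Rightarrow> wseries x i $ k * cartan_entry L i j)"
      using fS by (simp add: jk if_distrib cong: if_cong)
  qed
  finally show ?thesis .
qed

context simple_lie begin

text \<open>The solution with \<open>x(0) = c\<close> of the Riccati equation \<open>x' = - u\<^sub>i x - x\<^sup>2\<close>, in terms of the solution
  \<open>w = exp(- \<integral>u\<^sub>i)\<close> of its linear part.\<close>

definition riccati :: "('l \<times> nat \<Rightarrow> complex) \<Rightarrow> 'l \<Rightarrow> complex \<Rightarrow> complex fps" where
  "riccati x i c = fps_const c * wseries x i * inverse (1 + fps_const c * fps_integral0 (wseries x i))"

lemma riccati: "riccati x i c $ 0 = c"
  "fps_deriv (riccati x i c) = - useries x i * riccati x i c - riccati x i c * riccati x i c"
proof -
  let ?w = "wseries x i"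
  let ?D = "1 + fps_const c * fps_integral0 ?w"
  let ?r = "riccati x i c"
  have D0: "?D $ 0 = 1" by simp
  then have D0': "?D $ 0 \<noteq> 0" by simp
  show "?r $ 0 = c" by (simp add: riccati_def wseries_ode)
  have rD: "?r * ?D = fps_const c * ?w"
    using inverse_mult_eq_1[OF D0'] by (simp add: riccati_def mult.assoc)
  have dD: "fps_deriv ?D = fps_const c * ?w" by (simp add: fps_deriv_fps_integral)
  have "fps_deriv (?r * ?D) = ?r * fps_deriv ?D + fps_deriv ?r * ?D" by (rule fps_deriv_mult)
  then have "fps_deriv ?r * ?D + ?r * (?r * ?D) = fps_deriv (?r * ?D)"
    unfolding dD rD by (simp only: add.commute)
  also have "\<dots> = fps_const c * fps_deriv ?w" unfolding rD by (simp add: fps_deriv_mult)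
  also have "\<dots> = - useries x i * (?r * ?D)" unfolding rD wseries_ode(2) by (simp add: mult.left_commute)
  finally have "(fps_deriv ?r + ?r * ?r + useries x i * ?r) * ?D = 0" by (simp add: algebra_simps)
  moreover have "?D \<noteq> 0" using D0 by (metis fps_zero_nth zero_neq_one)
  ultimately have "fps_deriv ?r + ?r * ?r + useries x i * ?r = 0" by (simp only: mult_eq_0_iff) simp
  then show "fps_deriv ?r = - useries x i * ?r - ?r * ?r" by (simp add: eq_neg_iff_add_eq_0 algebra_simps)
qed

text \<open>The coordinates of the Miura oper that is obtained by the gauge transformation \<open>exp(x e\<^sub>i)\<close>,
  with \<open>x\<close> the solution of the Riccati equation: it adds \<open>x h\<^sub>i\<close>.\<close>

definition screen :: "'l \<Rightarrow> complex \<Rightarrow> ('l \<times> nat \<Rightarrow> complex) \<Rightarrow> 'l \<times> nat \<Rightarrow> complex" where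
  "screen i c x = (\<lambda>(j, n). x (j, n) + riccati x i c $ n * cartan_entry L i j)"

text \<open>This bracket has degree zero, so it commutes with the Cartan subalgebra; but its weight
  would be \<open>\<alpha>\<^sub>i - \<alpha>\<^sub>j\<close>.\<close>

lemma E_F_distinct: assumes "i \<noteq> j" shows "br (E i) (F j) = 0"
proof (rule ccontr)
  assume nz: "br (E i) (F j) \<noteq> 0"
  have "br (E i) (F j) \<in> gr (1 + - 1)" by (intro br_gr E_gr F_gr)
  then have g0: "br (E i) (F j) \<in> gr 0" by simp
  have eq: "\<alpha> i y = \<alpha> j y" if y: "y \<in> H" for y
  proof -
    have "0 = br y (br (E i) (F j))" using gr0_centralizes[OF g0 y] by simp
    also have "\<dots> = sc (\<alpha> i y - \<alpha> j y) (br (E i) (F j))"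
      using root_spaceD[OF E_root y, of i] root_spaceD[OF F_root y, of j]
      by (subst br_derivation) (simp add: bracket_scale_left bracket_scale_right br_neg scale_left_diff_distrib)
    finally show ?thesis using nz by simp
  qed
  have "(if i = i then 1 else if i = j then - 1 else 0 :: complex) = 0"
  proof (rule \<alpha>_indep[of "\<lambda>k. if k = i then 1 else if k = j then - 1 else 0"])
    fix y assume y: "y \<in> H"
    have "(\<Sum>k\<in>UNIV. (if k = i then 1 else if k = j then - 1 else 0) * \<alpha> k y) =
        (\<Sum>k\<in>{i, j}. (if k = i then 1 else if k = j then - 1 else 0) * \<alpha> k y)"
      by (rule sum.mono_neutral_right) auto
    then show "(\<Sum>k\<in>UNIV. (if k = i then 1 else if k = j then - 1 else 0) * \<alpha> k y) = 0"
      using assms eq[OF y] by simp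
  qed
  then show False by simp
qed

text \<open>On a Miura oper the exponential series stops at the quadratic term: \<open>ad e\<^sub>i\<close> maps \<open>p\<^sub>-\<^sub>1\<close> to
  \<open>h\<^sub>i\<close>, further to \<open>- 2 e\<^sub>i\<close>, and then to zero.\<close>

lemma exp_gauge_E_miura:
  "exp_gauge \<xi> (E i) (miura x) =
     miura x + tmul \<xi> (cst (Hc i)) - tmul (\<xi> * useries x i + \<xi> * \<xi> + fps_deriv \<xi>) (cst (E i))"
proof -
  let ?A = "miura x"
  have E1: "E i \<in> Fil 1" by (rule gr_Fil[OF E_gr]) simp
  have brE: "br (E i) y = sc (- \<alpha> i y) (E i)" if "y \<in> H" for y
    using root_spaceD[OF E_root that, of i] br_anti[of "E i" y] by simp
  have "br (E i) (p_minus L) = (\<Sum>j\<in>UNIV. if j = i then Hc i else 0)"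
    unfolding p_minus_def br_sum by (intro sum.cong refl) (simp add: E_F E_F_distinct)
  then have ep: "br (E i) (p_minus L) = Hc i" by simp
  have d1: "br (E i) (?A n) = cst (Hc i) n - sc (x (i, n)) (E i)" for n
  proof -
    have "br (E i) (?A n - pm n) = sc (- x (i, n)) (E i)"
      using brE[OF miura_H] cartan_coord_H[OF miura_H, of i x n] cartan_coord_miura[of i x n]
        lf_diff[OF linear_form_cartan_coord, of i "?A n" "pm n"] by (simp add: cartan_coord_pm)
    moreover have "br (E i) (pm n) = cst (Hc i) n" using ep by (simp add: cst_def)
    ultimately have "br (E i) (?A n - pm n) + br (E i) (pm n) = cst (Hc i) n - sc (x (i, n)) (E i)" by simp
    then show ?thesis by (simp add: br_diff)
  qed
  have d2: "br (E i) (br (E i) (?A n)) = cst (sc (- 2) (E i)) n" for n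
    unfolding d1 using brE[OF Hc_H, of i] \<alpha>_Hc by (auto simp: br_diff bracket_scale_right bracket_self cst_def)
  have d3: "(br (E i) ^^ (l + 3)) (?A n) = 0" for l n
  proof (induction l)
    case 0
    then show ?case using d2[of n] by (auto simp: eval_nat_numeral cst_def bracket_scale_right bracket_self br_neg)
  next
    case (Suc l)
    have "(br (E i) ^^ (Suc l + 3)) (?A n) = br (E i) ((br (E i) ^^ (l + 3)) (?A n))"
      by (simp only: add_Suc funpow.simps comp_def)
    then show ?case unfolding Suc.IH by (simp only: br_0)
  qed
  let ?D = "\<lambda>l. liftop (dpow (E i) l) ?A"
  have D0: "?D 0 = ?A" by (rule ext) (simp add: liftop_def)
  have D1: "?D 1 = cst (Hc i) - tmul (useries x i) (cst (E i))"
    by (rule ext) (simp add: liftop_def dpow_def d1 tmul_cst useries_def)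
  have D2: "?D 2 = - cst (E i)"
    by (rule ext) (simp add: liftop_def dpow_def eval_nat_numeral d2, simp add: cst_def)
  have D3: "?D l = 0" if "l \<ge> 3" for l
  proof -
    obtain m where "l = m + 3" using \<open>l \<ge> 3\<close> by (metis le_Suc_ex add.commute)
    then show ?thesis by (intro ext) (simp only: liftop_def dpow_def d3, simp)
  qed
  have "exp_loop \<xi> (E i) ?A = (\<Sum>l\<le>NN + 2. tmul (\<xi> ^ l) (?D l))"
    unfolding exp_loop_def
  proof (rule sum.mono_neutral_left)
    show "\<forall>l\<in>{..NN + 2} - {..NN}. tmul (\<xi> ^ l) (?D l) = 0"
    proof
      fix l assume "l \<in> {..NN + 2} - {..NN}"
      then have "?D l = 0" using dpow_zero[OF E1] by (intro ext) (simp add: liftop_def)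
      then show "tmul (\<xi> ^ l) (?D l) = 0" by (simp add: tmul_simps(6))
    qed
  qed auto
  also have "\<dots> = (\<Sum>l\<in>{0, 1, 2}. tmul (\<xi> ^ l) (?D l))"
  proof (rule sum.mono_neutral_right)
    show "\<forall>l\<in>{..NN + 2} - {0, 1, 2}. tmul (\<xi> ^ l) (?D l) = 0"
    proof
      fix l assume "l \<in> {..NN + 2} - {0, 1, 2}"
      then have "l \<ge> 3" by auto
      then show "tmul (\<xi> ^ l) (?D l) = 0" using D3 by (simp add: tmul_simps(6))
    qed
  qed auto
  also have "\<dots> = ?A + tmul \<xi> (cst (Hc i) - tmul (useries x i) (cst (E i))) + tmul (\<xi> * \<xi>) (- cst (E i))"
    using D0 D1 D2 by (simp add: tmul_simps(4) power2_eq_square add.assoc)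
  also have "tmul (\<xi> * \<xi>) (- cst (E i)) = - tmul (\<xi> * \<xi>) (cst (E i))"
    using tmul_simps(7)[of "\<xi> * \<xi>" 0 "cst (E i)"] by (simp add: tmul_simps(6))
  finally have "exp_loop \<xi> (E i) ?A = ?A + tmul \<xi> (cst (Hc i) - tmul (useries x i) (cst (E i))) - tmul (\<xi> * \<xi>) (cst (E i))"
    by (simp only: diff_conv_add_uminus)
  then have "exp_gauge \<xi> (E i) ?A n = (miura x + tmul \<xi> (cst (Hc i)) - tmul (\<xi> * useries x i + \<xi> * \<xi> + fps_deriv \<xi>) (cst (E i))) n" for n
    by (simp only: exp_gauge_def tmul_simps) (simp add: algebra_simps)
  then show ?thesis by (rule ext)
qed

lemma exp_gauge_riccati: "exp_gauge (riccati x i c) (E i) (miura x) = miura (screen i c x)"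
proof -
  let ?r = "riccati x i c"
  have z: "?r * useries x i + ?r * ?r + fps_deriv ?r = 0" unfolding riccati(2) by (simp add: algebra_simps)
  have "miura (screen i c x) n = miura x n + sc (?r $ n) (\<Sum>j\<in>UNIV. sc (\<alpha> j (Hc i)) (\<omega> j))" for n
    by (simp add: miura_def screen_def scale_left_distrib sum.distrib scale_sum_right cartan_entry_def add.assoc)
  then have "miura (screen i c x) n = miura x n + sc (?r $ n) (Hc i)" for n
    by (simp only: H_expand[OF Hc_H, symmetric])
  then have "miura (screen i c x) = miura x + tmul ?r (cst (Hc i))"
    by (intro ext) (simp add: tmul_cst)
  then show ?thesis unfolding exp_gauge_E_miura z by (simp add: tmul_simps(5))
qed

lemma E_Fil1: "E i \<in> Fil 1"
  by (rule gr_Fil[OF E_gr]) simp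

lemma screen_gauge: "(miura x, miura (screen i c x)) \<in> gauge_rel L"
  using exp_gauge_rel[OF E_Fil1[of i] miura_Conn[of x], of "riccati x i c"] by (simp only: exp_gauge_riccati)

lemma screen_0: "screen i 0 x = x"
  by (auto simp: screen_def riccati_def)

text \<open>Along the flow of \<open>screen i\<close> the derivative is the \<open>i\<close>-th screening operator: differentiating
  the Riccati equation in its initial value gives the linear equation of \<open>exp(- \<integral>u\<^sub>i)\<close> at the
  transformed point.\<close>

lemma riccati_derivative:
  "((\<lambda>c. riccati x i c $ n) has_field_derivative wseries (screen i c x) i $ n) (at c)"
proof (induction n rule: less_induct)
  case (less n)
  show ?case
  proof (cases n)
    case 0
    then show ?thesis by (simp add: riccati wseries_ode)
  next
    case (Suc m)
    let ?r = "\<lambda>c. riccati x i c" and ?w = "wseries (screen i c x) i"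
    have IH: "((\<lambda>c. ?r c $ j) has_field_derivative ?w $ j) (at c)" if "j \<le> m" for j
      using less.IH[of j] that Suc by simp
    have rec: "?r c $ Suc m = - (\<Sum>j\<le>m. x (i, j) * ?r c $ (m - j) + ?r c $ j * ?r c $ (m - j)) / of_nat (Suc m)" for c
    proof -
      have "of_nat (Suc m) * ?r c $ Suc m = fps_deriv (?r c) $ m" by simp
      also have "\<dots> = - (\<Sum>j\<le>m. x (i, j) * ?r c $ (m - j) + ?r c $ j * ?r c $ (m - j))"
        unfolding riccati(2) by (simp add: fps_mult_nth useries_def atLeast0AtMost sum.distrib sum_negf)
      finally show ?thesis by (simp add: field_simps del: of_nat_Suc)
    qed
    have "((\<lambda>c. - (\<Sum>j\<le>m. x (i, j) * ?r c $ (m - j) + ?r c $ j * ?r c $ (m - j)) / of_nat (Suc m)) has_field_derivative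
        - (\<Sum>j\<le>m. x (i, j) * ?w $ (m - j) + (?w $ j * ?r c $ (m - j) + ?w $ (m - j) * ?r c $ j)) / of_nat (Suc m)) (at c)"
      by (intro DERIV_cdivide DERIV_minus DERIV_sum DERIV_add DERIV_cmult DERIV_mult IH) auto
    moreover have "- (\<Sum>j\<le>m. x (i, j) * ?w $ (m - j) + (?w $ j * ?r c $ (m - j) + ?w $ (m - j) * ?r c $ j)) / of_nat (Suc m) = ?w $ Suc m"
    proof -
      have "(\<Sum>j\<le>m. ?w $ j * ?r c $ (m - j)) = (\<Sum>j\<le>m. ?w $ (m - j) * ?r c $ j)"
        by (rule sum.reindex_bij_witness[of _ "\<lambda>j. m - j" "\<lambda>j. m - j"]) auto
      then have "(\<Sum>j\<le>m. x (i, j) * ?w $ (m - j) + (?w $ j * ?r c $ (m - j) + ?w $ (m - j) * ?r c $ j)) =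
          (\<Sum>j\<le>m. (x (i, j) + 2 * ?r c $ j) * ?w $ (m - j))"
        by (simp add: sum.distrib distrib_right mult.assoc sum_distrib_left[symmetric] mult.commute[of "?r c $ _"])
      also have "\<dots> = (\<Sum>j\<le>m. useries (screen i c x) i $ j * ?w $ (m - j))"
        by (intro sum.cong refl) (simp add: useries_def screen_def cartan_entry_def \<alpha>_Hc mult.commute)
      also have "\<dots> = - (fps_deriv ?w $ m)"
        unfolding wseries_ode(2) by (simp add: fps_mult_nth atLeast0AtMost sum_negf)
      also have "\<dots> = - (of_nat (Suc m) * ?w $ Suc m)" by simp
      finally show ?thesis by (simp add: field_simps del: of_nat_Suc)
    qed
    ultimately show ?thesis unfolding Suc rec by simp
  qed
qed

lemma screen_derivative:
  "((\<lambda>c. pval (screen i c x) q) has_field_derivative pval (screen i c x) (V_screening L i q)) (at c)"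
  unfolding pval_V_screening
proof (rule has_field_derivative_pval)
  fix v :: "'l \<times> nat"
  obtain j n where v: "v = (j, n)" by fastforce
  have "((\<lambda>c. x (j, n) + riccati x i c $ n * cartan_entry L i j) has_field_derivative
      0 + wseries (screen i c x) i $ n * cartan_entry L i j) (at c)"
    by (intro DERIV_add DERIV_const DERIV_cmult_right riccati_derivative)
  then show "((\<lambda>s. screen i s x v) has_field_derivative
     (case v of (j, k) \<Rightarrow> wseries (screen i c x) i $ k * cartan_entry L i j)) (at c)"
    by (simp add: v screen_def)
qed

lemma W_screen_invariant:
  assumes q: "q \<in> classical_W L \<nu>" shows "pval (screen i c x) q = pval x q"
proof -
  have "V_screening L i q = 0" using q by (simp add: classical_W_def)
  then have "\<And>c. c \<in> UNIV \<Longrightarrow> ((\<lambda>c. pval (screen i c x) q) has_field_derivative 0) (at c within UNIV)"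
    using screen_derivative[of i x q] by simp
  then obtain k where "\<And>c. c \<in> UNIV \<Longrightarrow> pval (screen i c x) q = k"
    using has_field_derivative_zero_constant[of UNIV "\<lambda>c. pval (screen i c x) q"] by auto
  then have "pval (screen i c x) q = pval (screen i 0 x) q" by simp
  then show ?thesis by (simp only: screen_0)
qed

lemma W_screenI:
  assumes "\<And>i c x. pval (screen i c x) q = pval x q" shows "q \<in> classical_W L \<nu>"
proof -
  have "V_screening L i q = 0" for i
  proof (rule pval_zero_imp_zero)
    fix x
    have "((\<lambda>c. pval (screen i c x) q) has_field_derivative pval (screen i 0 x) (V_screening L i q)) (at 0)"
      by (rule screen_derivative)
    then have "((\<lambda>c::complex. pval x q) has_field_derivative pval x (V_screening L i q)) (at 0)"
      by (simp only: assms screen_0)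
    moreover have "((\<lambda>c::complex. pval x q) has_field_derivative 0) (at 0)" by (rule DERIV_const)
    ultimately show "pval x (V_screening L i q) = 0" by (rule DERIV_unique)
  qed
  then show ?thesis by (simp add: classical_W_def)
qed

subsection \<open>Invariants of the screening operators are gauge invariant\<close>

text \<open>The quotient \<open>R = S T\<^sup>-\<^sup>1\<close> of the two gauge transformations is \<open>1\<close> at \<open>t = 0\<close>. If its coefficients
  of \<open>t, \<dots>, t^n\<close> vanish, then the next one is \<open>ad (A'\<^sub>n - A''\<^sub>n)\<close> divided by \<open>n + 1\<close>. The coefficient
  raises degrees because \<open>R\<close> is unipotent, and \<open>A'\<^sub>n - A''\<^sub>n\<close> has degree zero, so both are zero.\<close>

lemma miura_gauge_unique:
  assumes T: "T \<in> ULoop" "\<And>v. nabla A' (T v) = T (nabla A v)"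
    and S: "S \<in> ULoop" "\<And>v. nabla A'' (S v) = S (nabla A v)"
    and eq: "coeff_op T 0 = coeff_op S 0"
    and H': "\<And>n. A' n - pm n \<in> H" and H'': "\<And>n. A'' n - pm n \<in> H"
  shows "A' = A''"
proof -
  obtain T' where T': "T' \<in> ULoop" "\<And>v. T' (T v) = v" "\<And>v. T (T' v) = v" using ULoop_inverse[OF T(1)] by metis
  define R where "R = (\<lambda>v. S (T' v))"
  have R: "R \<in> ULoop" unfolding R_def by (rule ULoop_comp[OF S(1) T'(1)])
  have "nabla A'' (R v) = R (nabla A' v)" for v
  proof -
    have "T (nabla A (T' v)) = nabla A' v" by (simp add: T(2)[symmetric] T'(3))
    then have "T' (nabla A' v) = nabla A (T' v)" by (metis T'(2))
    then show ?thesis by (simp add: R_def S(2))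
  qed
  then have gt: "gauge_transform L (coeff_op R) A' A''" using gauge_transform_iff[OF ULoopD(1)[OF R]] by blast
  have SR: "S = (\<lambda>v. R (T v))" by (simp add: R_def T'(2))
  have bT: "bij (coeff_op T 0)" using coeff_op_0_UAut[OF T(1)] by (simp add: UAut_def Aut_def)
  have R0: "coeff_op R 0 y = y" for y
  proof -
    obtain z where z: "y = coeff_op T 0 z" using bij_is_surj[OF bT] by (metis surjD)
    have "coeff_op S 0 z = coeff_op R 0 (coeff_op T 0 z)" using coeff_op_comp[OF ULoopD(1)[OF R], of T 0 z] unfolding SR[symmetric] by simp
    then show ?thesis using eq z by simp
  qed
  have "A' n = A'' n \<and> coeff_op R (Suc n) = (\<lambda>y. 0)" for n
  proof (induction n rule: less_induct)
    case (less n)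
    have Rz: "coeff_op R j y = 0" if "1 \<le> j" "j \<le> n" for j y
      using less.IH[of "j - 1"] that by (cases j) auto
    have key: "sc (of_nat (Suc n)) (coeff_op R (Suc n) y) + br (A'' n) y = br (A' n) y" for y
    proof -
      have z: "br (A'' i) (coeff_op R (n - i) y) = 0" "coeff_op R (n - i) (br (A' i) y) = 0" if "i < n" for i
        using Rz[of "n - i"] that by simp_all
      have "(\<Sum>i\<le>n. br (A'' i) (coeff_op R (n - i) y)) = (\<Sum>i\<in>{n}. br (A'' i) (coeff_op R (n - i) y))"
        by (rule sum.mono_neutral_right) (use z order_le_imp_less_or_eq in auto)
      moreover have "(\<Sum>i\<le>n. coeff_op R (n - i) (br (A' i) y)) = (\<Sum>i\<in>{n}. coeff_op R (n - i) (br (A' i) y))"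
        by (rule sum.mono_neutral_right) (use z order_le_imp_less_or_eq in auto)
      moreover have "sc (of_nat (Suc n)) (coeff_op R (Suc n) y) + (\<Sum>i\<le>n. br (A'' i) (coeff_op R (n - i) y)) =
          (\<Sum>i\<le>n. coeff_op R (n - i) (br (A' i) y))" using gt unfolding gauge_transform_def by blast
      ultimately show ?thesis by (simp add: R0 del: of_nat_Suc)
    qed
    define h where "h = A' n - A'' n"
    have h: "h \<in> H"
      using subspace_diff[OF subspace_H H'[of n] H''[of n]] by (simp add: h_def)
    have k2: "sc (of_nat (Suc n)) (coeff_op R (Suc n) y) = br h y" for y
      using key[of y] by (simp add: h_def br_diff algebra_simps del: of_nat_Suc)
    have "br h b = 0" if b: "b \<in> WB" for b
    proof -
      have bF: "b \<in> Fil (dg b)" by (rule gr_Fil[OF WB_gr[OF b] order_refl])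
      have "(R (cst b) - cst b) (Suc n) \<in> Fil (dg b + 1)"
        using ULoopD(3)[OF R SFil_rules(6)[OF bF]] by (simp add: SFil_def)
      then have "coeff_op R (Suc n) b \<in> Fil (dg b + 1)" by (simp add: coeff_op_def cst_def)
      then have "br h b \<in> Fil (dg b + 1)" unfolding k2[symmetric] by (rule Fil_subspace_rules(4))
      moreover have "br h b \<in> gr (0 + dg b)" by (intro br_gr H_gr0 h WB_gr b)
      ultimately show ?thesis by (auto simp: Fil_def gr_iff)
    qed
    then have bh: "br h y = 0" for y using lin_eq_on_WB[OF lin_br lin_zero] by blast
    then have "h = 0" by (rule center_trivial)
    moreover have "coeff_op R (Suc n) y = 0" for y
      using k2[of y] bh[of y] by (simp del: of_nat_Suc add: of_nat_neq_0)
    ultimately show ?case by (auto simp: h_def)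
  qed
  then show ?thesis by auto
qed

text \<open>A word in the \<open>exp(c e\<^sub>i)\<close> lifts, letter by letter, to a gauge transformation between Miura
  opers that has the given value at \<open>t = 0\<close> and preserves the values of \<open>q\<close>.\<close>

lemma screening_chain:
  assumes q: "q \<in> classical_W L \<nu>" and g: "g \<in> Egrp"
  shows "\<exists>y S. S \<in> ULoop \<and> (\<forall>v. nabla (miura y) (S v) = S (nabla (miura x) v)) \<and> coeff_op S 0 = g \<and> pval y q = pval x q"
  using g
proof (induction rule: Egrp.induct)
  case Egrp_id
  have "coeff_op (\<lambda>v. v) 0 = id" by (rule ext) (simp add: coeff_op_def cst_def)
  then show ?case using ULoop_id by (intro exI[of _ x] exI[of _ "\<lambda>v. v"]) auto
next
  case (Egrp_step g c i)
  then obtain y S where S: "S \<in> ULoop" "\<And>v. nabla (miura y) (S v) = S (nabla (miura x) v)" "coeff_op S 0 = g" "pval y q = pval x q"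
    by blast
  let ?X = "exp_loop (riccati y i c) (E i)"
  have "nabla (miura (screen i c y)) (?X (S v)) = ?X (S (nabla (miura x) v))" for v
    using exp_loop_intertwines[OF E_Fil1, of "riccati y i c" i "miura y" "S v"] S(2) by (simp add: exp_gauge_riccati)
  moreover have "(\<lambda>v. ?X (S v)) \<in> ULoop" by (rule ULoop_comp[OF exp_loop_ULoop[OF E_Fil1] S(1)])
  moreover have "coeff_op (\<lambda>v. ?X (S v)) 0 = Ad (sc c (E i)) \<circ> g"
  proof
    fix z
    have "coeff_op ?X 0 w = Ad (sc c (E i)) w" for w
      by (simp add: coeff_op_exp_loop Ad_nilpotent[OF cE_Fil] dpow_scale riccati fps_power_zeroth)
    then show "coeff_op (\<lambda>v. ?X (S v)) 0 z = (Ad (sc c (E i)) \<circ> g) z"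
      using coeff_op_comp[OF tlin_exp_loop, of "riccati y i c" "E i" S 0 z] S(3) by simp
  qed
  moreover have "pval (screen i c y) q = pval x q" using W_screen_invariant[OF q] S(4) by simp
  ultimately show ?case by blast
qed

lemma miura_inj: "miura x = miura y \<Longrightarrow> x = y"
  by (metis miura_coords_miura)

theorem W_gauge_invariant:
  assumes q: "q \<in> classical_W L \<nu>" and xy: "(miura x, miura y) \<in> gauge_rel L"
  shows "pval x q = pval y q"
proof -
  obtain T where T: "T \<in> ULoop" "\<And>v. nabla (miura y) (T v) = T (nabla (miura x) v)"
    using xy by (auto simp: gauge_rel_iff)
  have "coeff_op T 0 \<in> Egrp" by (rule UAut_Egrp[OF coeff_op_0_UAut[OF T(1)]])
  from screening_chain[OF q this, of x] obtain z S where
    S: "S \<in> ULoop" "\<And>v. nabla (miura z) (S v) = S (nabla (miura x) v)" "coeff_op S 0 = coeff_op T 0" "pval z q = pval x q" by blast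
  have "miura y = miura z" by (rule miura_gauge_unique[OF T S(1,2) S(3)[symmetric] miura_H miura_H])
  then show ?thesis using S(4) miura_inj by metis
qed

lemma W_gaugeI:
  assumes "\<And>x y. (miura x, miura y) \<in> gauge_rel L \<Longrightarrow> pval x q = pval y q"
  shows "q \<in> classical_W L \<nu>"
  by (rule W_screenI) (metis assms screen_gauge)

end

section \<open>Infinitesimal changes of coordinate\<close>

text \<open>The coordinate change \<open>\<phi>(s) = s - \<epsilon> \<xi>(s)\<close>. Only its coefficients of \<open>\<epsilon>^0\<close> and \<open>\<epsilon>^1\<close> matter
  below.\<close>

abbreviation inf_flow :: "complex fps \<Rightarrow> complex fps fps" where
  "inf_flow \<xi> \<equiv> fps_const fps_X - fps_X * fps_const \<xi>"

lemma inf_flow_power: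
  "(inf_flow \<xi> ^ k) $ 0 = fps_X ^ k"
  "(inf_flow \<xi> ^ k) $ 1 = - (of_nat k * fps_X ^ (k - 1) * \<xi>)"
proof -
  show 0: "(inf_flow \<xi> ^ k) $ 0 = fps_X ^ k" for k by (simp add: fps_power_zeroth)
  show "(inf_flow \<xi> ^ k) $ 1 = - (of_nat k * fps_X ^ (k - 1) * \<xi>)"
  proof (induction k)
    case (Suc k)
    have "(inf_flow \<xi> ^ Suc k) $ 1 = fps_X * (inf_flow \<xi> ^ k) $ 1 - \<xi> * (inf_flow \<xi> ^ k) $ 0"
      unfolding power_Suc fps_mult_nth_1 by simp
    also have "\<dots> = - (of_nat (Suc k) * fps_X ^ (Suc k - 1) * \<xi>)"
      unfolding 0 Suc.IH by (cases k) (simp_all add: algebra_simps)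
    finally show ?case .
  qed simp
qed

lemma d_ds_inf_flow: "d_ds (inf_flow \<xi>) $ 0 = 1" "d_ds (inf_flow \<xi>) $ 1 = - fps_deriv \<xi>"
  by (simp_all add: d_ds_def)

lemma d_ds_inf_flow_power:
  "(d_ds (inf_flow \<xi>) ^ k) $ 0 = 1" "(d_ds (inf_flow \<xi>) ^ k) $ 1 = - (of_nat k * fps_deriv \<xi>)"
proof -
  show 0: "(d_ds (inf_flow \<xi>) ^ k) $ 0 = 1" for k by (simp add: fps_power_zeroth d_ds_inf_flow)
  show "(d_ds (inf_flow \<xi>) ^ k) $ 1 = - (of_nat k * fps_deriv \<xi>)"
  proof (induction k)
    case (Suc k)
    then show ?case unfolding power_Suc fps_mult_nth_1 0 d_ds_inf_flow by (simp add: algebra_simps)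
  qed simp
qed

lemma d_ds_d_ds_inf_flow:
  "(d_ds (d_ds (inf_flow \<xi>)) * inverse (d_ds (inf_flow \<xi>))) $ 1 = - fps_deriv (fps_deriv \<xi>)"
proof -
  have "d_ds (d_ds (inf_flow \<xi>)) $ 0 = 0" "d_ds (d_ds (inf_flow \<xi>)) $ 1 = - fps_deriv (fps_deriv \<xi>)"
    unfolding d_ds_def[of "d_ds (inf_flow \<xi>)"] fps_nth_Abs_fps d_ds_inf_flow by simp_all
  then show ?thesis unfolding fps_mult_nth_1 by (simp add: d_ds_inf_flow)
qed

context simple_lie begin

lemma tmul_neg: "tmul c (- v) = - tmul c v"
  using tmul_simps(7)[of c 0 v] by (simp add: tmul_simps(6))

lemma family_scale_0: "family_scale L c w 0 = tmul (c $ 0) (w 0)"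
  by (rule ext) (simp add: family_scale_def tmul_def)

lemma family_scale_1: "family_scale L c w 1 = tmul (c $ 0) (w 1) + tmul (c $ 1) (w 0)"
  by (rule ext) (simp add: family_scale_def tmul_def)

lemma substitute_0: "substitute L v (inf_flow \<xi>) 0 = v"
proof
  fix b
  have "substitute L v (inf_flow \<xi>) 0 b = (\<Sum>k\<le>b. if k = b then v b else 0)"
    unfolding substitute_def by (intro sum.cong) (auto simp: inf_flow_power(1))
  then show "substitute L v (inf_flow \<xi>) 0 b = v b" by simp
qed

lemma substitute_1: "substitute L v (inf_flow \<xi>) 1 = - tmul \<xi> (sder v)"
proof
  fix b
  have "substitute L v (inf_flow \<xi>) 1 b = (\<Sum>k\<le>Suc b. sc ((inf_flow \<xi> ^ k) $ 1 $ b) (v k))"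
    by (simp only: substitute_def) simp
  also have "\<dots> = (\<Sum>k\<le>b. sc ((inf_flow \<xi> ^ Suc k) $ 1 $ b) (v (Suc k)))"
    unfolding sum.atMost_Suc_shift inf_flow_power(2) by simp
  also have "\<dots> = (\<Sum>k\<le>b. - sc (\<xi> $ (b - k)) (sder v k))"
  proof (rule sum.cong[OF refl])
    fix k assume "k \<in> {..b}"
    then have "(of_nat (Suc k) * fps_X ^ k * \<xi>) $ b = of_nat (Suc k) * \<xi> $ (b - k)"
      by (simp add: mult.assoc fps_X_power_mult_nth fps_mult_of_nat_nth del: of_nat_Suc)
    then show "sc ((inf_flow \<xi> ^ Suc k) $ 1 $ b) (v (Suc k)) = - sc (\<xi> $ (b - k)) (sder v k)"
      unfolding inf_flow_power(2) by (simp add: sder_def mult.commute del: of_nat_Suc)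
  qed
  also have "\<dots> = - (\<Sum>i\<le>b. sc (\<xi> $ i) (sder v (b - i)))"
    unfolding sum_negf
    by (rule arg_cong[of _ _ uminus], rule sum.reindex_bij_witness[of _ "\<lambda>i. b - i" "\<lambda>i. b - i"]) auto
  finally show "substitute L v (inf_flow \<xi>) 1 b = (- tmul \<xi> (sder v)) b" by (simp add: tmul_def)
qed

lemma Fil0_proj_neg: "v \<in> Fil 0 \<Longrightarrow> j < 0 \<Longrightarrow> proj j v = 0"
  by (simp add: Fil_def)

lemma sum_proj_nonneg: "v \<in> Fil 0 \<Longrightarrow> (\<Sum>k\<le>nat K. proj (int k) v) = v"
proof -
  assume v: "v \<in> Fil 0"
  have "(\<Sum>k\<le>nat K. proj (int k) v) = (\<Sum>k\<in>{0..K}. proj k v)"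
    by (rule sum.reindex_bij_witness[of _ nat int]) (use K(1) in auto)
  also have "\<dots> = (\<Sum>k\<in>{-K..K}. proj k v)"
    by (rule sum.mono_neutral_left) (use v K(1) in \<open>auto simp: Fil0_proj_neg\<close>)
  finally show ?thesis by (simp only: sum_proj)
qed

text \<open>A decomposition into eigenvectors of \<open>ad \<rho>\<^sup>\<or>\<close> is unique; applying the projections shows this.\<close>

lemma degree_part_eq: assumes v: "v \<in> Fil 0" shows "degree_part L k v = proj (int k) v"
  unfolding degree_part_def
proof (rule the_equality)
  have fin: "{j. proj (int j) v \<noteq> 0} \<subseteq> {..nat K}"
  proof
    fix j assume "j \<in> {j. proj (int j) v \<noteq> 0}"
    then have "\<not> \<bar>int j\<bar> > K" using proj_outside by blast
    then show "j \<in> {..nat K}" by auto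
  qed
  have "v = Sum_any (\<lambda>j. proj (int j) v)"
    using Sum_any.expand_superset[OF _ fin] sum_proj_nonneg[OF v] by simp
  then show "\<exists>z. finite {j. z j \<noteq> 0} \<and> (\<forall>j. br \<rho> (z j) = sc (of_nat j) (z j)) \<and> v = Sum_any z \<and> proj (int k) v = z k"
    using proj_gr[of "int _" v] finite_subset[OF fin]
    by (intro exI[of _ "\<lambda>j. proj (int j) v"]) (simp add: gr_def)
next
  fix y assume "\<exists>z. finite {j. z j \<noteq> 0} \<and> (\<forall>j. br \<rho> (z j) = sc (of_nat j) (z j)) \<and> v = Sum_any z \<and> y = z k"
  then obtain z where z: "finite {j. z j \<noteq> 0}" "\<And>j. br \<rho> (z j) = sc (of_nat j) (z j)" "v = Sum_any z" "y = z k" by blast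
  have "z j \<in> gr (int j)" for j using z(2) by (simp add: gr_def)
  then have pz: "proj (int k) (z j) = (if j = k then z k else 0)" for j using proj_of_gr[of "z j" "int j" "int k"] by auto
  have "proj (int k) v = (\<Sum>j\<in>{j. z j \<noteq> 0}. if j = k then z k else 0)"
    unfolding z(3) Sum_any.expand_set proj_sum pz ..
  then show "y = proj (int k) v" using z(1,4) by (auto simp: sum.delta)
qed

lemma rho_action_expand:
  assumes w: "\<And>i j. i \<le> a \<Longrightarrow> w i j \<in> Fil 0"
  shows "rho_action L c w a b = (\<Sum>k\<le>nat K. family_scale L (c ^ k) (\<lambda>i. liftop (proj (int k)) (w i)) a b)"
proof -
  have eq: "family_scale L (c ^ k) (\<lambda>i j. degree_part L k (w i j)) a b = family_scale L (c ^ k) (\<lambda>i. liftop (proj (int k)) (w i)) a b" for k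
    unfolding family_scale_def liftop_def
    by (intro sum.cong refl) (simp add: degree_part_eq w)
  have "family_scale L (c ^ k) (\<lambda>i. liftop (proj (int k)) (w i)) a b = 0" if "k > nat K" for k
    using that by (simp add: family_scale_def liftop_def proj_outside)
  then have "{k. family_scale L (c ^ k) (\<lambda>i. liftop (proj (int k)) (w i)) a b \<noteq> 0} \<subseteq> {..nat K}" by (force simp: not_less)
  then show ?thesis unfolding rho_action_def eq by (intro Sum_any.expand_superset) auto
qed

lemma rho_action_0:
  assumes "\<And>j. w 0 j \<in> Fil 0" shows "rho_action L (d_ds (inf_flow \<xi>)) w 0 = w 0"
proof
  fix b
  show "rho_action L (d_ds (inf_flow \<xi>)) w 0 b = w 0 b"
    using assms sum_proj_nonneg[of "w 0 b"]
    by (subst rho_action_expand) (simp_all add: family_scale_0 d_ds_inf_flow_power tmul_simps(4) liftop_def)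
qed

text \<open>In degree \<open>k\<close> the one-parameter subgroup acts by \<open>(1 - \<epsilon>\<xi>')^k\<close>, with first-order term
  \<open>- k \<xi>'\<close>, and \<open>k\<close> is the eigenvalue of \<open>ad \<rho>\<^sup>\<or>\<close>.\<close>

lemma rho_action_1:
  assumes w: "\<And>i j. i \<le> 1 \<Longrightarrow> w i j \<in> Fil 0"
  shows "rho_action L (d_ds (inf_flow \<xi>)) w 1 = w 1 - tmul (fps_deriv \<xi>) (liftop (br \<rho>) (w 0))"
proof
  fix b
  let ?p = "\<lambda>k. liftop (proj (int k))"
  have e: "br \<rho> v = (\<Sum>k\<le>nat K. sc (of_nat k) (proj (int k) v))" if "v \<in> Fil 0" for v
  proof -
    have "br \<rho> v = br \<rho> (\<Sum>k\<le>nat K. proj (int k) v)" using sum_proj_nonneg[OF that] by simp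
    also have "\<dots> = (\<Sum>k\<le>nat K. sc (of_nat k) (proj (int k) v))"
      unfolding br_sum using proj_gr[of "int _" v] by (intro sum.cong refl) (simp add: gr_def)
    finally show ?thesis .
  qed
  have "rho_action L (d_ds (inf_flow \<xi>)) w 1 b = (\<Sum>k\<le>nat K. ?p k (w 1) b - tmul (of_nat k * fps_deriv \<xi>) (?p k (w 0)) b)"
    by (subst rho_action_expand[OF w])
      (simp_all only: family_scale_1 d_ds_inf_flow_power tmul_simps plus_fun_apply uminus_apply minus_apply add_uminus_conv_diff)
  also have "\<dots> = w 1 b - (\<Sum>k\<le>nat K. \<Sum>i\<le>b. sc (fps_deriv \<xi> $ i) (sc (of_nat k) (proj (int k) (w 0 (b - i)))))"
  proof -
    have "tmul (of_nat k * fps_deriv \<xi>) (?p k (w 0)) b = (\<Sum>i\<le>b. sc (fps_deriv \<xi> $ i) (sc (of_nat k) (proj (int k) (w 0 (b - i)))))" for k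
      unfolding tmul_def liftop_def by (intro sum.cong refl) (simp add: fps_mult_of_nat_nth mult.commute)
    moreover have "(\<Sum>k\<le>nat K. ?p k (w 1) b) = w 1 b" using sum_proj_nonneg[OF w[of 1 b]] by (simp add: liftop_def)
    ultimately show ?thesis by (simp only: sum_subtractf)
  qed
  also have "(\<Sum>k\<le>nat K. \<Sum>i\<le>b. sc (fps_deriv \<xi> $ i) (sc (of_nat k) (proj (int k) (w 0 (b - i))))) =
      (\<Sum>i\<le>b. \<Sum>k\<le>nat K. sc (fps_deriv \<xi> $ i) (sc (of_nat k) (proj (int k) (w 0 (b - i)))))"
    by (rule sum.swap)
  also have "\<dots> = tmul (fps_deriv \<xi>) (liftop (br \<rho>) (w 0)) b"
    unfolding tmul_def liftop_def scale_sum_right[symmetric] using w by (intro sum.cong refl) (simp only: e zero_le_one)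
  finally show "rho_action L (d_ds (inf_flow \<xi>)) w 1 b = (w 1 - tmul (fps_deriv \<xi>) (liftop (br \<rho>) (w 0))) b" by simp
qed

text \<open>The first-order term in \<open>\<epsilon>\<close> of the coordinate change, for the \<open>\<bb>\<close>-part \<open>v\<close> of an oper.\<close>

definition variation :: "complex fps \<Rightarrow> (nat \<Rightarrow> 'g) \<Rightarrow> nat \<Rightarrow> 'g" where
  "variation \<xi> v = - tmul \<xi> (sder v) - tmul (fps_deriv \<xi>) (liftop (br \<rho>) v) - tmul (fps_deriv \<xi>) v
     + tmul (fps_deriv (fps_deriv \<xi>)) (cst \<rho>)"

lemma \<rho>_gr0: "\<rho> \<in> gr 0"
  by (rule H_gr0[OF \<rho>_H])

lemma br_\<rho>_Fil: "v \<in> Fil k \<Longrightarrow> br \<rho> v \<in> Fil k"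
  using br_Fil[OF gr_Fil[OF \<rho>_gr0 order_refl], of v k] by simp

lemma oper_variation_eq: assumes v: "v \<in> SFil 0" shows "oper_variation L \<xi> v = variation \<xi> v"
proof
  fix n
  let ?s = "substitute L v (inf_flow \<xi>)" and ?c = "d_ds (inf_flow \<xi>)"
  have s: "?s i j \<in> Fil 0" if "i \<le> 1" for i j
  proof -
    have "?s 0 \<in> SFil 0" "?s 1 \<in> SFil 0" unfolding substitute_0 substitute_1 using v by (intro SFil_rules | assumption)+
    moreover have "i = 0 \<or> i = 1" using that by auto
    ultimately show ?thesis by (auto simp: SFil_def)
  qed
  have r0: "rho_action L ?c ?s 0 = v"
    using rho_action_0[of ?s \<xi>, OF s] by (simp only: substitute_0)
  have r1: "rho_action L ?c ?s 1 = - tmul \<xi> (sder v) - tmul (fps_deriv \<xi>) (liftop (br \<rho>) v)"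
    using rho_action_1[of ?s \<xi>, OF s] by (simp only: substitute_0 substitute_1)
  have "family_scale L ?c (rho_action L ?c ?s) 1 = variation \<xi> v - tmul (fps_deriv (fps_deriv \<xi>)) (cst \<rho>)"
    unfolding family_scale_1 r1 r0 d_ds_inf_flow by (simp only: tmul_simps variation_def) (simp add: algebra_simps)
  then show "oper_variation L \<xi> v n = variation \<xi> v n"
    unfolding oper_variation_def coordinate_change_def d_ds_d_ds_inf_flow by (simp add: tmul_cst)
qed

lemma variation_SFil: "v \<in> SFil 0 \<Longrightarrow> variation \<xi> v \<in> SFil 0"
  unfolding variation_def
  by (intro SFil_rules gr_Fil[OF \<rho>_gr0 order_refl] | assumption | simp add: SFil_def liftop_def br_\<rho>_Fil)+

text \<open>The variation has the form of an infinitesimal gauge transformation, whose parameter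
  \<open>\<xi>A - \<xi>'\<rho>\<^sup>\<or>\<close> does not lie in \<open>\<nn>[[t]]\<close>. In this form one can read off how it changes under gauge
  transformations.\<close>

lemma variation_nabla: "variation \<xi> (A - pm) = - nabla A (tmul \<xi> A - tmul (fps_deriv \<xi>) (cst \<rho>))"
proof -
  have p: "liftop (br \<rho>) pm = - pm"
    using p_minus_gr by (auto simp: liftop_def cst_def gr_def)
  have r: "sbr A (cst \<rho>) = - liftop (br \<rho>) A" using sbr_anti[of A "cst \<rho>"] by (simp only: sbr_cst)
  have "variation \<xi> (A - pm) n = (- nabla A (tmul \<xi> A - tmul (fps_deriv \<xi>) (cst \<rho>))) n" for n
    unfolding variation_def nabla_diff nabla_tmul
    unfolding nabla_def sbr_self r sder_simps liftop_simps(5)[OF lin_br] p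
    by (simp only: tmul_simps) (simp add: algebra_simps tmul_neg)
  then show ?thesis by (rule ext)
qed

section \<open>Gauge equivalence of the variations\<close>


text \<open>By the intertwining property \<open>ad (T A - A')\<close>, composed with \<open>T\<close>, is the commutator of \<open>\<partial>\<^sub>t\<close>
  and \<open>T\<close>. This raises degrees because \<open>T\<close> is unipotent, so \<open>T A - A'\<close> has no component of degree
  zero.\<close>

lemma ULoop_connection_leading_term:
  assumes A: "A \<in> Conn" "A' \<in> Conn" and T: "T \<in> ULoop" "\<And>v. nabla A' (T v) = T (nabla A v)"
  shows "T A - A' \<in> SFil 1"
proof -
  let ?Z = "T A - A'"
  have "(T A - A) + (A - pm) - (A' - pm) \<in> SFil 0"
  proof -
    have "T A - A \<in> SFil 0" using ULoopD(3)[OF T(1) Conn_SFil[OF A(1)]] by simp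
    then show ?thesis using SFil_rules(3)[OF SFil_rules(2)[of "T A - A" 0 "A - pm"], of "A' - pm"] A unfolding Conn_iff by blast
  qed
  then have Z0: "?Z \<in> SFil 0" by simp
  have br: "sbr ?Z (T v) = sder (T v) - T (sder v)" for v
    using T(2)[of v] by (simp add: nabla_def sbr_simps tlinD(1)[OF ULoopD(1)[OF T(1)]] ULoopD(2)[OF T(1)] algebra_simps)
  \<comment> \<open>Every \<open>w\<close> is some \<open>T v\<close>, and the terms \<open>sder v\<close> cancel.\<close>
  have low: "sbr ?Z w \<in> SFil (k + 1)" if w: "w \<in> SFil k" for w k
  proof -
    obtain v where v: "v \<in> SFil k" "T v = w" using ULoop_surjective[OF T(1) w] by blast
    have "sder (T v - v) - (T (sder v) - sder v) \<in> SFil (k + 1)"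
      by (intro SFil_rules(3) SFil_rules(7) ULoopD(3)[OF T(1)] v(1))
    then show ?thesis using br[of v] by (simp add: sder_simps v(2))
  qed
  have "?Z n \<in> Fil 1" for n
  proof -
    let ?z = "proj 0 (?Z n)"
    have Zn: "?Z n \<in> Fil 0" using Z0 by (simp add: SFil_def)
    then have r: "?Z n - ?z \<in> Fil 1" using Fil_split[of "?Z n" 0] by simp
    have "br ?z b = 0" if b: "b \<in> WB" for b
    proof -
      have bF: "b \<in> Fil (dg b)" by (rule gr_Fil[OF WB_gr[OF b] order_refl])
      have "sbr ?Z (cst b) n \<in> Fil (dg b + 1)" using low[OF SFil_rules(6)[OF bF]] by (simp add: SFil_def)
      then have "br (?Z n) b \<in> Fil (dg b + 1)" by (simp add: sbr_cst_right)
      moreover have "br (?Z n - ?z) b \<in> Fil (1 + dg b)" by (rule br_Fil[OF r bF])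
      ultimately have "br (?Z n) b - br (?Z n - ?z) b \<in> Fil (dg b + 1)"
        by (intro Fil_subspace_rules(3)) (simp_all add: add.commute)
      then have "br ?z b \<in> Fil (dg b + 1)" by (simp add: br_diff)
      moreover have "br ?z b \<in> gr (0 + dg b)" by (intro br_gr proj_gr WB_gr b)
      ultimately show ?thesis by (auto simp: Fil_def gr_iff)
    qed
    then have "br ?z y = 0" for y using lin_eq_on_WB[OF lin_br lin_zero] by blast
    then have "?z = 0" by (rule center_trivial)
    then show ?thesis using r by simp
  qed
  then show ?thesis by (simp add: SFil_def)
qed

text \<open>Apply \<open>T\<close> to \<open>- \<nabla>\<^sub>A(\<xi>A - \<xi>'\<rho>\<^sup>\<or>)\<close>: it turns \<open>\<nabla>\<^sub>A\<close> into \<open>\<nabla>\<^sub>A\<^sub>'\<close> and changes \<open>A\<close> into \<open>A'\<close> and \<open>\<rho>\<^sup>\<or>\<close>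
  into itself up to terms in \<open>\<nn>[[t]]\<close>.\<close>

lemma variation_gauge:
  assumes A: "A \<in> Conn" "A' \<in> Conn" and T: "T \<in> ULoop" "\<And>v. nabla A' (T v) = T (nabla A v)"
  shows "\<exists>z\<in>SFil 1. T (variation \<xi> (A - pm)) = variation \<xi> (A' - pm) - nabla A' z"
proof
  note tl = tlinD[OF ULoopD(1)[OF T(1)]]
  let ?z = "tmul \<xi> (T A - A') - tmul (fps_deriv \<xi>) (T (cst \<rho>) - cst \<rho>)"
  have "T (cst \<rho>) - cst \<rho> \<in> SFil (0 + 1)"
    by (intro ULoopD(3)[OF T(1)] SFil_rules(6) gr_Fil[OF \<rho>_gr0 order_refl])
  then have "T (cst \<rho>) - cst \<rho> \<in> SFil 1" by (simp only: add_0)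
  then show "?z \<in> SFil 1"
    by (rule SFil_rules(3)[OF SFil_rules(4)[OF ULoop_connection_leading_term[OF A T]] SFil_rules(4)])
  have "T (variation \<xi> (A - pm)) = - nabla A' (T (tmul \<xi> A - tmul (fps_deriv \<xi>) (cst \<rho>)))"
    unfolding variation_nabla tl(6) T(2) ..
  also have "T (tmul \<xi> A - tmul (fps_deriv \<xi>) (cst \<rho>)) = (tmul \<xi> A' - tmul (fps_deriv \<xi>) (cst \<rho>)) + ?z"
    unfolding tl(4) tl(2) tmul_simps(7) by (simp add: algebra_simps)
  also have "- nabla A' \<dots> = variation \<xi> (A' - pm) - nabla A' ?z"
    unfolding variation_nabla nabla_add by simp
  finally show "T (variation \<xi> (A - pm)) = variation \<xi> (A' - pm) - nabla A' ?z" .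
qed

lemma tmul_const: "tmul (fps_const a) w n = sc a (w n)"
proof -
  have "(\<Sum>i\<le>n. sc (fps_const a $ i) (w (n - i))) = (\<Sum>i\<le>n. if i = 0 then sc a (w n) else 0)"
    by (intro sum.cong) auto
  then show ?thesis by (simp add: tmul_def)
qed

definition line :: "(nat \<Rightarrow> 'g) \<Rightarrow> (nat \<Rightarrow> 'g) \<Rightarrow> complex \<Rightarrow> nat \<Rightarrow> 'g" where
  "line A \<delta> \<epsilon> n = A n + sc \<epsilon> (\<delta> n)"

lemma line_eq: "line A \<delta> \<epsilon> = A + tmul (fps_const \<epsilon>) \<delta>"
  by (rule ext) (simp add: line_def tmul_const)

lemma line_Conn: "A \<in> Conn \<Longrightarrow> \<delta> \<in> SFil 0 \<Longrightarrow> line A \<delta> \<epsilon> \<in> Conn"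
  unfolding line_eq by (intro Conn_add SFil_rules(4))

lemma line_0: "line A \<delta> 0 = A"
  by (rule ext) (simp add: line_def)

lemma curve_derivative_line: "curve_derivative (line A \<delta>) \<delta>"
  unfolding curve_derivative_def
proof (intro allI impI)
  fix u n assume u: "linear_form L u"
  have "((\<lambda>\<epsilon>. u (A n) + \<epsilon> * u (\<delta> n)) has_field_derivative 0 + u (\<delta> n)) (at 0)"
    by (intro DERIV_add DERIV_const DERIV_cmult_right[of _ 1, simplified] DERIV_ident)
  then show "((\<lambda>\<epsilon>. u (line A \<delta> \<epsilon> n)) has_field_derivative u (\<delta> n)) (at 0)"
    by (simp add: line_def lf_add[OF u] lf_scale[OF u])
qed

text \<open>The gauge action of \<open>T\<close> on connections is affine with linear part \<open>T\<close>.\<close>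

lemma gauge_line:
  assumes A: "A \<in> Conn" "A' \<in> Conn" and T: "T \<in> ULoop" "\<And>v. nabla A' (T v) = T (nabla A v)"
    and d: "\<delta> \<in> SFil 0"
  shows "(line A \<delta> \<epsilon>, line A' (T \<delta>) \<epsilon>) \<in> gauge_rel L"
  unfolding gauge_rel_iff
proof (intro conjI bexI[of _ T] allI T(1) line_Conn A d ULoop_SFil[OF T(1) d])
  fix v
  have l: "nabla (line B w \<epsilon>) y = nabla B y + tmul (fps_const \<epsilon>) (sbr w y)" for B w y
    by (simp add: nabla_def line_eq sbr_simps add.assoc)
  show "nabla (line A' (T \<delta>) \<epsilon>) (T v) = T (nabla (line A \<delta> \<epsilon>) v)"
    unfolding l T(2) by (simp only: tlinD(1,2)[OF ULoopD(1)[OF T(1)]] ULoopD(2)[OF T(1)])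
qed

subsection \<open>The differential of a gauge invariant function\<close>

lemma curve_derivative_exp_loop_gauge:
  assumes b: "b \<in> WB" "dg b \<ge> 1"
  shows "curve_derivative (\<lambda>\<epsilon>. exp_gauge (fps_const \<epsilon> * x) b A) (- nabla A (tmul x (cst b)))"
  unfolding curve_derivative_def
proof (intro allI impI)
  fix u n assume u: "linear_form L u"
  let ?a = "\<lambda>l. u (tmul (x ^ l) (liftop (dpow b l) A) n)"
  have NN: "1 \<le> NN" using K(2)[OF b(1)] b(2) by (simp add: NN_def)
  have "u (exp_gauge (fps_const \<epsilon> * x) b A n) = (\<Sum>l\<le>NN. \<epsilon> ^ l * ?a l) - \<epsilon> * u (tmul (fps_deriv x) (cst b) n)" for \<epsilon>
  proof -
    have "(fps_const \<epsilon> * x) ^ l = fps_const (\<epsilon> ^ l) * x ^ l" for l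
      by (simp add: power_mult_distrib fps_const_power)
    moreover have "fps_deriv (fps_const \<epsilon> * x) = fps_const \<epsilon> * fps_deriv x" by (rule fps_deriv_mult_const_left)
    ultimately show ?thesis
      unfolding exp_gauge_def exp_loop_def minus_apply sum_fun_apply
      by (simp only: tmul_simps(3)[symmetric] tmul_const lf_diff[OF u] lf_sum[OF u] lf_scale[OF u])
  qed
  moreover have "((\<lambda>\<epsilon>. (\<Sum>l\<le>NN. \<epsilon> ^ l * ?a l) - \<epsilon> * u (tmul (fps_deriv x) (cst b) n)) has_field_derivative
      (\<Sum>l\<le>NN. (of_nat l * 0 ^ (l - 1)) * ?a l) - 1 * u (tmul (fps_deriv x) (cst b) n)) (at 0)"
  proof -
    have "((\<lambda>\<epsilon>::complex. \<epsilon> ^ l) has_field_derivative of_nat l * 0 ^ (l - 1)) (at 0)" for l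
      by (auto intro!: derivative_eq_intros)
    then show ?thesis by (intro DERIV_diff DERIV_sum DERIV_cmult_right DERIV_ident)
  qed
  moreover have "(\<Sum>l\<le>NN. (of_nat l * 0 ^ (l - 1)) * ?a l) = ?a 1"
  proof -
    have "(\<Sum>l\<le>NN. (of_nat l * 0 ^ (l - 1)) * ?a l) = (\<Sum>l\<le>NN. if l = 1 then ?a 1 else 0)"
    proof (rule sum.cong[OF refl])
      fix l show "(of_nat l * 0 ^ (l - 1)) * ?a l = (if l = 1 then ?a 1 else 0)"
        by (cases "l = 1"; cases l) (auto simp: power_0_left)
    qed
    then show ?thesis using NN by simp
  qed
  moreover have "?a 1 - 1 * u (tmul (fps_deriv x) (cst b) n) = u ((- nabla A (tmul x (cst b))) n)"
  proof -
    have "liftop (dpow b 1) A = - sbr A (cst b)" 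
    proof -
      have "liftop (dpow b 1) A = liftop (br b) A" by (rule ext) (simp add: liftop_def dpow_def)
      then show ?thesis using sbr_anti[of "cst b" A] by (simp only: sbr_cst)
    qed
    then have "?a 1 = u (- tmul x (sbr A (cst b)) n)" by (simp add: tmul_neg)
    then show ?thesis
      by (simp add: nabla_def sder_simps tmul_simps sbr_simps lf_neg[OF u] lf_add[OF u] lf_diff[OF u])
  qed
  ultimately show "((\<lambda>\<epsilon>. u (exp_gauge (fps_const \<epsilon> * x) b A n)) has_field_derivative u ((- nabla A (tmul x (cst b))) n)) (at 0)"
    by simp
qed

text \<open>The vectors \<open>\<nabla>\<^sub>A z\<close> with \<open>z\<close> in \<open>\<nn>[[t]]\<close> are the tangent vectors to the gauge orbit. By
  additivity it suffices to take \<open>z = x(t) b\<close> with \<open>b\<close> in the basis, where the curve \<open>exp(\<epsilon> x b)\<close>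
  of gauge transformations has velocity \<open>- \<nabla>\<^sub>A z\<close>.\<close>

lemma invariant_differential_vanishes:
  assumes inv: "\<And>A'. (A, A') \<in> gauge_rel L \<Longrightarrow> f A = f A'" and A: "A \<in> Conn"
    and D: "\<And>\<delta> \<delta>'. D (\<delta> + \<delta>') = D \<delta> + D \<delta>'"
      "\<And>c \<delta>. c 0 = A \<Longrightarrow> curve_derivative c \<delta> \<Longrightarrow> ((\<lambda>\<epsilon>. f (c \<epsilon>)) has_field_derivative (D \<delta> :: complex)) (at 0)"
    and z: "z \<in> SFil 1"
  shows "D (nabla A z) = 0"
proof -
  have D0: "D 0 = 0" using D(1)[of 0 0] by simp
  have Dneg: "D (- w) = - D w" for w using D(1)[of w "- w"] D0 by (simp add: eq_neg_iff_add_eq_0 add.commute)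
  have base: "D (nabla A (tmul x (cst b))) = 0" if b: "b \<in> WB" "dg b \<ge> 1" for x b
  proof -
    let ?c = "\<lambda>\<epsilon>. exp_gauge (fps_const \<epsilon> * x) b A"
    have bF: "b \<in> Fil 1" by (rule gr_Fil[OF WB_gr[OF b(1)] b(2)])
    have "f (?c \<epsilon>) = f A" for \<epsilon> using inv[OF exp_gauge_rel[OF bF A]] by simp
    moreover have "?c 0 = A"
    proof -
      have "(0 * x) ^ l = (if l = 0 then 1 else 0)" for l by (simp add: power_0_left)
      then have "exp_loop (0 * x) b A = (\<Sum>l\<le>NN. if l = 0 then liftop (dpow b 0) A else 0)"
        unfolding exp_loop_def by (intro sum.cong refl) (simp add: tmul_simps)
      moreover have "liftop (dpow b 0) A = A" by (rule ext) (simp add: liftop_def)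
      ultimately show ?thesis by (simp add: exp_gauge_def tmul_simps)
    qed
    ultimately have "((\<lambda>\<epsilon>. f A) has_field_derivative D (- nabla A (tmul x (cst b)))) (at 0)"
      using D(2)[of ?c, OF _ curve_derivative_exp_loop_gauge[OF b]] by simp
    then have "D (- nabla A (tmul x (cst b))) = 0" using DERIV_unique[OF _ DERIV_const] by blast
    then show ?thesis by (simp add: Dneg)
  qed
  have n0: "nabla A 0 = 0" by (simp add: nabla_def sder_simps sbr_simps)
  have summand: "D (nabla A (tmul (coord z b) (cst b))) = 0" if b: "b \<in> WB" for b
  proof (cases "dg b \<ge> 1")
    case False
    then have "coord z b = 0" using SFil_coord[OF z b] by simp
    then show ?thesis by (simp only: tmul_simps(5) n0 D0)
  qed (rule base[OF b])
  have "D (nabla A (\<Sum>b\<in>S. tmul (coord z b) (cst b))) = 0" if "S \<subseteq> WB" for S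
    using finite_subset[OF that finite_WB] that
  proof (induction S rule: finite_induct)
    case empty
    then show ?case by (simp only: sum.empty n0 D0)
  next
    case (insert b S)
    then show ?case by (simp only: sum.insert[OF insert.hyps] nabla_add D(1)) (simp add: summand)
  qed
  from this[OF order_refl] show ?thesis by (simp only: series_expand[symmetric])
qed

text \<open>The gauge transformation carries the line through \<open>A\<close> in the direction of its variation to a line
  through \<open>A'\<close>, whose direction differs from the variation of \<open>A'\<close> by a tangent vector to the gauge
  orbit.\<close>

lemma invariant_variation_derivative:
  assumes f: "polyc f" and inv: "\<And>A A'. (A, A') \<in> gauge_rel L \<Longrightarrow> f A = f A'"
    and AA': "(A, A') \<in> gauge_rel L"
    and d: "((\<lambda>\<epsilon>. f (line A' (variation \<xi> (A' - pm)) \<epsilon>)) has_field_derivative d) (at 0)"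
  shows "((\<lambda>\<epsilon>. f (line A (variation \<xi> (A - pm)) \<epsilon>)) has_field_derivative d) (at 0)"
proof -
  obtain T where T: "A \<in> Conn" "A' \<in> Conn" "T \<in> ULoop" "\<And>v. nabla A' (T v) = T (nabla A v)"
    using AA' by (auto simp: gauge_rel_iff)
  obtain D where D: "\<And>\<delta> \<delta>'. D (\<delta> + \<delta>') = D \<delta> + D \<delta>'"
      "\<And>c \<delta>. c 0 = A' \<Longrightarrow> curve_derivative c \<delta> \<Longrightarrow> ((\<lambda>\<epsilon>. f (c \<epsilon>)) has_field_derivative D \<delta>) (at 0)"
    using polyc_differential[OF f, of A'] by blast
  let ?\<delta> = "variation \<xi> (A - pm)" and ?\<delta>' = "variation \<xi> (A' - pm)"
  have dd: "((\<lambda>\<epsilon>. f (line A' w \<epsilon>)) has_field_derivative D w) (at 0)" for w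
    by (rule D(2)[OF line_0 curve_derivative_line])
  obtain z where z: "z \<in> SFil 1" "T ?\<delta> = ?\<delta>' - nabla A' z" using variation_gauge[OF T] by blast
  have "?\<delta>' = T ?\<delta> + nabla A' z" using z(2) by simp
  then have "D ?\<delta>' = D (T ?\<delta>) + D (nabla A' z)" by (simp only: D(1))
  also have "D (nabla A' z) = 0" by (rule invariant_differential_vanishes[OF inv T(2) D z(1)])
  finally have "D (T ?\<delta>) = d" unfolding DERIV_unique[OF d dd[of ?\<delta>']] by (simp only: add_0_right)
  moreover have "?\<delta> \<in> SFil 0" using T(1) by (intro variation_SFil) (simp add: Conn_iff)
  then have "f (line A ?\<delta> \<epsilon>) = f (line A' (T ?\<delta>) \<epsilon>)" for \<epsilon> by (intro inv gauge_line[OF T])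
  ultimately show ?thesis using dd[of "T ?\<delta>"] by simp
qed

subsection \<open>The variation of a Miura oper\<close>

text \<open>The induced variation \<open>u\<^sub>i \<mapsto> \<xi>'' - (\<xi>u\<^sub>i)'\<close>.\<close>

definition variation_coords :: "complex fps \<Rightarrow> ('l \<times> nat \<Rightarrow> complex) \<Rightarrow> 'l \<times> nat \<Rightarrow> complex" where
  "variation_coords \<xi> x = (\<lambda>(i, n). fps_deriv (fps_deriv \<xi> - \<xi> * useries x i) $ n)"

lemma line_miura: "line (miura x) (variation \<xi> (miura x - pm)) \<epsilon> = miura (\<lambda>v. x v + \<epsilon> * variation_coords \<xi> x v)"
proof -
  let ?v = "miura x - pm"
  let ?A = "line (miura x) (variation \<xi> ?v) \<epsilon>"
  have vH: "?v n \<in> H" for n using miura_H by simp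
  have rv: "liftop (br \<rho>) ?v = 0"
    using gr0_centralizes[OF H_gr0[OF vH] \<rho>_H] by (intro ext) (simp only: liftop_def zero_fun_apply)
  have var: "variation \<xi> ?v = tmul (fps_deriv (fps_deriv \<xi>)) (cst \<rho>) - tmul \<xi> (sder ?v) - tmul (fps_deriv \<xi>) ?v"
    unfolding variation_def rv by (simp add: tmul_simps(6))
  have tH: "tmul c w n \<in> H" if "\<And>n. w n \<in> H" for c w n
    unfolding tmul_def by (intro subspace_sum subspace_H subspace_scale that)
  have cH: "cst \<rho> n \<in> H" for n using \<rho>_H subspace_0[OF subspace_H] by (simp add: cst_def)
  have sH: "sder ?v n \<in> H" for n unfolding sder_def by (rule subspace_scale[OF subspace_H vH])
  have varH: "variation \<xi> ?v n \<in> H" for n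
  proof -
    have "tmul (fps_deriv (fps_deriv \<xi>)) (cst \<rho>) n - tmul \<xi> (sder ?v) n - tmul (fps_deriv \<xi>) ?v n \<in> H"
      by (rule subspace_diff[OF subspace_H subspace_diff[OF subspace_H tH[OF cH] tH[OF sH]] tH[OF vH]])
    then show ?thesis by (simp only: var minus_apply)
  qed
  have "?A n - pm n = ?v n + sc \<epsilon> (variation \<xi> ?v n)" for n by (simp add: line_def)
  then have AH: "?A n - pm n \<in> H" for n using vH varH subspace_add[OF subspace_H] subspace_scale[OF subspace_H] by metis
  have "cartan_coord i (?A n) = x (i, n) + \<epsilon> * variation_coords \<xi> x (i, n)" for i n
  proof -
    note u = linear_form_cartan_coord[of i]
    let ?c = "\<lambda>w. Abs_fps (\<lambda>n. cartan_coord i (w n))"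
    have ct: "cartan_coord i (tmul c w n) = (c * ?c w) $ n" for c w n
      by (simp add: tmul_def lf_sum[OF u] lf_scale[OF u] fps_mult_nth atLeast0AtMost)
    have c1: "?c ?v = useries x i"
      by (rule fps_ext) (simp add: lf_diff[OF u] cartan_coord_miura cartan_coord_pm useries_def)
    have c2: "?c (sder ?v) = fps_deriv (useries x i)"
      unfolding c1[symmetric] by (rule fps_ext) (simp add: sder_def lf_scale[OF u] del: of_nat_Suc)
    have c3: "?c (cst \<rho>) = 1"
      by (rule fps_ext) (simp add: cst_def lf_0[OF u] cartan_coord_H[OF \<rho>_H] \<alpha>_\<rho>)
    have "cartan_coord i (variation \<xi> ?v n) = variation_coords \<xi> x (i, n)"
    proof -
      obtain w where w: "?v = w" by simp
      have "cartan_coord i (variation \<xi> w n) =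
          (fps_deriv (fps_deriv \<xi>) - \<xi> * fps_deriv (useries x i) - fps_deriv \<xi> * useries x i) $ n"
        unfolding var[unfolded w] minus_apply lf_diff[OF u] ct c1[unfolded w] c2[unfolded w] c3 by simp
      then show ?thesis
        unfolding w variation_coords_def prod.case fps_deriv_sub fps_deriv_mult fps_sub_nth fps_add_nth
        by (simp only: diff_diff_eq)
    qed
    moreover have "cartan_coord i (?A n) = cartan_coord i (miura x n) + \<epsilon> * cartan_coord i (variation \<xi> ?v n)"
      unfolding line_def lf_add[OF u] lf_scale[OF u] ..
    ultimately show ?thesis unfolding cartan_coord_miura by metis
  qed
  then have "(\<lambda>(i, n). cartan_coord i (?A n)) = (\<lambda>v. x v + \<epsilon> * variation_coords \<xi> x v)"
    by (intro ext) (simp only: case_prod_unfold prod.collapse)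
  then show ?thesis using miura_of_H[OF AH] by metis
qed

text \<open>The action on \<open>\<pi>\<^sub>0\<close> is the derivative along the vector field \<open>u\<^sub>i \<mapsto> \<xi>'' - (\<xi>u\<^sub>i)'\<close>.\<close>

lemma pval_der_pi: "pval x (der_pi \<xi> q) = pdir x (variation_coords \<xi> x) q"
proof -
  define N where "N = Max (insert 0 (snd ` pvars q))"
  have N: "n \<le> N" if "(i, n) \<in> pvars q" for i n
    unfolding N_def using that finite_pvars[of q] by (intro Max_ge) force+
  define d where "d = (\<lambda>k (i::'l, n). if k \<le> n + 1 then of_nat (n + 1) * x (i, n + 1 - k)
     else if k = n + 2 then - (of_nat (n + 1) * of_nat (n + 2)) else 0)"
  have L0: "L_pi (int k - 1) q = 0" if k: "k > N + 2" for k
    unfolding L_pi_def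
  proof (rule derivation_of_zero)
    fix v assume v: "v \<in> pvars q"
    obtain i n where "v = (i, n)" by fastforce
    then show "(case v of (i, j) \<Rightarrow> let m = - int j - 1 in
       if int k - 1 < - m then pconst (of_int (- m)) * bgen i (int k - 1 + m)
       else if int k - 1 = - m then pconst (of_int (- (int k - 1) * (int k - 1 + 1)))
       else 0) = 0" using N[of i n] v k by (simp add: Let_def)
  qed
  have val: "pval x (L_pi (int k - 1) q) = pdir x (d k) q" for k
    unfolding L_pi_def pval_derivation_of
  proof (rule pdir_cong)
    fix v assume v: "v \<in> pvars q"
    obtain i n where v: "v = (i, n)" by fastforce
    consider "k \<le> n + 1" | "k = n + 2" | "k > n + 2" by linarith
    then show "pval x (case v of (i, j) \<Rightarrow> let m = - int j - 1 in
       if int k - 1 < - m then pconst (of_int (- m)) * bgen i (int k - 1 + m)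
       else if int k - 1 = - m then pconst (of_int (- (int k - 1) * (int k - 1 + 1)))
       else 0) = d k v"
    proof cases
      case 1
      then have "nat (- (int k - 1 + (- int n - 1)) - 1) = n + 1 - k" by simp
      then show ?thesis using 1 by (simp add: v d_def Let_def bgen_def idh.peval_mult)
    next
      case 2
      then show ?thesis by (simp add: v d_def Let_def algebra_simps)
    next
      case 3
      then show ?thesis by (simp add: v d_def Let_def)
    qed
  qed
  have "Sum_any (\<lambda>k. pconst (\<xi> $ k) * L_pi (int k - 1) q) = (\<Sum>k\<le>N+2. pconst (\<xi> $ k) * L_pi (int k - 1) q)"
    by (rule Sum_any.expand_superset) (use L0 in \<open>force simp: not_less[symmetric]\<close>)+
  then have "pval x (der_pi \<xi> q) = - (\<Sum>k\<le>N+2. \<xi> $ k * pdir x (d k) q)"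
    unfolding der_pi_def by (simp only: idh.peval_uminus idh.peval_sum idh.peval_mult val idh.peval_pconst)
  also have "\<dots> = pdir x (\<lambda>v. - 1 * (\<Sum>k\<le>N+2. \<xi> $ k * d k v)) q"
    unfolding pdir_scale pdir_sum by simp
  also have "\<dots> = pdir x (variation_coords \<xi> x) q"
  proof (rule pdir_cong)
    fix v assume v0: "v \<in> pvars q"
    obtain i n where v: "v = (i, n)" by fastforce
    have nN: "n \<le> N" using N v0 v by blast
    have "(\<Sum>k\<le>N+2. \<xi> $ k * d k v) = (\<Sum>k\<le>n+2. \<xi> $ k * d k v)"
      by (rule sum.mono_neutral_right) (use nN in \<open>auto simp: d_def v\<close>)
    also have "\<dots> = (\<Sum>k\<le>Suc n. \<xi> $ k * d k v) + \<xi> $ (n + 2) * d (n + 2) v" by (simp add: numeral_2_eq_2)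
    also have "(\<Sum>k\<le>Suc n. \<xi> $ k * d k v) = of_nat (Suc n) * (\<Sum>k\<le>Suc n. \<xi> $ k * x (i, Suc n - k))"
      unfolding sum_distrib_left by (intro sum.cong refl) (simp add: d_def v mult_ac del: of_nat_Suc)
    also have "(\<Sum>k\<le>Suc n. \<xi> $ k * x (i, Suc n - k)) = (\<xi> * useries x i) $ Suc n"
      by (simp add: fps_mult_nth useries_def atLeast0AtMost)
    finally have e: "(\<Sum>k\<le>N+2. \<xi> $ k * d k v) = of_nat (Suc n) * (\<xi> * useries x i) $ Suc n + \<xi> $ (n + 2) * d (n + 2) v" .
    have vc: "variation_coords \<xi> x v = of_nat (Suc n) * (of_nat (n + 2) * \<xi> $ (n + 2) - (\<xi> * useries x i) $ Suc n)"
      unfolding variation_coords_def v prod.case fps_deriv_nth fps_sub_nth by (simp del: of_nat_Suc)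
    show "- 1 * (\<Sum>k\<le>N+2. \<xi> $ k * d k v) = variation_coords \<xi> x v"
      unfolding e vc by (simp add: v d_def) (simp add: algebra_simps)
  qed
  finally show ?thesis .
qed

section \<open>The isomorphism\<close>


lemma W_function_invariant:
  assumes q: "q \<in> classical_W L \<nu>" and A: "(A, A') \<in> gauge_rel L"
  shows "pval (miura_coords A) q = pval (miura_coords A') q"
proof (rule W_gauge_invariant[OF q])
  have "A \<in> Conn" "A' \<in> Conn" using gauge_rel_Conn[OF A] by auto
  then show "(miura (miura_coords A), miura (miura_coords A')) \<in> gauge_rel L"
    using gauge_sym[OF miura_coords_gauge] A miura_coords_gauge gauge_trans by blast
qed

lemma W_function_derivative:
  assumes q: "q \<in> classical_W L \<nu>" and A: "(A, miura x) \<in> gauge_rel L"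
  shows "((\<lambda>\<epsilon>. pval (miura_coords (line A (variation \<xi> (A - pm)) \<epsilon>)) q) has_field_derivative pval x (der_pi \<xi> q)) (at 0)"
proof (rule invariant_variation_derivative[OF _ _ A])
  show "polyc (\<lambda>A. pval (miura_coords A) q)" by (rule polyc_pval[OF polyc_miura_coords])
  show "pval (miura_coords A) q = pval (miura_coords A') q" if "(A, A') \<in> gauge_rel L" for A A'
    by (rule W_function_invariant[OF q that])
  have "((\<lambda>\<epsilon>. pval (\<lambda>v. x v + \<epsilon> * variation_coords \<xi> x v) q) has_field_derivative
      pdir (\<lambda>v. x v + 0 * variation_coords \<xi> x v) (variation_coords \<xi> x) q) (at 0)"
    by (rule has_field_derivative_pval) (auto intro!: derivative_eq_intros)
  then show "((\<lambda>\<epsilon>. pval (miura_coords (line (miura x) (variation \<xi> (miura x - pm)) \<epsilon>)) q)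
      has_field_derivative pval x (der_pi \<xi> q)) (at 0)"
    unfolding line_miura miura_coords_miura pval_der_pi by simp
qed

text \<open>At gauge equivalent Miura opers the values of \<open>der_pi \<xi> q\<close> are the derivative of one and the
  same curve of values.\<close>

lemma der_pi_W:
  assumes q: "q \<in> classical_W L \<nu>" shows "der_pi \<xi> q \<in> classical_W L \<nu>"
proof (rule W_gaugeI)
  fix x y assume xy: "(miura x, miura y) \<in> gauge_rel L"
  show "pval x (der_pi \<xi> q) = pval y (der_pi \<xi> q)"
    by (rule DERIV_unique[OF W_function_derivative[OF q gauge_refl[OF miura_Conn]] W_function_derivative[OF q xy]])
qed

text \<open>The choice of the representative does not matter for \<open>q\<close> in the \<open>\<W>\<close>-algebra.\<close>

definition oper_function :: "('l \<times> nat) cpoly \<Rightarrow> (nat \<Rightarrow> 'g) set \<Rightarrow> complex" where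
  "oper_function q = (\<lambda>\<chi>\<in>opers L. pval (miura_coords (SOME A. A \<in> Conn \<and> \<chi> = oper_class L A)) q)"

lemma oper_function_eq:
  assumes q: "q \<in> classical_W L \<nu>" and A: "A \<in> Conn"
  shows "oper_function q (oper_class L A) = pval (miura_coords A) q"
proof -
  define B where "B = (SOME B. B \<in> Conn \<and> oper_class L A = oper_class L B)"
  have "B \<in> Conn \<and> oper_class L A = oper_class L B"
    unfolding B_def by (rule someI[of _ A]) (simp add: A)
  then have "(B, A) \<in> gauge_rel L" using gauge_refl[OF A] oper_class_mem by blast
  then have "pval (miura_coords B) q = pval (miura_coords A) q" by (rule W_function_invariant[OF q])
  moreover have "oper_function q (oper_class L A) = pval (miura_coords B) q"
    by (simp only: oper_function_def restrict_apply'[OF opers_class[OF A]] B_def)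
  ultimately show ?thesis by simp
qed

lemma oper_function_inj: "inj_on oper_function (classical_W L \<nu>)"
proof (rule inj_onI, rule pval_inject)
  fix p q x assume p: "p \<in> classical_W L \<nu>" and q: "q \<in> classical_W L \<nu>" and eq: "oper_function p = oper_function q"
  show "pval x p = pval x q"
    using oper_function_eq[OF p miura_Conn[of x]] oper_function_eq[OF q miura_Conn[of x]] eq
    by (simp add: miura_coords_miura)
qed

text \<open>The coordinates of the Miura representative are polynomial in the connection.\<close>

lemma oper_function_regular: assumes q: "q \<in> classical_W L \<nu>" shows "oper_function q \<in> fun_opers L"
proof -
  have "polyc (\<lambda>A. pval (miura_coords A) q)" by (rule polyc_pval[OF polyc_miura_coords])
  then obtain P :: "(('g \<Rightarrow> complex) \<times> nat) cpoly" where
    P: "\<forall>(u, n)\<in>pvars P. linear_form L u" "\<And>A. pval (miura_coords A) q = pval (\<lambda>(u, n). u (A n)) P"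
    unfolding polyc_def by blast
  have "\<forall>A\<in>Conn. oper_function q (oper_class L A) = pval (\<lambda>(u, n). u (A n)) P"
    using oper_function_eq[OF q] P(2) by simp
  moreover have "oper_function q \<in> extensional (opers L)" by (simp add: oper_function_def)
  ultimately show ?thesis unfolding fun_opers_def using P(1) by blast
qed

text \<open>Restricting a function on opers to Miura opers gives the polynomial that represents it.\<close>

lemma oper_function_surj: assumes \<phi>: "\<phi> \<in> fun_opers L" shows "\<exists>q\<in>classical_W L \<nu>. oper_function q = \<phi>"
proof -
  obtain P :: "(('g \<Rightarrow> complex) \<times> nat) cpoly" where
    P: "\<forall>(u, n)\<in>pvars P. linear_form L u" "\<And>A. A \<in> Conn \<Longrightarrow> \<phi> (oper_class L A) = pval (\<lambda>(u, n). u (A n)) P"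
    using \<phi> by (auto simp: fun_opers_def)
  define R :: "('g \<Rightarrow> complex) \<times> nat \<Rightarrow> ('l \<times> nat) cpoly"
    where "R = (\<lambda>(u, n). pconst (u (pm n)) + (\<Sum>i\<in>UNIV. pconst (u (\<omega> i)) * pvar (i, n)))"
  define q where "q = peval pconst R P"
  have val: "pval x q = \<phi> (oper_class L (miura x))" for x
  proof -
    have "pval x q = pval (\<lambda>v. pval x (R v)) P" unfolding q_def by (rule pval_subst)
    also have "\<dots> = pval (\<lambda>(u, n). u (miura x n)) P"
    proof (rule peval_cong)
      fix v assume "v \<in> pvars P"
      then obtain u n where v: "v = (u, n)" "linear_form L u" using P(1) by (cases v) auto
      show "pval x (R v) = (case v of (u, n) \<Rightarrow> u (miura x n))"
        by (simp add: v(1) R_def miura_def idh.peval_add idh.peval_sum idh.peval_mult lf_add[OF v(2)] lf_sum[OF v(2)] lf_scale[OF v(2)] mult.commute)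
    qed
    also have "\<dots> = \<phi> (oper_class L (miura x))" using P(2)[OF miura_Conn] by simp
    finally show ?thesis .
  qed
  have q: "q \<in> classical_W L \<nu>" for \<nu> :: "'g \<Rightarrow> 'g \<Rightarrow> complex"
    by (rule W_gaugeI) (simp add: val oper_class_eq)
  have "oper_function q \<chi> = \<phi> \<chi>" for \<chi>
  proof (cases "\<chi> \<in> opers L")
    case True
    then obtain A where A: "A \<in> Conn" "\<chi> = oper_class L A" by (rule opersE)
    then show ?thesis using oper_function_eq[OF q A(1)] val oper_class_eq[OF miura_coords_gauge[OF A(1)]] by simp
  next
    case False
    then show ?thesis using \<phi> by (simp add: oper_function_def fun_opers_def extensional_def)
  qed
  then show ?thesis using q by blast
qed

lemma oper_function_algebra:
  "oper_function (pconst c) = (\<lambda>\<chi>\<in>opers L. c)"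
  "oper_function (p + q) = (\<lambda>\<chi>\<in>opers L. oper_function p \<chi> + oper_function q \<chi>)"
  "oper_function (p * q) = (\<lambda>\<chi>\<in>opers L. oper_function p \<chi> * oper_function q \<chi>)"
  by (rule ext, simp add: oper_function_def idh.peval_add idh.peval_mult restrict_def)+

lemma oper_function_equivariant:
  assumes q: "q \<in> classical_W L \<nu>" shows "oper_function (der_pi \<xi> q) = der_opers L \<xi> (oper_function q)"
proof
  fix \<chi>
  show "oper_function (der_pi \<xi> q) \<chi> = der_opers L \<xi> (oper_function q) \<chi>"
  proof (cases "\<chi> \<in> opers L")
    case False
    then show ?thesis by (simp add: oper_function_def der_opers_def)
  next
    case True
    then obtain A where A: "A \<in> Conn" "\<chi> = oper_class L A" by (rule opersE)
    let ?d = "pval (miura_coords A) (der_pi \<xi> q)"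
    let ?f = "\<lambda>B \<epsilon>. oper_function q (oper_class L (\<lambda>n. B n + sc \<epsilon> (oper_variation L \<xi> (v_part L B) n)))"
    have f: "(?f B has_field_derivative ?d) (at 0)" if B: "B \<in> \<chi>" for B
    proof -
      have AB: "(A, B) \<in> gauge_rel L" using B A(2) oper_class_mem by simp
      then have BC: "B - pm \<in> SFil 0" "B \<in> Conn" using gauge_rel_Conn[OF AB] Conn_iff by auto
      have "(\<lambda>n. B n + sc \<epsilon> (oper_variation L \<xi> (v_part L B) n)) = line B (variation \<xi> (B - pm)) \<epsilon>" for \<epsilon>
        unfolding v_part_eq oper_variation_eq[OF BC(1)] by (rule ext) (simp only: line_def)
      then have "?f B = (\<lambda>\<epsilon>. pval (miura_coords (line B (variation \<xi> (B - pm)) \<epsilon>)) q)"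
        using oper_function_eq[OF q line_Conn[OF BC(2) variation_SFil[OF BC(1)]]] by (intro ext) (simp only:)
      moreover have "(B, miura (miura_coords A)) \<in> gauge_rel L"
        using gauge_trans[OF gauge_sym[OF AB] miura_coords_gauge[OF A(1)]] .
      ultimately show ?thesis using W_function_derivative[OF q] by (simp only:)
    qed
    have "A \<in> \<chi>" using A gauge_refl oper_class_mem by simp
    then have "(THE d. \<forall>B\<in>\<chi>. (?f B has_field_derivative d) (at 0)) = ?d"
      using f DERIV_unique[OF f] by (intro the_equality) blast+
    moreover have "der_opers L \<xi> (oper_function q) \<chi> = (THE d. \<forall>B\<in>\<chi>. (?f B has_field_derivative d) (at 0))"
      using True by (simp only: der_opers_def restrict_apply') 
    ultimately show ?thesis using oper_function_eq[OF der_pi_W[OF q] A(1), of \<xi>] A(2) by simp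
  qed
qed

end

theorem theorem11p2:
  fixes L :: "('g::ab_group_add, 'l::finite) lie_data"
    and \<nu> :: "'g \<Rightarrow> 'g \<Rightarrow> complex"
  assumes "simple_lie_data L"
    and "invariant_inner_product L \<nu>" and "\<exists>x y. \<nu> x y \<noteq> 0"
  shows "\<exists>\<Phi>. bij_betw \<Phi> (classical_W L \<nu>) (fun_opers L) \<and>
    (\<forall>c. \<Phi> (pconst c) = (\<lambda>\<chi>\<in>opers L. c)) \<and>
    (\<forall>p\<in>classical_W L \<nu>. \<forall>q\<in>classical_W L \<nu>.
       \<Phi> (p + q) = (\<lambda>\<chi>\<in>opers L. \<Phi> p \<chi> + \<Phi> q \<chi>) \<and>
       \<Phi> (p * q) = (\<lambda>\<chi>\<in>opers L. \<Phi> p \<chi> * \<Phi> q \<chi>)) \<and>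
    (\<forall>\<xi>. \<forall>p\<in>classical_W L \<nu>.
       der_pi \<xi> p \<in> classical_W L \<nu> \<and> \<Phi> (der_pi \<xi> p) = der_opers L \<xi> (\<Phi> p))"
proof -
  interpret simple_lie L by unfold_locales (rule assms(1))
  have "bij_betw oper_function (classical_W L \<nu>) (fun_opers L)"
    unfolding bij_betw_def using oper_function_inj oper_function_regular oper_function_surj[of _ \<nu>] by blast
  then show ?thesis
    using oper_function_algebra der_pi_W oper_function_equivariant by (intro exI[of _ oper_function]) blast
qed

end
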